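(* Let $0<p,q<\infty$, $\omega\in\mathcal{D}$, $n\in\mathbb{N}\cup\{0\}$, and let $\mu$ be a positive Borel measure on $\mathbb{D}$. Let $D^n f=f^{(n)}$. (a) If $0<p\le q<\infty$, then there exists $r=r(\omega)\in(0,1)$, depending only on $\omega$, such that the following statements hold: (i) $D^n:A^p_\omega\to L^q_\mu$ is bounded if and only if $$\sup_{z\in\mathbb{D}}\frac{\mu(\Delta(z,r))}{\omega(S(z))^{\frac{q}{p}}(1-|z|)^{nq}}<\infty.$$ (ii) $D^n:A^p_\omega\to L^q_\mu$ is compact if and only if $$\lim_{|z|\to1^-}\frac{\mu(\Delta(z,r))}{\omega(S(z))^{\frac{q}{p}}(1-|z|)^{nq}}=0.$$ (b) If $0<q<p<\infty$, then the following conditions are equivalent: (i) $D^n:A^p_\omega\to L^q_\mu$ is bounded; (ii) $D^n:A^p_\omega\to L^q_\mu$ is compact; (iii) the function $$z\mapsto\frac{\mu(\Delta(z,r))}{\omega(S(z))(1-|z|)^{nq}}$$ belongs to $L^{\frac{p}{p-q}}_{\widetilde{\omega}}$ for some (equivalently, for all) $r\in(0,1)$.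
   Context: $\mathbb{D}=\{z\in\mathbb{C}:|z|<1\}$; $\mathcal{H}(\mathbb{D})$ is the space of analytic functions on $\mathbb{D}$; $dA(z)=\frac{dx\,dy}{\pi}$ is normalized area measure. A weight is an integrable function $\omega:\mathbb{D}\to[0,\infty)$; it is radial if $\omega(z)=\omega(|z|)$ for all $z\in\mathbb{D}$. For a radial weight, $\widehat{\omega}(z)=\int_{|z|}^1\omega(s)\,ds$ and $\widetilde{\omega}(z)=\widehat{\omega}(z)/(1-|z|)$ for $z\in\mathbb{D}$; radial weights are taken to be nontrivial (not almost everywhere zero). The class $\mathcal{D}$ of doubling weights consists of the radial weights $\omega$ satisfying both: (1) there is a constant $C=C(\omega)\ge 1$ with $\widehat{\omega}(r)\le C\,\widehat{\omega}\left(\frac{1+r}{2}\right)$ for all $0\le r<1$; (2) there are constants $K=K(\omega)>1$ and $C=C(\omega)>1$ with $\widehat{\omega}(r)\ge C\,\widehat{\omega}\left(1-\frac{1-r}{K}\right)$ for all $0\le r<1$. For $0<p<\infty$ and a weight $\omega$, $L^p_\omega$ is the Lebesgue space of measurable $f$ on $\mathbb{D}$ with $\|f\|^p_{L^p_\omega}=\int_{\mathbb{D}}|f|^p\omega\,dA<\infty$, and the weighted Bergman space is $A^p_\omega=L^p_\omega\cap\mathcal{H}(\mathbb{D})$ with $\|f\|_{A^p_\omega}=\|f\|_{L^p_\omega}$. For a positive Borel measure $\mu$ on $\mathbb{D}$, $L^q_\mu$ is the space of measurable $f$ with $\|f\|^q_{L^q_\mu}=\int_{\mathbb{D}}|f|^q\,d\mu<\infty$.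 For measurable $E\subset\mathbb{D}$, $\omega(E)=\int_E\omega\,dA$. The Carleson square is $S(z)=\{\zeta\in\mathbb{D}:|z|<|\zeta|,\ |\arg\zeta-\arg z|<(1-|z|)/2\}$ for $z\in\mathbb{D}\setminus\{0\}$ (arguments compared modulo $2\pi$), and $S(0)=\mathbb{D}$. The pseudohyperbolic disc is $\Delta(a,r)=\{z\in\mathbb{D}:|(a-z)/(1-\overline{a}z)|<r\}$ for $a\in\mathbb{D}$, $0<r<1$.
   Formalization: In (a)(ii) the measure μ is additionally assumed finite on compact subsets of the disc; without this the equivalence fails, e.g. for an infinite point mass at 0 the limit is 0 but D^n does not map into L^q_μ. *)

theory Defs
  imports "HOL-Analysis.Analysis"
begin

definition disc_area :: "complex measure" where
  "disc_area = scale_measure (ennreal (1 / pi)) (lebesgue_on (ball 0 1))"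

text \<open>All functions on the unit disc are total functions on the complex plane; only their
  values on \<^term>\<open>ball (0::complex) 1\<close> matter.\<close>

definition weight :: "(complex \<Rightarrow> real) \<Rightarrow> bool" where
  "weight \<omega> \<longleftrightarrow> (\<forall>z\<in>ball 0 1. 0 \<le> \<omega> z) \<and> integrable disc_area \<omega>"

definition radial_weight :: "(complex \<Rightarrow> real) \<Rightarrow> bool" where
  "radial_weight \<omega> \<longleftrightarrow> weight \<omega> \<and> (\<forall>z\<in>ball 0 1. \<omega> z = \<omega> (of_real (cmod z)))
     \<and> \<not> (AE z in disc_area. \<omega> z = 0)"

text \<open>The tail integral is taken in the extended nonnegative reals: area integrability of a
  radial weight does not exclude that it is infinite at the origin.\<close>

definition omega_hat :: "(complex \<Rightarrow> real) \<Rightarrow> complex \<Rightarrow> ennreal" where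
  "omega_hat \<omega> z = (\<integral>\<^sup>+s\<in>{cmod z..<1}. ennreal (\<omega> (of_real s)) \<partial>lebesgue)"

definition omega_tilde :: "(complex \<Rightarrow> real) \<Rightarrow> complex \<Rightarrow> ennreal" where
  "omega_tilde \<omega> z = omega_hat \<omega> z / ennreal (1 - cmod z)"

definition doubling_weight :: "(complex \<Rightarrow> real) \<Rightarrow> bool" where
  "doubling_weight \<omega> \<longleftrightarrow> radial_weight \<omega>
     \<and> (\<exists>C::real. C \<ge> 1 \<and> (\<forall>r::real. 0 \<le> r \<and> r < 1 \<longrightarrow>
           omega_hat \<omega> (of_real r) \<le> ennreal C * omega_hat \<omega> (of_real ((1 + r) / 2))))
     \<and> (\<exists>K C::real. K > 1 \<and> C > 1 \<and> (\<forall>r::real. 0 \<le> r \<and> r < 1 \<longrightarrow>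
           omega_hat \<omega> (of_real r) \<ge> ennreal C * omega_hat \<omega> (of_real (1 - (1 - r) / K))))"

definition Lp_space :: "'a measure \<Rightarrow> real \<Rightarrow> ('a \<Rightarrow> 'b::real_normed_vector) set" where
  "Lp_space M p = {f \<in> borel_measurable M. integrable M (\<lambda>x. norm (f x) powr p)}"

definition Lp_norm :: "'a measure \<Rightarrow> real \<Rightarrow> ('a \<Rightarrow> 'b::real_normed_vector) \<Rightarrow> real" where
  "Lp_norm M p f = (\<integral>x. norm (f x) powr p \<partial>M) powr (1 / p)"

text \<open>Membership of a \<open>[0,\<infinity>]\<close>-valued function in a Lebesgue space.\<close>

definition extended_in_Lp :: "'a measure \<Rightarrow> real \<Rightarrow> ('a \<Rightarrow> ennreal) \<Rightarrow> bool" where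
  "extended_in_Lp M p g \<longleftrightarrow> g \<in> borel_measurable M \<and> (AE x in M. g x < \<infinity>)
     \<and> (\<lambda>x. enn2real (g x)) \<in> Lp_space M p"

definition weighted_area :: "(complex \<Rightarrow> real) \<Rightarrow> complex measure" where
  "weighted_area \<omega> = density disc_area (\<lambda>z. ennreal (\<omega> z))"

definition bergman_space :: "(complex \<Rightarrow> real) \<Rightarrow> real \<Rightarrow> (complex \<Rightarrow> complex) set" where
  "bergman_space \<omega> p = Lp_space (weighted_area \<omega>) p \<inter> {f. f holomorphic_on ball 0 1}"

definition borel_measure_on_disc :: "complex measure \<Rightarrow> bool" where
  "borel_measure_on_disc \<mu> \<longleftrightarrow> sets \<mu> = sets (restrict_space borel (ball 0 1))"

text \<open>Finiteness on compacts has to be requested separately: a limit condition at the boundary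
  says nothing about, e.g., an infinite point mass at the origin.\<close>

definition finite_on_compacts :: "complex measure \<Rightarrow> bool" where
  "finite_on_compacts \<mu> \<longleftrightarrow> (\<forall>K. compact K \<and> K \<subseteq> ball 0 1 \<longrightarrow> emeasure \<mu> K < \<infinity>)"

definition weight_of :: "(complex \<Rightarrow> real) \<Rightarrow> complex set \<Rightarrow> real" where
  "weight_of \<omega> E = (LINT z:E|disc_area. \<omega> z)"

definition carleson_square :: "complex \<Rightarrow> complex set" where
  "carleson_square z = (if z = 0 then ball 0 1 else
     {\<zeta> \<in> ball 0 1. cmod z < cmod \<zeta>
        \<and> (\<exists>k::int. \<bar>Arg \<zeta> - Arg z + 2 * pi * of_int k\<bar> < (1 - cmod z) / 2)})"

definition pseudohyperbolic_disc :: "complex \<Rightarrow> real \<Rightarrow> complex set" where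
  "pseudohyperbolic_disc a r = {z \<in> ball 0 1. cmod ((a - z) / (1 - cnj a * z)) < r}"

text \<open>Boundedness and compactness of a linear operator from the weighted Bergman space
  into \<open>L\<^sup>q(\<mu>)\<close>. Both spaces are only quasi-normed for exponents below 1.\<close>

definition bounded_operator ::
  "(complex \<Rightarrow> real) \<Rightarrow> real \<Rightarrow> complex measure \<Rightarrow> real
    \<Rightarrow> ((complex \<Rightarrow> complex) \<Rightarrow> complex \<Rightarrow> complex) \<Rightarrow> bool" where
  "bounded_operator \<omega> p \<mu> q T \<longleftrightarrow>
     (\<forall>f\<in>bergman_space \<omega> p. T f \<in> Lp_space \<mu> q)
     \<and> (\<exists>C. \<forall>f\<in>bergman_space \<omega> p. Lp_norm \<mu> q (T f) \<le> C * Lp_norm (weighted_area \<omega>) p f)"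

definition compact_operator ::
  "(complex \<Rightarrow> real) \<Rightarrow> real \<Rightarrow> complex measure \<Rightarrow> real
    \<Rightarrow> ((complex \<Rightarrow> complex) \<Rightarrow> complex \<Rightarrow> complex) \<Rightarrow> bool" where
  "compact_operator \<omega> p \<mu> q T \<longleftrightarrow>
     (\<forall>f\<in>bergman_space \<omega> p. T f \<in> Lp_space \<mu> q)
     \<and> (\<forall>F::nat \<Rightarrow> complex \<Rightarrow> complex.
          (\<forall>k. F k \<in> bergman_space \<omega> p)
          \<and> (\<exists>B. \<forall>k. Lp_norm (weighted_area \<omega>) p (F k) \<le> B)
          \<longrightarrow> (\<exists>g\<in>Lp_space \<mu> q. \<exists>s::nat \<Rightarrow> nat. strict_mono s
                \<and> (\<lambda>k. Lp_norm \<mu> q (\<lambda>z. T (F (s k)) z - g z)) \<longlonglongrightarrow> 0))"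

definition mass_ratio ::
  "(complex \<Rightarrow> real) \<Rightarrow> complex measure \<Rightarrow> real \<Rightarrow> real \<Rightarrow> real \<Rightarrow> complex \<Rightarrow> ennreal" where
  "mass_ratio \<omega> \<mu> r a b z =
     emeasure \<mu> (pseudohyperbolic_disc z r)
       / ennreal (weight_of \<omega> (carleson_square z) powr a * (1 - cmod z) powr b)"

end

theory Submission
  imports Defs "HOL-Complex_Analysis.Complex_Analysis"
begin

text \<open>Circular means of \<open>\<bar>f\<bar> ^ p\<close> increase with the radius, and condition (2) of the class gives every
  ring of a geometric scale a fixed share of the mass of \<open>\<omega>\<close>. Hence the norm for the weight \<open>\<omega>\<close>
  dominates the norm for its regularisation \<open>\<omega>~\<close>, which is almost constant on pseudohyperbolic discs.
  Sufficiency then follows from the local sub-mean-value inequality for derivatives, Tonelli's theorem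
  and, for \<open>q < p\<close>, Young's inequality. Necessity for \<open>p \<le> q\<close> follows by testing on powers of
  \<open>1 / (1 - cnj a * z)\<close>, and for \<open>q < p\<close> by testing on sums of such powers over Whitney boxes with
  averaged signs. Compactness amounts, by normal families, to uniform smallness of the
  integrals near the circle.\<close>

subsection \<open>Rotations and polar coordinates\<close>

text \<open>The obstacle is that the weight itself has no local regularity: it may vanish on whole
  rings, so a value of f cannot be compared with a nearby average of f against the weight. Only the
  tail integral is controlled, and condition (1) makes it comparable at comparable distances from
  the circle. Every local estimate is therefore carried out with the regularised density, and a
  one-sided comparison of norms, special to analytic functions, leads back to the weight. Condition
  (2) is used a second time: it leaves room for a slightly singular factor (1 - |z|) ^ (-\<delta>)
  in integrals against the weight, and the convexity step for sums of kernels with p > 1 consumes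
  this factor. For q < p the coefficients of the test sums are chosen so that the quantity Y to be
  bounded occurs on both sides, as Y <= D * Y ^ (q / p). Being a finite sum, Y can be absorbed, with
  a constant that does not depend on the number of boxes. No duality between function spaces is
  used, which keeps exponents below 1 within reach.\<close>

lemma lborel_open_mult_unit_le:
  fixes c :: complex and U :: "complex set"
  assumes c: "cmod c = 1" and U: "open U"
  shows "emeasure lborel U \<le> emeasure lborel ((*) c ` U)"
proof -
  define K where "K = {(x, r). 0 < r \<and> cball x r \<subseteq> U}"
  have S: "\<exists>i. i \<in> K \<and> x \<in> cball (fst i) (snd i) \<and> snd i < d" if xU: "x \<in> U" "0 < d" for x :: complex and d :: real
  proof -
    obtain e where e: "e > 0" "cball x e \<subseteq> U" using U xU(1) open_contains_cball by blast
    define r where "r = min e (d/2)"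
    have "0 < r" "r < d" "cball x r \<subseteq> U" using e xU by (auto simp: r_def)
    then show ?thesis by (intro exI[of _ "(x, r)"]) (auto simp: K_def)
  qed
  \<comment> \<open>Vitali: up to a null set U is a countable disjoint union of closed balls, and
    multiplication by c sends each of them to a ball of the same radius, hence of the same area.
    Only an inequality results, since nothing is said about the image of the null set.\<close>
  obtain C where C: "countable C" "C \<subseteq> K"
      "pairwise (\<lambda>i j. disjnt (cball (fst i) (snd i)) (cball (fst j) (snd j))) C"
      "negligible (U - (\<Union>i\<in>C. cball (fst i) (snd i)))"
  proof (rule Vitali_covering_theorem_cballs[of K snd U fst])
    show "0 < snd i" if "i \<in> K" for i using that by (auto simp: K_def)
    show "\<exists>i. i \<in> K \<and> x \<in> cball (fst i) (snd i) \<and> snd i < d" if "x \<in> U" "0 < d" for x d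
      using S[OF that] .
  qed blast
  let ?B = "\<lambda>i. cball (fst i) (snd i) :: complex set"
  have img: "(*) c ` cball x r = cball (c * x) r" for x r
  proof -
    have c0: "c \<noteq> 0" using c by auto
    show ?thesis
    proof (intro equalityI subsetI)
      fix y assume "y \<in> (*) c ` cball x r"
      then obtain z where z: "y = c * z" "z \<in> cball x r" by blast
      have "cmod (c * x - c * z) = cmod (x - z)" using c by (simp add: norm_mult flip: right_diff_distrib)
      then show "y \<in> cball (c * x) r" using z by (simp add: dist_norm)
    next
      fix y assume y: "y \<in> cball (c * x) r"
      have "c * x - y = c * (x - y / c)" using c0 by (simp add: field_simps)
      then have "cmod (x - y / c) = cmod (c * x - y)" using c by (simp add: norm_mult)
      then have "y / c \<in> cball x r" using y by (simp add: dist_norm)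
      then show "y \<in> (*) c ` cball x r" using c0 by (intro image_eqI[of _ _ "y / c"]) auto
    qed
  qed
  have same: "emeasure lborel (cball x r) = emeasure lborel (cball y r)" if "0 < r" for x y :: complex and r
    using that by (simp add: emeasure_cball)
  have mB: "(\<Union>i\<in>C. ?B i) \<in> sets borel"
    using C(1) by (intro sets.countable_UN') auto
  have mU: "U \<in> sets borel" using U by simp
  have mD: "U - (\<Union>i\<in>C. ?B i) \<in> sets borel" using mU mB by (rule sets.Diff)
  have "emeasure lborel U \<le> emeasure lborel ((\<Union>i\<in>C. ?B i) \<union> (U - (\<Union>i\<in>C. ?B i)))"
    using mB mD by (intro emeasure_mono) (auto simp del: Un_Diff_cancel)
  also have "\<dots> \<le> emeasure lborel (\<Union>i\<in>C. ?B i) + emeasure lborel (U - (\<Union>i\<in>C. ?B i))"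
    using mB mD by (intro emeasure_subadditive) simp_all
  also have "emeasure lborel (U - (\<Union>i\<in>C. ?B i)) = 0"
    using C(4) mD by (simp add: negligible_iff_null_sets null_sets_completion_iff null_sets_def)
  also have "emeasure lborel (\<Union>i\<in>C. ?B i) = (\<integral>\<^sup>+i. emeasure lborel (?B i) \<partial>count_space C)"
    using C(1,3) by (intro emeasure_UN_countable) (auto simp: disjoint_family_on_def pairwise_def disjnt_def)
  also have "\<dots> = (\<integral>\<^sup>+i. emeasure lborel ((*) c ` ?B i) \<partial>count_space C)"
    using C(2) by (intro nn_integral_cong) (auto simp: img K_def intro!: same)
  also have "\<dots> = emeasure lborel (\<Union>i\<in>C. (*) c ` ?B i)"
  proof (intro emeasure_UN_countable[symmetric])
    show "disjoint_family_on (\<lambda>i. (*) c ` ?B i) C"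
      unfolding disjoint_family_on_def
    proof (intro ballI impI)
      fix i j assume ij: "i \<in> C" "j \<in> C" "i \<noteq> j"
      then have "?B i \<inter> ?B j = {}" using C(3) by (auto simp only: pairwise_def disjnt_def)
      moreover have "inj ((*) c)" using c by (auto intro!: injI)
      ultimately show "(*) c ` ?B i \<inter> (*) c ` ?B j = {}" by (metis image_Int image_empty)
    qed
  qed (use C(1) img in auto)
  also have "\<dots> \<le> emeasure lborel ((*) c ` U)"
  proof (intro emeasure_mono)
    show "(\<Union>i\<in>C. (*) c ` ?B i) \<subseteq> (*) c ` U"
    proof -
      have "?B i \<subseteq> U" if "i \<in> C" for i using subsetD[OF C(2) that] by (cases i) (simp add: K_def)
      then show ?thesis by blast
    qed
    have "c \<noteq> 0" using c by auto
    then have "open ((*) c ` U)" using U by (intro open_times_image)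
    then show "(*) c ` U \<in> sets lborel" by auto
  qed
  finally show ?thesis by simp
qed

text \<open>The one-sided estimate for c and for 1 / c together gives equality on open sets, an
  intersection-stable generator of the Borel sets; the balls of integer radius exhaust the plane by
  sets of finite area.\<close>

lemma distr_lborel_mult_unit:
  fixes c :: complex
  assumes c: "cmod c = 1"
  shows "distr lborel borel ((*) c) = lborel"
proof (rule measure_eqI_generator_eq[where E = "Collect open" and \<Omega> = UNIV and A = "\<lambda>i. ball 0 (real i)"])
  have c0: "c \<noteq> 0" using c by auto
  fix U :: "complex set" assume "U \<in> Collect open"
  then have U: "open U" by simp
  have m: "(*) c \<in> borel_measurable lborel" by measurable
  have vim: "(*) c -` U = (*) (1 / c) ` U"
  proof (intro equalityI subsetI)
    fix x assume "x \<in> (*) c -` U"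
    then show "x \<in> (*) (1 / c) ` U" using c0 by (intro image_eqI[of _ _ "c * x"]) auto
  qed (use c0 in auto)
  have U': "open ((*) (1 / c) ` U)" using c0 U by (intro open_times_image) auto
  have "(*) c ` (*) (1 / c) ` U = U" using c0 by (auto simp: image_image)
  then have "emeasure lborel ((*) c -` U) = emeasure lborel U"
    using lborel_open_mult_unit_le[OF c U'] lborel_open_mult_unit_le[of "1 / c", OF _ U] c
    unfolding vim by (simp add: norm_divide)
  then show "emeasure (distr lborel borel ((*) c)) U = emeasure lborel U"
    using U m by (simp add: emeasure_distr)
next
  fix i
  have "(*) c -` ball 0 (real i) = ball 0 (real i)" using c by (auto simp: norm_mult)
  then show "emeasure (distr lborel borel ((*) c)) (ball 0 (real i)) \<noteq> \<infinity>"
    by (simp add: emeasure_distr emeasure_ball)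
next
  show "(\<Union>i. ball (0::complex) (real i)) = UNIV"
    by (auto simp: reals_Archimedean2)
qed (auto simp: Int_stable_def borel_def)

lemma nn_integral_mult_unit:
  fixes c :: complex
  assumes "cmod c = 1" "F \<in> borel_measurable borel"
  shows "(\<integral>\<^sup>+z. F (c * z) \<partial>lborel) = (\<integral>\<^sup>+z. F z \<partial>lborel)"
proof -
  have "(\<integral>\<^sup>+z. F z \<partial>lborel) = (\<integral>\<^sup>+z. F z \<partial>distr lborel borel ((*) c))"
    by (simp add: distr_lborel_mult_unit assms)
  also have "\<dots> = (\<integral>\<^sup>+z. F (c * z) \<partial>lborel)"
    using assms by (intro nn_integral_distr) auto
  finally show ?thesis by simp
qed

lemma emeasure_cball_complex: "r \<ge> 0 \<Longrightarrow> emeasure lborel (cball (c::complex) r) = ennreal (pi * r\<^sup>2)"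
  by (simp add: emeasure_cball unit_ball_vol_2)

lemma emeasure_ball_complex: "r \<ge> 0 \<Longrightarrow> emeasure lborel (ball (c::complex) r) = ennreal (pi * r\<^sup>2)"
  by (simp add: emeasure_ball unit_ball_vol_2)

text \<open>Polar coordinates for radial functions, in the form of an image measure. Both sides are
  finite and agree on every half-line: the part of the disc outside radius x has area pi * (1 -
  x^2), which is the integral of 2 * pi * s from x to 1.\<close>

lemma distr_cmod_ball:
  "distr (density lborel (indicator (ball (0::complex) 1))) borel cmod
     = density lborel (\<lambda>s. ennreal (2 * pi * s) * indicator {0..<1} s)"
    (is "?M = ?N")
proof (rule measure_eqI_lessThan)
  have tail: "emeasure ?N {x<..} = ennreal (pi * (1 - x\<^sup>2))" if "0 \<le> x" "x \<le> 1" for x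
  proof -
    have "emeasure ?N {x<..} = (\<integral>\<^sup>+s. ennreal (2 * pi * s) * indicator {0..<1} s * indicator {x<..} s \<partial>lborel)"
      by (simp add: emeasure_density)
    also have "\<dots> = (\<integral>\<^sup>+s. ennreal (2 * pi * s) * indicator {x..1} s \<partial>lborel)"
    proof (intro nn_integral_cong_AE)
      show "AE s in lborel. ennreal (2 * pi * s) * indicator {0..<1} s * indicator {x<..} s =
          ennreal (2 * pi * s) * indicator {x..1} s"
        using AE_lborel_singleton[of x] AE_lborel_singleton[of 1]
        by eventually_elim (use that in \<open>auto split: split_indicator\<close>)
    qed
    also have "\<dots> = ennreal (pi * 1\<^sup>2 - pi * x\<^sup>2)"
      using that by (intro nn_integral_FTC_Icc) (auto intro!: derivative_eq_intros)
    finally show ?thesis by (simp add: algebra_simps)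
  qed
  have M: "emeasure ?M {x<..} = emeasure lborel (ball 0 1 \<inter> {z::complex. x < cmod z})" for x
  proof -
    have "emeasure ?M {x<..} = emeasure (density lborel (indicator (ball 0 1))) {z. x < cmod z}"
      by (subst emeasure_distr) (auto intro!: arg_cong2[where f = emeasure])
    also have "\<dots> = (\<integral>\<^sup>+z. indicator (ball 0 1) z * indicator {z. x < cmod z} z \<partial>lborel)"
      by (intro emeasure_density borel_measurable_indicator) auto
    also have "\<dots> = (\<integral>\<^sup>+z. indicator (ball 0 1 \<inter> {z. x < cmod z}) z \<partial>lborel)"
      by (intro nn_integral_cong) (auto split: split_indicator)
    also have "\<dots> = emeasure lborel (ball 0 1 \<inter> {z. x < cmod z})"
      by (intro nn_integral_indicator) measurable
    finally show ?thesis .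
  qed
  fix x :: real
  have pos: "emeasure ?M {x<..} = emeasure ?N {x<..}" if "0 \<le> x"
  proof (cases "x \<le> 1")
    case True
    have "ball 0 1 \<inter> {z::complex. x < cmod z} = ball 0 1 - (if x = 1 then ball 0 1 else cball 0 x)"
      using True by auto
    then have "emeasure ?M {x<..} = ennreal (pi * 1\<^sup>2) - ennreal (pi * x\<^sup>2)"
      using True that M[of x] by (auto simp: emeasure_ball_complex emeasure_cball_complex emeasure_Diff subset_iff)
    also have "\<dots> = ennreal (pi * (1 - x\<^sup>2))"
      using True that by (subst ennreal_minus) (auto simp: algebra_simps)
    finally show ?thesis using tail[of x] True that by simp
  next
    case False
    then have "ball 0 1 \<inter> {z::complex. x < cmod z} = {}" by auto
    moreover have "emeasure ?N {x<..} = 0"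
    proof -
      have "emeasure ?N {x<..} = (\<integral>\<^sup>+s. ennreal (2 * pi * s) * indicator {0..<1} s * indicator {x<..} s \<partial>lborel)"
        by (simp add: emeasure_density)
      also have "\<dots> = (\<integral>\<^sup>+s. 0 \<partial>(lborel::real measure))"
        using False by (intro nn_integral_cong) (auto split: split_indicator)
      finally show ?thesis by simp
    qed
    ultimately show ?thesis using M[of x] by simp
  qed
  show "emeasure ?M {x<..} = emeasure ?N {x<..}"
  proof (cases "0 \<le> x")
    case False
    then have "emeasure ?M {x<..} = ennreal pi"
    proof -
      have "ball 0 1 \<inter> {z::complex. x < cmod z} = ball 0 1" using False norm_ge_zero[where 'a = complex] by (auto simp: less_le_trans not_le)
      then show ?thesis using M[of x] by (simp add: emeasure_ball_complex)
    qed
    moreover have "emeasure ?N {x<..} = emeasure ?N {0<..}"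
    proof -
      have N: "emeasure ?N {y<..} = (\<integral>\<^sup>+s. ennreal (2 * pi * s) * indicator {0..<1} s * indicator {y<..} s \<partial>lborel)" for y
        by (simp add: emeasure_density)
      show ?thesis unfolding N
      proof (intro nn_integral_cong_AE)
        show "AE s in lborel. ennreal (2 * pi * s) * indicator {0..<1} s * indicator {x<..} s
            = ennreal (2 * pi * s) * indicator {0..<1} s * indicator {0<..} s"
          using AE_lborel_singleton[of "0::real"] by eventually_elim (use False in \<open>auto split: split_indicator\<close>)
      qed
    qed
    ultimately show ?thesis using tail[of 0] by simp
  qed (rule pos)
  show "emeasure ?M {x<..} < \<infinity>"
  proof -
    have "emeasure ?M {x<..} \<le> emeasure lborel (ball (0::complex) 1)"
      unfolding M by (intro emeasure_mono) auto
    then show ?thesis by (simp add: emeasure_ball_complex le_less_trans)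
  qed
qed auto

lemma nn_integral_radial:
  fixes g :: "real \<Rightarrow> ennreal"
  assumes [measurable]: "g \<in> borel_measurable borel"
  shows "(\<integral>\<^sup>+z\<in>ball 0 1. g (cmod z) \<partial>lborel) = (\<integral>\<^sup>+s\<in>{0..<1}. ennreal (2 * pi * s) * g s \<partial>lborel)"
proof -
  have "(\<integral>\<^sup>+z\<in>ball 0 1. g (cmod z) \<partial>lborel) = (\<integral>\<^sup>+z. g (cmod z) \<partial>density lborel (indicator (ball 0 1)))"
    by (subst nn_integral_density) (auto simp: mult.commute intro!: borel_measurable_indicator)
  also have "\<dots> = (\<integral>\<^sup>+s. g s \<partial>distr (density lborel (indicator (ball (0::complex) 1))) borel cmod)"
    by (subst nn_integral_distr) auto
  also have "\<dots> = (\<integral>\<^sup>+s\<in>{0..<1}. ennreal (2 * pi * s) * g s \<partial>lborel)"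
    unfolding distr_cmod_ball by (subst nn_integral_density) (auto simp: mult_ac)
  finally show ?thesis .
qed

section \<open>Averages over rotations\<close>

definition circle_avg :: "(complex \<Rightarrow> ennreal) \<Rightarrow> complex \<Rightarrow> ennreal" where
  "circle_avg F z = ennreal (1 / (2 * pi)) * (\<integral>\<^sup>+\<phi>\<in>{0..<2 * pi}. F (z * cis \<phi>) \<partial>lborel)"

lemma borel_measurable_cis [measurable]: "cis \<in> borel_measurable borel"
  by (intro borel_measurable_continuous_onI continuous_intros)

lemma borel_measurable_circle_avg [measurable]:
  assumes [measurable]: "F \<in> borel_measurable borel"
  shows "circle_avg F \<in> borel_measurable borel"
  unfolding circle_avg_def by measurable

text \<open>Averaging the rotation invariance of the area over all angles and applying Tonelli's
  theorem replaces F by its circular mean; the radial factor is untouched. This does the work of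
  polar coordinates without a change of variables in the angle.\<close>

lemma nn_integral_circle_avg:
  fixes F :: "complex \<Rightarrow> ennreal" and V :: "real \<Rightarrow> ennreal"
  assumes [measurable]: "F \<in> borel_measurable borel" "V \<in> borel_measurable borel"
  shows "(\<integral>\<^sup>+z. F z * V (cmod z) \<partial>lborel) = (\<integral>\<^sup>+z. circle_avg F z * V (cmod z) \<partial>lborel)"
proof -
  let ?c = "ennreal (1 / (2 * pi))" and ?I = "\<integral>\<^sup>+z. F z * V (cmod z) \<partial>lborel"
  have rot: "(\<integral>\<^sup>+z. F (z * cis \<phi>) * V (cmod z) \<partial>lborel) = ?I" for \<phi>
  proof -
    have "(\<integral>\<^sup>+z. F (cis \<phi> * z) * V (cmod (cis \<phi> * z)) \<partial>lborel) = ?I"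
      by (rule nn_integral_mult_unit) auto
    then show ?thesis by (simp add: norm_mult mult.commute)
  qed
  have "(\<integral>\<^sup>+z. circle_avg F z * V (cmod z) \<partial>lborel)
      = (\<integral>\<^sup>+z. (\<integral>\<^sup>+\<phi>. ?c * indicator {0..<2 * pi} \<phi> * (F (z * cis \<phi>) * V (cmod z)) \<partial>lborel) \<partial>lborel)"
    unfolding circle_avg_def
    by (intro nn_integral_cong, subst nn_integral_cmult[symmetric], simp,
        subst nn_integral_multc[symmetric], simp) (auto simp: mult_ac)
  also have "\<dots> = (\<integral>\<^sup>+\<phi>. (\<integral>\<^sup>+z. ?c * indicator {0..<2 * pi} \<phi> * (F (z * cis \<phi>) * V (cmod z)) \<partial>lborel) \<partial>lborel)"
    by (rule lborel_pair.Fubini'[symmetric]) measurable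
  also have "\<dots> = (\<integral>\<^sup>+\<phi>. ?c * indicator {0..<2 * pi} \<phi> * ?I \<partial>lborel)"
    by (subst nn_integral_cmult) (auto simp: rot)
  also have "\<dots> = ?c * ennreal (2 * pi) * ?I"
    by (simp add: nn_integral_cmult nn_integral_multc)
  also have "\<dots> = ?I"
    by (simp add: ennreal_mult[symmetric])
  finally show ?thesis by simp
qed

text \<open>A multiple of the period moves c into [0, 2 * pi); the part of the window beyond 2 * pi
  is then shifted back by one period.\<close>

lemma nn_integral_periodic:
  fixes G :: "real \<Rightarrow> ennreal"
  assumes [measurable]: "G \<in> borel_measurable borel"
    and per: "\<And>\<phi> k. G (\<phi> + 2 * pi * of_int k) = G \<phi>"
  shows "(\<integral>\<^sup>+\<phi>\<in>{c..<c + 2 * pi}. G \<phi> \<partial>lborel) = (\<integral>\<^sup>+\<phi>\<in>{0..<2 * pi}. G \<phi> \<partial>lborel)"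
proof -
  define k where "k = \<lfloor>c / (2 * pi)\<rfloor>"
  define d where "d = c - 2 * pi * of_int k"
  have "of_int k \<le> c / (2 * pi)" "c / (2 * pi) < of_int k + 1" by (auto simp: k_def)
  then have d: "0 \<le> d" "d < 2 * pi" by (auto simp: d_def field_simps)
  have shift: "(\<integral>\<^sup>+\<phi>. G \<phi> * indicator (A::real set) \<phi> \<partial>lborel)
      = (\<integral>\<^sup>+\<phi>. G \<phi> * indicator A (\<phi> + 2 * pi * of_int j) \<partial>lborel)" if [measurable]: "A \<in> sets borel" for A j
  proof -
    have "(\<integral>\<^sup>+\<phi>. G \<phi> * indicator A \<phi> \<partial>lborel)
       = (\<integral>\<^sup>+\<phi>. G (2 * pi * of_int j + 1 * \<phi>) * indicator A (2 * pi * of_int j + 1 * \<phi>) \<partial>lborel)"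
      by (subst nn_integral_real_affine[of _ 1 "2 * pi * of_int j"]) auto
    also have "\<dots> = (\<integral>\<^sup>+\<phi>. G \<phi> * indicator A (\<phi> + 2 * pi * of_int j) \<partial>lborel)"
      by (simp add: add.commute[of "2 * pi * _"] per)
    finally show ?thesis .
  qed
  have "(\<integral>\<^sup>+\<phi>\<in>{c..<c + 2 * pi}. G \<phi> \<partial>lborel) = (\<integral>\<^sup>+\<phi>\<in>{d..<d + 2 * pi}. G \<phi> \<partial>lborel)"
    by (subst shift[of _ k]) (auto simp: d_def intro!: nn_integral_cong split: split_indicator)
  also have "\<dots> = (\<integral>\<^sup>+\<phi>. G \<phi> * indicator {d..<2 * pi} \<phi> + G \<phi> * indicator {2 * pi..<d + 2 * pi} \<phi> \<partial>lborel)"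
    using d by (intro nn_integral_cong) (auto split: split_indicator)
  also have "\<dots> = (\<integral>\<^sup>+\<phi>\<in>{d..<2 * pi}. G \<phi> \<partial>lborel) + (\<integral>\<^sup>+\<phi>\<in>{2 * pi..<d + 2 * pi}. G \<phi> \<partial>lborel)"
    by (rule nn_integral_add) auto
  also have "(\<integral>\<^sup>+\<phi>\<in>{2 * pi..<d + 2 * pi}. G \<phi> \<partial>lborel) = (\<integral>\<^sup>+\<phi>\<in>{0..<d}. G \<phi> \<partial>lborel)"
    by (subst shift[of _ 1]) (auto intro!: nn_integral_cong split: split_indicator)
  also have "(\<integral>\<^sup>+\<phi>\<in>{d..<2 * pi}. G \<phi> \<partial>lborel) + \<dots>
      = (\<integral>\<^sup>+\<phi>. G \<phi> * indicator {d..<2 * pi} \<phi> + G \<phi> * indicator {0..<d} \<phi> \<partial>lborel)"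
    by (rule nn_integral_add[symmetric]) auto
  also have "\<dots> = (\<integral>\<^sup>+\<phi>\<in>{0..<2 * pi}. G \<phi> \<partial>lborel)"
    using d by (intro nn_integral_cong) (auto split: split_indicator)
  finally show ?thesis .
qed

lemma cis_add_2pi_int [simp]: "cis (\<phi> + 2 * pi * of_int k) = cis \<phi>"
proof -
  have "cis (2 * pi * of_int k) = 1"
    using cis_multiple_2pi[of "of_int k"] by simp
  then show ?thesis by (simp flip: cis_mult)
qed

lemma circle_avg_shift:
  assumes [measurable]: "F \<in> borel_measurable borel"
  shows "circle_avg F z = ennreal (1 / (2 * pi)) * (\<integral>\<^sup>+\<phi>\<in>{c..<c + 2 * pi}. F (z * cis \<phi>) \<partial>lborel)"
  unfolding circle_avg_def by (subst nn_integral_periodic) auto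

lemma circle_avg_mult_cis:
  assumes [measurable]: "F \<in> borel_measurable borel"
  shows "circle_avg F (z * cis \<alpha>) = circle_avg F z"
proof -
  have "(\<integral>\<^sup>+\<phi>\<in>{\<alpha>..<\<alpha> + 2 * pi}. F (z * cis \<phi>) \<partial>lborel)
      = (\<integral>\<^sup>+\<phi>. F (z * cis (\<alpha> + 1 * \<phi>)) * indicator {\<alpha>..<\<alpha> + 2 * pi} (\<alpha> + 1 * \<phi>) \<partial>lborel)"
    by (subst nn_integral_real_affine[of _ 1 \<alpha>]) auto
  also have "\<dots> = (\<integral>\<^sup>+\<phi>\<in>{0..<2 * pi}. F (z * cis \<alpha> * cis \<phi>) \<partial>lborel)"
    by (intro nn_integral_cong) (auto simp: cis_mult[symmetric] mult_ac split: split_indicator)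
  finally show ?thesis using circle_avg_shift[OF assms, of z \<alpha>] by (simp add: circle_avg_def)
qed

lemma circle_avg_norm_cong:
  assumes [measurable]: "F \<in> borel_measurable borel" and "cmod z = cmod w"
  shows "circle_avg F z = circle_avg F w"
proof -
  have "circle_avg F z = circle_avg F (of_real (cmod z))" for z
    using circle_avg_mult_cis[OF assms(1), of "of_real (cmod z)" "Arg z"] rcis_cmod_Arg[of z]
    by (simp add: rcis_def)
  then show ?thesis using assms(2) by metis
qed

subsection \<open>Integral means of powers of analytic functions\<close>

text \<open>At an interior maximum point \<open>w\<close>, add the branches of \<open>f j powr p\<close> that are positive at \<open>w\<close>:
  the modulus of this analytic sum is maximal at \<open>w\<close>, so the maximum modulus principle applies.\<close>

lemma sum_norm_powr_max_principle:
  fixes f :: "'i \<Rightarrow> complex \<Rightarrow> complex"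
  assumes fin: "finite J" and hol: "\<And>j. j \<in> J \<Longrightarrow> f j holomorphic_on S"
    and S: "open S" "cball 0 \<rho> \<subseteq> S" and p: "0 < p" and z: "cmod z \<le> \<rho>"
  obtains \<zeta> where "cmod \<zeta> = \<rho>" "(\<Sum>j\<in>J. cmod (f j z) powr p) \<le> (\<Sum>j\<in>J. cmod (f j \<zeta>) powr p)"
proof -
  define u where "u \<zeta> = (\<Sum>j\<in>J. cmod (f j \<zeta>) powr p)" for \<zeta>
  have \<rho>: "0 \<le> \<rho>" using z norm_ge_zero order_trans by blast
  have cf: "continuous_on (cball 0 \<rho>) (f j)" if "j \<in> J" for j
    using hol[OF that] S(2) holomorphic_on_imp_continuous_on continuous_on_subset by blast
  have cu: "continuous_on (cball 0 \<rho>) u"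
    unfolding u_def using p by (intro continuous_on_sum continuous_on_powr' continuous_on_norm cf) auto
  obtain x0 where x0: "x0 \<in> cball 0 \<rho>" "\<And>y. y \<in> cball 0 \<rho> \<Longrightarrow> u y \<le> u x0"
    using continuous_attains_sup[OF compact_cball _ cu] \<rho> by fastforce
  define M where "M = cball 0 \<rho> \<inter> u -` {u x0}"
  have "closed M" unfolding M_def by (intro continuous_closed_preimage cu) auto
  then have "compact M" using M_def compact_Int_closed[OF compact_cball, of M 0 \<rho>]
    by (simp add: Int_absorb1)
  moreover have "M \<noteq> {}" using x0 by (auto simp: M_def)
  \<comment> \<open>Among the maximum points one of largest modulus is taken: if it were interior,
    the analytic sum would be constant near it, and a maximum point slightly further out would
    contradict this choice.\<close>
  ultimately obtain w where w: "w \<in> M" "\<And>y. y \<in> M \<Longrightarrow> cmod y \<le> cmod w"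
    using continuous_attains_sup[of M cmod] by (auto intro: continuous_intros)
  have uw: "u w = u x0" and wr: "cmod w \<le> \<rho>" using w(1) by (auto simp: M_def)
  have "cmod w = \<rho>"
  proof (rule ccontr)
    assume "cmod w \<noteq> \<rho>"
    with wr have wl: "cmod w < \<rho>" by simp
    \<comment> \<open>Terms vanishing at w have no branch of the power there. Dropping them does not
      change the value at w and can only decrease the sum elsewhere, which is the right direction
      for a maximum at w.\<close>
    define J' where "J' = {j\<in>J. f j w \<noteq> 0}"
    have finJ': "finite J'" using fin by (simp add: J'_def)
    have tend: "\<forall>\<^sub>F y in nhds w. cmod (f j y / f j w - 1) < 1" if "j \<in> J'" for j
    proof -
      have "continuous_on (ball 0 \<rho>) (f j)" using cf[of j] that
        by (auto simp: J'_def intro: continuous_on_subset)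
      then have "isCont (f j) w" using wl by (auto simp: continuous_on_eq_continuous_at)
      then have "isCont (\<lambda>y. f j y / f j w - 1) w" by (intro continuous_intros) (use that J'_def in auto)
      then have "((\<lambda>y. f j y / f j w - 1) \<longlongrightarrow> f j w / f j w - 1) (nhds w)"
        using tendsto_at_iff_tendsto_nhds[of "\<lambda>y. f j y / f j w - 1" w] by (simp only: isCont_def)
      then have "((\<lambda>y. f j y / f j w - 1) \<longlongrightarrow> 0) (nhds w)"
        using that by (simp add: J'_def)
      then show ?thesis by (auto simp: tendsto_iff dist_norm)
    qed
    have "\<forall>\<^sub>F y in nhds w. \<forall>j\<in>J'. cmod (f j y / f j w - 1) < 1"
      using finJ' tend by (intro eventually_ball_finite) auto
    moreover have "\<forall>\<^sub>F y in nhds w. y \<in> ball 0 \<rho>"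
      using wl by (intro eventually_nhds_in_open) auto
    ultimately have "\<forall>\<^sub>F y in nhds w. y \<in> ball 0 \<rho> \<and> (\<forall>j\<in>J'. cmod (f j y / f j w - 1) < 1)"
      by eventually_elim auto
    then obtain e where e: "e > 0" "\<And>y. y \<in> ball w e \<Longrightarrow> y \<in> ball 0 \<rho>"
        "\<And>y j. y \<in> ball w e \<Longrightarrow> j \<in> J' \<Longrightarrow> cmod (f j y / f j w - 1) < 1"
      unfolding eventually_nhds_metric by (auto simp: dist_commute)
    \<comment> \<open>A branch of the p-th power of f j up to a unimodular constant: its modulus is
      \<open>cmod (f j y) powr p\<close>, and its value at w is positive, so that the summands add
      up at w without cancellation.\<close>
    define T where "T j y = of_real (cmod (f j w) powr p) * exp (of_real p * Ln (f j y / f j w))" for j y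
    define G where "G y = (\<Sum>j\<in>J'. T j y)" for y
    have nz: "Re (f j y / f j w) > 0" if "y \<in> ball w e" "j \<in> J'" for y j
    proof -
      have "\<bar>Re (f j y / f j w - 1)\<bar> < 1"
        using e(3)[OF that] abs_Re_le_cmod le_less_trans by blast
      then show ?thesis by simp
    qed
    have cT: "cmod (T j y) = cmod (f j y) powr p" if "y \<in> ball w e" "j \<in> J'" for y j
    proof -
      let ?x = "f j y / f j w"
      have x0: "?x \<noteq> 0" using nz[OF that] by auto
      have "cmod (T j y) = cmod (f j w) powr p * cmod ?x powr p"
        using x0 by (simp add: T_def norm_mult powr_def)
      also have "\<dots> = (cmod (f j w) * cmod ?x) powr p" by (simp add: powr_mult)
      also have "cmod (f j w) * cmod ?x = cmod (f j y)" using x0 by (simp add: norm_divide)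
      finally show ?thesis .
    qed
    have Gle: "cmod (G y) \<le> u y" if "y \<in> ball w e" for y
    proof -
      have "cmod (G y) \<le> (\<Sum>j\<in>J'. cmod (T j y))" unfolding G_def by (rule norm_sum)
      also have "\<dots> = (\<Sum>j\<in>J'. cmod (f j y) powr p)" using cT that by (intro sum.cong) auto
      also have "\<dots> \<le> u y" unfolding u_def using fin by (intro sum_mono2) (auto simp: J'_def)
      finally show ?thesis .
    qed
    have Gw: "cmod (G w) = u w"
    proof -
      have "G w = of_real (\<Sum>j\<in>J'. cmod (f j w) powr p)"
        unfolding G_def T_def of_real_sum by (intro sum.cong) (auto simp: J'_def)
      then have "cmod (G w) = (\<Sum>j\<in>J'. cmod (f j w) powr p)"
        by (simp add: sum_nonneg del: of_real_sum)
      also have "\<dots> = u w" unfolding u_def using fin p by (intro sum.mono_neutral_left) (auto simp: J'_def)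
      finally show ?thesis .
    qed
    have "G holomorphic_on ball w e"
    proof -
      have hT: "T j holomorphic_on ball w e" if "j \<in> J'" for j
        unfolding T_def
      proof (intro holomorphic_intros holomorphic_on_subset[OF hol])
        show "ball w e \<subseteq> S"
        proof
          fix y assume "y \<in> ball w e"
          then have "y \<in> cball 0 \<rho>" using e(2)[of y] by simp
          then show "y \<in> S" using S(2) by blast
        qed
        show "f j y / f j w \<notin> \<real>\<^sub>\<le>\<^sub>0" if "y \<in> ball w e" for y
          using nz[OF that \<open>j \<in> J'\<close>] by (auto simp: complex_nonpos_Reals_iff)
      qed (use that J'_def in auto)
      then show ?thesis unfolding G_def by (intro holomorphic_on_sum hT)
    qed
    moreover have "cmod (G y) \<le> cmod (G w)" if "y \<in> ball w e" for y
      using Gle[OF that] Gw uw x0(2)[of y] e(2)[OF that] by auto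
    ultimately have "G constant_on ball w e"
      using e(1) by (intro maximum_modulus_principle[of G _ "ball w e" w]) auto
    then have const: "G y = G w" if "y \<in> ball w e" for y
      using that e(1) unfolding constant_on_def by (metis centre_in_ball)
    \<comment> \<open>The outward direction at w; from the origin every direction leads
      outward.\<close>
    define d where "d = (if w = 0 then 1 else sgn w)"
    define y where "y = w + of_real (e / 2) * d"
    have d1: "cmod d = 1" by (auto simp: d_def norm_sgn)
    have yb: "y \<in> ball w e" using e(1) d1 by (simp add: y_def dist_norm norm_mult)
    have "w = of_real (cmod w) * d" by (auto simp: d_def sgn_eq)
    then have "y = of_real (cmod w + e / 2) * d" by (simp add: y_def algebra_simps)
    then have ycm: "cmod y = cmod w + e / 2" using d1 e(1) by (simp only: norm_mult norm_of_real) simp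
    have "u y \<le> u x0" using x0(2)[of y] e(2)[OF yb] by auto
    moreover have "u x0 \<le> u y" using Gle[OF yb] const[OF yb] Gw uw by simp
    ultimately have "y \<in> M" using e(2)[OF yb] by (auto simp: M_def)
    then show False using w(2)[of y] ycm e(1) by simp
  qed
  moreover have "u z \<le> u w" using x0(2)[of z] z uw by simp
  ultimately show ?thesis using that unfolding u_def by blast
qed

text \<open>The error is controlled by the oscillation over one mesh width alone, so one mesh serves
  all integrands with a common modulus of continuity.\<close>

lemma integral_left_sum_bound:
  fixes g :: "real \<Rightarrow> real"
  assumes d: "0 \<le> d" and cont: "continuous_on {0..real k * d} g"
    and osc: "\<And>x y. x \<in> {0..real k * d} \<Longrightarrow> y \<in> {0..real k * d} \<Longrightarrow> \<bar>x - y\<bar> \<le> d \<Longrightarrow> \<bar>g x - g y\<bar> \<le> e"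
  shows "\<bar>integral {0..real k * d} g - d * (\<Sum>j<k. g (real j * d))\<bar> \<le> e * (real k * d)"
  using cont osc
proof (induction k)
  case (Suc k)
  let ?a = "real k * d" and ?b = "real (Suc k) * d"
  have ab: "0 \<le> ?a" "?a \<le> ?b" "?b - ?a = d" using d by (auto simp: algebra_simps)
  have ca: "continuous_on {0..?a} g" and cab: "continuous_on {?a..?b} g"
    using ab by (intro continuous_on_subset[OF Suc.prems(1)], simp only: atLeastatMost_subset_iff, simp)+
  have IH: "\<bar>integral {0..?a} g - d * (\<Sum>j<k. g (real j * d))\<bar> \<le> e * ?a"
    using ab by (intro Suc.IH ca Suc.prems(2)) auto
  have "integral {0..?b} g = integral {0..?a} g + integral {?a..?b} g"
    using ab Suc.prems(1) by (intro Henstock_Kurzweil_Integration.integral_combine[symmetric] integrable_continuous_interval) auto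
  moreover have "integral {?a..?b} (\<lambda>x. g x - g ?a) = integral {?a..?b} g - d * g ?a"
    using cab ab by (subst Henstock_Kurzweil_Integration.integral_diff) (auto intro: integrable_continuous_interval)
  moreover have "norm (integral {?a..?b} (\<lambda>x. g x - g ?a)) \<le> e * (?b - ?a)"
  proof (intro integral_bound continuous_intros cab ab(2))
    fix t assume t: "t \<in> {?a..?b}"
    have "?a \<le> t" "t \<le> ?b" using t by (simp_all only: atLeastAtMost_iff)
    moreover have "t \<in> {0..b} \<and> a \<in> {0..b} \<and> \<bar>t - a\<bar> \<le> d"
      if "0 \<le> a" "a \<le> b" "b - a = d" "a \<le> t" "t \<le> b" for a b using that by auto
    ultimately have "t \<in> {0..?b} \<and> ?a \<in> {0..?b} \<and> \<bar>t - ?a\<bar> \<le> d" using ab by blast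
    then show "norm (g t - g ?a) \<le> e" using Suc.prems(2)[of t ?a] by simp
  qed
  ultimately show ?case using IH ab by (simp add: algebra_simps abs_le_iff)
qed auto

text \<open>Cut off outside the disc, since f is a total function with arbitrary values there; the
  cut-off function is Borel on the plane whenever f is holomorphic on the disc.\<close>

definition pow_mod :: "(complex \<Rightarrow> complex) \<Rightarrow> real \<Rightarrow> complex \<Rightarrow> ennreal" where
  "pow_mod f p z = ennreal (cmod (f z) powr p) * indicator (ball 0 1) z"

lemma borel_measurable_norm_powr_indicator:
  fixes f :: "complex \<Rightarrow> complex"
  assumes "continuous_on S f" "open S"
  shows "(\<lambda>x. ennreal (cmod (f x) powr p) * indicator S x) \<in> borel_measurable borel"
proof -
  define g where "g = (\<lambda>z. indicator S z *\<^sub>R f z)"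
  have [measurable]: "g \<in> borel_measurable borel" "S \<in> sets borel"
    unfolding g_def using assms by (auto intro!: borel_measurable_continuous_on_indicator)
  have "(\<lambda>x. ennreal (cmod (f x) powr p) * indicator S x) = (\<lambda>z. ennreal (cmod (g z) powr p) * indicator S z)"
    by (auto simp: fun_eq_iff g_def split: split_indicator)
  then show ?thesis by (simp only:) measurable
qed

lemma borel_measurable_pow_mod [measurable]:
  assumes "f holomorphic_on ball 0 1"
  shows "pow_mod f p \<in> borel_measurable borel"
  unfolding pow_mod_def[abs_def] using holomorphic_on_imp_continuous_on[OF assms]
  by (intro borel_measurable_norm_powr_indicator) auto

text \<open>Riemann sums of a circular mean are sums over finitely many rotations of \<open>f\<close>, to which the
  maximum principle above applies.\<close>

lemma circle_avg_pow_mod_mono: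
  assumes hol: "f holomorphic_on ball 0 1" and p: "0 < p" and zw: "cmod z \<le> cmod w" "cmod w < 1"
  shows "circle_avg (pow_mod f p) z \<le> circle_avg (pow_mod f p) w"
proof -
  define v where "v x = cmod (f x) powr p" for x
  define I where "I x = integral {0..2 * pi} (\<lambda>\<phi>. v (x * cis \<phi>))" for x
  have cf: "continuous_on (ball 0 1) f" using hol holomorphic_on_imp_continuous_on by blast
  have cv: "continuous_on (ball 0 1) v"
    unfolding v_def using p by (intro continuous_on_powr' continuous_on_norm cf continuous_on_const) auto
  have cI: "continuous_on {0..2 * pi} (\<lambda>\<phi>. v (x * cis \<phi>))" if "cmod x < 1" for x
    using that by (intro continuous_on_compose2[OF cv] continuous_intros) (auto simp: norm_mult)
  have avg: "circle_avg (pow_mod f p) x = ennreal (1 / (2 * pi)) * ennreal (I x)" if "cmod x < 1" for x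
  proof -
    have "(\<integral>\<^sup>+\<phi>\<in>{0..<2 * pi}. pow_mod f p (x * cis \<phi>) \<partial>lborel)
        = (\<integral>\<^sup>+\<phi>. ennreal (v (x * cis \<phi>)) * indicator {0..2*pi} \<phi> \<partial>lborel)"
    proof (intro nn_integral_cong_AE)
      show "AE \<phi> in lborel. pow_mod f p (x * cis \<phi>) * indicator {0..<2 * pi} \<phi> =
              ennreal (v (x * cis \<phi>)) * indicator {0..2 * pi} \<phi>"
        using AE_lborel_singleton[of "2 * pi"]
        by eventually_elim (use that in \<open>auto simp: pow_mod_def v_def norm_mult split: split_indicator\<close>)
    qed
    also have "\<dots> = ennreal (I x)"
      unfolding I_def using cI[OF that]
      by (intro nn_integral_has_integral_lebesgue' integrable_integral integrable_continuous_interval)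
         (auto simp: v_def)
    finally show ?thesis by (simp add: circle_avg_def)
  qed
  have Inn: "0 \<le> I x" if "cmod x < 1" for x
    unfolding I_def using cI[OF that]
    by (intro Henstock_Kurzweil_Integration.integral_nonneg integrable_continuous_interval) (auto simp: v_def)
  have Icong: "I \<zeta> = I w" if "cmod \<zeta> = cmod w" for \<zeta>
  proof -
    have "circle_avg (pow_mod f p) \<zeta> = circle_avg (pow_mod f p) w"
      using hol that by (intro circle_avg_norm_cong) auto
    then have "ennreal (1 / (2 * pi)) * ennreal (I \<zeta>) = ennreal (1 / (2 * pi)) * ennreal (I w)"
      using avg[of \<zeta>] avg[of w] that zw by simp
    then show ?thesis using Inn[of \<zeta>] Inn[of w] that zw pi_gt_zero
      by (auto simp: not_le[symmetric] ennreal_mult_cancel_left ennreal_eq_0_iff)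
  qed
  let ?\<rho> = "cmod w"
  have "I z \<le> I w + e" if e: "0 < e" for e
  proof -
    \<comment> \<open>Two Riemann sums are compared, each with error at most e' * (2 * pi), whence 4
      * pi.\<close>
    define e' where "e' = e / (4 * pi)"
    have e': "e' > 0" using e by (simp add: e'_def)
    \<comment> \<open>Uniform in the base point as well as in the angle: the mesh has to be fixed
      before the boundary point \<zeta> is known.\<close>
    have "uniformly_continuous_on (cball 0 ?\<rho> \<times> {0..2 * pi}) (\<lambda>x. v (fst x * cis (snd x)))"
    proof (intro compact_uniformly_continuous compact_Times)
      show "continuous_on (cball 0 ?\<rho> \<times> {0..2 * pi}) (\<lambda>x. v (fst x * cis (snd x)))"
      proof (rule continuous_on_compose2[OF cv])
        show "continuous_on (cball 0 ?\<rho> \<times> {0..2 * pi}) (\<lambda>x. fst x * cis (snd x))"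
          by (intro continuous_intros)
        show "(\<lambda>x. fst x * cis (snd x)) ` (cball 0 ?\<rho> \<times> {0..2 * pi}) \<subseteq> ball 0 1"
          using zw by (auto simp: norm_mult)
      qed
    qed auto
    then obtain \<delta> where \<delta>: "\<delta> > 0" "\<And>x x'. x \<in> cball 0 ?\<rho> \<times> {0..2 * pi} \<Longrightarrow> x' \<in> cball 0 ?\<rho> \<times> {0..2 * pi}
        \<Longrightarrow> dist x' x < \<delta> \<Longrightarrow> dist (v (fst x' * cis (snd x'))) (v (fst x * cis (snd x))) < e'"
      unfolding uniformly_continuous_on_def using e' by meson
    obtain N :: nat where N: "2 * pi / \<delta> < real N" using reals_Archimedean2 by blast
    have N0: "N > 0" using N \<delta>(1) by (cases N) (auto simp: field_simps)
    define d where "d = 2 * pi / real N"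
    have d: "0 < d" "d < \<delta>" "real N * d = 2 * pi"
      using N N0 \<delta>(1) by (auto simp: d_def field_simps)
    have app: "\<bar>I x - d * (\<Sum>j<N. v (x * cis (real j * d)))\<bar> \<le> e' * (2 * pi)" if x: "cmod x \<le> ?\<rho>" for x
    proof -
      have "\<bar>integral {0..real N * d} (\<lambda>\<phi>. v (x * cis \<phi>)) - d * (\<Sum>j<N. v (x * cis (real j * d)))\<bar> \<le> e' * (real N * d)"
      proof (rule integral_left_sum_bound)
        show "continuous_on {0..real N * d} (\<lambda>\<phi>. v (x * cis \<phi>))" using cI[of x] x zw d by simp
        fix a b assume ab: "a \<in> {0..real N * d}" "b \<in> {0..real N * d}" "\<bar>a - b\<bar> \<le> d"
        then have "dist (v (x * cis a)) (v (x * cis b)) < e'"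
          using \<delta>(2)[of "(x, b)" "(x, a)"] x d by (auto simp: dist_Pair_Pair dist_real_def)
        then show "\<bar>v (x * cis a) - v (x * cis b)\<bar> \<le> e'" by (simp add: dist_real_def)
      qed (use d in auto)
      then show ?thesis by (simp add: I_def d)
    qed
    \<comment> \<open>The point \<zeta> depends on the mesh and need not be w. This is harmless,
      because the integral over the circle depends on the modulus only
      (\<open>Icong\<close>).\<close>
    obtain \<zeta> where \<zeta>: "cmod \<zeta> = ?\<rho>"
      "(\<Sum>j<N. v (z * cis (real j * d))) \<le> (\<Sum>j<N. v (\<zeta> * cis (real j * d)))"
    proof (rule sum_norm_powr_max_principle[of "{..<N}" "\<lambda>j x. f (x * cis (real j * d))" "ball 0 1" ?\<rho> p z])
      show "(\<lambda>x. f (x * cis (real j * d))) holomorphic_on ball 0 1" for j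
      proof -
        have h1: "(\<lambda>x. x * cis (real j * d)) holomorphic_on ball 0 1" by (intro holomorphic_intros)
        have h2: "(\<lambda>x. x * cis (real j * d)) ` ball 0 1 \<subseteq> ball 0 1" by (auto simp: norm_mult)
        show ?thesis using holomorphic_on_compose_gen[OF h1 hol h2] by (simp add: o_def)
      qed
    qed (use zw p in \<open>auto simp: v_def\<close>)
    have "d * (\<Sum>j<N. v (z * cis (real j * d))) \<le> d * (\<Sum>j<N. v (\<zeta> * cis (real j * d)))"
      using \<zeta>(2) d by simp
    then have "I z \<le> I \<zeta> + 2 * (e' * (2 * pi))" using app[of z] app[of \<zeta>] zw \<zeta>(1) by (simp add: abs_le_iff)
    also have "2 * (e' * (2 * pi)) = e" by (simp add: e'_def)
    finally show ?thesis using Icong[OF \<zeta>(1)] by simp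
  qed
  then have "I z \<le> I w" by (rule field_le_epsilon)
  then show ?thesis using avg[of z] avg[of w] zw by (auto intro!: mult_left_mono ennreal_leI)
qed

text \<open>The value at the centre is the mean over a degenerate circle, which by monotonicity is
  at most every other circular mean; integrating over the unit disc and rescaling gives the claim.
  No restriction p >= 1 arises, since monotonicity holds for all p > 0.\<close>

lemma sub_mean_value_ball:
  assumes hol: "f holomorphic_on ball c R" and R: "0 < R" and p: "0 < p"
  shows "ennreal (pi * R\<^sup>2) * ennreal (cmod (f c) powr p)
    \<le> (\<integral>\<^sup>+x\<in>ball c R. ennreal (cmod (f x) powr p) \<partial>lborel)"
proof -
  define g where "g \<zeta> = f (c + of_real R * \<zeta>)" for \<zeta>
  have aff: "c + of_real R * \<zeta> \<in> ball c R \<longleftrightarrow> \<zeta> \<in> ball 0 1" for \<zeta>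
    using R by (simp add: dist_norm norm_mult)
  have hg: "g holomorphic_on ball 0 1"
  proof -
    have h1: "(\<lambda>\<zeta>. c + of_real R * \<zeta>) holomorphic_on ball 0 1" by (intro holomorphic_intros)
    have h2: "(\<lambda>\<zeta>. c + of_real R * \<zeta>) ` ball 0 1 \<subseteq> ball c R" using aff by blast
    show ?thesis using holomorphic_on_compose_gen[OF h1 hol h2] by (simp add: o_def g_def[abs_def])
  qed
  note [measurable] = borel_measurable_pow_mod[OF hg, of p]
  have cf: "continuous_on (ball c R) f" using hol holomorphic_on_imp_continuous_on by blast
  have mf: "(\<lambda>x. ennreal (cmod (f x) powr p) * indicator (ball c R) x) \<in> borel_measurable borel"
    using cf by (intro borel_measurable_norm_powr_indicator) auto
  have "ennreal (cmod (f c) powr p) = circle_avg (pow_mod g p) 0"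
    by (simp add: circle_avg_def pow_mod_def g_def nn_integral_cmult mult_ac flip: ennreal_mult)
  have "ennreal (cmod (f c) powr p) * ennreal pi = (\<integral>\<^sup>+\<zeta>. ennreal (cmod (f c) powr p) * indicator (ball (0::complex) 1) \<zeta> \<partial>lborel)"
    by (subst nn_integral_cmult_indicator) (auto simp: emeasure_ball_complex)
  also have "\<dots> \<le> (\<integral>\<^sup>+\<zeta>. circle_avg (pow_mod g p) \<zeta> * indicator {..<1} (cmod \<zeta>) \<partial>lborel)"
  proof (intro nn_integral_mono)
    fix \<zeta> :: complex
    show "ennreal (cmod (f c) powr p) * indicator (ball 0 1) \<zeta> \<le> circle_avg (pow_mod g p) \<zeta> * indicator {..<1} (cmod \<zeta>)"
      using circle_avg_pow_mod_mono[OF hg p, of 0 \<zeta>] \<open>ennreal (cmod (f c) powr p) = _\<close>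
      by (auto split: split_indicator)
  qed
  also have "\<dots> = (\<integral>\<^sup>+\<zeta>. pow_mod g p \<zeta> * indicator {..<1} (cmod \<zeta>) \<partial>lborel)"
    by (rule nn_integral_circle_avg[symmetric]) auto
  also have "\<dots> = (\<integral>\<^sup>+\<zeta>. ennreal (cmod (f (c + R *\<^sub>R \<zeta>)) powr p) * indicator (ball c R) (c + R *\<^sub>R \<zeta>) \<partial>lborel)"
    using aff by (intro nn_integral_cong)
      (auto simp: pow_mod_def g_def scaleR_conv_of_real dist_norm norm_mult R split: split_indicator)
  finally have le: "ennreal (cmod (f c) powr p) * ennreal pi
      \<le> (\<integral>\<^sup>+\<zeta>. ennreal (cmod (f (c + R *\<^sub>R \<zeta>)) powr p) * indicator (ball c R) (c + R *\<^sub>R \<zeta>) \<partial>lborel)" .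
  have "(\<integral>\<^sup>+x\<in>ball c R. ennreal (cmod (f x) powr p) \<partial>lborel)
      = (\<integral>\<^sup>+x. ennreal (cmod (f x) powr p) * indicator (ball c R) x
          \<partial>density (distr lborel borel (\<lambda>x. c + R *\<^sub>R x)) (\<lambda>_. ennreal (\<bar>R\<bar>^DIM(complex))))"
    using R by (subst lborel_affine[of R c]) auto
  also have "\<dots> = ennreal (R\<^sup>2) * (\<integral>\<^sup>+\<zeta>. ennreal (cmod (f (c + R *\<^sub>R \<zeta>)) powr p) * indicator (ball c R) (c + R *\<^sub>R \<zeta>) \<partial>lborel)"
    using mf by (simp add: nn_integral_density nn_integral_cmult nn_integral_distr)
  finally have eq: "(\<integral>\<^sup>+x\<in>ball c R. ennreal (cmod (f x) powr p) \<partial>lborel)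
     = ennreal (R\<^sup>2) * (\<integral>\<^sup>+\<zeta>. ennreal (cmod (f (c + R *\<^sub>R \<zeta>)) powr p) * indicator (ball c R) (c + R *\<^sub>R \<zeta>) \<partial>lborel)" .
  have "ennreal (pi * R\<^sup>2) * ennreal (cmod (f c) powr p) = ennreal (R\<^sup>2) * (ennreal (cmod (f c) powr p) * ennreal pi)"
    by (simp add: ennreal_mult mult_ac)
  then show ?thesis unfolding eq using le by (simp add: mult_left_mono)
qed

text \<open>Sub-mean values on discs of radius R / 2 bound f on the disc of half the size, where
  Cauchy's inequality applies. The area of the small discs contributes 4 / pi and the exponent -2,
  the Cauchy radius R / 2 contributes the p-th powers of 2 ^ n and of R ^ (- n).\<close>

lemma deriv_powr_le_integral_ball:
  assumes hol: "f holomorphic_on ball c R" and R: "0 < R" and p: "0 < p"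
  shows "ennreal (cmod ((deriv ^^ n) f c) powr p)
    \<le> ennreal ((fact n * 2 ^ n) powr p * 4 / pi * R powr (- (real n * p) - 2))
        * (\<integral>\<^sup>+x\<in>ball c R. ennreal (cmod (f x) powr p) \<partial>lborel)"
    (is "_ \<le> ennreal ?C * ?I")
proof (cases "?I = \<infinity>")
  case True
  have top: "ennreal c * \<infinity> = \<infinity>" if "c > 0" for c
    using that by (simp add: ennreal_mult_top)
  have "?C > 0" using R by simp
  then show ?thesis unfolding True top[OF \<open>?C > 0\<close>] by simp
next
  case False
  then obtain A where A: "?I = ennreal A" "0 \<le> A" by (cases ?I) auto
  define B where "B = (4 * A / (pi * R\<^sup>2)) powr (1 / p)"
  have sub: "ball w (R/2) \<subseteq> ball c R" if "w \<in> cball c (R/2)" for w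
  proof
    fix x assume "x \<in> ball w (R/2)"
    then show "x \<in> ball c R" using that dist_triangle[of c x w] by simp
  qed
  have Bw: "cmod (f w) \<le> B" if w: "w \<in> cball c (R/2)" for w
  proof -
    have "ennreal (pi * (R/2)\<^sup>2) * ennreal (cmod (f w) powr p)
       \<le> (\<integral>\<^sup>+x\<in>ball w (R/2). ennreal (cmod (f x) powr p) \<partial>lborel)"
      using R p by (intro sub_mean_value_ball holomorphic_on_subset[OF hol sub[OF w]]) auto
    also have "\<dots> \<le> ?I"
      using sub[OF w] by (intro nn_integral_mono mult_left_mono) (auto split: split_indicator)
    finally have "ennreal (pi * (R/2)\<^sup>2 * cmod (f w) powr p) \<le> ennreal A"
      using A by (simp add: ennreal_mult)
    then have "pi * (R/2)\<^sup>2 * cmod (f w) powr p \<le> A"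
      using A(2) by (subst (asm) ennreal_le_iff) auto
    then have "cmod (f w) powr p \<le> 4 * A / (pi * R\<^sup>2)"
      using R by (simp add: field_simps power2_eq_square)
    then have "(cmod (f w) powr p) powr (1 / p) \<le> B"
      unfolding B_def using p by (intro powr_mono2) auto
    then show ?thesis using p by (simp add: powr_powr)
  qed
  have "ball c (R/2) \<subseteq> ball c R" "cball c (R/2) \<subseteq> ball c R" using R by auto
  then have "cmod ((deriv ^^ n) f c) \<le> fact n * B / (R/2) ^ n"
    using R Bw hol holomorphic_on_imp_continuous_on[OF holomorphic_on_subset[OF hol]]
    by (intro Cauchy_inequality) (auto simp: dist_norm intro: holomorphic_on_subset)
  also have "\<dots> = fact n * 2 ^ n * R powr (- real n) * B"
    using R by (simp add: powr_minus powr_realpow power_divide field_simps)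
  finally have "cmod ((deriv ^^ n) f c) powr p \<le> (fact n * 2 ^ n * R powr (- real n) * B) powr p"
    using p by (intro powr_mono2) auto
  also have "\<dots> = (fact n * 2 ^ n) powr p * R powr (- real n * p) * B powr p"
    using R by (simp add: powr_mult powr_powr B_def)
  also have "B powr p = 4 * A / (pi * R\<^sup>2)"
    using p A R by (simp add: B_def powr_powr)
  also have "(fact n * 2 ^ n) powr p * R powr (- real n * p) * (4 * A / (pi * R\<^sup>2)) = ?C * A"
    using R by (simp add: powr_diff field_simps)
  finally show ?thesis unfolding A(1) using A(2) by (simp flip: ennreal_mult')
qed

subsection \<open>Doubling profiles\<close>

lemma ball_sets_borel [measurable]: "ball (c::complex) r \<in> sets borel"
  by simp

lemma ex_power_between:
  fixes b y :: real
  assumes "1 < b" "1 \<le> y"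
  obtains i where "b ^ i \<le> y" "y < b ^ Suc i"
proof -
  define n where "n = (LEAST n. y < b ^ n)"
  have ex: "\<exists>n. y < b ^ n" using real_arch_pow assms by blast
  have n: "y < b ^ n" unfolding n_def by (rule LeastI_ex[OF ex])
  then have "n \<noteq> 0" using assms(2) by (cases n) auto
  then obtain i where i: "n = Suc i" by (cases n) auto
  have "\<not> y < b ^ i" using not_less_Least[of i "\<lambda>n. y < b ^ n"] i by (simp add: n_def)
  then show ?thesis using that[of i] n i by simp
qed

text \<open>A kernel is large on a short arc only. Where the cosine is not positive, the real part
  is at least 1 and pi < 4 suffices; elsewhere the angle is at most 2 in modulus and comparable with
  its sine.\<close>

lemma abs_le_norm_1_minus_cis:
  assumes x: "0 \<le> x" "x \<le> 1" and \<psi>: "\<bar>\<psi>\<bar> \<le> pi"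
  shows "\<bar>\<psi>\<bar> \<le> 4 * cmod (1 - of_real x * cis \<psi>)"
proof (cases "cos \<psi> \<le> 0")
  case True
  have "1 \<le> Re (1 - of_real x * cis \<psi>)" using True x by (simp add: mult_nonneg_nonpos)
  also have "\<dots> \<le> cmod (1 - of_real x * cis \<psi>)" by (rule complex_Re_le_cmod)
  finally show ?thesis using \<psi> pi_less_4 by linarith
next
  case False
  have "\<bar>\<psi>\<bar> < pi / 2"
  proof (rule ccontr)
    assume "\<not> \<bar>\<psi>\<bar> < pi / 2"
    then have "cos \<bar>\<psi>\<bar> \<le> cos (pi / 2)" using \<psi> by (intro cos_monotone_0_pi_le) auto
    then show False using False by simp
  qed
  then have l2: "\<bar>\<psi>\<bar> \<le> 2" using pi_less_4 by linarith
  have "\<bar>sin \<psi> - (\<Sum>m<3. sin_coeff m * \<psi> ^ m)\<bar> \<le> inverse (fact 3) * \<bar>\<psi>\<bar> ^ 3"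
    by (rule Maclaurin_sin_bound)
  moreover have "(\<Sum>m<3. sin_coeff m * \<psi> ^ m) = \<psi>"
    by (simp add: eval_nat_numeral sin_coeff_def)
  ultimately have "\<bar>sin \<psi> - \<psi>\<bar> \<le> \<bar>\<psi>\<bar> ^ 3 / 6"
    by (simp add: fact_numeral)
  moreover have "y ^ 3 / 6 \<le> 4 * y / 6" if "0 \<le> y" "y \<le> 2" for y :: real
    using mult_right_mono[OF power_mono[OF that(2,1), of 2] that(1)]
    by (simp add: power3_eq_cube power2_eq_square)
  ultimately have "\<bar>sin \<psi> - \<psi>\<bar> \<le> 4 * \<bar>\<psi>\<bar> / 6"
    using l2 by (meson abs_ge_zero order_trans)
  then have s: "\<bar>\<psi>\<bar> \<le> 3 * \<bar>sin \<psi>\<bar>" by linarith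
  \<comment> \<open>Rotating by -\<psi> makes the term with x real, so the imaginary part is -sin
    \<psi> whatever x is.\<close>
  have "\<bar>sin \<psi>\<bar> = \<bar>Im (cis (-\<psi>) * (1 - of_real x * cis \<psi>))\<bar>"
    by (simp add: right_diff_distrib mult.left_commute[of "cis _" "of_real x"] cis_mult)
  also have "\<dots> \<le> cmod (cis (-\<psi>) * (1 - of_real x * cis \<psi>))" by (rule abs_Im_le_cmod)
  also have "\<dots> = cmod (1 - of_real x * cis \<psi>)" by (simp add: norm_mult)
  finally show ?thesis using s norm_ge_zero[of "1 - of_real x * cis \<psi>"] by linarith
qed

lemma circle_avg_le_indicator_length:
  assumes [measurable]: "F \<in> borel_measurable borel" and "\<And>\<phi>. \<phi> \<in> {c..<c + 2 * pi} \<Longrightarrow> F (z * cis \<phi>) \<le> indicator {a..b} \<phi>"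
    and "a \<le> b"
  shows "circle_avg F z \<le> ennreal ((b - a) / (2 * pi))"
proof -
  have "circle_avg F z = ennreal (1 / (2 * pi)) * (\<integral>\<^sup>+\<phi>\<in>{c..<c + 2 * pi}. F (z * cis \<phi>) \<partial>lborel)"
    by (rule circle_avg_shift) measurable
  also have "\<dots> \<le> ennreal (1 / (2 * pi)) * (\<integral>\<^sup>+\<phi>. indicator {a..b} \<phi> \<partial>lborel)"
  proof (intro mult_left_mono nn_integral_mono)
    fix \<phi> :: real
    show "F (z * cis \<phi>) * indicator {c..<c + 2 * pi} \<phi> \<le> indicator {a..b} \<phi>"
    proof (cases "\<phi> \<in> {c..<c + 2 * pi}")
      case True
      then show ?thesis using assms(2)[OF True] by simp
    qed auto
  qed simp
  also have "\<dots> = ennreal ((b - a) / (2 * pi))"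
    using assms(3) by (simp flip: ennreal_mult)
  finally show ?thesis .
qed

text \<open>After a rotation cnj a * z is a real number in [0, 1], so the points in question lie in
  an arc of half-length 4 * \<eta>; its share 8 * \<eta> / (2 * pi) of the circle is at most 2 *
  \<eta> because pi >= 2.\<close>

lemma circle_avg_near_le:
  assumes a: "cmod a \<le> 1" and z: "cmod z \<le> 1" and \<eta>: "0 \<le> \<eta>"
  shows "circle_avg (indicator {x. cmod (1 - cnj a * x) < \<eta>}) z \<le> ennreal (2 * \<eta>)"
proof -
  obtain \<beta> where \<beta>: "cnj a * z = of_real (cmod (cnj a * z)) * cis \<beta>"
    using rcis_cmod_Arg[of "cnj a * z"] by (metis rcis_def)
  have x: "0 \<le> cmod (cnj a * z)" "cmod (cnj a * z) \<le> 1"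
    using a z by (auto simp: norm_mult mult_le_one)
  have "circle_avg (indicator {x. cmod (1 - cnj a * x) < \<eta>}) z
      \<le> ennreal ((- \<beta> + 4 * \<eta> - (- \<beta> - 4 * \<eta>)) / (2 * pi))"
  proof (rule circle_avg_le_indicator_length[where c = "- \<beta> - pi"])
    fix \<phi> assume \<phi>: "\<phi> \<in> {- \<beta> - pi..<- \<beta> - pi + 2 * pi}"
    have "\<bar>\<phi> + \<beta>\<bar> \<le> 4 * \<eta>" if "cmod (1 - cnj a * (z * cis \<phi>)) < \<eta>"
    proof -
      have "cnj a * (z * cis \<phi>) = of_real (cmod (cnj a * z)) * cis (\<phi> + \<beta>)"
        using \<beta> by (metis cis_mult mult.assoc add.commute)
      moreover have "\<bar>\<phi> + \<beta>\<bar> \<le> pi" using \<phi> by auto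
      ultimately have "\<bar>\<phi> + \<beta>\<bar> \<le> 4 * cmod (1 - cnj a * (z * cis \<phi>))"
        using abs_le_norm_1_minus_cis[OF x, of "\<phi> + \<beta>"] by simp
      then show ?thesis using that by simp
    qed
    then show "indicator {x. cmod (1 - cnj a * x) < \<eta>} (z * cis \<phi>) \<le> (indicator {- \<beta> - 4 * \<eta>..- \<beta> + 4 * \<eta>} \<phi> :: ennreal)"
      by (auto simp: abs_le_iff split: split_indicator)
  qed (use \<eta> in auto)
  also have "\<dots> \<le> ennreal (2 * \<eta>)"
    using \<eta> pi_ge_two mult_left_mono[OF pi_ge_two \<eta>] by (intro ennreal_leI) (simp add: field_simps)
  finally show ?thesis .
qed

lemma nn_integral_radial_le:
  fixes g :: "real \<Rightarrow> ennreal"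
  assumes [measurable]: "g \<in> borel_measurable borel"
  shows "(\<integral>\<^sup>+z\<in>ball 0 1. g (cmod z) \<partial>lborel) \<le> ennreal (2 * pi) * (\<integral>\<^sup>+s\<in>{0..<1}. g s \<partial>lborel)"
proof -
  have "(\<integral>\<^sup>+z\<in>ball 0 1. g (cmod z) \<partial>lborel) = (\<integral>\<^sup>+s\<in>{0..<1}. ennreal (2 * pi * s) * g s \<partial>lborel)"
    by (rule nn_integral_radial) measurable
  also have "\<dots> \<le> (\<integral>\<^sup>+s. ennreal (2 * pi) * (g s * indicator {0..<1} s) \<partial>lborel)"
    by (intro nn_integral_mono) (auto split: split_indicator intro!: mult_right_mono ennreal_leI)
  also have "\<dots> = ennreal (2 * pi) * (\<integral>\<^sup>+s\<in>{0..<1}. g s \<partial>lborel)"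
    by (rule nn_integral_cmult) measurable
  finally show ?thesis .
qed

lemma suminf_geometric_ennreal:
  assumes "0 \<le> c" "0 \<le> x" "x < (1::real)"
  shows "(\<Sum>i. ennreal (c * x ^ i)) = ennreal (c / (1 - x))"
proof -
  have s: "(\<lambda>i. c * x ^ i) sums (c * (1 / (1 - x)))"
    using assms by (intro sums_mult geometric_sums) auto
  then have "(\<Sum>i. ennreal (c * x ^ i)) = ennreal (\<Sum>i. c * x ^ i)"
    using assms by (intro suminf_ennreal2) (auto simp: sums_iff)
  then show ?thesis using s by (simp add: sums_iff)
qed

lemma ennreal_le_suminf: "f j \<le> (\<Sum>i. f i :: ennreal)"
  using sum_le_suminf[OF summableI, of "{j}" f] by simp

text \<open>\<open>W\<close> stands for a Borel version of the radial density of the weight and \<open>h\<close> for its tail integral.\<close>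

locale doubling_profile =
  fixes W :: "real \<Rightarrow> ennreal" and h :: "real \<Rightarrow> real" and C1 C2 K :: real
  assumes W_measurable [measurable]: "W \<in> borel_measurable borel"
    and h_measurable [measurable]: "h \<in> borel_measurable borel"
    and tail: "\<And>r. 0 \<le> r \<Longrightarrow> r < 1 \<Longrightarrow> (\<integral>\<^sup>+s\<in>{r..<1}. W s \<partial>lborel) = ennreal (h r)"
    and h_pos: "\<And>r. 0 \<le> r \<Longrightarrow> r < 1 \<Longrightarrow> 0 < h r"
    and C1: "1 \<le> C1" "\<And>r. 0 \<le> r \<Longrightarrow> r < 1 \<Longrightarrow> h r \<le> C1 * h ((1 + r) / 2)"
    and KC2: "1 < K" "1 < C2" "\<And>r. 0 \<le> r \<Longrightarrow> r < 1 \<Longrightarrow> C2 * h (1 - (1 - r) / K) \<le> h r"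
begin

lemma h_antimono: "0 \<le> r \<Longrightarrow> r \<le> s \<Longrightarrow> s < 1 \<Longrightarrow> h s \<le> h r"
proof -
  assume r: "0 \<le> r" "r \<le> s" "s < 1"
  have "ennreal (h s) \<le> ennreal (h r)"
    using r by (subst (1 2) tail[symmetric]) (auto intro!: nn_integral_mono mult_left_mono split: split_indicator)
  then show ?thesis using h_pos[of r] r by (subst (asm) ennreal_le_iff) auto
qed

text \<open>Condition (1) iterated k times, each use doubling the distance to the circle. The
  maximum with 0 covers the case in which the doubled distance exceeds the radius of the
  disc.\<close>

lemma h_outer:
  assumes "0 < t" "t \<le> 1"
  shows "h (max 0 (1 - 2 ^ k * t)) \<le> C1 ^ k * h (1 - t)"
proof (induction k)
  case 0
  then show ?case using assms by simp
next
  case (Suc k)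
  define r where "r = max 0 (1 - 2 ^ Suc k * t)"
  define r' where "r' = max 0 (1 - 2 ^ k * t)"
  have p: "0 < 2 ^ k * t" using assms by simp
  have r: "0 \<le> r" "r < 1" "0 \<le> r'" "r' < 1" "r' \<le> (1 + r) / 2"
    using p by (auto simp: r_def r'_def max_def field_simps)
  have "h r \<le> C1 * h ((1 + r) / 2)" using r by (intro C1) auto
  also have "\<dots> \<le> C1 * h r'" using r C1(1) by (intro mult_left_mono h_antimono) auto
  also have "\<dots> \<le> C1 * (C1 ^ k * h (1 - t))" using Suc C1(1) by (auto simp: r'_def)
  finally show ?case by (simp add: r_def)
qed

text \<open>Condition (1) in the form used for local estimates: B is absorbed into a power of 2 and
  costs that many doublings. The distance condition is one-sided because \<open>h\<close> is
  decreasing.\<close>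

lemma h_comparable:
  obtains C where "1 \<le> C" "\<And>r s. 0 \<le> r \<Longrightarrow> r < 1 \<Longrightarrow> 0 \<le> s \<Longrightarrow> s < 1 \<Longrightarrow> 1 - r \<le> B * (1 - s) \<Longrightarrow> h r \<le> C * h s"
proof -
  obtain k :: nat where k: "B < 2 ^ k" using real_arch_pow[of 2 B] by auto
  have k': "B \<le> 2 ^ k" using k by simp
  show ?thesis
  proof (rule that[of "C1 ^ k"])
    show "1 \<le> C1 ^ k" using C1(1) by simp
    fix r s :: real assume rs: "0 \<le> r" "r < 1" "0 \<le> s" "s < 1" "1 - r \<le> B * (1 - s)"
    have "B * (1 - s) \<le> 2 ^ k * (1 - s)" using k' rs by (intro mult_right_mono) auto
    then have "1 - 2 ^ k * (1 - s) \<le> r" using rs(5) by linarith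
    then have "max 0 (1 - 2 ^ k * (1 - s)) \<le> r" using rs(1) by (rule max.boundedI[rotated])
    then have "h r \<le> h (max 0 (1 - 2 ^ k * (1 - s)))" using rs by (intro h_antimono) auto
    also have "\<dots> \<le> C1 ^ k * h (1 - (1 - s))" using rs by (intro h_outer) auto
    finally show "h r \<le> C1 ^ k * h s" by simp
  qed
qed

lemma inner_radius: "0 \<le> r \<Longrightarrow> r < 1 \<Longrightarrow> 0 \<le> 1 - (1 - r) / K ^ j \<and> 1 - (1 - r) / K ^ j < 1"
proof -
  assume r: "0 \<le> r" "r < 1"
  have "1 \<le> K ^ j" using KC2(1) by simp
  then have "(1 - r) / K ^ j \<le> 1" "(1 - r) / K ^ j > 0" using r by (auto simp: divide_le_eq_1)
  then show ?thesis by simp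
qed

lemma h_inner: "0 \<le> r \<Longrightarrow> r < 1 \<Longrightarrow> h (1 - (1 - r) / K ^ j) \<le> h r / C2 ^ j"
proof (induction j)
  case (Suc j)
  have "C2 * h (1 - (1 - (1 - (1 - r) / K ^ j)) / K) \<le> h (1 - (1 - r) / K ^ j)"
    using inner_radius[OF Suc.prems, of j] by (intro KC2) auto
  also have "\<dots> \<le> h r / C2 ^ j" by (rule Suc.IH[OF Suc.prems])
  finally show ?case using KC2 by (simp add: field_simps)
qed auto

text \<open>On the ring at distance about (1 - r) / K ^ j the singular factor costs K powr \<delta>
  per step while condition (2) gains C2 per step, so the rings sum to a geometric series as soon as
  K powr \<delta> < C2. This spare room is spent on sums of kernels with p > 1.\<close>

lemma weighted_tail_le:
  assumes \<delta>: "0 \<le> \<delta>" "K powr \<delta> < C2"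
  obtains C where "0 < C" "\<And>r. 0 \<le> r \<Longrightarrow> r < 1 \<Longrightarrow>
    (\<integral>\<^sup>+s\<in>{r..<1}. ennreal ((1 - s) powr (-\<delta>)) * W s \<partial>lborel) \<le> ennreal (C * (1 - r) powr (-\<delta>) * h r)"
proof -
  let ?x = "K powr \<delta> / C2"
  have x: "0 \<le> ?x" "?x < 1" using KC2 \<delta> by auto
  define C where "C = K powr \<delta> / (1 - ?x)"
  have "0 < C" using x KC2 by (auto simp: C_def)
  moreover have "(\<integral>\<^sup>+s\<in>{r..<1}. ennreal ((1 - s) powr (-\<delta>)) * W s \<partial>lborel) \<le> ennreal (C * (1 - r) powr (-\<delta>) * h r)"
    if r: "0 \<le> r" "r < 1" for r
  proof -
    define \<rho> where "\<rho> j = 1 - (1 - r) / K ^ j" for j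
    define c where "c j = (1 - r) powr (-\<delta>) * (K powr \<delta>) ^ Suc j" for j
    have \<rho>: "0 \<le> \<rho> j" "\<rho> j < 1" for j using inner_radius[OF r] by (auto simp: \<rho>_def)
    have pt: "ennreal ((1 - s) powr (-\<delta>)) * W s * indicator {r..<1} s \<le> (\<Sum>j. ennreal (c j) * (W s * indicator {\<rho> j..<1} s))"
      for s
    proof (cases "s \<in> {r..<1}")
      case True
      have "1 \<le> (1 - r) / (1 - s)" using True by (auto simp: le_divide_eq_1)
      then obtain j where j: "K ^ j \<le> (1 - r) / (1 - s)" "(1 - r) / (1 - s) < K ^ Suc j"
        using ex_power_between[OF KC2(1)] by blast
      have Kp: "0 < K ^ j" "0 < K ^ Suc j" using KC2(1) by auto
      have "K ^ j * (1 - s) \<le> 1 - r" using j(1) True by (simp add: pos_le_divide_eq)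
      then have "1 - s \<le> (1 - r) / K ^ j" using Kp by (simp add: pos_le_divide_eq mult.commute)
      then have in_j: "s \<in> {\<rho> j..<1}" using True by (simp add: \<rho>_def)
      have "1 - r < K ^ Suc j * (1 - s)" using j(2) True by (simp add: pos_divide_less_eq del: power_Suc)
      then have "(1 - r) / K ^ Suc j \<le> 1 - s" using Kp by (simp add: pos_divide_le_eq mult.commute del: power_Suc)
      then have "(1 - s) powr (-\<delta>) \<le> ((1 - r) / K ^ Suc j) powr (-\<delta>)"
        using r Kp \<delta> by (intro powr_mono2') auto
      also have "\<dots> = (1 - r) powr (-\<delta>) / (K ^ Suc j) powr (-\<delta>)"
        using r Kp by (simp add: powr_divide del: power_Suc)
      also have "(K ^ Suc j) powr (-\<delta>) = inverse ((K powr \<delta>) ^ Suc j)"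
        using KC2(1) by (simp add: powr_minus powr_realpow[symmetric] powr_powr mult.commute del: power_Suc of_nat_Suc)
      finally have "(1 - s) powr (-\<delta>) \<le> c j" by (simp add: c_def divide_inverse del: power_Suc)
      then have "ennreal ((1 - s) powr (-\<delta>)) * W s * indicator {r..<1} s \<le> ennreal (c j) * (W s * indicator {\<rho> j..<1} s)"
        using in_j True by (auto intro!: mult_right_mono ennreal_leI)
      also have "\<dots> \<le> (\<Sum>j. ennreal (c j) * (W s * indicator {\<rho> j..<1} s))"
        by (rule ennreal_le_suminf)
      finally show ?thesis .
    qed auto
    have "(\<integral>\<^sup>+s\<in>{r..<1}. ennreal ((1 - s) powr (-\<delta>)) * W s \<partial>lborel)
        \<le> (\<integral>\<^sup>+s. (\<Sum>j. ennreal (c j) * (W s * indicator {\<rho> j..<1} s)) \<partial>lborel)"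
      by (intro nn_integral_mono pt)
    also have "\<dots> = (\<Sum>j. ennreal (c j) * (\<integral>\<^sup>+s. W s * indicator {\<rho> j..<1} s \<partial>lborel))"
      by (simp add: nn_integral_suminf nn_integral_cmult)
    also have "\<dots> = (\<Sum>j. ennreal (c j * h (\<rho> j)))"
      using \<rho> by (intro suminf_cong) (simp add: tail ennreal_mult c_def less_imp_le[OF h_pos])
    also have "\<dots> \<le> (\<Sum>j. ennreal ((1 - r) powr (-\<delta>) * K powr \<delta> * h r * ?x ^ j))"
    proof (intro suminf_le summableI ennreal_leI)
      fix j
      have "c j * h (\<rho> j) \<le> c j * (h r / C2 ^ j)"
        unfolding \<rho>_def using h_inner[OF r, of j] by (intro mult_left_mono) (auto simp: c_def)
      then show "c j * h (\<rho> j) \<le> (1 - r) powr (-\<delta>) * K powr \<delta> * h r * ?x ^ j"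
        by (simp add: c_def power_divide mult_ac)
    qed
    also have "\<dots> = ennreal ((1 - r) powr (-\<delta>) * K powr \<delta> * h r / (1 - ?x))"
      using x h_pos[OF r] by (intro suminf_geometric_ennreal) auto
    also have "(1 - r) powr (-\<delta>) * K powr \<delta> * h r / (1 - ?x) = C * (1 - r) powr (-\<delta>) * h r"
      by (simp add: C_def)
    finally show ?thesis .
  qed
  ultimately show ?thesis using that by blast
qed

lemma ring_weight_le:
  assumes "0 \<le> \<delta>" "K powr \<delta> < C2"
  obtains C where "0 < C" "\<And>r. 0 \<le> r \<Longrightarrow> r < 1 \<Longrightarrow>
    (\<integral>\<^sup>+z\<in>ball 0 1. indicator {r..<1} (cmod z) * (ennreal ((1 - cmod z) powr (-\<delta>)) * W (cmod z)) \<partial>lborel)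
      \<le> ennreal (C * (1 - r) powr (-\<delta>) * h r)"
proof -
  obtain C where C: "0 < C" "\<And>r. 0 \<le> r \<Longrightarrow> r < 1 \<Longrightarrow>
    (\<integral>\<^sup>+s\<in>{r..<1}. ennreal ((1 - s) powr (-\<delta>)) * W s \<partial>lborel) \<le> ennreal (C * (1 - r) powr (-\<delta>) * h r)"
    using weighted_tail_le[OF assms] by blast
  show ?thesis
  proof (rule that[of "2 * pi * C"])
    fix r :: real assume r: "0 \<le> r" "r < 1"
    have "(\<integral>\<^sup>+z\<in>ball 0 1. indicator {r..<1} (cmod z) * (ennreal ((1 - cmod z) powr (-\<delta>)) * W (cmod z)) \<partial>lborel)
      \<le> ennreal (2 * pi) * (\<integral>\<^sup>+s\<in>{0..<1}. indicator {r..<1} s * (ennreal ((1 - s) powr (-\<delta>)) * W s) \<partial>lborel)"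
      by (rule nn_integral_radial_le) measurable
    also have "(\<integral>\<^sup>+s\<in>{0..<1}. indicator {r..<1} s * (ennreal ((1 - s) powr (-\<delta>)) * W s) \<partial>lborel)
      = (\<integral>\<^sup>+s\<in>{r..<1}. ennreal ((1 - s) powr (-\<delta>)) * W s \<partial>lborel)"
      using r by (intro nn_integral_cong) (auto split: split_indicator)
    also have "ennreal (2 * pi) * \<dots> \<le> ennreal (2 * pi) * ennreal (C * (1 - r) powr (-\<delta>) * h r)"
      by (intro mult_left_mono C r) simp
    also have "\<dots> = ennreal (2 * pi * C * (1 - r) powr (-\<delta>) * h r)"
      by (simp flip: ennreal_mult' add: mult_ac)
    finally show "(\<integral>\<^sup>+z\<in>ball 0 1. indicator {r..<1} (cmod z) * (ennreal ((1 - cmod z) powr (-\<delta>)) * W (cmod z)) \<partial>lborel)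
      \<le> ennreal (2 * pi * C * (1 - r) powr (-\<delta>) * h r)" .
  qed (use C in simp)
qed

text \<open>In the radial variable the ring carries h a - h b. The factor a is the minimum of the
  Jacobian on it up to 2 * pi, so the bound is of use only for rings away from the origin.\<close>

lemma ring_weight_ge:
  assumes "0 \<le> a" "a \<le> b" "b < 1"
  shows "ennreal (2 * pi * a * (h a - h b)) \<le> (\<integral>\<^sup>+z\<in>ball 0 1. indicator {a..<b} (cmod z) * W (cmod z) \<partial>lborel)"
proof -
  have ha: "(\<integral>\<^sup>+s\<in>{a..<b}. W s \<partial>lborel) + ennreal (h b) = ennreal (h a)"
  proof -
    have "(\<integral>\<^sup>+s\<in>{a..<b}. W s \<partial>lborel) + (\<integral>\<^sup>+s\<in>{b..<1}. W s \<partial>lborel)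
       = (\<integral>\<^sup>+s. W s * indicator {a..<b} s + W s * indicator {b..<1} s \<partial>lborel)"
      by (rule nn_integral_add[symmetric]) measurable
    also have "\<dots> = (\<integral>\<^sup>+s\<in>{a..<1}. W s \<partial>lborel)"
      using assms by (intro nn_integral_cong) (auto split: split_indicator)
    finally show ?thesis using assms by (simp add: tail)
  qed
  have "ennreal (h a - h b) \<le> (\<integral>\<^sup>+s\<in>{a..<b}. W s \<partial>lborel)"
  proof -
    have "ennreal (h a - h b) = ennreal (h a) - ennreal (h b)"
      using assms by (intro ennreal_minus[symmetric] less_imp_le[OF h_pos]) auto
    also have "\<dots> \<le> (\<integral>\<^sup>+s\<in>{a..<b}. W s \<partial>lborel)"
      unfolding ha[symmetric] by simp
    finally show ?thesis .
  qed
  then have "ennreal (2 * pi * a) * ennreal (h a - h b) \<le> ennreal (2 * pi * a) * (\<integral>\<^sup>+s\<in>{a..<b}. W s \<partial>lborel)"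
    by (intro mult_left_mono) auto
  also have "\<dots> = (\<integral>\<^sup>+s. ennreal (2 * pi * a) * (W s * indicator {a..<b} s) \<partial>lborel)"
    by (rule nn_integral_cmult[symmetric]) measurable
  also have "\<dots> \<le> (\<integral>\<^sup>+s\<in>{0..<1}. ennreal (2 * pi * s) * (indicator {a..<b} s * W s) \<partial>lborel)"
    using assms by (intro nn_integral_mono) (auto split: split_indicator intro!: mult_right_mono ennreal_leI)
  also have "\<dots> = (\<integral>\<^sup>+z\<in>ball 0 1. indicator {a..<b} (cmod z) * W (cmod z) \<partial>lborel)"
    by (rule nn_integral_radial[symmetric]) measurable
  finally show ?thesis
    using assms by (simp add: ennreal_mult' mult.assoc)
qed

text \<open>Condition (2) of the class gives every ring of a geometric scale its share of mass, so a
  radially increasing average over one ring is dominated by the average over the next ring.\<close>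

lemma nn_integral_tilde_le:
  fixes F :: "complex \<Rightarrow> ennreal"
  assumes Fm [measurable]: "F \<in> borel_measurable borel"
    and mono: "\<And>z w. cmod z \<le> cmod w \<Longrightarrow> cmod w < 1 \<Longrightarrow> circle_avg F z \<le> circle_avg F w"
    and C: "1 \<le> C" "\<And>r s. 0 \<le> r \<Longrightarrow> r < 1 \<Longrightarrow> 0 \<le> s \<Longrightarrow> s < 1 \<Longrightarrow> 1 - r \<le> K * (1 - s) \<Longrightarrow> h r \<le> C * h s"
  shows "(\<integral>\<^sup>+z\<in>ball 0 1. F z * ennreal (h (cmod z) / (1 - cmod z)) \<partial>lborel)
     \<le> ennreal (K * C / ((1 - 1 / K) * (1 - 1 / C2))) * (\<integral>\<^sup>+z\<in>ball 0 1. F z * W (cmod z) \<partial>lborel)"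
proof -
  \<comment> \<open>Radii at distance K ^ (- j) from the circle, so that condition (2) compares
    consecutive ones exactly.\<close>
  define \<rho> where "\<rho> j = 1 - 1 / K ^ j" for j
  have Kj: "0 < K ^ j" "1 \<le> K ^ j" for j using KC2(1) by auto
  have \<rho>: "0 \<le> \<rho> j" "\<rho> j < 1" for j using inner_radius[of 0 j] by (auto simp: \<rho>_def)
  have \<rho>_mono: "\<rho> i \<le> \<rho> j" if "i \<le> j" for i j
    using that KC2(1) Kj unfolding \<rho>_def by (auto intro!: divide_left_mono power_increasing)
  define A where "A j = {z::complex. \<rho> j \<le> cmod z \<and> cmod z < \<rho> (Suc j)}" for j
  have Am [measurable]: "A j \<in> sets borel" for j unfolding A_def by measurable
  have A_sub: "A j \<subseteq> ball 0 1" for j using \<rho>[of "Suc j"] by (auto simp: A_def)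
  have disj: "disjoint_family A"
    unfolding disjoint_family_on_def
  proof (intro ballI impI)
    fix i j :: nat assume "i \<noteq> j"
    then have "\<rho> (Suc i) \<le> \<rho> j \<or> \<rho> (Suc j) \<le> \<rho> i" using \<rho>_mono[of "Suc i" j] \<rho>_mono[of "Suc j" i] by linarith
    then show "A i \<inter> A j = {}" by (auto simp: A_def)
  qed
  have cover: "(\<Union>j. A j) = ball 0 1"
  proof (intro equalityI subsetI)
    fix z :: complex assume "z \<in> ball 0 1"
    then have z: "cmod z < 1" by simp
    then have "1 \<le> 1 / (1 - cmod z)" by (simp add: le_divide_eq_1)
    then obtain j where j: "K ^ j \<le> 1 / (1 - cmod z)" "1 / (1 - cmod z) < K ^ Suc j"
      using ex_power_between[OF KC2(1)] by blast
    have "K ^ j * (1 - cmod z) \<le> 1" using j(1) z by (simp add: pos_le_divide_eq)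
    then have "1 - cmod z \<le> 1 / K ^ j" using Kj(1)[of j] by (simp add: pos_le_divide_eq mult.commute)
    moreover have "1 < K ^ Suc j * (1 - cmod z)" using j(2) z by (simp add: pos_divide_less_eq del: power_Suc)
    then have "1 / K ^ Suc j < 1 - cmod z" using Kj(1)[of "Suc j"] by (simp add: pos_divide_less_eq mult.commute del: power_Suc)
    ultimately show "z \<in> (\<Union>j. A j)" by (auto simp: A_def \<rho>_def simp del: power_Suc intro!: exI[of _ j])
  qed (use A_sub in blast)
  define M where "M j = circle_avg F (of_real (\<rho> j))" for j
  let ?V = "\<lambda>s. ennreal (h s / (1 - s))"
  have avg: "(\<integral>\<^sup>+z\<in>ball 0 1. F z * V (cmod z) \<partial>lborel) = (\<integral>\<^sup>+z\<in>ball 0 1. circle_avg F z * V (cmod z) \<partial>lborel)"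
    if [measurable]: "V \<in> borel_measurable borel" for V
  proof -
    have ind: "indicator (ball 0 1) z = (indicator {..<1} (cmod z) :: ennreal)" for z :: complex
      by (simp add: indicator_def)
    show ?thesis
      unfolding ind mult.assoc using nn_integral_circle_avg[of F "\<lambda>s. V s * indicator {..<1} s"] by simp
  qed
  \<comment> \<open>On ring j the mean is at most its value at the outer radius, the regularised
    density at most h (\<rho> j) * K ^ Suc j, and the area at most 2 * pi / K ^ j. The powers of K
    cancel up to one factor.\<close>
  have upper: "(\<integral>\<^sup>+z\<in>A j. circle_avg F z * ?V (cmod z) \<partial>lborel) \<le> ennreal (2 * pi * K * C) * (M (Suc j) * ennreal (h (\<rho> (Suc j))))" for j
  proof -
    have hj: "h (\<rho> j) \<le> C * h (\<rho> (Suc j))"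
      using \<rho>[of j] \<rho>[of "Suc j"] Kj(1)[of j] Kj(1)[of "Suc j"] KC2(1) by (intro C) (simp_all add: \<rho>_def)
    have "(\<integral>\<^sup>+z\<in>A j. circle_avg F z * ?V (cmod z) \<partial>lborel)
      \<le> (\<integral>\<^sup>+z. M (Suc j) * ennreal (h (\<rho> j) * K ^ Suc j) * indicator (ball 0 1 - ball (0::complex) (\<rho> j)) z \<partial>lborel)"
    proof (intro nn_integral_mono)
      fix z :: complex
      show "circle_avg F z * ?V (cmod z) * indicator (A j) z
        \<le> M (Suc j) * ennreal (h (\<rho> j) * K ^ Suc j) * indicator (ball 0 1 - ball 0 (\<rho> j)) z"
      proof (cases "z \<in> A j")
        case True
        then have z: "\<rho> j \<le> cmod z" "cmod z < \<rho> (Suc j)" "cmod z < 1" using \<rho>[of "Suc j"] by (auto simp: A_def)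
        have "1 / K ^ Suc j \<le> 1 - cmod z" using z by (simp add: \<rho>_def)
        then have "1 / (1 - cmod z) \<le> K ^ Suc j"
          using Kj(1)[of "Suc j"] z by (simp add: pos_divide_le_eq mult.commute del: power_Suc)
        moreover have "h (cmod z) \<le> h (\<rho> j)" using z \<rho> by (intro h_antimono) auto
        moreover have "0 \<le> h (cmod z)" "0 \<le> h (\<rho> j)" using z \<rho>[of j] by (auto intro!: less_imp_le[OF h_pos])
        ultimately have "h (cmod z) * (1 / (1 - cmod z)) \<le> h (\<rho> j) * K ^ Suc j"
          using z by (intro mult_mono) auto
        moreover have "circle_avg F z \<le> M (Suc j)"
          unfolding M_def using z \<rho>[of "Suc j"] by (intro mono) auto
        ultimately have "circle_avg F z * ?V (cmod z) \<le> M (Suc j) * ennreal (h (\<rho> j) * K ^ Suc j)"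
          by (intro mult_mono ennreal_leI) auto
        then show ?thesis using True z by simp
      qed simp
    qed
    then have le: "(\<integral>\<^sup>+z\<in>A j. circle_avg F z * ?V (cmod z) \<partial>lborel)
       \<le> M (Suc j) * ennreal (h (\<rho> j) * K ^ Suc j) * emeasure lborel (ball 0 1 - ball (0::complex) (\<rho> j))"
      by (subst (asm) nn_integral_cmult_indicator) auto
    have area: "emeasure lborel (ball 0 1 - ball (0::complex) (\<rho> j)) \<le> ennreal (2 * pi / K ^ j)"
    proof -
      have "emeasure lborel (ball 0 1 - ball (0::complex) (\<rho> j)) = ennreal (pi * 1\<^sup>2) - ennreal (pi * (\<rho> j)\<^sup>2)"
        using \<rho>[of j] by (subst emeasure_Diff) (auto simp: emeasure_ball_complex)
      also have "\<dots> = ennreal (pi * (1 - (\<rho> j)\<^sup>2))"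
        by (subst ennreal_minus) (auto simp: algebra_simps)
      also have "\<dots> \<le> ennreal (2 * pi / K ^ j)"
      proof (intro ennreal_leI)
        have "1 - (\<rho> j)\<^sup>2 = (1 - \<rho> j) * (1 + \<rho> j)" by (simp add: power2_eq_square algebra_simps)
        also have "\<dots> \<le> (1 / K ^ j) * 2" using \<rho>[of j] Kj[of j] by (intro mult_mono) (simp_all add: \<rho>_def divide_le_eq)
        finally show "pi * (1 - (\<rho> j)\<^sup>2) \<le> 2 * pi / K ^ j"
          using mult_left_mono[of "1 - (\<rho> j)\<^sup>2" "(1 / K ^ j) * 2" pi] by (simp add: mult_ac)
      qed
      finally show ?thesis .
    qed
    note le
    also have "M (Suc j) * ennreal (h (\<rho> j) * K ^ Suc j) * emeasure lborel (ball 0 1 - ball (0::complex) (\<rho> j))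
       \<le> M (Suc j) * ennreal (h (\<rho> j) * K ^ Suc j) * ennreal (2 * pi / K ^ j)"
      by (intro mult_left_mono area) simp
    also have "\<dots> = M (Suc j) * ennreal (2 * pi * K * h (\<rho> j))"
    proof -
      have "ennreal (h (\<rho> j) * K ^ Suc j) * ennreal (2 * pi / K ^ j) = ennreal (2 * pi * K * h (\<rho> j))"
        using Kj[of j] \<rho>[of j] h_pos[of "\<rho> j"] KC2(1) by (subst ennreal_mult[symmetric]) (auto simp: mult_ac)
      then show ?thesis by (simp only: mult.assoc)
    qed
    also have "\<dots> \<le> M (Suc j) * ennreal (2 * pi * K * (C * h (\<rho> (Suc j))))"
      using hj KC2(1) by (intro mult_left_mono ennreal_leI) auto
    also have "\<dots> = ennreal (2 * pi * K * C) * (M (Suc j) * ennreal (h (\<rho> (Suc j))))"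
      using KC2(1) C(1) \<rho>[of "Suc j"] h_pos[of "\<rho> (Suc j)"] by (simp add: ennreal_mult mult_ac)
    finally show ?thesis .
  qed
  let ?c = "2 * pi * (1 - 1 / K) * (1 - 1 / C2)"
  have cpos: "0 < ?c" using KC2 by simp
  \<comment> \<open>On the next ring the mean is at least its value at the inner radius, which is
    the same \<open>M (Suc j)\<close>. Across this ring the tail drops by the share 1 - 1 / C2 of
    its value, and the radius is at least 1 - 1 / K because ring 0 is left out.\<close>
  have lower: "ennreal ?c * (M (Suc j) * ennreal (h (\<rho> (Suc j)))) \<le> (\<integral>\<^sup>+z\<in>A (Suc j). circle_avg F z * W (cmod z) \<partial>lborel)" for j
  proof -
    let ?a = "\<rho> (Suc j)" and ?b = "\<rho> (Suc (Suc j))"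
    have "C2 * h (1 - (1 - ?a) / K) \<le> h ?a" using \<rho> by (intro KC2) auto
    moreover have "1 - (1 - ?a) / K = ?b" by (simp add: \<rho>_def)
    ultimately have "h ?b \<le> h ?a / C2" using KC2(2) by (simp add: field_simps)
    then have d: "(1 - 1 / C2) * h ?a \<le> h ?a - h ?b" by (simp add: algebra_simps)
    have r1: "1 - 1 / K \<le> ?a" using \<rho>_mono[of 1 "Suc j"] by (simp add: \<rho>_def)
    have "?c * h ?a = 2 * pi * (1 - 1 / K) * ((1 - 1 / C2) * h ?a)" by simp
    also have "\<dots> \<le> 2 * pi * ?a * (h ?a - h ?b)"
      using d r1 KC2 \<rho>[of "Suc j"] h_pos[of ?a] by (intro mult_mono) auto
    finally have "ennreal (?c * h ?a) \<le> ennreal (2 * pi * ?a * (h ?a - h ?b))" by (rule ennreal_leI)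
    also have "\<dots> \<le> (\<integral>\<^sup>+z\<in>ball 0 1. indicator {?a..<?b} (cmod z) * W (cmod z) \<partial>lborel)"
      using \<rho> \<rho>_mono[of "Suc j" "Suc (Suc j)"] by (intro ring_weight_ge) auto
    finally have m: "ennreal (?c * h ?a) \<le> (\<integral>\<^sup>+z\<in>ball 0 1. indicator {?a..<?b} (cmod z) * W (cmod z) \<partial>lborel)" .
    have "ennreal ?c * (M (Suc j) * ennreal (h ?a)) = M (Suc j) * ennreal (?c * h ?a)"
      using cpos h_pos[of ?a] \<rho>[of "Suc j"] by (simp add: ennreal_mult' mult_ac)
    also have "\<dots> \<le> M (Suc j) * (\<integral>\<^sup>+z\<in>ball 0 1. indicator {?a..<?b} (cmod z) * W (cmod z) \<partial>lborel)"
      by (intro mult_left_mono m) simp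
    also have "\<dots> = (\<integral>\<^sup>+z. M (Suc j) * (indicator {?a..<?b} (cmod z) * W (cmod z) * indicator (ball 0 1) z) \<partial>lborel)"
      by (rule nn_integral_cmult[symmetric]) measurable
    also have "\<dots> \<le> (\<integral>\<^sup>+z\<in>A (Suc j). circle_avg F z * W (cmod z) \<partial>lborel)"
    proof (intro nn_integral_mono)
      fix z :: complex
      show "M (Suc j) * (indicator {?a..<?b} (cmod z) * W (cmod z) * indicator (ball 0 1) z) \<le> circle_avg F z * W (cmod z) * indicator (A (Suc j)) z"
      proof (cases "z \<in> A (Suc j)")
        case True
        then have z: "?a \<le> cmod z" "cmod z < ?b" "cmod z < 1" using \<rho>[of "Suc (Suc j)"] by (auto simp: A_def)
        have "M (Suc j) \<le> circle_avg F z"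
          unfolding M_def using z \<rho>[of "Suc j"] by (intro mono) auto
        then show ?thesis using True z by (auto intro!: mult_right_mono)
      qed (auto simp: A_def split: split_indicator)
    qed
    finally show ?thesis .
  qed
  have "ennreal ?c * (\<integral>\<^sup>+z\<in>ball 0 1. F z * ?V (cmod z) \<partial>lborel)
      = ennreal ?c * (\<integral>\<^sup>+z\<in>(\<Union>j. A j). circle_avg F z * ?V (cmod z) \<partial>lborel)"
    unfolding cover by (subst avg) auto
  also have "\<dots> = ennreal ?c * (\<Sum>j. \<integral>\<^sup>+z\<in>A j. circle_avg F z * ?V (cmod z) \<partial>lborel)"
    using disj by (subst nn_integral_disjoint_family) auto
  also have "\<dots> \<le> ennreal ?c * (\<Sum>j. ennreal (2 * pi * K * C) * (M (Suc j) * ennreal (h (\<rho> (Suc j)))))"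
    by (intro mult_left_mono suminf_le summableI upper) simp
  also have "\<dots> = ennreal (2 * pi * K * C) * (\<Sum>j. ennreal ?c * (M (Suc j) * ennreal (h (\<rho> (Suc j)))))"
    by (simp only: ennreal_suminf_cmult) (simp only: mult_ac)
  also have "\<dots> \<le> ennreal (2 * pi * K * C) * (\<Sum>j. \<integral>\<^sup>+z\<in>A (Suc j). circle_avg F z * W (cmod z) \<partial>lborel)"
    by (intro mult_left_mono suminf_le summableI lower) simp
  also have "\<dots> \<le> ennreal (2 * pi * K * C) * (\<integral>\<^sup>+z\<in>ball 0 1. F z * W (cmod z) \<partial>lborel)"
  proof (rule mult_left_mono)
  have "(\<Sum>j. \<integral>\<^sup>+z\<in>A (Suc j). circle_avg F z * W (cmod z) \<partial>lborel)
      = (\<integral>\<^sup>+z\<in>(\<Union>j. A (Suc j)). circle_avg F z * W (cmod z) \<partial>lborel)"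
  proof (rule nn_integral_disjoint_family[symmetric])
    show "disjoint_family (\<lambda>j. A (Suc j))" using disj by (auto simp: disjoint_family_on_def)
  qed measurable
  also have "\<dots> \<le> (\<integral>\<^sup>+z\<in>ball 0 1. circle_avg F z * W (cmod z) \<partial>lborel)"
    using A_sub by (intro nn_integral_mono mult_left_mono) (auto split: split_indicator dest!: subsetD[OF A_sub])
  also have "\<dots> = (\<integral>\<^sup>+z\<in>ball 0 1. F z * W (cmod z) \<partial>lborel)"
    by (rule avg[symmetric]) measurable
  finally show "(\<Sum>j. \<integral>\<^sup>+z\<in>A (Suc j). circle_avg F z * W (cmod z) \<partial>lborel)
      \<le> (\<integral>\<^sup>+z\<in>ball 0 1. F z * W (cmod z) \<partial>lborel)" .
  qed simp
  finally have main: "ennreal ?c * (\<integral>\<^sup>+z\<in>ball 0 1. F z * ?V (cmod z) \<partial>lborel)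
      \<le> ennreal (2 * pi * K * C) * (\<integral>\<^sup>+z\<in>ball 0 1. F z * W (cmod z) \<partial>lborel)"
    .
  have "(\<integral>\<^sup>+z\<in>ball 0 1. F z * ?V (cmod z) \<partial>lborel) = ennreal (1 / ?c) * (ennreal ?c * (\<integral>\<^sup>+z\<in>ball 0 1. F z * ?V (cmod z) \<partial>lborel))"
  proof -
    have "ennreal (1 / ?c) * ennreal ?c = 1" using cpos by (subst ennreal_mult[symmetric]) auto
    then show ?thesis by (simp only: mult.assoc[symmetric] mult_1)
  qed
  also have "\<dots> \<le> ennreal (1 / ?c) * (ennreal (2 * pi * K * C) * (\<integral>\<^sup>+z\<in>ball 0 1. F z * W (cmod z) \<partial>lborel))"
    by (intro mult_left_mono main) simp
  also have "\<dots> = ennreal (1 / ?c * (2 * pi * K * C)) * (\<integral>\<^sup>+z\<in>ball 0 1. F z * W (cmod z) \<partial>lborel)"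
    using cpos C(1) KC2(1) by (subst ennreal_mult) (auto simp: mult.assoc)
  also have "1 / ?c * (2 * pi * K * C) = K * C / ((1 - 1 / K) * (1 - 1 / C2))"
    by simp
  finally show ?thesis .
qed

end

subsection \<open>Carleson squares and kernel estimates\<close>

lemma norm_1_minus_cnj_mult:
  assumes "cmod a < 1" "cmod z < 1"
  shows "1 - cmod a \<le> cmod (1 - cnj a * z)" "1 - cmod z \<le> cmod (1 - cnj a * z)"
    "cmod (z - a) \<le> cmod (1 - cnj a * z)" "cmod (1 - cnj a * z) < 2"
proof -
  have 1: "cmod a * cmod z \<le> cmod a" "cmod a * cmod z \<le> cmod z"
    using assms by (auto simp: mult_left_le mult_left_le_one_le)
  have 2: "1 - cmod a * cmod z \<le> cmod (1 - cnj a * z)"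
    using norm_triangle_ineq2[of 1 "cnj a * z"] by (simp add: norm_mult)
  show "1 - cmod a \<le> cmod (1 - cnj a * z)" "1 - cmod z \<le> cmod (1 - cnj a * z)"
    using 1 2 by linarith+
  show "cmod (1 - cnj a * z) < 2"
    using norm_triangle_ineq4[of 1 "cnj a * z"] 1 assms by (simp add: norm_mult)
  have "(cmod (1 - cnj a * z))\<^sup>2 - (cmod (z - a))\<^sup>2 = (1 - (cmod a)\<^sup>2) * (1 - (cmod z)\<^sup>2)"
    unfolding cmod_power2 by (simp add: algebra_simps power2_eq_square)
  moreover have "0 \<le> (1 - (cmod a)\<^sup>2) * (1 - (cmod z)\<^sup>2)"
    using assms by (intro mult_nonneg_nonneg) (auto simp: power_le_one)
  ultimately have "(cmod (z - a))\<^sup>2 \<le> (cmod (1 - cnj a * z))\<^sup>2" by linarith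
  then show "cmod (z - a) \<le> cmod (1 - cnj a * z)" by (rule power2_le_imp_le) simp
qed

lemma Arg_mult_cis:
  assumes "z \<noteq> 0"
  obtains n :: int where "Arg (z * cis \<phi>) = Arg z + \<phi> + 2 * pi * of_int n"
proof -
  have "rcis (cmod z) (Arg (z * cis \<phi>)) = z * cis \<phi>"
    using rcis_cmod_Arg[of "z * cis \<phi>"] by (simp add: norm_mult)
  also have "\<dots> = rcis (cmod z) (Arg z + \<phi>)"
    using rcis_cmod_Arg[of z] by (metis cis_mult mult.assoc rcis_def)
  finally have "cis (Arg (z * cis \<phi>)) = cis (Arg z + \<phi>)" using assms by (simp add: rcis_def)
  then have "sin (Arg (z * cis \<phi>)) = sin (Arg z + \<phi>) \<and> cos (Arg (z * cis \<phi>)) = cos (Arg z + \<phi>)"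
    by (simp add: complex_eq_iff)
  then obtain n :: int where "Arg (z * cis \<phi>) = Arg z + \<phi> + 2 * pi * of_int n"
    unfolding sin_cos_eq_iff by auto
  then show ?thesis by (rule that)
qed

lemma borel_measurable_Arg [measurable]: "Arg \<in> borel_measurable borel"
proof -
  have "Arg = (\<lambda>z. if z = 0 then 0 else Im (Ln z))" by (simp add: fun_eq_iff Arg_def)
  also have "\<dots> \<in> borel_measurable borel" by measurable
  finally show ?thesis .
qed

text \<open>The angular half of a Carleson square. For small apertures its circular means are the
  same at every nonzero point, so the square splits into an angular share and a radial
  integral.\<close>

definition arg_near :: "real \<Rightarrow> real \<Rightarrow> complex set" where
  "arg_near \<alpha> \<eta> = {z. \<exists>k::int. \<bar>Arg z - \<alpha> + 2 * pi * of_int k\<bar> < \<eta>}"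

lemma arg_near_sets [measurable]: "arg_near \<alpha> \<eta> \<in> sets borel"
  unfolding arg_near_def by measurable

lemma carleson_square_eq:
  "z \<noteq> 0 \<Longrightarrow> carleson_square z = {\<zeta>. cmod z < cmod \<zeta> \<and> cmod \<zeta> < 1} \<inter> arg_near (Arg z) ((1 - cmod z) / 2)"
  by (auto simp: carleson_square_def arg_near_def)

lemma carleson_square_sets [measurable]: "carleson_square z \<in> sets borel"
proof (cases "z = 0")
  case False
  have "{\<zeta>. cmod z < cmod \<zeta> \<and> cmod \<zeta> < 1} \<in> sets borel" by measurable
  then show ?thesis unfolding carleson_square_eq[OF False] by (intro sets.Int) auto
qed (simp add: carleson_square_def)

text \<open>In a window of length 2 * pi centred at the target angle only the shift k = 0 can come
  within \<eta>, as \<eta> <= 1 < pi; the average is then the length 2 * \<eta> divided by 2 *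
  pi.\<close>

lemma circle_avg_arg_near:
  assumes z: "z \<noteq> 0" and \<eta>: "0 < \<eta>" "\<eta> \<le> 1"
  shows "circle_avg (indicator (arg_near \<alpha> \<eta>)) z = ennreal (\<eta> / pi)"
proof -
  define \<beta> where "\<beta> = Arg z - \<alpha>"
  have iff: "z * cis \<phi> \<in> arg_near \<alpha> \<eta> \<longleftrightarrow> \<bar>\<phi> + \<beta>\<bar> < \<eta>" if \<phi>: "\<phi> \<in> {- \<beta> - pi..<- \<beta> - pi + 2 * pi}" for \<phi>
  proof -
    obtain n :: int where n: "Arg (z * cis \<phi>) = Arg z + \<phi> + 2 * pi * of_int n" using Arg_mult_cis[OF z] by blast
    have "z * cis \<phi> \<in> arg_near \<alpha> \<eta> \<longleftrightarrow> (\<exists>k::int. \<bar>\<phi> + \<beta> + 2 * pi * of_int (n + k)\<bar> < \<eta>)"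
      by (simp add: arg_near_def n \<beta>_def algebra_simps)
    also have "\<dots> \<longleftrightarrow> (\<exists>k::int. \<bar>\<phi> + \<beta> + 2 * pi * of_int k\<bar> < \<eta>)"
      by (metis add_diff_cancel_left' add.commute diff_add_cancel)
    also have "\<dots> \<longleftrightarrow> \<bar>\<phi> + \<beta>\<bar> < \<eta>"
    proof
      assume "\<exists>k::int. \<bar>\<phi> + \<beta> + 2 * pi * of_int k\<bar> < \<eta>"
      then obtain k :: int where k: "\<bar>\<phi> + \<beta> + 2 * pi * of_int k\<bar> < \<eta>" by blast
      have "\<bar>\<phi> + \<beta>\<bar> \<le> pi" using \<phi> by auto
      then have "\<bar>2 * pi * of_int k\<bar> < pi + pi" using k \<eta> pi_ge_two by linarith
      then have "\<bar>of_int k\<bar> < (1::real)" by (simp add: abs_mult)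
      then have "k = 0" by linarith
      then show "\<bar>\<phi> + \<beta>\<bar> < \<eta>" using k by simp
    qed (auto intro: exI[of _ 0])
    finally show ?thesis .
  qed
  have "circle_avg (indicator (arg_near \<alpha> \<eta>)) z = ennreal (1 / (2 * pi)) *
     (\<integral>\<^sup>+\<phi>\<in>{- \<beta> - pi..<- \<beta> - pi + 2 * pi}. indicator (arg_near \<alpha> \<eta>) (z * cis \<phi>) \<partial>lborel)"
    by (rule circle_avg_shift) measurable
  also have "(\<integral>\<^sup>+\<phi>\<in>{- \<beta> - pi..<- \<beta> - pi + 2 * pi}. indicator (arg_near \<alpha> \<eta>) (z * cis \<phi>) \<partial>lborel)
     = (\<integral>\<^sup>+\<phi>. indicator {- \<beta> - \<eta><..<- \<beta> + \<eta>} \<phi> \<partial>lborel)"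
  proof (intro nn_integral_cong)
    fix \<phi> :: real
    show "indicator (arg_near \<alpha> \<eta>) (z * cis \<phi>) * indicator {- \<beta> - pi..<- \<beta> - pi + 2 * pi} \<phi>
       = (indicator {- \<beta> - \<eta><..<- \<beta> + \<eta>} \<phi> :: ennreal)"
    proof (cases "\<phi> \<in> {- \<beta> - pi..<- \<beta> - pi + 2 * pi}")
      case True
      then show ?thesis using iff[OF True] by (auto simp: abs_less_iff split: split_indicator)
    next
      case False
      then have "\<phi> \<notin> {- \<beta> - \<eta><..<- \<beta> + \<eta>}" using \<eta> pi_ge_two by auto
      then show ?thesis using False by simp
    qed
  qed
  also have "\<dots> = ennreal (2 * \<eta>)" using \<eta> by simp
  also have "ennreal (1 / (2 * pi)) * ennreal (2 * \<eta>) = ennreal (\<eta> / pi)"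
    using \<eta> by (subst ennreal_mult[symmetric]) auto
  finally show ?thesis .
qed

section \<open>Kernels and Carleson squares against the weight\<close>

context doubling_profile
begin

text \<open>The disc is cut by the dyadic size of cmod (1 - cnj a * z) relative to t = 1 - cmod a.
  At scale i the kernel factor is at most (2 powr (-\<gamma>)) ^ i, the set takes a share of order 2
  ^ i * t of each circle, and the tail of the weight has grown by at most C1 ^ Suc i. The series
  thus has ratio 2 * C1 * 2 powr (-\<gamma>), which the hypothesis on \<gamma> makes at most 1 /
  2.\<close>

lemma test_function_weight_le:
  assumes \<delta>: "0 \<le> \<delta>" "K powr \<delta> < C2" and \<gamma>: "4 * C1 \<le> 2 powr \<gamma>"
  obtains C where "0 < C" "\<And>a. cmod a < 1 \<Longrightarrow>
    (\<integral>\<^sup>+z\<in>ball 0 1. ennreal (((1 - cmod a) / cmod (1 - cnj a * z)) powr \<gamma> * (1 - cmod z) powr (-\<delta>)) * W (cmod z) \<partial>lborel)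
      \<le> ennreal (C * (1 - cmod a) powr (1 - \<delta>) * h (cmod a))"
proof -
  obtain C' where C': "0 < C'" "\<And>r. 0 \<le> r \<Longrightarrow> r < 1 \<Longrightarrow>
    (\<integral>\<^sup>+z\<in>ball 0 1. indicator {r..<1} (cmod z) * (ennreal ((1 - cmod z) powr (-\<delta>)) * W (cmod z)) \<partial>lborel)
      \<le> ennreal (C' * (1 - r) powr (-\<delta>) * h r)"
    using ring_weight_le[OF \<delta>] by blast
  define q where "q = 2 powr (-\<gamma>)"
  have q: "0 < q" "2 * C1 * q \<le> 1 / 2" using \<gamma> by (auto simp: q_def powr_minus field_simps)
  have \<gamma>0: "0 \<le> \<gamma>"
  proof (rule ccontr)
    assume "\<not> 0 \<le> \<gamma>"
    then have "2 powr \<gamma> < 2 powr 0" by (intro powr_less_mono) auto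
    then show False using \<gamma> C1(1) by simp
  qed
  show ?thesis
  proof (rule that[of "8 * C1 * C'"])
    fix a :: complex assume a: "cmod a < 1"
    define t where "t = 1 - cmod a"
    have t: "0 < t" "t \<le> 1" using a by (auto simp: t_def)
    define H where "H i = 2 ^ Suc i * t" for i
    \<comment> \<open>Points whose denominator is below H i have modulus at least r i, because 1 -
      cmod z is at most the denominator.\<close>
    define r where "r i = max 0 (1 - H i)" for i
    define V where "V i s = indicator {r i..<1} s * (ennreal ((1 - s) powr (-\<delta>)) * W s)" for i s
    have [measurable]: "V i \<in> borel_measurable borel" for i unfolding V_def by measurable
    have H: "0 < H i" for i using t by (simp add: H_def)
    have r: "0 \<le> r i" "r i < 1" for i using H[of i] by (auto simp: r_def)
    let ?I = "\<lambda>i. indicator {z. cmod (1 - cnj a * z) < H i} :: complex \<Rightarrow> ennreal"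
    have pt: "ennreal ((t / cmod (1 - cnj a * z)) powr \<gamma> * (1 - cmod z) powr (-\<delta>)) * W (cmod z) * indicator (ball 0 1) z
      \<le> (\<Sum>i. ennreal (q ^ i) * (?I i z * V i (cmod z)))" for z
    proof (cases "cmod z < 1")
      case True
      define x where "x = cmod (1 - cnj a * z)"
      have x: "t \<le> x" "1 - cmod z \<le> x" using norm_1_minus_cnj_mult[OF a True] by (auto simp: x_def t_def)
      have "1 \<le> x / t" using x t by simp
      then obtain i where i: "2 ^ i \<le> x / t" "x / t < 2 ^ Suc i" using ex_power_between[of 2 "x / t"] by auto
      have xH: "x < H i" using i(2) t by (simp add: H_def pos_divide_less_eq del: power_Suc)
      have "2 ^ i * t \<le> x" using i(1) t by (simp add: pos_le_divide_eq)
      then have "t / x \<le> 1 / 2 ^ i" using t x by (simp add: field_simps)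
      then have "(t / x) powr \<gamma> \<le> (1 / 2 ^ i) powr \<gamma>" using t x \<gamma>0 by (intro powr_mono2) auto
      also have "(1 / 2 ^ i) powr \<gamma> = q ^ i"
        by (simp add: q_def powr_divide powr_realpow[symmetric] powr_powr powr_minus field_simps flip: powr_power)
      finally have "(t / x) powr \<gamma> * (1 - cmod z) powr (-\<delta>) \<le> q ^ i * (1 - cmod z) powr (-\<delta>)"
        by (intro mult_right_mono) auto
      moreover have "r i \<le> cmod z" using x xH by (auto simp: r_def)
      ultimately have "ennreal ((t / x) powr \<gamma> * (1 - cmod z) powr (-\<delta>)) * W (cmod z) * indicator (ball 0 1) z
         \<le> ennreal (q ^ i * (1 - cmod z) powr (-\<delta>)) * W (cmod z)"
        using True by (simp add: mult_right_mono ennreal_leI)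
      also have "\<dots> = ennreal (q ^ i) * (?I i z * V i (cmod z))"
        using xH True \<open>r i \<le> cmod z\<close> q by (simp add: V_def x_def ennreal_mult mult.assoc)
      also have "\<dots> \<le> (\<Sum>i. ennreal (q ^ i) * (?I i z * V i (cmod z)))" by (rule ennreal_le_suminf)
      finally show ?thesis by (simp add: x_def)
    qed auto
    have term_le: "(\<integral>\<^sup>+z. ?I i z * V i (cmod z) \<partial>lborel) \<le> ennreal (2 * H i * (C' * t powr (-\<delta>) * (C1 ^ Suc i * h (cmod a))))" for i
    proof -
      have "(\<integral>\<^sup>+z. ?I i z * V i (cmod z) \<partial>lborel) = (\<integral>\<^sup>+z. circle_avg (?I i) z * V i (cmod z) \<partial>lborel)"
        by (rule nn_integral_circle_avg) measurable
      also have "\<dots> \<le> (\<integral>\<^sup>+z. ennreal (2 * H i) * (V i (cmod z) * indicator (ball 0 1) z) \<partial>lborel)"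
      proof (intro nn_integral_mono)
        fix z :: complex
        show "circle_avg (?I i) z * V i (cmod z) \<le> ennreal (2 * H i) * (V i (cmod z) * indicator (ball 0 1) z)"
        proof (cases "cmod z < 1")
          case True
          then show ?thesis using a H[of i] by (auto intro!: mult_right_mono circle_avg_near_le)
        qed (simp add: V_def)
      qed
      also have "\<dots> = ennreal (2 * H i) * (\<integral>\<^sup>+z\<in>ball 0 1. V i (cmod z) \<partial>lborel)"
        by (rule nn_integral_cmult) measurable
      also have "\<dots> \<le> ennreal (2 * H i) * ennreal (C' * (1 - r i) powr (-\<delta>) * h (r i))"
        unfolding V_def by (intro mult_left_mono C' r) simp
      also have "\<dots> \<le> ennreal (2 * H i) * ennreal (C' * t powr (-\<delta>) * (C1 ^ Suc i * h (cmod a)))"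
      proof (intro mult_left_mono ennreal_leI mult_mono)
        have "1 * t \<le> H i" unfolding H_def using t by (intro mult_right_mono one_le_power) auto
        then have "t \<le> 1 - r i" using t by (auto simp: r_def)
        then show "(1 - r i) powr (-\<delta>) \<le> t powr (-\<delta>)" using t \<delta> by (intro powr_mono2') auto
        show "h (r i) \<le> C1 ^ Suc i * h (cmod a)"
          using h_outer[OF t, of "Suc i"] by (simp add: r_def H_def t_def)
      qed (use C' less_imp_le[OF h_pos[OF r]] in auto)
      also have "\<dots> = ennreal (2 * H i * (C' * t powr (-\<delta>) * (C1 ^ Suc i * h (cmod a))))"
        using H[of i] by (subst ennreal_mult') auto
      finally show ?thesis .
    qed
    let ?A = "2 * 2 * C1 * C' * t * t powr (-\<delta>) * h (cmod a)"
    have hp: "0 < h (cmod a)" using a by (intro h_pos) auto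
    have "(\<integral>\<^sup>+z\<in>ball 0 1. ennreal ((t / cmod (1 - cnj a * z)) powr \<gamma> * (1 - cmod z) powr (-\<delta>)) * W (cmod z) \<partial>lborel)
       \<le> (\<integral>\<^sup>+z. (\<Sum>i. ennreal (q ^ i) * (?I i z * V i (cmod z))) \<partial>lborel)"
      by (intro nn_integral_mono pt)
    also have "\<dots> = (\<Sum>i. ennreal (q ^ i) * (\<integral>\<^sup>+z. ?I i z * V i (cmod z) \<partial>lborel))"
      by (simp add: nn_integral_suminf nn_integral_cmult)
    also have "\<dots> \<le> (\<Sum>i. ennreal (q ^ i) * ennreal (2 * H i * (C' * t powr (-\<delta>) * (C1 ^ Suc i * h (cmod a)))))"
      by (intro suminf_le summableI mult_left_mono term_le) simp
    also have "\<dots> = (\<Sum>i. ennreal (?A * (2 * C1 * q) ^ i))"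
    proof (rule suminf_cong)
      fix i
      let ?X = "2 * H i * (C' * t powr (-\<delta>) * (C1 ^ Suc i * h (cmod a)))"
      have "ennreal (q ^ i) * ennreal ?X = ennreal (q ^ i * ?X)"
        using q by (subst ennreal_mult') auto
      also have "q ^ i * ?X = ?A * (2 * C1 * q) ^ i"
      proof -
        let ?D = "C' * t powr (-\<delta>)"
        have e1: "2 * (2 * 2 ^ i * t) = (2 * 2 * t) * 2 ^ i" by simp
        have e2: "?D * (C1 * C1 ^ i * h (cmod a)) = (C1 * ?D * h (cmod a)) * C1 ^ i" by simp
        have e3: "x * ((A * P) * (B * R)) = (A * B) * (P * R * x)" for x A P B R :: real by simp
        have "(2 * 2 * t) * (C1 * ?D * h (cmod a)) = ?A" by simp
        then show ?thesis unfolding H_def power_Suc power_mult_distrib e1 e2 e3 by simp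
      qed
      finally show "ennreal (q ^ i) * ennreal ?X = ennreal (?A * (2 * C1 * q) ^ i)" .
    qed
    also have "\<dots> = ennreal (?A / (1 - 2 * C1 * q))"
      using q C1(1) C'(1) t hp by (intro suminf_geometric_ennreal) auto
    also have "\<dots> \<le> ennreal (?A / (1 / 2))"
      using q C1(1) C'(1) t hp by (intro ennreal_leI divide_left_mono) auto
    also have "?A / (1 / 2) = 8 * C1 * C' * t powr (1 - \<delta>) * h (cmod a)"
    proof -
      have "t * t powr (-\<delta>) = t powr (1 - \<delta>)" using t powr_mult_base[of t "-\<delta>"] by simp
      then show ?thesis by simp
    qed
    finally show "(\<integral>\<^sup>+z\<in>ball 0 1. ennreal (((1 - cmod a) / cmod (1 - cnj a * z)) powr \<gamma> * (1 - cmod z) powr (-\<delta>)) * W (cmod z) \<partial>lborel)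
      \<le> ennreal (8 * C1 * C' * (1 - cmod a) powr (1 - \<delta>) * h (cmod a))" by (simp add: t_def)
  qed (use C1(1) C'(1) in simp)
qed

abbreviation "square_weight a \<equiv> \<integral>\<^sup>+z\<in>carleson_square a. W (cmod z) \<partial>lborel"

text \<open>Averaging over rotations, the angular window takes the constant share (1 - cmod a) / (2
  * pi) of each circle. The origin is excluded, its square being the whole disc.\<close>

lemma nn_integral_carleson_square:
  assumes a: "a \<noteq> 0" "cmod a < 1"
  shows "square_weight a
    = ennreal ((1 - cmod a) / (2 * pi)) * (\<integral>\<^sup>+z\<in>ball 0 1. indicator {cmod a<..<1} (cmod z) * W (cmod z) \<partial>lborel)"
proof -
  let ?F = "indicator (arg_near (Arg a) ((1 - cmod a) / 2)) :: complex \<Rightarrow> ennreal"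
  let ?V = "\<lambda>s. indicator {cmod a<..<1} s * W s"
  have "square_weight a = (\<integral>\<^sup>+z. ?F z * ?V (cmod z) \<partial>lborel)"
    unfolding carleson_square_eq[OF a(1)] by (intro nn_integral_cong) (auto split: split_indicator)
  also have "\<dots> = (\<integral>\<^sup>+z. circle_avg ?F z * ?V (cmod z) \<partial>lborel)"
    by (rule nn_integral_circle_avg) measurable
  also have "\<dots> = (\<integral>\<^sup>+z. ennreal ((1 - cmod a) / (2 * pi)) * (?V (cmod z) * indicator (ball 0 1) z) \<partial>lborel)"
  proof (intro nn_integral_cong)
    fix z :: complex
    show "circle_avg ?F z * ?V (cmod z) = ennreal ((1 - cmod a) / (2 * pi)) * (?V (cmod z) * indicator (ball 0 1) z)"
    proof (cases "cmod a < cmod z \<and> cmod z < 1")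
      case True
      then have "z \<noteq> 0" using norm_ge_zero[of a] by auto
      moreover have "0 < (1 - cmod a) / 2" "(1 - cmod a) / 2 \<le> 1"
        using a by (auto simp: field_simps intro: order_trans[OF _ norm_ge_zero])
      ultimately have "circle_avg ?F z = ennreal ((1 - cmod a) / 2 / pi)" by (rule circle_avg_arg_near)
      then show ?thesis using True by simp
    qed auto
  qed
  also have "\<dots> = ennreal ((1 - cmod a) / (2 * pi)) * (\<integral>\<^sup>+z\<in>ball 0 1. ?V (cmod z) \<partial>lborel)"
    by (rule nn_integral_cmult) measurable
  finally show ?thesis .
qed

text \<open>The angular share is 1 - cmod a up to a constant and the radial integral is at most a
  multiple of the tail. Only the lower bound needs work: it calls for a ring that stays away from
  the origin yet carries a fixed share of the tail.\<close>

lemma carleson_square_weight: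
  obtains c C where "0 < c" "0 < C"
    "\<And>a. cmod a < 1 \<Longrightarrow> ennreal (c * ((1 - cmod a) * h (cmod a))) \<le> square_weight a"
    "\<And>a. cmod a < 1 \<Longrightarrow> square_weight a \<le> ennreal (C * ((1 - cmod a) * h (cmod a)))"
proof -
  obtain C' where C': "0 < C'" "\<And>r. 0 \<le> r \<Longrightarrow> r < 1 \<Longrightarrow>
    (\<integral>\<^sup>+z\<in>ball 0 1. indicator {r..<1} (cmod z) * (ennreal ((1 - cmod z) powr (-0)) * W (cmod z)) \<partial>lborel)
      \<le> ennreal (C' * (1 - r) powr (-0) * h r)"
    using ring_weight_le[of 0] KC2 by auto
  define c' where "c' = pi * (1 - 1 / C2) / C1"
  have c': "0 < c'" using KC2 C1 by (simp add: c'_def)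
  let ?R = "\<lambda>r. (\<integral>\<^sup>+z\<in>ball (0::complex) 1. indicator {r<..<1} (cmod z) * W (cmod z) \<partial>lborel)"
  have up: "(\<integral>\<^sup>+z\<in>ball (0::complex) 1. indicator {r..<1} (cmod z) * W (cmod z) \<partial>lborel) \<le> ennreal (C' * h r)" if r: "0 \<le> r" "r < 1" for r
  proof -
    have "(\<integral>\<^sup>+z\<in>ball (0::complex) 1. indicator {r..<1} (cmod z) * W (cmod z) \<partial>lborel)
      = (\<integral>\<^sup>+z\<in>ball (0::complex) 1. indicator {r..<1} (cmod z) * (ennreal ((1 - cmod z) powr (-0)) * W (cmod z)) \<partial>lborel)"
      by (intro nn_integral_cong) (auto split: split_indicator)
    also have "\<dots> \<le> ennreal (C' * (1 - r) powr (-0) * h r)" by (rule C'(2)[OF r])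
    finally show ?thesis using r by simp
  qed
  have up': "?R r \<le> ennreal (C' * h r)" if r: "0 \<le> r" "r < 1" for r
    by (rule order_trans[OF nn_integral_mono up[OF r]]) (auto split: split_indicator)
  have lo: "ennreal (c' * h r) \<le> ?R r" if r: "0 \<le> r" "r < 1" for r
  proof -
    \<comment> \<open>Halfway to the circle: a >= 1 / 2 keeps the Jacobian bounded below, condition
      (1) compares h a with h r, and from a to b condition (2) makes the tail drop by a fixed
      share.\<close>
    define a where "a = (1 + r) / 2"
    define b where "b = 1 - (1 - a) / K"
    have a: "1 / 2 \<le> a" "a < 1" "r < a" using r by (auto simp: a_def)
    have b: "0 \<le> b" "b < 1" using inner_radius[of a 1] a by (auto simp: b_def)
    have ab: "a \<le> b"
    proof -
      have "(1 - a) / K \<le> (1 - a) / 1" using a KC2(1) by (intro divide_left_mono) auto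
      then show ?thesis by (simp add: b_def)
    qed
    have hb: "h b \<le> h a / C2" using h_inner[of a 1] a by (simp add: b_def)
    have hC: "h a / C2 \<le> h a" using a h_pos[of a] KC2(2) by (simp add: divide_le_eq)
    have hba: "h b \<le> h a" using a ab b by (intro h_antimono) auto
    have ha: "h r \<le> C1 * h a" using C1(2)[OF r] by (simp add: a_def)
    have "c' * h r \<le> c' * (C1 * h a)" using ha c' by (intro mult_left_mono) auto
    also have "\<dots> = 2 * pi * (1 / 2) * ((1 - 1 / C2) * h a)" using C1(1) by (simp add: c'_def)
    also have "\<dots> \<le> 2 * pi * a * (h a - h b)"
      using a hb hba hC h_pos[of a] KC2(2) by (intro mult_mono) (auto simp: algebra_simps)
    finally have "ennreal (c' * h r) \<le> ennreal (2 * pi * a * (h a - h b))" by (rule ennreal_leI)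
    also have "\<dots> \<le> (\<integral>\<^sup>+z\<in>ball (0::complex) 1. indicator {a..<b} (cmod z) * W (cmod z) \<partial>lborel)"
      using a ab b by (intro ring_weight_ge) auto
    also have "\<dots> \<le> ?R r" using a b by (intro nn_integral_mono) (auto split: split_indicator)
    finally show ?thesis .
  qed
  show ?thesis
  \<comment> \<open>The maximum accommodates a = 0, where the square is the whole disc and the
    angular factor 1 / (2 * pi) is absent.\<close>
  proof (rule that[of "c' / (2 * pi)" "max C' (C' / (2 * pi))"])
    fix a :: complex assume a: "cmod a < 1"
    have ha: "0 < h (cmod a)" using a by (intro h_pos) auto
    show "ennreal (c' / (2 * pi) * ((1 - cmod a) * h (cmod a))) \<le> square_weight a"
    proof (cases "a = 0")
      case True
      have "c' / (2 * pi) * ((1 - cmod a) * h (cmod a)) \<le> c' * h 0"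
        using True c' ha pi_ge_two by (simp add: field_simps mult_le_cancel_left1)
      then have "ennreal (c' / (2 * pi) * ((1 - cmod a) * h (cmod a))) \<le> ennreal (c' * h 0)" by (rule ennreal_leI)
      also have "\<dots> \<le> ?R 0" by (rule lo) auto
      also have "\<dots> \<le> square_weight a"
        using True by (intro nn_integral_mono) (auto simp: carleson_square_def split: split_indicator)
      finally show ?thesis .
    next
      case False
      have "ennreal (c' / (2 * pi) * ((1 - cmod a) * h (cmod a))) = ennreal ((1 - cmod a) / (2 * pi)) * ennreal (c' * h (cmod a))"
        using a by (subst ennreal_mult'[symmetric]) (auto simp: mult_ac)
      also have "\<dots> \<le> ennreal ((1 - cmod a) / (2 * pi)) * ?R (cmod a)"
        using a by (intro mult_left_mono lo) auto
      finally show ?thesis by (simp add: nn_integral_carleson_square[OF False a])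
    qed
    show "square_weight a \<le> ennreal (max C' (C' / (2 * pi)) * ((1 - cmod a) * h (cmod a)))"
    proof (cases "a = 0")
      case True
      have "square_weight a \<le> (\<integral>\<^sup>+z\<in>ball (0::complex) 1. indicator {0..<1} (cmod z) * W (cmod z) \<partial>lborel)"
        using True by (intro nn_integral_mono) (auto simp: carleson_square_def split: split_indicator)
      also have "\<dots> \<le> ennreal (C' * h 0)" by (rule up) auto
      also have "\<dots> \<le> ennreal (max C' (C' / (2 * pi)) * ((1 - cmod a) * h (cmod a)))"
        using True ha by (intro ennreal_leI) (simp add: mult_right_mono)
      finally show ?thesis .
    next
      case False
      have "square_weight a \<le> ennreal ((1 - cmod a) / (2 * pi)) * ennreal (C' * h (cmod a))"
        unfolding nn_integral_carleson_square[OF False a] using a by (intro mult_left_mono up') auto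
      also have "\<dots> = ennreal (C' / (2 * pi) * ((1 - cmod a) * h (cmod a)))"
        using a by (subst ennreal_mult'[symmetric]) (auto simp: mult_ac)
      also have "\<dots> \<le> ennreal (max C' (C' / (2 * pi)) * ((1 - cmod a) * h (cmod a)))"
        using a ha by (intro ennreal_leI mult_right_mono) auto
      finally show ?thesis .
    qed
  qed (use c' C' in auto)
qed

end

subsection \<open>Derivatives and pseudohyperbolic discs\<close>

lemma pseudohyperbolic_disc_sets [measurable]: "pseudohyperbolic_disc a r \<in> sets borel"
  unfolding pseudohyperbolic_disc_def by measurable

text \<open>The denominator cmod (1 - cnj a * z) dominates both distances to the circle, so r times
  either of them will do as a Euclidean radius. Both forms occur: the distance of z when integrals
  are exchanged, that of a when compact sets are covered.\<close>

lemma near_in_pseudohyperbolic_disc: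
  assumes a: "cmod a < 1" and z: "cmod z < 1" and "cmod (z - a) < r * (1 - cmod z) \<or> cmod (z - a) < r * (1 - cmod a)"
    and r: "0 < r"
  shows "z \<in> pseudohyperbolic_disc a r"
proof -
  define X where "X = cmod (1 - cnj a * z)"
  have X: "1 - cmod a \<le> X" "1 - cmod z \<le> X" "0 < X"
    using norm_1_minus_cnj_mult(1,2)[OF a z] a by (auto simp: X_def)
  have "r * (1 - cmod z) \<le> r * X" "r * (1 - cmod a) \<le> r * X" using X r by (auto intro: mult_left_mono)
  then have "cmod (a - z) < r * X" using assms(3) by (auto simp: norm_minus_commute)
  then show ?thesis using X z by (simp add: pseudohyperbolic_disc_def norm_divide X_def[symmetric] pos_divide_less_eq)
qed

text \<open>With X = cmod (1 - cnj a * z), the identity X^2 - |z - a|^2 = (1 - |a|^2) * (1 - |z|^2)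
  gives (1 - r^2) * X^2 <= 4 * (1 - |a|) * (1 - |z|). As X dominates 1 - |a| and 1 - |z|, one factor
  X cancels, and both distances are comparable to X.\<close>

lemma pseudohyperbolic_disc_bounds:
  assumes a: "cmod a < 1" and r: "0 < r" "r < 1" and z: "z \<in> pseudohyperbolic_disc a r"
  defines "B \<equiv> 4 / (1 - r\<^sup>2)"
  shows "cmod (1 - cnj a * z) \<le> B * (1 - cmod a)" "cmod (1 - cnj a * z) \<le> B * (1 - cmod z)"
    "1 - cmod a \<le> B * (1 - cmod z)" "1 - cmod z \<le> B * (1 - cmod a)" "cmod (z - a) \<le> B * (1 - cmod a)"
proof -
  define X where "X = cmod (1 - cnj a * z)"
  have z1: "cmod z < 1" using z by (simp add: pseudohyperbolic_disc_def)
  have X: "1 - cmod a \<le> X" "1 - cmod z \<le> X" "cmod (z - a) \<le> X" "0 < X"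
    using norm_1_minus_cnj_mult(1,2,3)[OF a z1] a by (auto simp: X_def)
  have r2: "r\<^sup>2 < 1" using r by (simp add: power_less_one_iff)
  have "cmod (a - z) < r * X"
    using z X(4) by (simp add: pseudohyperbolic_disc_def norm_divide X_def[symmetric] pos_divide_less_eq)
  then have "(cmod (z - a))\<^sup>2 \<le> (r * X)\<^sup>2" by (intro power_mono) (auto simp: norm_minus_commute)
  moreover have "X\<^sup>2 - (cmod (z - a))\<^sup>2 = (1 - (cmod a)\<^sup>2) * (1 - (cmod z)\<^sup>2)"
    unfolding X_def cmod_power2 by (simp add: algebra_simps power2_eq_square)
  ultimately have "(1 - r\<^sup>2) * X\<^sup>2 \<le> (1 - (cmod a)\<^sup>2) * (1 - (cmod z)\<^sup>2)"
    by (simp add: power_mult_distrib algebra_simps)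
  also have "\<dots> = ((1 + cmod a) * (1 + cmod z)) * ((1 - cmod a) * (1 - cmod z))"
    by (simp add: power2_eq_square algebra_simps)
  also have "\<dots> \<le> (2 * 2) * ((1 - cmod a) * (1 - cmod z))"
    using a z1 by (intro mult_right_mono mult_mono mult_nonneg_nonneg) auto
  finally have main: "(1 - r\<^sup>2) * X\<^sup>2 \<le> 4 * ((1 - cmod a) * (1 - cmod z))" by simp
  have "(1 - cmod a) * (1 - cmod z) \<le> (1 - cmod a) * X" using X(2) a by (intro mult_left_mono) auto
  then have "(1 - r\<^sup>2) * X\<^sup>2 \<le> 4 * ((1 - cmod a) * X)" using main by linarith
  then have "((1 - r\<^sup>2) * X) * X \<le> (4 * (1 - cmod a)) * X" by (simp only: power2_eq_square mult.assoc)
  then have "(1 - r\<^sup>2) * X \<le> 4 * (1 - cmod a)" using X(4) by (rule mult_right_le_imp_le)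
  then show XA: "X \<le> B * (1 - cmod a)"
    using r2 by (simp add: B_def pos_le_divide_eq mult.commute)
  have "(1 - cmod a) * (1 - cmod z) \<le> X * (1 - cmod z)" using X(1) z1 by (intro mult_right_mono) auto
  then have "(1 - r\<^sup>2) * X\<^sup>2 \<le> 4 * ((1 - cmod z) * X)"
    using main by (subst (asm) mult.commute[of X "1 - cmod z"]) linarith
  then have "((1 - r\<^sup>2) * X) * X \<le> (4 * (1 - cmod z)) * X" by (simp only: power2_eq_square mult.assoc)
  then have "(1 - r\<^sup>2) * X \<le> 4 * (1 - cmod z)" using X(4) by (rule mult_right_le_imp_le)
  then show XZ: "X \<le> B * (1 - cmod z)"
    using r2 by (simp add: B_def pos_le_divide_eq mult.commute)
  show "1 - cmod a \<le> B * (1 - cmod z)" "1 - cmod z \<le> B * (1 - cmod a)" "cmod (z - a) \<le> B * (1 - cmod a)"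
    using X XA XZ by linarith+
qed

abbreviation deriv_int_on :: "complex set \<Rightarrow> nat \<Rightarrow> real \<Rightarrow> complex measure \<Rightarrow> (complex \<Rightarrow> complex) \<Rightarrow> ennreal" where
  "deriv_int_on A n q \<nu> f \<equiv> (\<integral>\<^sup>+z\<in>A. ennreal (cmod ((deriv ^^ n) f z) powr q) \<partial>\<nu>)"

lemma borel_measurable_higher_deriv_powr:
  assumes "f holomorphic_on ball 0 1"
  shows "(\<lambda>z. ennreal (cmod ((deriv ^^ n) f z) powr q) * indicator (ball 0 1) z) \<in> borel_measurable borel"
  using assms by (intro borel_measurable_norm_powr_indicator holomorphic_on_imp_continuous_on holomorphic_higher_deriv) auto

text \<open>The local estimate on the Euclidean disc of radius r * (1 - cmod z) is integrated over
  \<nu> and the order of integration exchanged; the points z that see a given x lie in the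
  pseudohyperbolic disc about x. The parameter \<rho> records that from the ring beyond \<rho> only
  points at distance at most 2 * (1 - \<rho>) from the circle are seen, so one estimate serves for
  boundedness and for smallness near the circle.\<close>

lemma nn_integral_higher_deriv_le:
  assumes q: "0 < q" and r: "0 < r" "r < 1"
  obtains C where "0 < C"
    "\<And>f \<nu> \<rho>. f holomorphic_on ball 0 1 \<Longrightarrow> sets \<nu> = sets borel \<Longrightarrow> sigma_finite_measure \<nu> \<Longrightarrow>
      deriv_int_on (ball 0 1 - ball 0 \<rho>) n q \<nu> f
        \<le> ennreal C * (\<integral>\<^sup>+x\<in>ball 0 1 - ball 0 (1 - 2 * (1 - \<rho>)).
            ennreal (cmod (f x) powr q) * (emeasure \<nu> (pseudohyperbolic_disc x r) * ennreal ((1 - cmod x) powr (- (real n * q) - 2))) \<partial>lborel)"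
proof -
  \<comment> \<open>The part n * q comes from the derivative, 2 from the area of the local disc. The
    factor 2 powr e in \<open>C\<close> pays for replacing 1 - cmod z by 1 - cmod x.\<close>
  define e where "e = real n * q + 2"
  have e: "0 < e" using q by (auto simp: e_def intro: add_nonneg_pos)
  define C0 where "C0 = (fact n * 2 ^ n) powr q * 4 / pi"
  have C0: "0 < C0" by (simp add: C0_def)
  define C where "C = C0 * r powr (-e) * 2 powr e"
  have C: "0 < C" using C0 r by (simp add: C_def)
  show ?thesis
  proof (rule that[OF C])
    fix f :: "complex \<Rightarrow> complex" and \<nu> :: "complex measure" and \<rho> :: real
    assume hol: "f holomorphic_on ball 0 1" and s [measurable_cong]: "sets \<nu> = sets borel" and sf: "sigma_finite_measure \<nu>"
    interpret N: sigma_finite_measure \<nu> by (rule sf)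
    interpret P: pair_sigma_finite \<nu> lborel ..
    let ?E = "ball 0 1 - ball (0::complex) \<rho>" and ?E' = "ball 0 1 - ball (0::complex) (1 - 2 * (1 - \<rho>))"
    define G where "G x = ennreal (cmod (f x) powr q) * indicator (ball 0 1) x" for x
    have [measurable]: "G \<in> borel_measurable borel"
      unfolding G_def using hol by (intro borel_measurable_norm_powr_indicator holomorphic_on_imp_continuous_on) auto
    define w where "w x = ennreal ((1 - cmod x) powr (-e))" for x :: complex
    have [measurable]: "w \<in> borel_measurable borel" unfolding w_def by measurable
    \<comment> \<open>Pairs (z, x) with z in the outer ring and x in the local disc about z,
      collected in one Borel set of the product as Tonelli's theorem requires.\<close>
    define Q where "Q = {y :: complex \<times> complex. cmod (fst y) < 1 \<and> \<not> cmod (fst y) < \<rho> \<and> cmod (snd y - fst y) < r * (1 - cmod (fst y))}"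
    have "{y \<in> space (borel \<Otimes>\<^sub>M borel). cmod (fst y) < 1 \<and> \<not> cmod (fst y) < \<rho> \<and> cmod (snd y - fst y) < r * (1 - cmod (fst y))}
        \<in> sets (borel \<Otimes>\<^sub>M borel :: (complex \<times> complex) measure)" by measurable
    then have Qm [measurable]: "Q \<in> sets (borel \<Otimes>\<^sub>M borel)"
      by (simp add: Q_def space_pair_measure)
    have close: "1 - cmod x \<le> 2 * (1 - cmod z)" if "cmod (x - z) < r * (1 - cmod z)" "cmod z < 1" for x z :: complex
    proof -
      have "r * (1 - cmod z) \<le> 1 * (1 - cmod z)" using r that by (intro mult_right_mono) auto
      with that(1) have "cmod (x - z) < 1 * (1 - cmod z)" by (rule less_le_trans)
      moreover have "cmod z - cmod x \<le> cmod (x - z)" by (metis norm_minus_commute norm_triangle_ineq2)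
      moreover have "1 - X \<le> 2 * (1 - Z)" if "D < 1 * (1 - Z)" "Z - X \<le> D" for X Z D :: real
        using that by (simp add: algebra_simps)
      ultimately show ?thesis by blast
    qed
    have pt: "ennreal (cmod ((deriv ^^ n) f z) powr q) * indicator ?E z
       \<le> ennreal C * (\<integral>\<^sup>+x. G x * w x * indicator Q (z, x) \<partial>lborel)" for z
    proof (cases "z \<in> ?E")
      case True
      then have z: "cmod z < 1" by simp
      let ?R = "r * (1 - cmod z)"
      have R: "0 < ?R" using r z by simp
      have sub: "ball z ?R \<subseteq> ball 0 1"
      proof
        fix x assume "x \<in> ball z ?R"
        then have "cmod (x - z) < ?R" by (simp add: dist_norm norm_minus_commute)
        moreover have "?R \<le> 1 * (1 - cmod z)" using r z by (intro mult_right_mono) auto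
        ultimately show "x \<in> ball 0 1" using norm_triangle_ineq2[of x z] by simp
      qed
      have "ennreal (cmod ((deriv ^^ n) f z) powr q)
        \<le> ennreal (C0 * ?R powr (- (real n * q) - 2)) * (\<integral>\<^sup>+x\<in>ball z ?R. ennreal (cmod (f x) powr q) \<partial>lborel)"
        unfolding C0_def by (intro deriv_powr_le_integral_ball holomorphic_on_subset[OF hol sub] R q)
      also have "\<dots> = (\<integral>\<^sup>+x. ennreal (C0 * ?R powr (-e)) * (G x * indicator (ball z ?R) x) \<partial>lborel)"
      proof -
        have "(\<integral>\<^sup>+x\<in>ball z ?R. ennreal (cmod (f x) powr q) \<partial>lborel) = (\<integral>\<^sup>+x. G x * indicator (ball z ?R) x \<partial>lborel)"
          using sub by (intro nn_integral_cong) (auto simp: G_def split: split_indicator)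
        then show ?thesis by (subst nn_integral_cmult) (auto simp: e_def)
      qed
      also have "\<dots> \<le> (\<integral>\<^sup>+x. ennreal C * (G x * w x * indicator Q (z, x)) \<partial>lborel)"
      proof (intro nn_integral_mono)
        fix x :: complex
        show "ennreal (C0 * ?R powr (-e)) * (G x * indicator (ball z ?R) x) \<le> ennreal C * (G x * w x * indicator Q (z, x))"
        proof (cases "x \<in> ball z ?R")
          case True': True
          then have xz: "cmod (x - z) < ?R" by (simp add: dist_norm norm_minus_commute)
          have x1: "cmod x < 1" using sub True' by auto
          have "(2 * (1 - cmod z)) powr (-e) \<le> (1 - cmod x) powr (-e)"
            using close[OF xz z] x1 e by (intro powr_mono2') auto
          moreover have "(2 * (1 - cmod z)) powr (-e) = 2 powr (-e) * (1 - cmod z) powr (-e)"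
            using z by (subst powr_mult) auto
          ultimately have "C * (2 powr (-e) * (1 - cmod z) powr (-e)) \<le> C * (1 - cmod x) powr (-e)"
            using C by (simp only: mult_le_cancel_left_pos)
          moreover have "?R powr (-e) = r powr (-e) * (1 - cmod z) powr (-e)"
            using z r by (subst powr_mult) auto
          then have "C0 * ?R powr (-e) = C * (2 powr (-e) * (1 - cmod z) powr (-e))"
            by (simp add: C_def powr_minus)
          ultimately have "C0 * ?R powr (-e) \<le> C * (1 - cmod x) powr (-e)" by simp
          then have "ennreal (C0 * ?R powr (-e)) \<le> ennreal C * w x"
            using C by (simp add: w_def ennreal_leI flip: ennreal_mult)
          then have "ennreal (C0 * ?R powr (-e)) * G x \<le> ennreal C * w x * G x" by (rule mult_right_mono) simp
          moreover have "(z, x) \<in> Q" using True xz by (simp add: Q_def)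
          ultimately show ?thesis using True' by (simp add: mult_ac)
        qed simp
      qed
      also have "\<dots> = ennreal C * (\<integral>\<^sup>+x. G x * w x * indicator Q (z, x) \<partial>lborel)"
        by (rule nn_integral_cmult) measurable
      finally show ?thesis using True by simp
    qed simp
    have "deriv_int_on (?E) n q \<nu> f
       \<le> (\<integral>\<^sup>+z. ennreal C * (\<integral>\<^sup>+x. G x * w x * indicator Q (z, x) \<partial>lborel) \<partial>\<nu>)"
      by (intro nn_integral_mono pt)
    also have "\<dots> = ennreal C * (\<integral>\<^sup>+z. (\<integral>\<^sup>+x. G x * w x * indicator Q (z, x) \<partial>lborel) \<partial>\<nu>)"
      by (rule nn_integral_cmult) measurable
    also have "(\<integral>\<^sup>+z. (\<integral>\<^sup>+x. G x * w x * indicator Q (z, x) \<partial>lborel) \<partial>\<nu>)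
       = (\<integral>\<^sup>+x. (\<integral>\<^sup>+z. G x * w x * indicator Q (z, x) \<partial>\<nu>) \<partial>lborel)"
      by (rule P.Fubini'[symmetric]) measurable
    also have "\<dots> = (\<integral>\<^sup>+x. G x * w x * emeasure \<nu> {z. (z, x) \<in> Q} \<partial>lborel)"
    proof (intro nn_integral_cong)
      fix x
      have "{z. (z, x) \<in> Q} = {z. cmod z < 1 \<and> \<not> cmod z < \<rho> \<and> cmod (x - z) < r * (1 - cmod z)}"
        by (auto simp: Q_def)
      also have "\<dots> \<in> sets borel" by measurable
      finally have m: "{z. (z, x) \<in> Q} \<in> sets \<nu>" using s by simp
      have "(\<integral>\<^sup>+z. G x * w x * indicator Q (z, x) \<partial>\<nu>) = (\<integral>\<^sup>+z. G x * w x * indicator {z. (z, x) \<in> Q} z \<partial>\<nu>)"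
        by (intro nn_integral_cong) (auto split: split_indicator)
      also have "\<dots> = G x * w x * emeasure \<nu> {z. (z, x) \<in> Q}"
        using m by (rule nn_integral_cmult_indicator)
      finally show "(\<integral>\<^sup>+z. G x * w x * indicator Q (z, x) \<partial>\<nu>) = G x * w x * emeasure \<nu> {z. (z, x) \<in> Q}" .
    qed
    also have "\<dots> \<le> (\<integral>\<^sup>+x\<in>?E'. ennreal (cmod (f x) powr q) * (emeasure \<nu> (pseudohyperbolic_disc x r) * w x) \<partial>lborel)"
    proof (intro nn_integral_mono)
      fix x :: complex
      show "G x * w x * emeasure \<nu> {z. (z, x) \<in> Q}
        \<le> ennreal (cmod (f x) powr q) * (emeasure \<nu> (pseudohyperbolic_disc x r) * w x) * indicator ?E' x"
      proof (cases "x \<in> ball 0 1 \<and> {z. (z, x) \<in> Q} \<noteq> {}")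
        case True
        then have x: "cmod x < 1" by simp
        have "{z. (z, x) \<in> Q} \<subseteq> pseudohyperbolic_disc x r"
          using x r by (auto simp: Q_def norm_minus_commute intro!: near_in_pseudohyperbolic_disc)
        then have emle: "emeasure \<nu> {z. (z, x) \<in> Q} \<le> emeasure \<nu> (pseudohyperbolic_disc x r)"
          by (intro emeasure_mono) (auto simp: s)
        obtain z where z: "z \<in> ?E" "cmod (x - z) < r * (1 - cmod z)" using True by (auto simp: Q_def)
        moreover have "x \<in> ?E'" using close[OF z(2)] z(1) x by auto
        ultimately show ?thesis using x mult_left_mono[OF emle, of "G x * w x"]
          by (simp add: G_def mult_ac)
      qed (auto simp: G_def)
    qed
    finally show "deriv_int_on (?E) n q \<nu> f
        \<le> ennreal C * (\<integral>\<^sup>+x\<in>?E'. ennreal (cmod (f x) powr q) *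
            (emeasure \<nu> (pseudohyperbolic_disc x r) * ennreal ((1 - cmod x) powr (- (real n * q) - 2))) \<partial>lborel)"
      by (simp add: w_def e_def mult_left_mono)
  qed
qed

section \<open>Derivatives of kernel sums\<close>

lemma has_field_derivative_inverse_power:
  fixes c z :: complex
  assumes "1 - c * z \<noteq> 0"
  shows "((\<lambda>z. inverse (1 - c * z) ^ N) has_field_derivative of_nat N * c * inverse (1 - c * z) ^ Suc N) (at z)"
proof -
  have d: "((\<lambda>z. inverse (1 - c * z)) has_field_derivative c * inverse (1 - c * z) ^ 2) (at z)"
    using assms by (auto intro!: derivative_eq_intros simp: field_simps power2_eq_square)
  show ?thesis using DERIV_power[OF d, of N] by (cases N) (simp_all add: power2_eq_square mult_ac)
qed

lemma higher_deriv_sum_inverse_power: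
  fixes b c :: "'k \<Rightarrow> complex"
  assumes c: "\<And>k. k \<in> J \<Longrightarrow> cmod (c k) \<le> 1" and z: "cmod z < 1"
  shows "(deriv ^^ n) (\<lambda>z. \<Sum>k\<in>J. b k * inverse (1 - c k * z) ^ m) z
    = (\<Sum>k\<in>J. b k * (of_nat (pochhammer m n) * c k ^ n * inverse (1 - c k * z) ^ (m + n)))"
  using z
proof (induction n arbitrary: z)
  case (Suc n)
  let ?g = "\<lambda>z. \<Sum>k\<in>J. b k * (of_nat (pochhammer m n) * c k ^ n * inverse (1 - c k * z) ^ (m + n))"
  have nz: "1 - c k * z \<noteq> 0" if "k \<in> J" for k
  proof
    assume "1 - c k * z = 0"
    then have "cmod (c k) * cmod z = 1" by (metis eq_iff_diff_eq_0 norm_mult norm_one)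
    moreover have "cmod (c k) * cmod z \<le> 1 * cmod z" using c[OF that] by (intro mult_right_mono) auto
    ultimately show False using Suc.prems by simp
  qed
  have dk: "((\<lambda>z. b k * (of_nat (pochhammer m n) * c k ^ n * inverse (1 - c k * z) ^ (m + n))) has_field_derivative
     b k * (of_nat (pochhammer m (Suc n)) * c k ^ Suc n * inverse (1 - c k * z) ^ (m + Suc n))) (at z)" if "k \<in> J" for k
  proof -
    have "((\<lambda>z. b k * (of_nat (pochhammer m n) * c k ^ n * inverse (1 - c k * z) ^ (m + n))) has_field_derivative
      b k * (of_nat (pochhammer m n) * c k ^ n * (of_nat (m + n) * c k * inverse (1 - c k * z) ^ Suc (m + n)))) (at z)"
      by (intro DERIV_cmult has_field_derivative_inverse_power nz that)
    moreover have "of_nat (pochhammer m n) * c k ^ n * (of_nat (m + n) * c k * inverse (1 - c k * z) ^ Suc (m + n))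
      = of_nat (pochhammer m (Suc n)) * c k ^ Suc n * inverse (1 - c k * z) ^ (m + Suc n)"
      by (simp add: pochhammer_Suc)
    ultimately show ?thesis by (simp only:)
  qed
  have "(?g has_field_derivative
     (\<Sum>k\<in>J. b k * (of_nat (pochhammer m (Suc n)) * c k ^ Suc n * inverse (1 - c k * z) ^ (m + Suc n)))) (at z)"
    by (intro DERIV_sum dk)
  then have "((deriv ^^ n) (\<lambda>z. \<Sum>k\<in>J. b k * inverse (1 - c k * z) ^ m) has_field_derivative
     (\<Sum>k\<in>J. b k * (of_nat (pochhammer m (Suc n)) * c k ^ Suc n * inverse (1 - c k * z) ^ (m + Suc n)))) (at z)"
    using Suc.prems Suc.IH by (elim has_field_derivative_transform_within_open[where S = "ball 0 1"]) auto
  then show ?case by (simp add: DERIV_imp_deriv)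
qed auto

lemma holomorphic_sum_inverse_power:
  fixes b c :: "'k \<Rightarrow> complex"
  assumes c: "\<And>k. k \<in> J \<Longrightarrow> cmod (c k) \<le> 1"
  shows "(\<lambda>z. \<Sum>k\<in>J. b k * inverse (1 - c k * z) ^ m) holomorphic_on ball 0 1"
proof (intro holomorphic_intros)
  fix k z assume k: "k \<in> J" and z: "z \<in> ball (0::complex) 1"
  show "1 - c k * z \<noteq> 0"
  proof
    assume "1 - c k * z = 0"
    then have "cmod (c k) * cmod z = 1" by (metis eq_iff_diff_eq_0 norm_mult norm_one)
    moreover have "cmod (c k) * cmod z \<le> 1 * cmod z" using c[OF k] by (intro mult_right_mono) auto
    ultimately show False using z by simp
  qed
qed

subsection \<open>Sums of kernels over Whitney boxes\<close>

lemma add_powr_le: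
  fixes x y p :: real
  assumes "0 \<le> x" "0 \<le> y" "0 < p" "p \<le> 1"
  shows "(x + y) powr p \<le> x powr p + y powr p"
proof (cases "x + y = 0")
  case False
  then have s: "0 < x + y" using assms by linarith
  have le: "z \<le> z powr p" if "0 \<le> z" "z \<le> 1" for z :: real
    using powr_mono'[of p 1 z] that assms by simp
  have "1 = x / (x + y) + y / (x + y)" using s by (simp add: add_divide_distrib[symmetric])
  also have "\<dots> \<le> (x / (x + y)) powr p + (y / (x + y)) powr p"
    using assms s by (intro add_mono le) auto
  also have "\<dots> = (x powr p + y powr p) / (x + y) powr p"
    using assms s by (simp add: powr_divide add_divide_distrib)
  finally show ?thesis using s by (simp add: pos_le_divide_eq)
qed (use assms in auto)

lemma sum_powr_le:
  fixes x :: "'k \<Rightarrow> real"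
  assumes "finite J" "\<And>k. k \<in> J \<Longrightarrow> 0 \<le> x k" "0 < p" "p \<le> 1"
  shows "(\<Sum>k\<in>J. x k) powr p \<le> (\<Sum>k\<in>J. x k powr p)"
  using assms(1,2)
proof (induction J rule: finite_induct)
  case (insert k J)
  have "(\<Sum>k\<in>insert k J. x k) powr p \<le> x k powr p + (\<Sum>k\<in>J. x k) powr p"
    using insert assms by (simp add: add_powr_le sum_nonneg)
  also have "\<dots> \<le> x k powr p + (\<Sum>k\<in>J. x k powr p)" using insert by auto
  finally show ?case using insert by simp
qed simp

text \<open>Jensen's inequality with the weights l k / L. Summands with y k = 0 are removed first
  because convexity of the power is applied on the open half-line.\<close>

lemma weighted_sum_powr_le:
  fixes l y :: "'k \<Rightarrow> real"
  assumes J: "finite J" and l: "\<And>k. k \<in> J \<Longrightarrow> 0 < l k" and y: "\<And>k. k \<in> J \<Longrightarrow> 0 \<le> y k" and p: "1 \<le> p"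
  shows "(\<Sum>k\<in>J. l k * y k) powr p \<le> (\<Sum>k\<in>J. l k) powr (p - 1) * (\<Sum>k\<in>J. l k * y k powr p)"
proof -
  define J' where "J' = {k\<in>J. 0 < y k}"
  have J': "finite J'" "J' \<subseteq> J" using J by (auto simp: J'_def)
  have e1: "(\<Sum>k\<in>J. l k * y k) = (\<Sum>k\<in>J'. l k * y k)"
    using J y by (intro sum.mono_neutral_right) (auto simp: J'_def order_le_less)
  show ?thesis
  proof (cases "J' = {}")
    case True
    then show ?thesis using e1 p l by (auto intro!: mult_nonneg_nonneg sum_nonneg less_imp_le[OF l])
  next
    case False
    define L where "L = (\<Sum>k\<in>J'. l k)"
    have L: "0 < L" unfolding L_def using False J' l by (intro sum_pos) auto
    have LJ: "L \<le> (\<Sum>k\<in>J. l k)" unfolding L_def using J J' by (intro sum_mono2) (auto intro: less_imp_le[OF l])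
    have "(\<Sum>k\<in>J'. (l k / L) *\<^sub>R y k) powr p \<le> (\<Sum>k\<in>J'. (l k / L) * y k powr p)"
    proof (rule convex_on_sum[OF J'(1) False powr_convex[OF p]])
      show "(\<Sum>k\<in>J'. l k / L) = 1" using L by (simp add: L_def sum_divide_distrib[symmetric])
      show "0 \<le> l k / L" if "k \<in> J'" for k using that L l[of k] J' by auto
      show "y k \<in> {0<..}" if "k \<in> J'" for k using that by (simp add: J'_def)
    qed
    also have "(\<Sum>k\<in>J'. (l k / L) *\<^sub>R y k) = (\<Sum>k\<in>J'. l k * y k) / L" by (simp add: sum_divide_distrib)
    also have "(\<Sum>k\<in>J'. (l k / L) * y k powr p) = (\<Sum>k\<in>J'. l k * y k powr p) / L" by (simp add: sum_divide_distrib)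
    also have "((\<Sum>k\<in>J'. l k * y k) / L) powr p = (\<Sum>k\<in>J'. l k * y k) powr p / L powr p"
      using L by (simp add: powr_divide)
    finally have "(\<Sum>k\<in>J'. l k * y k) powr p \<le> L powr p / L * (\<Sum>k\<in>J'. l k * y k powr p)"
      using L by (simp add: field_simps)
    also have "L powr p / L = L powr (p - 1)" using L by (simp add: powr_diff)
    also have "L powr (p - 1) * (\<Sum>k\<in>J'. l k * y k powr p) \<le> (\<Sum>k\<in>J. l k) powr (p - 1) * (\<Sum>k\<in>J. l k * y k powr p)"
      using L LJ p J J' by (intro mult_mono powr_mono2 sum_mono2 sum_nonneg)
        (auto intro!: mult_nonneg_nonneg intro: less_imp_le[OF l])
    finally show ?thesis unfolding e1 .
  qed
qed

text \<open>Every distance to p is attained at most twice, once on each side.\<close>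

lemma sum_int_dist_le:
  fixes \<phi> :: "nat \<Rightarrow> real" and M :: "int set"
  assumes M: "finite M" and \<phi>: "summable \<phi>" "\<And>n. 0 \<le> \<phi> n"
  shows "(\<Sum>m\<in>M. \<phi> (nat \<bar>m - p\<bar>)) \<le> 2 * (\<Sum>n. \<phi> n)"
proof -
  have half: "(\<Sum>m\<in>A. \<phi> (nat \<bar>m - p\<bar>)) \<le> (\<Sum>n. \<phi> n)" if A: "finite A" "inj_on (\<lambda>m. nat \<bar>m - p\<bar>) A" for A
  proof -
    have "(\<Sum>m\<in>A. \<phi> (nat \<bar>m - p\<bar>)) = (\<Sum>n\<in>(\<lambda>m. nat \<bar>m - p\<bar>) ` A. \<phi> n)"
      using A(2) by (simp add: sum.reindex)
    also have "\<dots> \<le> (\<Sum>n. \<phi> n)" using A(1) \<phi> by (intro sum_le_suminf) auto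
    finally show ?thesis .
  qed
  have "(\<Sum>m\<in>M. \<phi> (nat \<bar>m - p\<bar>)) = (\<Sum>m\<in>M \<inter> {p..}. \<phi> (nat \<bar>m - p\<bar>)) + (\<Sum>m\<in>M - {p..}. \<phi> (nat \<bar>m - p\<bar>))"
    using M by (subst sum.union_disjoint[symmetric]) (auto intro!: sum.cong)
  also have "\<dots> \<le> (\<Sum>n. \<phi> n) + (\<Sum>n. \<phi> n)"
    using M by (intro add_mono half) (auto intro!: inj_onI)
  finally show ?thesis by simp
qed

text \<open>Uniformity in x is the point: replacing x by its floor costs a factor 4 and leaves
  integer distances only.\<close>

lemma sum_inverse_square_dist_le:
  obtains G where "0 < G" "\<And>(x::real) (M :: int set). finite M \<Longrightarrow> (\<Sum>m\<in>M. 1 / (1 + \<bar>of_int m - x\<bar>)\<^sup>2) \<le> G"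
proof -
  define \<phi> where "\<phi> n = 4 / (1 + real n)\<^sup>2" for n
  have "summable (\<lambda>n. inverse (real (Suc n) ^ 2))"
    using inverse_power_summable[of 2, where 'a = real] by (subst summable_Suc_iff) simp
  then have "summable (\<lambda>n. 4 * inverse (real (Suc n) ^ 2))" by (rule summable_mult)
  then have \<phi>: "summable \<phi>" "\<And>n. 0 \<le> \<phi> n" by (auto simp: \<phi>_def[abs_def] divide_inverse add.commute)
  have "(\<Sum>m\<in>M. 1 / (1 + \<bar>of_int m - x\<bar>)\<^sup>2) \<le> 2 * (\<Sum>n. \<phi> n) + 1" if M: "finite M" for x :: real and M :: "int set"
  proof -
    have "(\<Sum>m\<in>M. 1 / (1 + \<bar>of_int m - x\<bar>)\<^sup>2) \<le> (\<Sum>m\<in>M. \<phi> (nat \<bar>m - \<lfloor>x\<rfloor>\<bar>))"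
    proof (rule sum_mono)
      fix m
      have "\<bar>of_int (m - \<lfloor>x\<rfloor>)\<bar> \<le> \<bar>of_int m - x\<bar> + 1" by linarith
      then have N: "real (nat \<bar>m - \<lfloor>x\<rfloor>\<bar>) \<le> \<bar>of_int m - x\<bar> + 1" by simp
      have "1 + N \<le> 2 * (1 + A)" if "N \<le> A + 1" "0 \<le> A" for N A :: real
        using that by argo
      from this[OF N abs_ge_zero] have "1 + real (nat \<bar>m - \<lfloor>x\<rfloor>\<bar>) \<le> 2 * (1 + \<bar>of_int m - x\<bar>)" .
      then have "(1 + real (nat \<bar>m - \<lfloor>x\<rfloor>\<bar>))\<^sup>2 \<le> (2 * (1 + \<bar>of_int m - x\<bar>))\<^sup>2" by (intro power_mono) auto
      then have "4 / (2 * (1 + \<bar>of_int m - x\<bar>))\<^sup>2 \<le> \<phi> (nat \<bar>m - \<lfloor>x\<rfloor>\<bar>)"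
        unfolding \<phi>_def by (intro divide_left_mono) (auto intro!: mult_pos_pos zero_less_power add_pos_nonneg)
      then show "1 / (1 + \<bar>of_int m - x\<bar>)\<^sup>2 \<le> \<phi> (nat \<bar>m - \<lfloor>x\<rfloor>\<bar>)"
        by (simp only: power_mult_distrib) simp
    qed
    also have "\<dots> \<le> 2 * (\<Sum>n. \<phi> n)" using M \<phi> by (rule sum_int_dist_le)
    finally show ?thesis by simp
  qed
  moreover have "0 < 2 * (\<Sum>n. \<phi> n) + 1" using suminf_nonneg[OF \<phi>] by simp
  ultimately show ?thesis using that by blast
qed

text \<open>Whitney boxes: the ring at distance between \<open>2 ^ (- j - 1)\<close> and \<open>2 ^ (- j)\<close> from the
  circle, cut by the grid of mesh \<open>2 ^ (- j)\<close>.\<close>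

fun whitney_box :: "nat \<times> int \<times> int \<Rightarrow> complex set" where
  "whitney_box (j, m, n) = {z. cmod z < 1 \<and> 2 ^ j * (1 - cmod z) \<le> 1 \<and> 1 < 2 ^ Suc j * (1 - cmod z)
     \<and> \<lfloor>2 ^ j * Re z\<rfloor> = m \<and> \<lfloor>2 ^ j * Im z\<rfloor> = n}"

lemma whitney_box_sets [measurable]: "whitney_box k \<in> sets borel"
  by (cases k) simp

lemma whitney_box_subset: "z \<in> whitney_box k \<Longrightarrow> cmod z < 1"
  by (cases k) simp

lemma whitney_box_cover:
  assumes "cmod z < 1"
  obtains k where "z \<in> whitney_box k"
proof -
  have "1 \<le> 1 / (1 - cmod z)" using assms by (simp add: le_divide_eq_1)
  then obtain j where "2 ^ j \<le> 1 / (1 - cmod z)" "1 / (1 - cmod z) < 2 ^ Suc j"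
    using ex_power_between[of 2 "1 / (1 - cmod z)"] by auto
  then have "2 ^ j * (1 - cmod z) \<le> 1" "1 < 2 ^ Suc j * (1 - cmod z)"
    using assms by (simp_all add: pos_le_divide_eq pos_divide_less_eq del: power_Suc)
  then have "z \<in> whitney_box (j, \<lfloor>2 ^ j * Re z\<rfloor>, \<lfloor>2 ^ j * Im z\<rfloor>)" using assms by simp
  then show ?thesis by (rule that)
qed

lemma whitney_level_unique:
  assumes "2 ^ i * t \<le> 1" "1 < 2 ^ Suc j * t" "0 < (t::real)"
  shows "i \<le> j"
proof (rule ccontr)
  assume "\<not> i \<le> j"
  then have "(2::real) ^ Suc j \<le> 2 ^ i" by (intro power_increasing) auto
  then have "2 ^ Suc j * t \<le> 2 ^ i * t" using assms(3) by (intro mult_right_mono) auto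
  then show False using assms by linarith
qed

lemma whitney_box_disjoint:
  assumes "z \<in> whitney_box k" "z \<in> whitney_box l"
  shows "k = l"
proof -
  obtain j m n where k: "k = (j, m, n)" by (metis prod_cases3)
  obtain j' m' n' where l: "l = (j', m', n')" by (metis prod_cases3)
  have t: "0 < 1 - cmod z" using whitney_box_subset[OF assms(1)] by simp
  have "j \<le> j'" "j' \<le> j"
    using assms whitney_level_unique[OF _ _ t, of j j'] whitney_level_unique[OF _ _ t, of j' j] by (auto simp: k l)
  then show ?thesis using assms by (auto simp: k l)
qed

text \<open>Within a box of level j both coordinates differ by at most 2 ^ (- j), which is less than
  2 * (1 - cmod z); hence 4. For the third bound 1 - cnj z * w is split into (1 - |z|^2) + cnj z *
  (z - w); hence 2 + 4.\<close>

lemma whitney_box_bounds: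
  assumes z: "z \<in> whitney_box k" and w: "w \<in> whitney_box k"
  shows "cmod (z - w) \<le> 4 * (1 - cmod z)" "1 - cmod w \<le> 2 * (1 - cmod z)"
    "cmod (1 - cnj z * w) \<le> 6 * (1 - cmod z)"
proof -
  obtain j m n where k: "k = (j, m, n)" by (metis prod_cases3)
  let ?D = "(2::real) ^ j"
  have zz: "?D * (1 - cmod z) \<le> 1" "1 < 2 * (?D * (1 - cmod z))" "\<lfloor>?D * Re z\<rfloor> = m" "\<lfloor>?D * Im z\<rfloor> = n" "cmod z < 1"
    using z by (auto simp: k)
  have ww: "?D * (1 - cmod w) \<le> 1" "1 < 2 * (?D * (1 - cmod w))" "\<lfloor>?D * Re w\<rfloor> = m" "\<lfloor>?D * Im w\<rfloor> = n" "cmod w < 1"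
    using w by (auto simp: k)
  have D: "0 < ?D" by simp
  have re: "\<bar>?D * Re z - ?D * Re w\<bar> \<le> 1" using zz(3) ww(3) by linarith
  have im: "\<bar>?D * Im z - ?D * Im w\<bar> \<le> 1" using zz(4) ww(4) by linarith
  have "?D * cmod (z - w) = cmod (of_real ?D * (z - w))" by (simp add: norm_mult norm_power)
  also have "\<dots> \<le> \<bar>Re (of_real ?D * (z - w))\<bar> + \<bar>Im (of_real ?D * (z - w))\<bar>" by (rule cmod_le)
  also have "\<dots> \<le> 2" using re im by (simp add: right_diff_distrib)
  also have "(2::real) \<le> 4 * (?D * (1 - cmod z))" using zz(2) by linarith
  also have "\<dots> = ?D * (4 * (1 - cmod z))" by simp
  finally show zw: "cmod (z - w) \<le> 4 * (1 - cmod z)" using D by (simp only: mult_le_cancel_left_pos)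
  have "?D * (1 - cmod w) \<le> 2 * (?D * (1 - cmod z))" using ww(1) zz(2) by linarith
  also have "\<dots> = ?D * (2 * (1 - cmod z))" by simp
  finally show "1 - cmod w \<le> 2 * (1 - cmod z)" using D by (simp only: mult_le_cancel_left_pos)
  have "1 - cnj z * w = of_real (1 - (cmod z)\<^sup>2) + cnj z * (z - w)"
    by (simp add: right_diff_distrib complex_norm_square[symmetric] mult.commute[of "cnj z" z])
  then have "cmod (1 - cnj z * w) \<le> \<bar>1 - (cmod z)\<^sup>2\<bar> + cmod z * cmod (z - w)"
    by (metis complex_mod_cnj norm_mult norm_of_real norm_triangle_ineq)
  also have "\<bar>1 - (cmod z)\<^sup>2\<bar> = (1 + cmod z) * (1 - cmod z)"
    using zz(5) by (simp add: power2_eq_square algebra_simps abs_of_nonneg mult_le_one)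
  also have "\<dots> \<le> 2 * (1 - cmod z)" using zz(5) by (intro mult_right_mono) auto
  also have "cmod z * cmod (z - w) \<le> 1 * (4 * (1 - cmod z))" using zz(5) zw by (intro mult_mono) auto
  finally show "cmod (1 - cnj z * w) \<le> 6 * (1 - cmod z)" by simp
qed

text \<open>Here s is the ratio of the distances to the circle of points at levels j and i, so it is
  about 2 powr (i - j). For s <= 1 the product equals s, for s > 1 it is s powr (-\<delta>); both
  decay geometrically in the level difference, the slower rate being 2 powr (-\<delta>).\<close>

lemma min_powr_le_level:
  fixes s \<delta> :: real and i j :: nat
  assumes s: "0 < s" "s * 2 ^ j \<le> 2 * 2 ^ i" "2 ^ i \<le> 2 * 2 ^ j * s" and \<delta>: "0 < \<delta>" "\<delta> \<le> 1"
  shows "min 1 s powr (1 + \<delta>) * s powr (-\<delta>) \<le> 2 * (2 powr (-\<delta>)) ^ nat \<bar>int j - int i\<bar>"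
proof (cases "i \<le> j")
  case True
  then have dij: "nat \<bar>int j - int i\<bar> = j - i" by simp
  have "s \<le> 2 / 2 ^ (j - i)"
  proof -
    have "(2::real) ^ j = 2 ^ i * 2 ^ (j - i)" using True by (simp flip: power_add)
    then have "2 ^ i * (s * 2 ^ (j - i)) \<le> 2 ^ i * 2" using s(2) by (simp add: mult_ac)
    then show ?thesis by (simp add: pos_le_divide_eq)
  qed
  moreover have "min 1 s powr (1 + \<delta>) * s powr (-\<delta>) \<le> s powr (1 + \<delta>) * s powr (-\<delta>)"
    using s \<delta> by (intro mult_right_mono powr_mono2) auto
  moreover have "s powr (1 + \<delta>) * s powr (-\<delta>) = s" using s by (simp add: powr_add[symmetric])
  moreover have "2 / 2 ^ (j - i) \<le> 2 * (2 powr (-\<delta>)) ^ (j - i)"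
  proof -
    have "(2::real) powr (-1) \<le> 2 powr (-\<delta>)" using \<delta> by (intro powr_mono) auto
    then have "1 / 2 \<le> 2 powr (-\<delta>)" by (simp add: powr_minus_divide)
    then have "(1 / 2) ^ (j - i) \<le> (2 powr (-\<delta>)) ^ (j - i)" by (rule power_mono) simp
    then show ?thesis by (simp add: power_one_over)
  qed
  ultimately show ?thesis unfolding dij by linarith
next
  case False
  then have dij: "nat \<bar>int j - int i\<bar> = i - j" by simp
  have "2 ^ (i - j) / 2 \<le> s"
  proof -
    have "(2::real) ^ i = 2 ^ j * 2 ^ (i - j)" using False by (simp flip: power_add)
    then have "2 ^ j * 2 ^ (i - j) \<le> 2 ^ j * (2 * s)" using s(3) by (simp add: mult_ac)
    then have "2 ^ (i - j) \<le> 2 * s" by (simp only: mult_le_cancel_left_pos zero_less_power zero_less_numeral)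
    then show ?thesis by simp
  qed
  then have "s powr (-\<delta>) \<le> (2 ^ (i - j) / 2) powr (-\<delta>)" using \<delta> by (intro powr_mono2') auto
  also have "\<dots> = 2 powr \<delta> * (2 powr (-\<delta>)) ^ (i - j)"
  proof -
    have "2 ^ (i - j) / 2 = (2::real) powr (real (i - j) - 1)" by (simp add: powr_diff powr_realpow)
    then have "(2 ^ (i - j) / 2) powr (-\<delta>) = (2::real) powr (\<delta> + (-\<delta>) * real (i - j))"
      by (simp add: powr_powr algebra_simps)
    also have "\<dots> = 2 powr \<delta> * 2 powr ((-\<delta>) * real (i - j))" by (rule powr_add)
    also have "2 powr ((-\<delta>) * real (i - j)) = (2 powr (-\<delta>)) ^ (i - j)"
      by (simp add: powr_realpow[symmetric] powr_powr)
    finally show ?thesis .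
  qed
  also have "\<dots> \<le> 2 * (2 powr (-\<delta>)) ^ (i - j)"
    using \<delta> powr_mono[of \<delta> 1 2] by (intro mult_right_mono) auto
  finally have "s powr (-\<delta>) \<le> 2 * (2 powr (-\<delta>)) ^ (i - j)" .
  moreover have "min 1 s powr (1 + \<delta>) * s powr (-\<delta>) \<le> 1 * s powr (-\<delta>)"
    using s \<delta> powr_le1[of "1 + \<delta>" "min 1 s"] by (intro mult_right_mono) auto
  ultimately show ?thesis unfolding dij by linarith
qed

text \<open>A Schur-type bound: the power -\<delta> of the distance to the circle, summed against
  the kernels, is reproduced at z. Of the exponent \<gamma>, four powers pay for the two grid
  directions, two for each, so that the sums over the grid converge; 1 + \<delta> further powers
  give geometric decay in the level difference.\<close>

lemma sum_whitney_kernel_le: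
  fixes \<delta> \<gamma> :: real
  assumes \<delta>: "0 < \<delta>" "\<delta> \<le> 1" and \<gamma>: "5 + \<delta> \<le> \<gamma>"
  obtains C where "0 < C" "\<And>J a z. finite J \<Longrightarrow> (\<And>k. k \<in> J \<Longrightarrow> a k \<in> whitney_box k) \<Longrightarrow> cmod z < 1 \<Longrightarrow>
    (\<Sum>k\<in>J. ((1 - cmod (a k)) / cmod (1 - cnj (a k) * z)) powr \<gamma> * (1 - cmod (a k)) powr (-\<delta>))
      \<le> C * (1 - cmod z) powr (-\<delta>)"
proof -
  obtain G where G: "0 < G" "\<And>(x::real) (M :: int set). finite M \<Longrightarrow> (\<Sum>m\<in>M. 1 / (1 + \<bar>of_int m - x\<bar>)\<^sup>2) \<le> G"
    using sum_inverse_square_dist_le by blast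
  define \<beta> where "\<beta> = 2 powr (-\<delta>)"
  have \<beta>: "0 < \<beta>" "\<beta> < 1" using \<delta> powr_less_mono[of "-\<delta>" 0 2] by (auto simp: \<beta>_def)
  define C where "C = 81 * 2 * (2 * (1 / (1 - \<beta>))) * G * G"
  have "0 < C" using G \<beta> by (simp add: C_def)
  moreover have "(\<Sum>k\<in>J. ((1 - cmod (a k)) / cmod (1 - cnj (a k) * z)) powr \<gamma> * (1 - cmod (a k)) powr (-\<delta>))
      \<le> C * (1 - cmod z) powr (-\<delta>)"
    if J: "finite J" and a: "\<And>k. k \<in> J \<Longrightarrow> a k \<in> whitney_box k" and z: "cmod z < 1" for J a z
  proof -
    obtain i mz nz where "z \<in> whitney_box (i, mz, nz)" using whitney_box_cover[OF z] by (metis prod_cases3)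
    then have i: "2 ^ i * (1 - cmod z) \<le> 1" "1 < 2 * (2 ^ i * (1 - cmod z))" by auto
    define T where "T = 1 - cmod z"
    have T: "0 < T" using z by (simp add: T_def)
    let ?g = "\<lambda>j (m::int) x. 1 / (1 + \<bar>of_int m - 2 ^ j * x\<bar>)\<^sup>2 :: real"
    have each: "((1 - cmod (a k)) / cmod (1 - cnj (a k) * z)) powr \<gamma> * (1 - cmod (a k)) powr (-\<delta>)
       \<le> 81 * 2 * T powr (-\<delta>) * (\<beta> ^ nat \<bar>int j - int i\<bar> * (?g j m (Re z) * ?g j n (Im z)))"
      if k: "k \<in> J" "k = (j, m, n)" for k j m n
    proof -
      have ak: "2 ^ j * (1 - cmod (a k)) \<le> 1" "1 < 2 * (2 ^ j * (1 - cmod (a k)))"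
        "\<lfloor>2 ^ j * Re (a k)\<rfloor> = m" "\<lfloor>2 ^ j * Im (a k)\<rfloor> = n" "cmod (a k) < 1"
        using a[OF k(1)] by (auto simp: k(2))
      define t where "t = 1 - cmod (a k)"
      define X where "X = cmod (1 - cnj (a k) * z)"
      have t: "0 < t" using ak by (simp add: t_def)
      have X: "t \<le> X" "T \<le> X" "cmod (z - a k) \<le> X"
        using norm_1_minus_cnj_mult(1,2,3)[OF ak(5) z] by (auto simp: t_def X_def T_def)
      have X0: "0 < X" using X t by simp
      define u where "u = t / X"
      have u: "0 < u" "u \<le> 1" "u \<le> t / T"
        using t T X X0 by (auto simp: u_def intro!: divide_left_mono)
      \<comment> \<open>X bounds the distance of the two points and 2 ^ j * X is at most 1 / u. So u
        decays at least like the inverse of the distance between the grid index and 2 ^ j times the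
        coordinate of z.\<close>
      have grid: "u \<le> 3 / (1 + \<bar>of_int l - 2 ^ j * x\<bar>)" if "\<lfloor>2 ^ j * y\<rfloor> = l" "\<bar>y - x\<bar> \<le> X" for l x y
      proof -
        have "2 ^ j * \<bar>y - x\<bar> \<le> 2 ^ j * X" using that(2) by (intro mult_left_mono) auto
        then have "\<bar>2 ^ j * y - 2 ^ j * x\<bar> \<le> 2 ^ j * X"
          by (simp add: abs_mult right_diff_distrib[symmetric])
        moreover have "\<bar>of_int l - 2 ^ j * y\<bar> \<le> 1" using that(1) by linarith
        moreover have "2 ^ j * X \<le> 1 / u"
        proof -
          have "2 ^ j * X * u = 2 ^ j * t" using X0 by (simp add: u_def)
          also have "\<dots> \<le> 1" using ak(1) by (simp add: t_def)
          finally show ?thesis using u(1) by (simp add: pos_le_divide_eq)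
        qed
        moreover have "1 \<le> 1 / u" using u by (simp add: le_divide_eq_1)
        ultimately have "1 + \<bar>of_int l - 2 ^ j * x\<bar> \<le> 3 * (1 / u)" by linarith
        then show ?thesis using u(1) by (simp add: pos_le_divide_eq field_simps)
      qed
      have "\<bar>Re (a k) - Re z\<bar> \<le> X" "\<bar>Im (a k) - Im z\<bar> \<le> X"
        using abs_Re_le_cmod[of "a k - z"] abs_Im_le_cmod[of "a k - z"] X(3) by (auto simp: norm_minus_commute)
      then have "u \<le> 3 / (1 + \<bar>of_int m - 2 ^ j * Re z\<bar>)" "u \<le> 3 / (1 + \<bar>of_int n - 2 ^ j * Im z\<bar>)"
        using grid ak by auto
      then have "u\<^sup>2 \<le> (3 / (1 + \<bar>of_int m - 2 ^ j * Re z\<bar>))\<^sup>2" "u\<^sup>2 \<le> (3 / (1 + \<bar>of_int n - 2 ^ j * Im z\<bar>))\<^sup>2"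
        using u by (auto intro!: power_mono)
      then have "u\<^sup>2 * u\<^sup>2 \<le> (9 * ?g j m (Re z)) * (9 * ?g j n (Im z))"
        by (intro mult_mono) (auto simp: power_divide)
      then have u4: "u powr 4 \<le> 81 * (?g j m (Re z) * ?g j n (Im z))"
        using u(1) by (simp add: power4_eq_xxxx power2_eq_square)
      define s where "s = t / T"
      have s: "0 < s" using t T by (simp add: s_def)
      have "u powr (\<gamma> - 4) \<le> u powr (1 + \<delta>)" using u \<gamma> by (intro powr_mono') auto
      also have "\<dots> \<le> min 1 s powr (1 + \<delta>)" using u \<delta> by (intro powr_mono2) (auto simp: s_def)
      finally have ug: "u powr (\<gamma> - 4) \<le> min 1 s powr (1 + \<delta>)" .
      have ts: "t powr (-\<delta>) = T powr (-\<delta>) * s powr (-\<delta>)"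
        using t T by (simp add: s_def powr_divide)
      have lev: "min 1 s powr (1 + \<delta>) * s powr (-\<delta>) \<le> 2 * \<beta> ^ nat \<bar>int j - int i\<bar>"
        unfolding \<beta>_def
      proof (rule min_powr_le_level[OF s _ _ \<delta>])
        have "2 ^ j * t \<le> 2 * (2 ^ i * T)" using ak(1) i(2) by (simp add: t_def T_def)
        then have "(2 ^ j * t) / T \<le> (2 * (2 ^ i * T)) / T" using T by (intro divide_right_mono) auto
        then show "s * 2 ^ j \<le> 2 * 2 ^ i" using T by (simp add: s_def mult.commute)
        have "2 ^ i * T \<le> 2 * (2 ^ j * t)" using ak(2) i(1) by (simp add: t_def T_def)
        then have "(2 ^ i * T) / T \<le> (2 * (2 ^ j * t)) / T" using T by (intro divide_right_mono) auto
        then show "2 ^ i \<le> 2 * 2 ^ j * s" using T by (simp add: s_def)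
      qed
      have "u powr \<gamma> * t powr (-\<delta>) = u powr 4 * (u powr (\<gamma> - 4) * s powr (-\<delta>)) * T powr (-\<delta>)"
      proof -
        have "u powr \<gamma> = u powr 4 * u powr (\<gamma> - 4)" using powr_add[of u 4 "\<gamma> - 4"] by (simp del: powr_numeral)
        then show ?thesis by (simp only: ts mult_ac)
      qed
      also have "\<dots> \<le> (81 * (?g j m (Re z) * ?g j n (Im z))) * (2 * \<beta> ^ nat \<bar>int j - int i\<bar>) * T powr (-\<delta>)"
        using \<beta> by (intro mult_mono u4 order_trans[OF _ lev] ug) (auto intro!: mult_nonneg_nonneg)
      also have "\<dots> = 81 * 2 * T powr (-\<delta>) * (\<beta> ^ nat \<bar>int j - int i\<bar> * (?g j m (Re z) * ?g j n (Im z)))"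
        by (simp only: mult_ac)
      finally show ?thesis by (simp only: u_def t_def X_def)
    qed
    define JJ where "JJ = fst ` J"
    define MM where "MM = (fst \<circ> snd) ` J"
    define NN where "NN = (snd \<circ> snd) ` J"
    have fin: "finite JJ" "finite MM" "finite NN" using J by (auto simp: JJ_def MM_def NN_def)
    have sub: "J \<subseteq> JJ \<times> MM \<times> NN" by (force simp: JJ_def MM_def NN_def)
    have "(\<Sum>k\<in>J. ((1 - cmod (a k)) / cmod (1 - cnj (a k) * z)) powr \<gamma> * (1 - cmod (a k)) powr (-\<delta>))
       \<le> (\<Sum>k\<in>J. 81 * 2 * T powr (-\<delta>) * (case k of (j, m, n) \<Rightarrow> \<beta> ^ nat \<bar>int j - int i\<bar> * (?g j m (Re z) * ?g j n (Im z))))"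
      using each by (intro sum_mono) (auto split: prod.split)
    \<comment> \<open>Enlarging the index set to a product lets the sum factor into one over levels
      and two over the grid.\<close>
    also have "\<dots> \<le> (\<Sum>k\<in>JJ \<times> MM \<times> NN. 81 * 2 * T powr (-\<delta>) * (case k of (j, m, n) \<Rightarrow> \<beta> ^ nat \<bar>int j - int i\<bar> * (?g j m (Re z) * ?g j n (Im z))))"
      using sub fin \<beta> by (intro sum_mono2) (auto split: prod.split)
    also have "\<dots> = 81 * 2 * T powr (-\<delta>) * (\<Sum>j\<in>JJ. \<Sum>m\<in>MM. \<Sum>n\<in>NN. \<beta> ^ nat \<bar>int j - int i\<bar> * (?g j m (Re z) * ?g j n (Im z)))"
      by (simp add: sum_distrib_left[symmetric] sum.cartesian_product[symmetric] del: split_paired_All)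
    also have "(\<Sum>j\<in>JJ. \<Sum>m\<in>MM. \<Sum>n\<in>NN. \<beta> ^ nat \<bar>int j - int i\<bar> * (?g j m (Re z) * ?g j n (Im z)))
      = (\<Sum>j\<in>JJ. \<beta> ^ nat \<bar>int j - int i\<bar> * ((\<Sum>m\<in>MM. ?g j m (Re z)) * (\<Sum>n\<in>NN. ?g j n (Im z))))"
      by (simp only: sum_product) (simp only: sum_distrib_left)
    also have "\<dots> \<le> (\<Sum>j\<in>JJ. \<beta> ^ nat \<bar>int j - int i\<bar> * (G * G))"
      using \<beta> G(1) fin by (intro sum_mono mult_left_mono mult_mono G(2)) (auto intro!: sum_nonneg)
    also have "\<dots> = (\<Sum>j\<in>JJ. \<beta> ^ nat \<bar>int j - int i\<bar>) * (G * G)" by (rule sum_distrib_right[symmetric])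
    also have "(\<Sum>j\<in>JJ. \<beta> ^ nat \<bar>int j - int i\<bar>) = (\<Sum>j\<in>int ` JJ. \<beta> ^ nat \<bar>j - int i\<bar>)"
      by (simp add: sum.reindex)
    also have "\<dots> \<le> 2 * (\<Sum>n. \<beta> ^ n)"
      using fin \<beta> by (intro sum_int_dist_le) (auto intro!: summable_geometric)
    also have "(\<Sum>n. \<beta> ^ n) = 1 / (1 - \<beta>)" using \<beta> by (intro suminf_geometric) auto
    finally show ?thesis using G(1) T by (simp add: C_def T_def mult_ac mult_left_mono)
  qed
  ultimately show ?thesis using that by blast
qed

abbreviation kernel_sum :: "nat \<Rightarrow> 'k set \<Rightarrow> ('k \<Rightarrow> real) \<Rightarrow> ('k \<Rightarrow> complex) \<Rightarrow> complex \<Rightarrow> real" where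
  "kernel_sum m J b a z \<equiv> \<Sum>k\<in>J. b k * ((1 - cmod (a k)) / cmod (1 - cnj (a k) * z)) ^ m"

context doubling_profile
begin

text \<open>For p <= 1 the power of a sum is at most the sum of the powers. For p > 1 Jensen's
  inequality is used with weights whose total is bounded by the Schur-type sum; the factor (1 - cmod
  z) powr (-(\<delta> * (p - 1))) that this leaves is tolerated by the weight. The estimate is given
  for all large m, so that the exponent of the kernels can still be raised.\<close>

lemma synthesis_le:
  assumes p: "0 < p"
  obtains m0 where "\<And>m. m0 \<le> m \<Longrightarrow> \<exists>C>0. \<forall>J a b. finite J \<longrightarrow> (\<forall>k\<in>J. a k \<in> whitney_box k \<and> 0 \<le> b k) \<longrightarrow>
      (\<integral>\<^sup>+z\<in>ball 0 1. ennreal (kernel_sum m J b a z powr p) * W (cmod z) \<partial>lborel)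
        \<le> ennreal (C * (\<Sum>k\<in>J. b k powr p * ((1 - cmod (a k)) * h (cmod (a k)))))"
proof -
  define u where "u a z = (1 - cmod a) / cmod (1 - cnj a * z)" for a z
  have um: "(\<lambda>z. u a z) \<in> borel_measurable borel" for a unfolding u_def by measurable
  have upos: "0 < u a z" if "cmod a < 1" "cmod z < 1" for a z
    using norm_1_minus_cnj_mult(1)[OF that] that by (auto simp: u_def intro!: divide_pos_pos)
  obtain g0 :: nat where g0: "4 * C1 < 2 ^ g0" using real_arch_pow[of 2] by auto
  have g0': "4 * C1 \<le> 2 powr \<gamma>" if "real g0 \<le> \<gamma>" for \<gamma>
  proof -
    have "4 * C1 \<le> 2 powr real g0" using g0 by (simp add: powr_realpow)
    also have "\<dots> \<le> 2 powr \<gamma>" using that by (intro powr_mono) auto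
    finally show ?thesis .
  qed
  show ?thesis
  proof (cases "p \<le> 1")
    case True
    show ?thesis
    proof (rule that[of "nat \<lceil>real g0 / p\<rceil>"])
      fix m :: nat assume m: "nat \<lceil>real g0 / p\<rceil> \<le> m"
      have "real g0 / p \<le> real m" using m by linarith
      then have "real g0 \<le> real m * p" using p by (simp add: pos_divide_le_eq)
      then obtain C where C: "0 < C" "\<And>a. cmod a < 1 \<Longrightarrow>
        (\<integral>\<^sup>+z\<in>ball 0 1. ennreal (u a z powr (real m * p) * (1 - cmod z) powr (-0)) * W (cmod z) \<partial>lborel)
          \<le> ennreal (C * (1 - cmod a) powr (1 - 0) * h (cmod a))"
        using test_function_weight_le[of 0 "real m * p"] KC2 g0' unfolding u_def by auto
      show "\<exists>C>0. \<forall>J a b. finite J \<longrightarrow> (\<forall>k\<in>J. a k \<in> whitney_box k \<and> 0 \<le> b k) \<longrightarrow>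
        (\<integral>\<^sup>+z\<in>ball 0 1. ennreal (kernel_sum m J b a z powr p) * W (cmod z) \<partial>lborel)
        \<le> ennreal (C * (\<Sum>k\<in>J. b k powr p * ((1 - cmod (a k)) * h (cmod (a k)))))"
      proof (intro exI[of _ C] conjI allI impI C(1))
        fix J :: "(nat \<times> int \<times> int) set" and a :: "nat \<times> int \<times> int \<Rightarrow> complex" and b :: "nat \<times> int \<times> int \<Rightarrow> real"
        assume J: "finite J" and ab: "\<forall>k\<in>J. a k \<in> whitney_box k \<and> 0 \<le> b k"
        have a1: "cmod (a k) < 1" if "k \<in> J" for k using ab that whitney_box_subset by blast
        have "(\<integral>\<^sup>+z\<in>ball 0 1. ennreal ((\<Sum>k\<in>J. b k * u (a k) z ^ m) powr p) * W (cmod z) \<partial>lborel)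
          \<le> (\<integral>\<^sup>+z. (\<Sum>k\<in>J. ennreal (b k powr p) * (ennreal (u (a k) z powr (real m * p) * (1 - cmod z) powr (-0)) * W (cmod z) * indicator (ball 0 1) z)) \<partial>lborel)"
        proof (intro nn_integral_mono)
          fix z :: complex
          show "ennreal ((\<Sum>k\<in>J. b k * u (a k) z ^ m) powr p) * W (cmod z) * indicator (ball 0 1) z
            \<le> (\<Sum>k\<in>J. ennreal (b k powr p) * (ennreal (u (a k) z powr (real m * p) * (1 - cmod z) powr (-0)) * W (cmod z) * indicator (ball 0 1) z))"
          proof (cases "cmod z < 1")
            case z: True
            have "(\<Sum>k\<in>J. b k * u (a k) z ^ m) powr p \<le> (\<Sum>k\<in>J. (b k * u (a k) z ^ m) powr p)"
              using ab p True J by (intro sum_powr_le) (auto intro!: mult_nonneg_nonneg zero_le_power less_imp_le[OF upos[OF a1 z]])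
            also have "\<dots> = (\<Sum>k\<in>J. b k powr p * u (a k) z powr (real m * p))"
              using ab upos[OF a1 z] by (intro sum.cong) (auto simp: powr_mult powr_realpow[symmetric] powr_powr)
            finally have "ennreal ((\<Sum>k\<in>J. b k * u (a k) z ^ m) powr p) \<le> (\<Sum>k\<in>J. ennreal (b k powr p * u (a k) z powr (real m * p)))"
              by (subst sum_ennreal) (auto intro: ennreal_leI)
            then have "ennreal ((\<Sum>k\<in>J. b k * u (a k) z ^ m) powr p) * W (cmod z)
              \<le> (\<Sum>k\<in>J. ennreal (b k powr p * u (a k) z powr (real m * p))) * W (cmod z)" by (rule mult_right_mono) simp
            then show ?thesis using z by (simp add: sum_distrib_right ennreal_mult mult.assoc)
          qed simp
        qed
        also have "\<dots> = (\<Sum>k\<in>J. ennreal (b k powr p) * (\<integral>\<^sup>+z\<in>ball 0 1. ennreal (u (a k) z powr (real m * p) * (1 - cmod z) powr (-0)) * W (cmod z) \<partial>lborel))"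
          using um by (subst nn_integral_sum) (auto simp: nn_integral_cmult)
        also have "\<dots> \<le> (\<Sum>k\<in>J. ennreal (b k powr p) * ennreal (C * (1 - cmod (a k)) powr (1 - 0) * h (cmod (a k))))"
          using a1 by (intro sum_mono mult_left_mono C(2)) auto
        also have "\<dots> = (\<Sum>k\<in>J. ennreal (C * (b k powr p * ((1 - cmod (a k)) * h (cmod (a k))))))"
        proof (intro sum.cong refl)
          fix k assume k: "k \<in> J"
          show "ennreal (b k powr p) * ennreal (C * (1 - cmod (a k)) powr (1 - 0) * h (cmod (a k)))
             = ennreal (C * (b k powr p * ((1 - cmod (a k)) * h (cmod (a k)))))"
            using a1[OF k] by (subst ennreal_mult'[symmetric]) (auto simp: mult_ac)
        qed
        also have "\<dots> = ennreal (C * (\<Sum>k\<in>J. b k powr p * ((1 - cmod (a k)) * h (cmod (a k)))))"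
        proof -
          have nn: "0 \<le> C * (b k powr p * ((1 - cmod (a k)) * h (cmod (a k))))" if "k \<in> J" for k
            using a1[OF that] C h_pos[of "cmod (a k)"] by simp
          then show ?thesis by (subst sum_ennreal) (simp_all only: sum_distrib_left)
        qed
        finally show "(\<integral>\<^sup>+z\<in>ball 0 1. ennreal (kernel_sum m J b a z powr p) * W (cmod z) \<partial>lborel)
          \<le> ennreal (C * (\<Sum>k\<in>J. b k powr p * ((1 - cmod (a k)) * h (cmod (a k)))))"
          unfolding u_def .
      qed
    qed
  next
    case False
    then have p1: "1 < p" by simp
    \<comment> \<open>As C2 > 1, condition (2) leaves a whole interval of admissible exponents;
      \<delta> is taken so small that \<delta> * (p - 1) lies in it.\<close>
    have "((\<lambda>d. K powr d) \<longlongrightarrow> K powr 0) (at_right 0)"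
      using KC2 by (intro tendsto_intros) auto
    then have "\<forall>\<^sub>F d in at_right 0. K powr d < C2"
      using KC2 by (intro order_tendstoD) auto
    then obtain d0 where d0: "0 < d0" "\<And>d. 0 < d \<Longrightarrow> d < d0 \<Longrightarrow> K powr d < C2"
      unfolding eventually_at_right_field by auto
    define \<delta> where "\<delta> = min 1 (d0 / (2 * p))"
    have \<delta>: "0 < \<delta>" "\<delta> \<le> 1" using d0 p by (auto simp: \<delta>_def)
    have "\<delta> * (p - 1) \<le> d0 / (2 * p) * p" using p1 d0 by (intro mult_mono) (auto simp: \<delta>_def)
    then have \<delta>p: "0 < \<delta> * (p - 1)" "\<delta> * (p - 1) < d0" using \<delta> p1 d0 by auto
    obtain CG where CG: "0 < CG" "\<And>J a z. finite J \<Longrightarrow> (\<And>k. k \<in> J \<Longrightarrow> a k \<in> whitney_box k) \<Longrightarrow> cmod z < 1 \<Longrightarrow>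
      (\<Sum>k\<in>J. ((1 - cmod (a k)) / cmod (1 - cnj (a k) * z)) powr 6 * (1 - cmod (a k)) powr (-\<delta>))
        \<le> CG * (1 - cmod z) powr (-\<delta>)"
      by (rule sum_whitney_kernel_le[OF \<delta>, of 6], use \<delta> in simp, blast)
    show ?thesis
    proof (rule that[of "6 + g0"])
      fix m :: nat assume m: "6 + g0 \<le> m"
      \<comment> \<open>The exponent that remains on each kernel: 6 from the weight
        \<open>l k\<close>, and p times the m - 6 powers put into \<open>y k\<close>.\<close>
      define \<gamma> where "\<gamma> = 6 + p * (real m - 6)"
      have "1 * real g0 \<le> p * (real m - 6)" using m p1 by (intro mult_mono) auto
      then have "real g0 \<le> \<gamma>" by (simp add: \<gamma>_def)
      then obtain CT where CT: "0 < CT" "\<And>a. cmod a < 1 \<Longrightarrow>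
        (\<integral>\<^sup>+z\<in>ball 0 1. ennreal (u a z powr \<gamma> * (1 - cmod z) powr (-(\<delta> * (p - 1)))) * W (cmod z) \<partial>lborel)
          \<le> ennreal (CT * (1 - cmod a) powr (1 - \<delta> * (p - 1)) * h (cmod a))"
        using test_function_weight_le[of "\<delta> * (p - 1)" \<gamma>] d0(2)[OF \<delta>p] \<delta>p g0' unfolding u_def by auto
      define C where "C = CG powr (p - 1) * CT"
      have C: "0 < C" using CG CT by (simp add: C_def)
      show "\<exists>C>0. \<forall>J a b. finite J \<longrightarrow> (\<forall>k\<in>J. a k \<in> whitney_box k \<and> 0 \<le> b k) \<longrightarrow>
        (\<integral>\<^sup>+z\<in>ball 0 1. ennreal (kernel_sum m J b a z powr p) * W (cmod z) \<partial>lborel)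
        \<le> ennreal (C * (\<Sum>k\<in>J. b k powr p * ((1 - cmod (a k)) * h (cmod (a k)))))"
      proof (intro exI[of _ C] conjI allI impI C)
        fix J :: "(nat \<times> int \<times> int) set" and a :: "nat \<times> int \<times> int \<Rightarrow> complex" and b :: "nat \<times> int \<times> int \<Rightarrow> real"
        assume J: "finite J" and ab: "\<forall>k\<in>J. a k \<in> whitney_box k \<and> 0 \<le> b k"
        have a1: "cmod (a k) < 1" if "k \<in> J" for k using ab that whitney_box_subset by blast
        let ?t = "\<lambda>k. 1 - cmod (a k)"
        let ?e = "\<lambda>k. CG powr (p - 1) * (b k powr p * ?t k powr (\<delta> * (p - 1)))"
        have "(\<integral>\<^sup>+z\<in>ball 0 1. ennreal ((\<Sum>k\<in>J. b k * u (a k) z ^ m) powr p) * W (cmod z) \<partial>lborel)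
          \<le> (\<integral>\<^sup>+z. (\<Sum>k\<in>J. ennreal (?e k) * (ennreal (u (a k) z powr \<gamma> * (1 - cmod z) powr (-(\<delta> * (p - 1)))) * W (cmod z) * indicator (ball 0 1) z)) \<partial>lborel)"
        proof (intro nn_integral_mono)
          fix z :: complex
          show "ennreal ((\<Sum>k\<in>J. b k * u (a k) z ^ m) powr p) * W (cmod z) * indicator (ball 0 1) z
            \<le> (\<Sum>k\<in>J. ennreal (?e k) * (ennreal (u (a k) z powr \<gamma> * (1 - cmod z) powr (-(\<delta> * (p - 1)))) * W (cmod z) * indicator (ball 0 1) z))"
          proof (cases "cmod z < 1")
            case z: True
            have up: "0 < u (a k) z" if "k \<in> J" for k using upos[OF a1[OF that] z] .
            \<comment> \<open>The factor with exponent -\<delta> makes the sum of the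
              \<open>l k\<close> controllable; \<open>y k\<close> compensates it and takes the
              remaining powers of the kernel.\<close>
            define l where "l k = u (a k) z powr 6 * ?t k powr (-\<delta>)" for k
            define y where "y k = b k * u (a k) z powr (real m - 6) * ?t k powr \<delta>" for k
            have ly: "b k * u (a k) z ^ m = l k * y k" if "k \<in> J" for k
            proof -
              have "l k * y k = b k * (u (a k) z powr 6 * u (a k) z powr (real m - 6)) * (?t k powr (-\<delta>) * ?t k powr \<delta>)"
                by (simp only: l_def y_def mult_ac)
              also have "u (a k) z powr 6 * u (a k) z powr (real m - 6) = u (a k) z ^ m"
                using up[OF that] powr_add[of "u (a k) z" 6 "real m - 6"] by (simp add: powr_realpow del: powr_numeral)
              also have "?t k powr (-\<delta>) * ?t k powr \<delta> = 1" using a1[OF that] by (simp add: powr_add[symmetric])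
              finally show ?thesis by simp
            qed
            have lyp: "l k * y k powr p = b k powr p * ?t k powr (\<delta> * (p - 1)) * u (a k) z powr \<gamma>" if "k \<in> J" for k
            proof -
              have tp: "0 < ?t k" using a1[OF that] by simp
              have bk: "0 \<le> b k" using ab that by auto
              have "y k powr p = b k powr p * u (a k) z powr ((real m - 6) * p) * ?t k powr (\<delta> * p)"
                using bk up[OF that] tp by (simp add: y_def powr_mult powr_powr)
              then have "l k * y k powr p = b k powr p * (?t k powr (-\<delta>) * ?t k powr (\<delta> * p)) * (u (a k) z powr 6 * u (a k) z powr ((real m - 6) * p))"
                by (simp only: l_def mult_ac)
              also have "?t k powr (-\<delta>) * ?t k powr (\<delta> * p) = ?t k powr (\<delta> * (p - 1))"
                by (simp add: powr_add[symmetric] algebra_simps)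
              also have "u (a k) z powr 6 * u (a k) z powr ((real m - 6) * p) = u (a k) z powr \<gamma>"
                by (simp add: powr_add[symmetric] \<gamma>_def mult.commute del: powr_numeral)
              finally show ?thesis .
            qed
            have "(\<Sum>k\<in>J. b k * u (a k) z ^ m) powr p = (\<Sum>k\<in>J. l k * y k) powr p" using ly by simp
            also have "\<dots> \<le> (\<Sum>k\<in>J. l k) powr (p - 1) * (\<Sum>k\<in>J. l k * y k powr p)"
            proof (rule weighted_sum_powr_le[OF J])
              show "0 < l k" if "k \<in> J" for k using up[OF that] a1[OF that] by (simp add: l_def)
              show "0 \<le> y k" if "k \<in> J" for k using up[OF that] ab that by (simp add: y_def)
            qed (use p1 in simp)
            also have "\<dots> \<le> (CG * (1 - cmod z) powr (-\<delta>)) powr (p - 1) * (\<Sum>k\<in>J. l k * y k powr p)"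
            proof (intro mult_right_mono powr_mono2)
              show "(\<Sum>k\<in>J. l k) \<le> CG * (1 - cmod z) powr (-\<delta>)"
                unfolding l_def u_def using ab z J by (intro CG(2)) auto
            qed (use p1 ab in \<open>auto simp: l_def intro!: sum_nonneg mult_nonneg_nonneg\<close>)
            also have "(CG * (1 - cmod z) powr (-\<delta>)) powr (p - 1) = CG powr (p - 1) * (1 - cmod z) powr (-(\<delta> * (p - 1)))"
              using CG(1) z by (simp add: powr_mult powr_powr)
            also have "CG powr (p - 1) * (1 - cmod z) powr (-(\<delta> * (p - 1))) * (\<Sum>k\<in>J. l k * y k powr p)
               = (\<Sum>k\<in>J. ?e k * (u (a k) z powr \<gamma> * (1 - cmod z) powr (-(\<delta> * (p - 1)))))"
              unfolding sum_distrib_left by (intro sum.cong refl) (simp only: lyp mult_ac)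
            finally have "ennreal ((\<Sum>k\<in>J. b k * u (a k) z ^ m) powr p)
              \<le> (\<Sum>k\<in>J. ennreal (?e k * (u (a k) z powr \<gamma> * (1 - cmod z) powr (-(\<delta> * (p - 1))))))"
              by (subst sum_ennreal) (auto intro: ennreal_leI)
            from mult_right_mono[OF this, of "W (cmod z)"] have "ennreal ((\<Sum>k\<in>J. b k * u (a k) z ^ m) powr p) * W (cmod z)
              \<le> (\<Sum>k\<in>J. ennreal (?e k * (u (a k) z powr \<gamma> * (1 - cmod z) powr (-(\<delta> * (p - 1)))))) * W (cmod z)"
              by simp
            also have "\<dots> = (\<Sum>k\<in>J. ennreal (?e k) * (ennreal (u (a k) z powr \<gamma> * (1 - cmod z) powr (-(\<delta> * (p - 1)))) * W (cmod z)))"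
              unfolding sum_distrib_right by (intro sum.cong refl) (subst ennreal_mult, auto simp: mult.assoc)
            finally have le: "ennreal ((\<Sum>k\<in>J. b k * u (a k) z ^ m) powr p) * W (cmod z) \<le>
              (\<Sum>k\<in>J. ennreal (?e k) * (ennreal (u (a k) z powr \<gamma> * (1 - cmod z) powr (-(\<delta> * (p - 1)))) * W (cmod z)))" .
            have ind: "indicator (ball 0 1) z = (1 :: ennreal)" using z by simp
            show ?thesis unfolding ind mult_1_right by (rule le)
          qed simp
        qed
        also have "\<dots> = (\<Sum>k\<in>J. ennreal (?e k) * (\<integral>\<^sup>+z\<in>ball 0 1. ennreal (u (a k) z powr \<gamma> * (1 - cmod z) powr (-(\<delta> * (p - 1)))) * W (cmod z) \<partial>lborel))"
          using um by (subst nn_integral_sum) (auto simp: nn_integral_cmult)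
        also have "\<dots> \<le> (\<Sum>k\<in>J. ennreal (?e k) * ennreal (CT * ?t k powr (1 - \<delta> * (p - 1)) * h (cmod (a k))))"
          using a1 by (intro sum_mono mult_left_mono CT(2)) auto
        also have "\<dots> = (\<Sum>k\<in>J. ennreal (C * (b k powr p * (?t k * h (cmod (a k))))))"
        proof (intro sum.cong refl)
          fix k assume k: "k \<in> J"
          have "?t k powr (\<delta> * (p - 1)) * ?t k powr (1 - \<delta> * (p - 1)) = ?t k"
            using a1[OF k] by (simp add: powr_add[symmetric])
          moreover have "?e k * (CT * ?t k powr (1 - \<delta> * (p - 1)) * h (cmod (a k)))
             = C * (b k powr p * ((?t k powr (\<delta> * (p - 1)) * ?t k powr (1 - \<delta> * (p - 1))) * h (cmod (a k))))"
            by (simp only: C_def mult_ac)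
          ultimately have eq: "?e k * (CT * ?t k powr (1 - \<delta> * (p - 1)) * h (cmod (a k))) = C * (b k powr p * (?t k * h (cmod (a k))))"
            by (simp only:)
          have "ennreal (?e k) * ennreal (CT * ?t k powr (1 - \<delta> * (p - 1)) * h (cmod (a k)))
            = ennreal (?e k * (CT * ?t k powr (1 - \<delta> * (p - 1)) * h (cmod (a k))))"
            by (rule ennreal_mult'[symmetric]) simp
          then show "ennreal (?e k) * ennreal (CT * ?t k powr (1 - \<delta> * (p - 1)) * h (cmod (a k)))
            = ennreal (C * (b k powr p * (?t k * h (cmod (a k)))))"
            by (simp only: eq)
        qed
        also have "\<dots> = ennreal (C * (\<Sum>k\<in>J. b k powr p * (?t k * h (cmod (a k)))))"
        proof -
          have nn: "0 \<le> C * (b k powr p * (?t k * h (cmod (a k))))" if "k \<in> J" for k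
            using a1[OF that] C h_pos[of "cmod (a k)"] by simp
          then show ?thesis by (subst sum_ennreal) (simp_all only: sum_distrib_left)
        qed
        finally show "(\<integral>\<^sup>+z\<in>ball 0 1. ennreal (kernel_sum m J b a z powr p) * W (cmod z) \<partial>lborel)
          \<le> ennreal (C * (\<Sum>k\<in>J. b k powr p * ((1 - cmod (a k)) * h (cmod (a k)))))"
          unfolding u_def .
      qed
    qed
  qed
qed

end

subsection \<open>Random signs\<close>

text \<open>Averaging over signs: flipping the sign of a single term already shows that the average
  is at least half of that term, so no Khinchine inequality is needed.\<close>

lemma sign_average_ge:
  fixes d :: "'k \<Rightarrow> complex"
  assumes J: "finite J" and k: "k \<in> J" and q: "0 < q"
  shows "2 ^ card J * cmod (d k) powr q \<le> 2 * (\<Sum>S\<in>Pow J. cmod (\<Sum>j\<in>J. if j \<in> S then d j else - d j) powr q)"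
proof -
  define D where "D S = (\<Sum>j\<in>J. if j \<in> S then d j else - d j)" for S
  \<comment> \<open>Toggling k is an involution of the subsets, and the two signed sums of a pair
    differ by 2 * d k up to sign; hence one of them is at least d k in modulus.\<close>
  define fl where "fl S = (if k \<in> S then S - {k} else insert k S)" for S
  have flip: "(\<Sum>S\<in>Pow J. cmod (D (fl S)) powr q) = (\<Sum>S\<in>Pow J. cmod (D S) powr q)"
    by (rule sum.reindex_bij_witness[of _ fl fl]) (use k in \<open>auto simp: fl_def split: if_splits\<close>)
  have ge: "cmod (d k) powr q \<le> cmod (D S) powr q + cmod (D (fl S)) powr q" for S
  proof -
    have split: "D S = (if k \<in> S then d k else - d k) + (\<Sum>j\<in>J - {k}. if j \<in> S then d j else - d j)" for S
      unfolding D_def using J k by (rule sum.remove)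
    have rest: "(\<Sum>j\<in>J - {k}. if j \<in> fl S then d j else - d j) = (\<Sum>j\<in>J - {k}. if j \<in> S then d j else - d j)"
      by (intro sum.cong) (auto simp: fl_def)
    have "D S - D (fl S) = (if k \<in> S then 2 * d k else - (2 * d k))"
      unfolding split[of S] split[of "fl S"] rest by (auto simp: fl_def)
    then have "2 * cmod (d k) = cmod (D S - D (fl S))" by (auto simp: norm_mult split: if_splits)
    also have "\<dots> \<le> cmod (D S) + cmod (D (fl S))" by (rule norm_triangle_ineq4)
    finally have "cmod (d k) \<le> cmod (D S) \<or> cmod (d k) \<le> cmod (D (fl S))" by linarith
    then have "cmod (d k) powr q \<le> cmod (D S) powr q \<or> cmod (d k) powr q \<le> cmod (D (fl S)) powr q"
      using q by (auto intro: powr_mono2)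
    then show ?thesis by (auto intro: add_increasing add_increasing2)
  qed
  have "2 ^ card J * cmod (d k) powr q = (\<Sum>S\<in>Pow J. cmod (d k) powr q)"
    using J by (simp add: card_Pow)
  also have "\<dots> \<le> (\<Sum>S\<in>Pow J. cmod (D S) powr q + cmod (D (fl S)) powr q)"
    by (intro sum_mono ge)
  also have "\<dots> = 2 * (\<Sum>S\<in>Pow J. cmod (D S) powr q)" by (simp add: sum.distrib flip)
  finally show ?thesis by (simp add: D_def)
qed

text \<open>Absorption of a sublinear power. Dividing by it is legitimate because Y is a finite
  number, which is the reason for working with finite families of boxes.\<close>

lemma le_powr_imp_le:
  fixes Y D \<theta> :: real
  assumes "0 \<le> Y" "0 \<le> D" "\<theta> < 1" "Y \<le> D * Y powr \<theta>"
  shows "Y \<le> D powr (1 / (1 - \<theta>))"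
proof (cases "Y = 0")
  case False
  then have Y: "0 < Y" using assms by simp
  have "Y powr (1 - \<theta>) = Y / Y powr \<theta>" using Y by (simp add: powr_diff)
  also have "\<dots> \<le> D" using assms(4) Y by (simp add: pos_divide_le_eq)
  finally have "(Y powr (1 - \<theta>)) powr (1 / (1 - \<theta>)) \<le> D powr (1 / (1 - \<theta>))"
    using assms by (intro powr_mono2) auto
  then show ?thesis using Y assms by (simp add: powr_powr)
qed simp

context doubling_profile
begin

text \<open>Up to constants, this is the weight of the Carleson square at \<open>z\<close>.\<close>

definition mass :: "complex \<Rightarrow> real" where
  "mass z = (1 - cmod z) * h (cmod z)"

text \<open>Taken without the factor 1 / pi of the normalised area and with extended values; the
  factor reappears where the norm of the Bergman space is expressed by it.\<close>

definition bergman_int :: "real \<Rightarrow> (complex \<Rightarrow> complex) \<Rightarrow> ennreal" where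
  "bergman_int p f = (\<integral>\<^sup>+z\<in>ball 0 1. ennreal (cmod (f z) powr p) * W (cmod z) \<partial>lborel)"

lemma mass_pos: "cmod z < 1 \<Longrightarrow> 0 < mass z"
  using h_pos[of "cmod z"] by (simp add: mass_def)

text \<open>With y k the mass ratio of box k, the test functions are signed sums of the kernels ((1
  - |a k|) / (1 - cnj (a k) * z)) ^ m with coefficients y k powr (1 / (p - q)). Averaged over signs,
  the derivative keeps on box k at least its k-th term up to a constant, and this bounds the sum Y
  in question by a multiple of Y powr (q / p). Boxes of level 0 are left out because the n-th
  derivative carries the factor cnj (a k) ^ n, which may degenerate near the origin.\<close>

lemma box_mass_sum_le_outer:
  fixes \<nu> :: "complex measure"
  assumes q: "0 < q" "q < p" and s: "sets \<nu> = sets borel" and fin: "finite_measure \<nu>" and B: "0 \<le> B"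
    and bd: "\<And>f. f holomorphic_on ball 0 1 \<Longrightarrow> bergman_int p f < \<infinity> \<Longrightarrow>
      deriv_int_on (ball 0 1) n q \<nu> f \<le> ennreal (B * enn2real (bergman_int p f) powr (q / p))"
  obtains C where "\<And>J a. finite J \<Longrightarrow> (\<And>k. k \<in> J \<Longrightarrow> a k \<in> whitney_box k \<and> 1 \<le> fst k) \<Longrightarrow>
    (\<Sum>k\<in>J. (measure \<nu> (whitney_box k) / (mass (a k) * (1 - cmod (a k)) powr (real n * q))) powr (p / (p - q)) * mass (a k)) \<le> C"
proof -
  interpret N: finite_measure \<nu> by (rule fin)
  have p: "0 < p" using q by simp
  obtain m0 where m0: "\<And>m. m0 \<le> m \<Longrightarrow> \<exists>C>0. \<forall>J a b. finite J \<longrightarrow> (\<forall>k\<in>J. a k \<in> whitney_box k \<and> 0 \<le> b k) \<longrightarrow>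
      (\<integral>\<^sup>+z\<in>ball 0 1. ennreal (kernel_sum m J b a z powr p) * W (cmod z) \<partial>lborel)
        \<le> ennreal (C * (\<Sum>k\<in>J. b k powr p * ((1 - cmod (a k)) * h (cmod (a k)))))"
    using synthesis_le[OF p] by blast
  \<comment> \<open>Positive, so that the Pochhammer factor of the n-th derivative is at least
    1.\<close>
  define m where "m = Suc m0"
  have "m0 \<le> m" by (simp add: m_def)
  from m0[OF this] obtain CS where CS1: "0 < CS" and
    "\<forall>J a b. finite J \<longrightarrow> (\<forall>k\<in>J. a k \<in> whitney_box k \<and> 0 \<le> b k) \<longrightarrow>
      (\<integral>\<^sup>+z\<in>ball 0 1. ennreal (kernel_sum m J b a z powr p) * W (cmod z) \<partial>lborel)
        \<le> ennreal (CS * (\<Sum>k\<in>J. b k powr p * ((1 - cmod (a k)) * h (cmod (a k)))))"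
    by blast
  then have CS: "0 < CS" "\<And>J a b. finite J \<Longrightarrow> (\<And>k. k \<in> J \<Longrightarrow> a k \<in> whitney_box k \<and> 0 \<le> b k) \<Longrightarrow>
      (\<integral>\<^sup>+z\<in>ball 0 1. ennreal (kernel_sum m J b a z powr p) * W (cmod z) \<partial>lborel)
        \<le> ennreal (CS * (\<Sum>k\<in>J. b k powr p * mass (a k)))"
    unfolding mass_def by blast+
  \<comment> \<open>Lower bound for the n-th derivative of a kernel on its own box: |a k| >= 1 / 2
    accounts for the power of 1 / 2, and |1 - cnj (a k) * z| <= 6 * t k for the power of 6.\<close>
  define \<kappa> where "\<kappa> = (1 / 2 :: real) ^ n / 6 ^ (m + n)"
  have \<kappa>: "0 < \<kappa>" by (simp add: \<kappa>_def)
  define D where "D = 2 * B * CS powr (q / p) / \<kappa> powr q"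
  have D: "0 \<le> D" using B by (simp add: D_def)
  have "(\<Sum>k\<in>J. (measure \<nu> (whitney_box k) / (mass (a k) * (1 - cmod (a k)) powr (real n * q))) powr (p / (p - q)) * mass (a k))
      \<le> D powr (1 / (1 - q / p))"
    if J: "finite J" and aJ: "\<And>k. k \<in> J \<Longrightarrow> a k \<in> whitney_box k \<and> 1 \<le> fst k"
    for J :: "(nat \<times> int \<times> int) set" and a :: "nat \<times> int \<times> int \<Rightarrow> complex"
  proof -
    define t where "t k = 1 - cmod (a k)" for k
    have a1: "cmod (a k) < 1" if "k \<in> J" for k using aJ[OF that] whitney_box_subset by blast
    have t: "0 < t k" if "k \<in> J" for k using a1[OF that] by (simp add: t_def)
    have a2: "1 / 2 \<le> cmod (a k)" if k: "k \<in> J" for k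
    proof -
      obtain j l i where kj: "k = (j, l, i)" by (metis prod_cases3)
      have "2 ^ j * (1 - cmod (a k)) \<le> 1" "1 \<le> j" using aJ[OF k] by (auto simp: kj)
      moreover have "(2::real) ^ 1 \<le> 2 ^ j" using \<open>1 \<le> j\<close> by (intro power_increasing) auto
      then have "2 ^ 1 * (1 - cmod (a k)) \<le> 2 ^ j * (1 - cmod (a k))" using a1[OF k] by (intro mult_right_mono) auto
      ultimately show ?thesis by simp
    qed
    define M where "M k = measure \<nu> (whitney_box k)" for k
    define y where "y k = M k / (mass (a k) * t k powr (real n * q))" for k
    have mp: "0 < mass (a k)" if "k \<in> J" for k using mass_pos[OF a1[OF that]] .
    have y0: "0 \<le> y k" if "k \<in> J" for k using mp[OF that] by (simp add: y_def M_def)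
    \<comment> \<open>Extremal coefficients: b k powr p and b k powr q * y k both equal y k powr (p
      / (p - q)), so the norm of the test function and the lower bound for its derivative involve
      the same sum Y.\<close>
    define b where "b k = y k powr (1 / (p - q))" for k
    have b0: "0 \<le> b k" for k by (simp add: b_def)
    define Y where "Y = (\<Sum>k\<in>J. y k powr (p / (p - q)) * mass (a k))"
    have Y0: "0 \<le> Y" unfolding Y_def using less_imp_le[OF mp] by (intro sum_nonneg mult_nonneg_nonneg) auto
    have bp: "(\<Sum>k\<in>J. b k powr p * mass (a k)) = Y"
      unfolding Y_def b_def by (simp add: powr_powr mult.commute)
    define d where "d k z = of_real (b k * t k ^ m) * (of_nat (pochhammer m n) * cnj (a k) ^ n * inverse (1 - cnj (a k) * z) ^ (m + n))" for k z
    define F where "F S z = (\<Sum>k\<in>J. (if k \<in> S then of_real (b k * t k ^ m) else - of_real (b k * t k ^ m)) * inverse (1 - cnj (a k) * z) ^ m)"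
      for S z
    have hF: "F S holomorphic_on ball 0 1" for S
      unfolding F_def using a1 by (intro holomorphic_sum_inverse_power) (auto intro: less_imp_le)
    have dF: "(deriv ^^ n) (F S) z = (\<Sum>k\<in>J. if k \<in> S then d k z else - d k z)" if z: "cmod z < 1" for S z
    proof -
      have "(deriv ^^ n) (F S) z = (\<Sum>k\<in>J. (if k \<in> S then of_real (b k * t k ^ m) else - of_real (b k * t k ^ m))
          * (of_nat (pochhammer m n) * cnj (a k) ^ n * inverse (1 - cnj (a k) * z) ^ (m + n)))"
        unfolding F_def using a1 z by (intro higher_deriv_sum_inverse_power) (auto intro: less_imp_le)
      also have "\<dots> = (\<Sum>k\<in>J. if k \<in> S then d k z else - d k z)"
        by (intro sum.cong) (auto simp: d_def)
      finally show ?thesis .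
    qed
    have NF: "bergman_int p (F S) \<le> ennreal (CS * Y)" for S
    proof -
      have "bergman_int p (F S) \<le> (\<integral>\<^sup>+z\<in>ball 0 1. ennreal (kernel_sum m J b a z powr p) * W (cmod z) \<partial>lborel)"
        unfolding bergman_int_def
      proof (intro nn_integral_mono mult_right_mono ennreal_leI powr_mono2)
        fix z
        have "cmod (F S z) \<le> (\<Sum>k\<in>J. cmod ((if k \<in> S then of_real (b k * t k ^ m) else - of_real (b k * t k ^ m)) * inverse (1 - cnj (a k) * z) ^ m))"
          unfolding F_def by (rule norm_sum)
        also have "\<dots> = (kernel_sum m J b a z)"
        proof (intro sum.cong refl)
          fix k assume k: "k \<in> J"
          have "cmod (if k \<in> S then of_real (b k * t k ^ m) else - of_real (b k * t k ^ m) :: complex) = b k * t k ^ m"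
            using b0[of k] t[OF k] by (auto simp: norm_mult norm_power)
          then show "cmod ((if k \<in> S then of_real (b k * t k ^ m) else - of_real (b k * t k ^ m)) * inverse (1 - cnj (a k) * z) ^ m)
            = b k * ((1 - cmod (a k)) / cmod (1 - cnj (a k) * z)) ^ m"
            by (simp only: norm_mult) (simp add: norm_power norm_inverse t_def power_divide power_inverse divide_inverse power_mult_distrib)
        qed
        finally show "cmod (F S z) \<le> (kernel_sum m J b a z)" .
      qed (use p in auto)
      also have "\<dots> \<le> ennreal (CS * (\<Sum>k\<in>J. b k powr p * mass (a k)))"
        using aJ b0 by (intro CS(2) J) auto
      finally show ?thesis by (simp only: bp)
    qed
    have dlow: "b k * \<kappa> / t k ^ n \<le> cmod (d k z)" if k: "k \<in> J" and z: "z \<in> whitney_box k" for k z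
    proof -
      let ?X = "cmod (1 - cnj (a k) * z)"
      have X: "?X \<le> 6 * t k" using whitney_box_bounds(3)[of "a k" k z] aJ[OF k] z by (simp add: t_def)
      have X0: "0 < ?X" using norm_1_minus_cnj_mult(1)[OF a1[OF k] whitney_box_subset[OF z]] a1[OF k] by linarith
      have "(1 / (6 * t k)) ^ (m + n) \<le> (1 / ?X) ^ (m + n)"
        using X X0 t[OF k] by (intro power_mono divide_left_mono) auto
      moreover have "(1 / 2) ^ n \<le> cmod (a k) ^ n" using a2[OF k] by (intro power_mono) auto
      moreover have "(1::real) \<le> real (pochhammer m n)"
      proof -
        have "0 < pochhammer m n" by (simp add: m_def pochhammer_pos)
        then show ?thesis by linarith
      qed
      ultimately have "1 * (1 / 2) ^ n * (1 / (6 * t k)) ^ (m + n) \<le> real (pochhammer m n) * cmod (a k) ^ n * (1 / ?X) ^ (m + n)"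
        using t[OF k] by (intro mult_mono) auto
      then have "b k * t k ^ m * (1 * (1 / 2) ^ n * (1 / (6 * t k)) ^ (m + n))
         \<le> b k * t k ^ m * (real (pochhammer m n) * cmod (a k) ^ n * (1 / ?X) ^ (m + n))"
        using b0[of k] t[OF k] by (intro mult_left_mono) auto
      also have "\<dots> = cmod (d k z)"
        using b0[of k] t[OF k] by (simp add: d_def norm_mult norm_power norm_inverse divide_inverse)
      also have "b k * t k ^ m * (1 * (1 / 2) ^ n * (1 / (6 * t k)) ^ (m + n)) = b k * \<kappa> / t k ^ n"
        using t[OF k] by (simp add: \<kappa>_def power_divide power_mult_distrib power_add)
      finally show ?thesis .
    qed
    let ?w = "\<lambda>k. 2 ^ card J * (b k * \<kappa> / t k ^ n) powr q"
    \<comment> \<open>The boxes are disjoint, so at most one term survives on the left, and the sign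
      average is needed for that index only.\<close>
    have pt: "(\<Sum>k\<in>J. ennreal (?w k) * indicator (whitney_box k) z)
       \<le> (\<Sum>S\<in>Pow J. ennreal 2 * (ennreal (cmod ((deriv ^^ n) (F S) z) powr q) * indicator (ball 0 1) z))" for z
    proof (cases "\<exists>k\<in>J. z \<in> whitney_box k")
      case True
      then obtain k where k: "k \<in> J" "z \<in> whitney_box k" by blast
      have z1: "cmod z < 1" using whitney_box_subset[OF k(2)] .
      have ind: "indicator (whitney_box k') z = (0::ennreal)" if "k' \<noteq> k" for k'
        using that whitney_box_disjoint[OF k(2), of k'] by (auto simp: indicator_def)
      have "(\<Sum>k'\<in>J. ennreal (?w k') * indicator (whitney_box k') z) = (\<Sum>k'\<in>J. if k' = k then ennreal (?w k) else 0)"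
        using k(2) ind by (intro sum.cong) auto
      also have "\<dots> = ennreal (?w k)" using J k(1) by simp
      also have "\<dots> \<le> ennreal (2 ^ card J * cmod (d k z) powr q)"
        using dlow[OF k] q b0[of k] \<kappa> t[OF k(1)] by (intro ennreal_leI mult_left_mono powr_mono2) auto
      also have "\<dots> \<le> ennreal (2 * (\<Sum>S\<in>Pow J. cmod (\<Sum>j\<in>J. if j \<in> S then d j z else - d j z) powr q))"
        using sign_average_ge[OF J k(1) q(1), of "\<lambda>j. d j z"] by (rule ennreal_leI)
      also have "\<dots> = ennreal (\<Sum>S\<in>Pow J. 2 * cmod ((deriv ^^ n) (F S) z) powr q)"
        using dF[OF z1] by (simp add: sum_distrib_left)
      also have "\<dots> = (\<Sum>S\<in>Pow J. ennreal 2 * (ennreal (cmod ((deriv ^^ n) (F S) z) powr q) * indicator (ball 0 1) z))"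
        using z1 by (subst sum_ennreal[symmetric]) (auto simp: ennreal_mult)
      finally show ?thesis .
    qed (auto simp: indicator_def)
    have mDF: "(\<lambda>z. ennreal (cmod ((deriv ^^ n) (F S) z) powr q) * indicator (ball 0 1) z) \<in> borel_measurable \<nu>" for S
      using borel_measurable_higher_deriv_powr[OF hF] measurable_cong_sets[OF s refl] by blast
    have mbox: "whitney_box k \<in> sets \<nu>" for k by (simp add: s)
    have "(\<Sum>k\<in>J. ennreal (?w k) * emeasure \<nu> (whitney_box k)) = (\<integral>\<^sup>+z. (\<Sum>k\<in>J. ennreal (?w k) * indicator (whitney_box k) z) \<partial>\<nu>)"
      using mbox by (subst nn_integral_sum) (auto simp: nn_integral_cmult_indicator)
    also have "\<dots> \<le> (\<integral>\<^sup>+z. (\<Sum>S\<in>Pow J. ennreal 2 * (ennreal (cmod ((deriv ^^ n) (F S) z) powr q) * indicator (ball 0 1) z)) \<partial>\<nu>)"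
      by (intro nn_integral_mono pt)
    also have "\<dots> = (\<Sum>S\<in>Pow J. ennreal 2 * deriv_int_on (ball 0 1) n q \<nu> (F S))"
      using mDF by (subst nn_integral_sum) (auto intro!: sum.cong nn_integral_cmult)
    also have "\<dots> \<le> (\<Sum>S\<in>Pow J. ennreal 2 * ennreal (B * (CS * Y) powr (q / p)))"
    proof (intro sum_mono mult_left_mono)
      fix S
      have "bergman_int p (F S) < \<infinity>" using NF[of S] by (simp add: le_less_trans)
      then have "deriv_int_on (ball 0 1) n q \<nu> (F S)
         \<le> ennreal (B * enn2real (bergman_int p (F S)) powr (q / p))" by (intro bd hF)
      also have "\<dots> \<le> ennreal (B * (CS * Y) powr (q / p))"
        using B p q Y0 CS(1) NF[of S] by (intro ennreal_leI mult_left_mono powr_mono2 enn2real_leI) auto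
      finally show "deriv_int_on (ball 0 1) n q \<nu> (F S) \<le> ennreal (B * (CS * Y) powr (q / p))" .
    qed simp
    also have "\<dots> = ennreal (2 ^ card J * (2 * (B * (CS * Y) powr (q / p))))"
      using J B by (simp add: card_Pow ennreal_mult ennreal_power[symmetric])
    finally have "(\<Sum>k\<in>J. ennreal (?w k) * emeasure \<nu> (whitney_box k)) \<le> ennreal (2 ^ card J * (2 * (B * (CS * Y) powr (q / p))))" .
    moreover have "(\<Sum>k\<in>J. ennreal (?w k) * emeasure \<nu> (whitney_box k)) = ennreal (\<Sum>k\<in>J. ?w k * M k)"
      by (subst sum_ennreal[symmetric]) (auto simp: M_def N.emeasure_eq_measure ennreal_mult)
    ultimately have "(\<Sum>k\<in>J. ?w k * M k) \<le> 2 ^ card J * (2 * (B * (CS * Y) powr (q / p)))"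
      using B by (simp add: ennreal_le_iff)
    moreover have "(\<Sum>k\<in>J. ?w k * M k) = 2 ^ card J * (\<kappa> powr q * Y)"
      unfolding Y_def sum_distrib_left
    proof (intro sum.cong refl)
      fix k assume k: "k \<in> J"
      have tk: "0 < t k" using t[OF k] .
      have Mk: "M k = y k * (mass (a k) * t k powr (real n * q))" using mp[OF k] tk by (simp add: y_def)
      have "(b k * \<kappa> / t k ^ n) powr q = b k powr q * \<kappa> powr q / t k powr (real n * q)"
        using b0[of k] \<kappa> tk by (simp add: powr_mult powr_divide powr_realpow[symmetric] powr_powr)
      then have "(b k * \<kappa> / t k ^ n) powr q * M k = \<kappa> powr q * ((b k powr q * y k) * mass (a k))"
        using tk by (simp add: Mk)
      also have "b k powr q * y k = y k powr (p / (p - q))"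
      proof (cases "y k = 0")
        case False
        then have "0 < y k" using y0[OF k] by simp
        then have "b k powr q * y k = y k powr (q / (p - q) + 1)" by (simp add: b_def powr_powr powr_add)
        also have "q / (p - q) + 1 = p / (p - q)" using q by (simp add: field_simps)
        finally show ?thesis .
      qed simp
      finally show "?w k * M k = 2 ^ card J * (\<kappa> powr q * (y k powr (p / (p - q)) * mass (a k)))" by simp
    qed
    ultimately have "\<kappa> powr q * Y \<le> 2 * (B * (CS * Y) powr (q / p))" by simp
    also have "(CS * Y) powr (q / p) = CS powr (q / p) * Y powr (q / p)" using CS(1) Y0 by (simp add: powr_mult)
    finally have "Y \<le> D * Y powr (q / p)" using \<kappa> by (simp add: D_def field_simps)
    then have "Y \<le> D powr (1 / (1 - q / p))" using Y0 D q by (intro le_powr_imp_le) auto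
    then show ?thesis by (simp add: Y_def y_def M_def t_def)
  qed
  then show ?thesis using that by blast
qed

text \<open>Passage from boxes to the integral. The disc about z meets boundedly many boxes, all
  comparable to z in position and size, so the integrand at z is at most the sum over these boxes of
  \<open>g k\<close>, a constant times c k / (t k)^2. Each k contributes on \<open>near k\<close>
  only, a set of area at most a multiple of (t k)^2, and the finite sums of \<open>c k\<close> are
  bounded by the estimate over boxes.\<close>

lemma nn_integral_mass_ratio_finite:
  fixes \<nu> :: "complex measure"
  assumes q: "0 < q" "q < p" and s: "sets \<nu> = sets borel" and fin: "finite_measure \<nu>" and B: "0 \<le> B"
    and bd: "\<And>f. f holomorphic_on ball 0 1 \<Longrightarrow> bergman_int p f < \<infinity> \<Longrightarrow>
      deriv_int_on (ball 0 1) n q \<nu> f \<le> ennreal (B * enn2real (bergman_int p f) powr (q / p))"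
    and r: "0 < r" "r < 1"
  shows "(\<integral>\<^sup>+z\<in>ball 0 1. ennreal ((measure \<nu> (pseudohyperbolic_disc z r) / (mass z * (1 - cmod z) powr (real n * q))) powr (p / (p - q))
     * (h (cmod z) / (1 - cmod z))) \<partial>lborel) < \<infinity>"
proof -
  interpret N: finite_measure \<nu> by (rule fin)
  define \<sigma> where "\<sigma> = p / (p - q)"
  have \<sigma>: "0 < \<sigma>" using q by (simp add: \<sigma>_def)
  define e where "e = real n * q"
  have e: "0 \<le> e" using q by (simp add: e_def)
  define valid where "valid k \<longleftrightarrow> whitney_box k \<noteq> {}" for k
  define a where "a k = (SOME z. z \<in> whitney_box k)" for k
  have ak: "a k \<in> whitney_box k" if "valid k" for k
  proof -
    obtain z where "z \<in> whitney_box k" using \<open>valid k\<close> by (auto simp only: valid_def)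
    then show ?thesis unfolding a_def by (rule someI)
  qed
  have a1: "cmod (a k) < 1" if "valid k" for k using whitney_box_subset[OF ak[OF that]] .
  define t where "t k = 1 - cmod (a k)" for k
  have t: "0 < t k" if "valid k" for k using a1[OF that] by (simp add: t_def)
  define M where "M k = measure \<nu> (whitney_box k)" for k
  define y where "y k = M k / (mass (a k) * t k powr e)" for k
  have mp: "0 < mass (a k)" if "valid k" for k using mass_pos[OF a1[OF that]] .
  have y0: "0 \<le> y k" if "valid k" for k using mp[OF that] by (simp add: y_def M_def)
  define c where "c k = (if valid k then y k powr \<sigma> * mass (a k) else 0)" for k
  have c0: "0 \<le> c k" for k using mp[of k] by (cases "valid k") (simp_all add: c_def less_imp_le)
  obtain C0 where C0: "\<And>J a. finite J \<Longrightarrow> (\<And>k. k \<in> J \<Longrightarrow> a k \<in> whitney_box k \<and> 1 \<le> fst k) \<Longrightarrow>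
    (\<Sum>k\<in>J. (measure \<nu> (whitney_box k) / (mass (a k) * (1 - cmod (a k)) powr (real n * q))) powr (p / (p - q)) * mass (a k)) \<le> C0"
    using box_mass_sum_le_outer[OF q s fin B bd] by blast
  \<comment> \<open>The nonempty boxes of level 0, which the box estimate leaves out, are among
    these four; they add a fixed finite amount.\<close>
  define K0 where "K0 = {0::nat} \<times> {-1, 0::int} \<times> {-1, 0::int}"
  have inner: "k \<in> K0" if k: "valid k" "fst k = 0" for k
  proof -
    obtain j m l where kj: "k = (j, m, l)" by (metis prod_cases3)
    have fl: "\<lfloor>Re (a k)\<rfloor> = m" "\<lfloor>Im (a k)\<rfloor> = l" using ak[OF k(1)] k(2) by (auto simp: kj)
    have "\<bar>Re (a k)\<bar> < 1" "\<bar>Im (a k)\<bar> < 1"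
      using abs_Re_le_cmod[of "a k"] abs_Im_le_cmod[of "a k"] a1[OF k(1)] by linarith+
    then have "m = -1 \<or> m = 0" "l = -1 \<or> l = 0" using fl by linarith+
    then show ?thesis using k(2) by (auto simp: K0_def kj)
  qed
  define C where "C = C0 + (\<Sum>k\<in>K0. c k)"
  have total: "(\<Sum>k\<in>J. c k) \<le> C" if J: "finite J" for J
  proof -
    define J1 where "J1 = {k\<in>J. valid k \<and> 1 \<le> fst k}"
    have "(\<Sum>k\<in>J. c k) = (\<Sum>k\<in>{k\<in>J. valid k}. c k)"
      using J by (intro sum.mono_neutral_right) (auto simp: c_def)
    also have "\<dots> \<le> (\<Sum>k\<in>J1 \<union> K0. c k)"
      using J inner c0 by (intro sum_mono2) (auto simp: J1_def K0_def Suc_le_eq)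
    also have "\<dots> \<le> (\<Sum>k\<in>J1. c k) + (\<Sum>k\<in>K0. c k)"
    proof -
      have "(\<Sum>k\<in>J1 \<union> K0. c k) + (\<Sum>k\<in>J1 \<inter> K0. c k) = (\<Sum>k\<in>J1. c k) + (\<Sum>k\<in>K0. c k)"
        using J by (intro sum.union_inter) (auto simp: J1_def K0_def)
      moreover have "0 \<le> (\<Sum>k\<in>J1 \<inter> K0. c k)" by (intro sum_nonneg c0)
      ultimately show ?thesis by linarith
    qed
    also have "(\<Sum>k\<in>J1. c k) = (\<Sum>k\<in>J1. (measure \<nu> (whitney_box k) / (mass (a k) * (1 - cmod (a k)) powr (real n * q))) powr (p / (p - q)) * mass (a k))"
      by (intro sum.cong refl) (simp add: c_def J1_def y_def M_def t_def e_def \<sigma>_def)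
    also have "\<dots> \<le> C0" using J ak by (intro C0) (auto simp: J1_def)
    finally show ?thesis by (simp add: C_def)
  qed
  define B0 where "B0 = 4 / (1 - r\<^sup>2)"
  have B0: "4 \<le> B0" using r by (simp add: B0_def pos_le_divide_eq power_less_one_iff)
  \<comment> \<open>From z to a point of its disc the distance to the circle changes by at most the
    factor B0, from there to \<open>a k\<close> by at most 2; and |z - a k| is at most 2 * B0^2 + 4
    times t k. The number b covers all of these.\<close>
  define b where "b = 2 * B0\<^sup>2 + 4"
  have b: "1 \<le> b" "2 * B0 \<le> b"
  proof -
    have "B0 \<le> B0\<^sup>2" using self_le_power[of B0 2] B0 by simp
    then show "1 \<le> b" "2 * B0 \<le> b" unfolding b_def using B0 by linarith+
  qed
  define near where "near k = {z. cmod z < 1 \<and> cmod (z - a k) \<le> b * t k \<and> t k \<le> b * (1 - cmod z) \<and> 1 - cmod z \<le> b * t k}" for k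
  have near_m [measurable]: "near k \<in> sets borel" for k unfolding near_def by measurable
  have meets: "z \<in> near k" if z: "cmod z < 1" and w: "w \<in> whitney_box k" "w \<in> pseudohyperbolic_disc z r" for z w k
  proof -
    have v: "valid k" using w(1) by (auto simp: valid_def)
    have 1: "1 - cmod z \<le> B0 * (1 - cmod w)" "1 - cmod w \<le> B0 * (1 - cmod z)" "cmod (w - z) \<le> B0 * (1 - cmod z)"
      using pseudohyperbolic_disc_bounds(3-5)[OF z r w(2)] by (auto simp: B0_def)
    have 2: "1 - cmod w \<le> 2 * t k" "cmod (a k - w) \<le> 4 * t k"
      using whitney_box_bounds(1,2)[OF ak[OF v] w(1)] by (auto simp: t_def)
    have 3: "t k \<le> 2 * (1 - cmod w)" using whitney_box_bounds(2)[OF w(1) ak[OF v]] by (simp add: t_def)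
    have tz: "1 - cmod z \<le> 2 * B0 * t k"
    proof -
      have "B0 * (1 - cmod w) \<le> B0 * (2 * t k)" using 2(1) B0 by (intro mult_left_mono) auto
      also have "\<dots> = 2 * B0 * t k" by simp
      finally show ?thesis using 1(1) by (rule order_trans[rotated])
    qed
    have tk: "t k \<le> 2 * B0 * (1 - cmod z)" using 1(2) 3 by simp
    have "B0 * (1 - cmod z) \<le> B0 * (2 * B0 * t k)" using tz B0 by (intro mult_left_mono) auto
    then have "cmod (w - z) + cmod (a k - w) \<le> b * t k"
      using 1(3) 2(2) by (simp add: b_def power2_eq_square algebra_simps)
    moreover have "cmod (z - a k) \<le> cmod (w - z) + cmod (a k - w)"
      using norm_triangle_ineq[of "z - w" "w - a k"] by (simp add: norm_minus_commute)
    moreover have "2 * B0 * t k \<le> b * t k" "2 * B0 * (1 - cmod z) \<le> b * (1 - cmod z)"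
      using b t[OF v] z by (auto intro!: mult_right_mono)
    ultimately show ?thesis using z tz tk unfolding near_def mem_Collect_eq by linarith
  qed
  obtain L :: nat where L: "2 * b < 2 ^ L" using real_arch_pow[of 2] by auto
  define I where "I z = {k. valid k \<and> z \<in> near k}" for z
  define Q where "Q = nat \<lceil>b + 1\<rceil>"
  have count: "finite (I z) \<and> real (card (I z)) \<le> real ((2 * L + 1) * ((2 * Q + 1) * (2 * Q + 1)))" if z: "cmod z < 1" for z
  proof -
    obtain i mz lz where "z \<in> whitney_box (i, mz, lz)" using whitney_box_cover[OF z] by (metis prod_cases3)
    then have i: "2 ^ i * (1 - cmod z) \<le> 1" "1 < 2 * (2 ^ i * (1 - cmod z))" by auto
    \<comment> \<open>Boxes near z are coded by a level and by grid offsets relative to z, all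
      within fixed ranges. This bounds their number independently of z.\<close>
    define f where "f = (\<lambda>(x::int, m::int, l::int). (nat x, m + \<lfloor>2 ^ nat x * Re z\<rfloor>, l + \<lfloor>2 ^ nat x * Im z\<rfloor>))"
    let ?X = "{int i - int L..int i + int L} \<times> {- int Q..int Q} \<times> {- int Q..int Q}"
    have "I z \<subseteq> f ` ?X"
    proof
      fix k assume "k \<in> I z"
      then have v: "valid k" and nk: "cmod (z - a k) \<le> b * t k" "t k \<le> b * (1 - cmod z)" "1 - cmod z \<le> b * t k"
        by (auto simp: I_def near_def)
      obtain j m l where kj: "k = (j, m, l)" by (metis prod_cases3)
      have kk: "2 ^ j * t k \<le> 1" "1 < 2 * (2 ^ j * t k)" "\<lfloor>2 ^ j * Re (a k)\<rfloor> = m" "\<lfloor>2 ^ j * Im (a k)\<rfloor> = l"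
        using ak[OF v] by (auto simp: kj t_def)
      have lev: "x \<le> y + L" if "2 ^ x * T \<le> 1" "1 < 2 * (2 ^ y * T')" "T' \<le> b * T" "0 < T" for x y :: nat and T T' :: real
      proof -
        have "2 ^ y * T' \<le> 2 ^ y * (b * T)" using that(3) by (intro mult_left_mono) auto
        then have "1 < 2 * (2 ^ y * (b * T))" using that(2) by linarith
        also have "\<dots> = (2 * b) * (2 ^ y * T)" by simp
        also have "\<dots> \<le> 2 ^ L * (2 ^ y * T)" using L that(4) by (intro mult_right_mono) auto
        also have "\<dots> \<le> 2 ^ Suc (y + L) * T" using that(4) by (simp add: power_add)
        finally show ?thesis using whitney_level_unique[OF that(1) _ that(4), of "y + L"] by simp
      qed
      have "j \<le> i + L" using lev[OF kk(1) i(2) nk(3) t[OF v]] .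
      moreover have "i \<le> j + L" using lev[OF i(1) kk(2) nk(2)] z by simp
      moreover have grid: "m' - \<lfloor>2 ^ j * x\<rfloor> \<in> {- int Q..int Q}" if "\<lfloor>2 ^ j * x'\<rfloor> = m'" "\<bar>x - x'\<bar> \<le> b * t k" for x x' :: real and m'
      proof -
        have "\<bar>2 ^ j * x - 2 ^ j * x'\<bar> = 2 ^ j * \<bar>x - x'\<bar>" by (simp add: abs_mult right_diff_distrib[symmetric])
        also have "\<dots> \<le> 2 ^ j * (b * t k)" using that(2) by (intro mult_left_mono) auto
        also have "\<dots> = b * (2 ^ j * t k)" by simp
        also have "\<dots> \<le> b * 1" using kk(1) b by (intro mult_left_mono) auto
        finally have "\<bar>2 ^ j * x - 2 ^ j * x'\<bar> \<le> b" by simp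
        then have "\<bar>of_int (m' - \<lfloor>2 ^ j * x\<rfloor>)\<bar> \<le> b + 1" using that(1) by linarith
        then have "\<bar>of_int (m' - \<lfloor>2 ^ j * x\<rfloor>)\<bar> \<le> real Q" using b by (simp add: Q_def) linarith
        then have "\<bar>m' - \<lfloor>2 ^ j * x\<rfloor>\<bar> \<le> int Q" by linarith
        then show ?thesis by auto
      qed
      have "\<bar>Re z - Re (a k)\<bar> \<le> b * t k" "\<bar>Im z - Im (a k)\<bar> \<le> b * t k"
        using abs_Re_le_cmod[of "z - a k"] abs_Im_le_cmod[of "z - a k"] nk(1) by auto
      then have "m - \<lfloor>2 ^ j * Re z\<rfloor> \<in> {- int Q..int Q}" "l - \<lfloor>2 ^ j * Im z\<rfloor> \<in> {- int Q..int Q}"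
        using grid kk by auto
      ultimately show "k \<in> f ` ?X"
        by (intro image_eqI[of _ _ "(int j, m - \<lfloor>2 ^ j * Re z\<rfloor>, l - \<lfloor>2 ^ j * Im z\<rfloor>)"]) (auto simp: f_def kj)
    qed
    note sub = this
    have fin: "finite (I z)" by (rule finite_subset[OF sub]) simp
    have c1: "card (I z) \<le> card (f ` ?X)" by (rule card_mono[OF _ sub]) simp
    have c2: "card (f ` ?X) \<le> card ?X" by (rule card_image_le) simp
    have c3: "card ?X = (2 * L + 1) * ((2 * Q + 1) * (2 * Q + 1))"
      by (simp only: card_cartesian_product card_atLeastAtMost_int) (simp add: nat_add_distrib nat_mult_distrib)
    from c1 c2 have "card (I z) \<le> (2 * L + 1) * ((2 * Q + 1) * (2 * Q + 1))"
      unfolding c3 by (rule order_trans)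
    then show ?thesis using fin by (simp only: of_nat_le_iff simp_thms)
  qed
  define Nc where "Nc = real ((2 * L + 1) * ((2 * Q + 1) * (2 * Q + 1)))"
  have Nc: "1 \<le> Nc" unfolding Nc_def by (subst of_nat_1[symmetric], subst of_nat_le_iff) simp
  obtain Ch where Ch: "1 \<le> Ch" "\<And>r s. 0 \<le> r \<Longrightarrow> r < 1 \<Longrightarrow> 0 \<le> s \<Longrightarrow> s < 1 \<Longrightarrow> 1 - r \<le> b * (1 - s) \<Longrightarrow> h r \<le> Ch * h s"
    using h_comparable by blast
  define A where "A = (Nc * (b * Ch * b powr e)) powr \<sigma> * (Ch * b)"
  have A: "0 \<le> A" using b Ch by (simp add: A_def)
  let ?T = "\<lambda>z. (measure \<nu> (pseudohyperbolic_disc z r) / (mass z * (1 - cmod z) powr e)) powr \<sigma> * (h (cmod z) / (1 - cmod z))"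
  define g where "g k = A * c k / (t k)\<^sup>2" for k
  have g0: "0 \<le> g k" for k using A c0 by (simp add: g_def)
  have pt: "?T z \<le> (\<Sum>k\<in>I z. g k)" if z: "cmod z < 1" for z
  proof -
    have fI: "finite (I z)" and cI: "real (card (I z)) \<le> Nc" using count[OF z] by (auto simp: Nc_def)
    define T where "T = 1 - cmod z"
    have T: "0 < T" using z by (simp add: T_def)
    have hz: "0 < h (cmod z)" using z by (intro h_pos) auto
    have "measure \<nu> (pseudohyperbolic_disc z r) \<le> measure \<nu> (\<Union>k\<in>I z. whitney_box k)"
    proof (rule N.finite_measure_mono)
      show "pseudohyperbolic_disc z r \<subseteq> (\<Union>k\<in>I z. whitney_box k)"
      proof
        fix w assume w: "w \<in> pseudohyperbolic_disc z r"
        then have "cmod w < 1" by (simp add: pseudohyperbolic_disc_def)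
        then obtain k where k: "w \<in> whitney_box k" using whitney_box_cover by blast
        then have "k \<in> I z" using meets[OF z k w] by (auto simp: I_def valid_def)
        then show "w \<in> (\<Union>k\<in>I z. whitney_box k)" using k by blast
      qed
      show "(\<Union>k\<in>I z. whitney_box k) \<in> sets \<nu>" using fI by (auto simp: s)
    qed
    also have "\<dots> \<le> (\<Sum>k\<in>I z. M k)"
      unfolding M_def using fI by (intro N.finite_measure_subadditive_finite) (auto simp: s)
    also have "\<dots> \<le> (\<Sum>k\<in>I z. y k * (b * Ch * b powr e * (mass z * T powr e)))"
    proof (rule sum_mono)
      fix k assume k: "k \<in> I z"
      then have v: "valid k" and nk: "t k \<le> b * T" "T \<le> b * t k" by (auto simp: I_def near_def T_def)
      have "h (cmod (a k)) \<le> Ch * h (cmod z)" using a1[OF v] z nk by (intro Ch) (auto simp: t_def T_def)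
      then have "t k * h (cmod (a k)) \<le> (b * T) * (Ch * h (cmod z))"
        using nk t[OF v] T b a1[OF v] by (intro mult_mono) (auto intro!: less_imp_le[OF h_pos])
      moreover have "t k powr e \<le> (b * T) powr e" using nk t[OF v] e by (intro powr_mono2) auto
      ultimately have "mass (a k) * t k powr e \<le> ((b * T) * (Ch * h (cmod z))) * (b * T) powr e"
        using b T Ch hz by (intro mult_mono) (auto simp: mass_def t_def)
      also have "\<dots> = b * Ch * b powr e * (mass z * T powr e)"
        using b T by (simp add: mass_def T_def powr_mult)
      finally have "y k * (mass (a k) * t k powr e) \<le> y k * (b * Ch * b powr e * (mass z * T powr e))"
        using y0[OF v] by (intro mult_left_mono)
      then show "M k \<le> y k * (b * Ch * b powr e * (mass z * T powr e))"
        using mp[OF v] t[OF v] by (simp add: y_def)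
    qed
    also have "\<dots> = (\<Sum>k\<in>I z. y k) * (b * Ch * b powr e) * (mass z * T powr e)"
      by (simp add: sum_distrib_right mult.assoc)
    finally have "measure \<nu> (pseudohyperbolic_disc z r) / (mass z * T powr e) \<le> (\<Sum>k\<in>I z. y k) * (b * Ch * b powr e)"
      using mass_pos[OF z] T by (simp add: pos_divide_le_eq)
    show ?thesis
    proof (cases "I z = {}")
      case True
      then have "measure \<nu> (pseudohyperbolic_disc z r) / (mass z * T powr e) \<le> 0"
        using \<open>measure \<nu> (pseudohyperbolic_disc z r) / (mass z * T powr e) \<le> _\<close> by simp
      moreover have "0 \<le> measure \<nu> (pseudohyperbolic_disc z r) / (mass z * T powr e)"
        using mass_pos[OF z] by simp
      ultimately have "measure \<nu> (pseudohyperbolic_disc z r) / (mass z * T powr e) = 0" by linarith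
      then have "?T z = 0" unfolding T_def[symmetric] by (simp only:) simp
      then show ?thesis by (simp only: True sum.empty order_refl)
    next
      case False
      \<comment> \<open>A sum of boundedly many ratios is at most a multiple of the largest, so its
        power is controlled by a single box.\<close>
      define ym where "ym = Max (y ` I z)"
      have "ym \<in> y ` I z" unfolding ym_def using fI False by (intro Max_in) auto
      then obtain k0 where "k0 \<in> I z" "ym = y k0" by blast
      then have k0: "k0 \<in> I z" "y k0 = ym" by simp_all
      have v0: "valid k0" and n0: "t k0 \<le> b * T" "T \<le> b * t k0" using k0(1) by (auto simp: I_def near_def T_def)
      have ym0: "0 \<le> ym" using y0[OF v0] k0(2) by simp
      have "(\<Sum>k\<in>I z. y k) \<le> (\<Sum>k\<in>I z. ym)"
        unfolding ym_def using fI by (intro sum_mono Max_ge) auto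
      also have "\<dots> \<le> Nc * ym" using cI ym0 by (simp add: mult_right_mono)
      finally have "(\<Sum>k\<in>I z. y k) * (b * Ch * b powr e) \<le> Nc * ym * (b * Ch * b powr e)"
        using b Ch by (intro mult_right_mono) auto
      then have "measure \<nu> (pseudohyperbolic_disc z r) / (mass z * T powr e) \<le> (Nc * (b * Ch * b powr e)) * ym"
        using \<open>measure \<nu> (pseudohyperbolic_disc z r) / (mass z * T powr e) \<le> _\<close> by (simp add: mult_ac)
      then have "(measure \<nu> (pseudohyperbolic_disc z r) / (mass z * T powr e)) powr \<sigma> \<le> ((Nc * (b * Ch * b powr e)) * ym) powr \<sigma>"
        using mass_pos[OF z] \<sigma> by (intro powr_mono2) auto
      also have "\<dots> = (Nc * (b * Ch * b powr e)) powr \<sigma> * ym powr \<sigma>" using Nc b Ch ym0 by (subst powr_mult) auto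
      finally have X1: "(measure \<nu> (pseudohyperbolic_disc z r) / (mass z * T powr e)) powr \<sigma>
         \<le> (Nc * (b * Ch * b powr e)) powr \<sigma> * ym powr \<sigma>" .
      have X2: "h (cmod z) / T \<le> (Ch * b) * (mass (a k0) / (t k0)\<^sup>2)"
      proof -
        have t0: "0 < t k0" using t[OF v0] .
        have "h (cmod z) \<le> Ch * h (cmod (a k0))" using a1[OF v0] z n0 by (intro Ch) (auto simp: t_def T_def)
        moreover have "1 / T \<le> b / t k0" using n0 T t0 by (simp add: field_simps)
        ultimately have "h (cmod z) * (1 / T) \<le> (Ch * h (cmod (a k0))) * (b / t k0)"
          using T hz by (intro mult_mono) auto
        also have "\<dots> = (Ch * b) * (mass (a k0) / (t k0)\<^sup>2)"
          using t0 by (simp add: mass_def t_def power2_eq_square)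
        finally show ?thesis by simp
      qed
      have "?T z \<le> ((Nc * (b * Ch * b powr e)) powr \<sigma> * ym powr \<sigma>) * ((Ch * b) * (mass (a k0) / (t k0)\<^sup>2))"
        using X1 X2 T hz by (intro mult_mono) (auto simp: T_def)
      also have "\<dots> = g k0"
        using v0 k0(2) by (simp add: g_def A_def c_def)
      also have "\<dots> \<le> (\<Sum>k\<in>I z. g k)" using fI k0(1) g0 by (intro member_le_sum) auto
      finally show ?thesis .
    qed
  qed
  \<comment> \<open>The boxes are enumerated by natural numbers; \<open>ok\<close> admits the
    nonempty ones, each under its own code only, so none is counted twice.\<close>
  define key where "key i = (from_nat i :: nat \<times> int \<times> int)" for i
  define ok where "ok i \<longleftrightarrow> valid (key i) \<and> to_nat (key i) = i" for i
  define G where "G i z = (if ok i then ennreal (g (key i)) * indicator (near (key i)) z else 0)" for i z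
  have [measurable]: "G i \<in> borel_measurable borel" for i unfolding G_def[abs_def] by measurable
  have ptG: "ennreal (?T z) * indicator (ball 0 1) z \<le> (\<Sum>i. G i z)" for z
  proof (cases "cmod z < 1")
    case z: True
    have fI: "finite (I z)" using count[OF z] by simp
    have "ennreal (?T z) \<le> ennreal (\<Sum>k\<in>I z. g k)" using pt[OF z] by (rule ennreal_leI)
    also have "\<dots> = (\<Sum>k\<in>I z. ennreal (g k))" using g0 by (subst sum_ennreal) auto
    also have "\<dots> = (\<Sum>k\<in>I z. G (to_nat k) z)"
      by (intro sum.cong) (auto simp: G_def ok_def key_def I_def)
    also have "\<dots> = (\<Sum>i\<in>to_nat ` I z. G i z)" by (subst sum.reindex) (auto intro: inj_on_subset[OF inj_to_nat])
    also have "\<dots> \<le> (\<Sum>i. G i z)" using fI by (intro sum_le_suminf summableI) auto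
    finally show ?thesis using z by simp
  qed simp
  define cc where "cc i = (if ok i then c (key i) else 0)" for i
  have cc0: "0 \<le> cc i" for i using c0 by (simp add: cc_def)
  have term_le: "(\<integral>\<^sup>+z. G i z \<partial>lborel) \<le> ennreal (A * pi * b\<^sup>2 * cc i)" for i
  proof (cases "ok i")
    case True
    then have v: "valid (key i)" by (simp add: ok_def)
    have tk: "0 < t (key i)" using t[OF v] .
    have "(\<integral>\<^sup>+z. G i z \<partial>lborel) = ennreal (g (key i)) * emeasure lborel (near (key i))"
      using True by (simp add: G_def nn_integral_cmult_indicator)
    also have "emeasure lborel (near (key i)) \<le> emeasure lborel (cball (a (key i)) (b * t (key i)))"
      by (intro emeasure_mono) (auto simp: near_def dist_norm norm_minus_commute)
    also have "\<dots> = ennreal (pi * (b * t (key i))\<^sup>2)" using b tk by (intro emeasure_cball_complex) auto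
    finally have "(\<integral>\<^sup>+z. G i z \<partial>lborel) \<le> ennreal (g (key i)) * ennreal (pi * (b * t (key i))\<^sup>2)"
      by (simp add: mult_left_mono)
    also have "\<dots> = ennreal (A * pi * b\<^sup>2 * c (key i))"
    proof -
      have "g (key i) * (pi * (b * t (key i))\<^sup>2) = A * pi * b\<^sup>2 * c (key i)"
        using tk by (simp add: g_def power_mult_distrib)
      moreover have "ennreal (g (key i)) * ennreal (pi * (b * t (key i))\<^sup>2) = ennreal (g (key i) * (pi * (b * t (key i))\<^sup>2))"
        using g0 by (intro ennreal_mult[symmetric]) simp_all
      ultimately show ?thesis by (simp only:)
    qed
    finally show ?thesis using True by (simp add: cc_def)
  qed (simp add: G_def)
  have "(\<integral>\<^sup>+z\<in>ball 0 1. ennreal (?T z) \<partial>lborel) \<le> (\<integral>\<^sup>+z. (\<Sum>i. G i z) \<partial>lborel)"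
    by (intro nn_integral_mono ptG)
  also have "\<dots> = (\<Sum>i. \<integral>\<^sup>+z. G i z \<partial>lborel)" by (rule nn_integral_suminf) measurable
  also have "\<dots> \<le> (\<Sum>i. ennreal (A * pi * b\<^sup>2 * cc i))"
    by (intro suminf_le summableI term_le)
  also have "\<dots> = (SUP N. \<Sum>i<N. ennreal (A * pi * b\<^sup>2 * cc i))"
    by (rule suminf_eq_SUP)
  also have "\<dots> \<le> ennreal (A * pi * b\<^sup>2 * C)"
  proof (rule SUP_least)
    fix N
    have "(\<Sum>i<N. ennreal (A * pi * b\<^sup>2 * cc i)) = ennreal (A * pi * b\<^sup>2 * (\<Sum>i<N. cc i))"
      unfolding sum_distrib_left using A cc0 by (intro sum_ennreal) simp
    also have "(\<Sum>i<N. cc i) = (\<Sum>i\<in>{i\<in>{..<N}. ok i}. c (key i))"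
      unfolding cc_def by (rule sum.inter_filter[symmetric]) simp
    also have "\<dots> = (\<Sum>k\<in>key ` {i\<in>{..<N}. ok i}. c k)"
    proof -
      have "inj_on key {i\<in>{..<N}. ok i}" unfolding ok_def by (rule inj_on_inverseI[of _ to_nat]) simp
      then show ?thesis by (simp add: sum.reindex)
    qed
    also have "ennreal (A * pi * b\<^sup>2 * (\<Sum>k\<in>key ` {i\<in>{..<N}. ok i}. c k)) \<le> ennreal (A * pi * b\<^sup>2 * C)"
      using A total by (intro ennreal_leI mult_left_mono) auto
    finally show "(\<Sum>i<N. ennreal (A * pi * b\<^sup>2 * cc i)) \<le> ennreal (A * pi * b\<^sup>2 * C)" .
  qed
  finally show ?thesis unfolding e_def \<sigma>_def by (simp add: le_less_trans)
qed

end

subsection \<open>Embedding estimates and test functions\<close>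

text \<open>The discs are the sections of one Borel subset of the product, so sigma-finiteness
  yields measurability in the centre.\<close>

lemma borel_measurable_emeasure_pseudohyperbolic_disc:
  fixes \<nu> :: "complex measure"
  assumes "sigma_finite_measure \<nu>" "sets \<nu> = sets borel"
  shows "(\<lambda>x. emeasure \<nu> (pseudohyperbolic_disc x r)) \<in> borel_measurable borel"
proof -
  interpret N: sigma_finite_measure \<nu> by (rule assms(1))
  have [measurable]: "cnj \<in> borel_measurable borel"
    by (intro borel_measurable_continuous_onI continuous_intros)
  define Q where "Q = {y :: complex \<times> complex. cmod (snd y) < 1 \<and> cmod ((fst y - snd y) / (1 - cnj (fst y) * snd y)) < r}"
  have "{y \<in> space (borel \<Otimes>\<^sub>M borel). cmod (snd y) < 1 \<and> cmod ((fst y - snd y) / (1 - cnj (fst y) * snd y)) < r}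
    \<in> sets (borel \<Otimes>\<^sub>M borel :: (complex \<times> complex) measure)" by measurable
  then have "Q \<in> sets (borel \<Otimes>\<^sub>M borel)" by (simp add: Q_def space_pair_measure)
  then have "Q \<in> sets (borel \<Otimes>\<^sub>M \<nu>)" using sets_pair_measure_cong[OF refl assms(2)] by metis
  then have "(\<lambda>x. emeasure \<nu> (Pair x -` Q)) \<in> borel_measurable borel" by (rule N.measurable_emeasure_Pair)
  moreover have "Pair x -` Q = pseudohyperbolic_disc x r" for x
    by (auto simp: Q_def pseudohyperbolic_disc_def)
  ultimately show ?thesis by simp
qed

context doubling_profile
begin

lemma bergman_int_eq: "bergman_int p f = (\<integral>\<^sup>+z\<in>ball 0 1. pow_mod f p z * W (cmod z) \<partial>lborel)"
  unfolding bergman_int_def pow_mod_def by (intro nn_integral_cong) (auto split: split_indicator)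

lemma nn_integral_tilde_le_bergman:
  obtains C where "0 < C" "\<And>f p. f holomorphic_on ball 0 1 \<Longrightarrow> 0 < p \<Longrightarrow>
    (\<integral>\<^sup>+z\<in>ball 0 1. ennreal (cmod (f z) powr p) * ennreal (h (cmod z) / (1 - cmod z)) \<partial>lborel) \<le> ennreal C * bergman_int p f"
proof -
  obtain C' where C': "1 \<le> C'" "\<And>r s. 0 \<le> r \<Longrightarrow> r < 1 \<Longrightarrow> 0 \<le> s \<Longrightarrow> s < 1 \<Longrightarrow> 1 - r \<le> K * (1 - s) \<Longrightarrow> h r \<le> C' * h s"
    using h_comparable by blast
  let ?C = "K * C' / ((1 - 1 / K) * (1 - 1 / C2))"
  show ?thesis
  proof (rule that[of ?C])
    show "0 < ?C" using C' KC2 by simp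
    fix f p assume f: "f holomorphic_on ball 0 1" and p: "0 < (p::real)"
    have "(\<integral>\<^sup>+z\<in>ball 0 1. ennreal (cmod (f z) powr p) * ennreal (h (cmod z) / (1 - cmod z)) \<partial>lborel)
       = (\<integral>\<^sup>+z\<in>ball 0 1. pow_mod f p z * ennreal (h (cmod z) / (1 - cmod z)) \<partial>lborel)"
      unfolding pow_mod_def by (intro nn_integral_cong) (auto split: split_indicator)
    also have "\<dots> \<le> ennreal ?C * (\<integral>\<^sup>+z\<in>ball 0 1. pow_mod f p z * W (cmod z) \<partial>lborel)"
      using f p C' by (intro nn_integral_tilde_le circle_avg_pow_mod_mono) auto
    finally show "(\<integral>\<^sup>+z\<in>ball 0 1. ennreal (cmod (f z) powr p) * ennreal (h (cmod z) / (1 - cmod z)) \<partial>lborel) \<le> ennreal ?C * bergman_int p f"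
      by (simp only: bergman_int_eq)
  qed
qed

text \<open>On the disc of radius t / 2, t = 1 - cmod z, the regularised density is bounded below by
  a multiple of its value at z, so the sub-mean-value inequality can be taken against it; the weight
  itself might vanish there. The area, of order t^2, times the density h / t gives
  \<open>mass z\<close>.\<close>

lemma pointwise_le_bergman:
  obtains C where "0 < C" "\<And>f p z. f holomorphic_on ball 0 1 \<Longrightarrow> 0 < p \<Longrightarrow> cmod z < 1 \<Longrightarrow>
    ennreal (cmod (f z) powr p) \<le> ennreal (C / mass z) * bergman_int p f"
proof -
  obtain CA where CA: "0 < CA" "\<And>f p. f holomorphic_on ball 0 1 \<Longrightarrow> 0 < p \<Longrightarrow>
    (\<integral>\<^sup>+z\<in>ball 0 1. ennreal (cmod (f z) powr p) * ennreal (h (cmod z) / (1 - cmod z)) \<partial>lborel) \<le> ennreal CA * bergman_int p f"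
    using nn_integral_tilde_le_bergman by blast
  obtain Ch where Ch: "1 \<le> Ch" "\<And>r s. 0 \<le> r \<Longrightarrow> r < 1 \<Longrightarrow> 0 \<le> s \<Longrightarrow> s < 1 \<Longrightarrow> 1 - r \<le> 2 * (1 - s) \<Longrightarrow> h r \<le> Ch * h s"
    using h_comparable by blast
  show ?thesis
  proof (rule that[of "8 * Ch * CA / pi"])
    show "0 < 8 * Ch * CA / pi" using CA Ch by simp
    fix f z and p :: real assume f: "f holomorphic_on ball 0 1" and p: "0 < p" and z: "cmod z < 1"
    define t where "t = 1 - cmod z"
    have t: "0 < t" using z by (simp add: t_def)
    have hz: "0 < h (cmod z)" using z by (intro h_pos) auto
    have near: "t / 2 \<le> 1 - cmod x \<and> 1 - cmod x \<le> 2 * t" if "x \<in> ball z (t / 2)" for x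
    proof -
      have "cmod (x - z) < t / 2" using that by (simp add: dist_norm norm_minus_commute)
      then have "\<bar>cmod x - cmod z\<bar> < t / 2" using norm_triangle_ineq3[of x z] by linarith
      then have "cmod x - cmod z < t / 2 \<and> - (cmod x - cmod z) < t / 2" by (simp only: abs_less_iff)
      then show ?thesis using t t_def by argo
    qed
    have sub: "ball z (t / 2) \<subseteq> ball 0 1" using near t by fastforce
    have "ennreal (pi * (t / 2)\<^sup>2) * ennreal (cmod (f z) powr p) \<le> (\<integral>\<^sup>+x\<in>ball z (t / 2). ennreal (cmod (f x) powr p) \<partial>lborel)"
      using t p by (intro sub_mean_value_ball holomorphic_on_subset[OF f sub]) auto
    also have "\<dots> \<le> (\<integral>\<^sup>+x. ennreal (2 * Ch * t / h (cmod z)) * (ennreal (cmod (f x) powr p) * ennreal (h (cmod x) / (1 - cmod x)) * indicator (ball 0 1) x) \<partial>lborel)"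
    proof (intro nn_integral_mono)
      fix x :: complex
      show "ennreal (cmod (f x) powr p) * indicator (ball z (t / 2)) x
        \<le> ennreal (2 * Ch * t / h (cmod z)) * (ennreal (cmod (f x) powr p) * ennreal (h (cmod x) / (1 - cmod x)) * indicator (ball 0 1) x)"
      proof (cases "x \<in> ball z (t / 2)")
        case True
        have x: "t / 2 \<le> 1 - cmod x" "1 - cmod x \<le> 2 * t" "cmod x < 1" using near[OF True] t by auto
        have "h (cmod z) \<le> Ch * h (cmod x)" using x z by (intro Ch) (auto simp: t_def)
        moreover have "0 < h (cmod x)" using x by (intro h_pos) auto
        ultimately have "h (cmod z) * (1 - cmod x) \<le> (Ch * h (cmod x)) * (2 * t)"
          using x Ch t by (intro mult_mono) auto
        then have "1 \<le> 2 * Ch * t / h (cmod z) * (h (cmod x) / (1 - cmod x))"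
          using hz x by (simp add: field_simps)
        then have "ennreal 1 \<le> ennreal (2 * Ch * t / h (cmod z) * (h (cmod x) / (1 - cmod x)))" by (rule ennreal_leI)
        also have "\<dots> = ennreal (2 * Ch * t / h (cmod z)) * ennreal (h (cmod x) / (1 - cmod x))"
          using Ch t hz by (intro ennreal_mult') auto
        finally have "1 * ennreal (cmod (f x) powr p) \<le> ennreal (2 * Ch * t / h (cmod z)) * ennreal (h (cmod x) / (1 - cmod x)) * ennreal (cmod (f x) powr p)"
          by (intro mult_right_mono) auto
        then show ?thesis using True x by (simp add: mult_ac)
      qed simp
    qed
    also have "\<dots> = ennreal (2 * Ch * t / h (cmod z)) * (\<integral>\<^sup>+x\<in>ball 0 1. ennreal (cmod (f x) powr p) * ennreal (h (cmod x) / (1 - cmod x)) \<partial>lborel)"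
    proof (rule nn_integral_cmult)
      have "(\<lambda>x. pow_mod f p x * ennreal (h (cmod x) / (1 - cmod x))) \<in> borel_measurable lborel"
        using borel_measurable_pow_mod[OF f] by measurable
      then show "(\<lambda>x. ennreal (cmod (f x) powr p) * ennreal (h (cmod x) / (1 - cmod x)) * indicator (ball 0 1) x) \<in> borel_measurable lborel"
        by (simp add: pow_mod_def mult_ac)
    qed
    also have "\<dots> \<le> ennreal (2 * Ch * t / h (cmod z)) * (ennreal CA * bergman_int p f)"
      by (intro mult_left_mono CA f p) simp
    finally have "ennreal (4 / (pi * t\<^sup>2)) * (ennreal (pi * (t / 2)\<^sup>2) * ennreal (cmod (f z) powr p))
       \<le> ennreal (4 / (pi * t\<^sup>2)) * (ennreal (2 * Ch * t / h (cmod z)) * (ennreal CA * bergman_int p f))"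
      by (rule mult_left_mono) simp
    moreover have "ennreal (4 / (pi * t\<^sup>2)) * ennreal (pi * (t / 2)\<^sup>2) = 1"
      using t by (subst ennreal_mult[symmetric]) (auto simp: power_divide field_simps)
    moreover have "ennreal (4 / (pi * t\<^sup>2)) * (ennreal (2 * Ch * t / h (cmod z)) * ennreal CA) = ennreal (8 * Ch * CA / pi / mass z)"
    proof -
      have "4 / (pi * t\<^sup>2) * (2 * Ch * t / h (cmod z) * CA) = 8 * Ch * CA / pi / mass z"
        using t by (simp add: mass_def t_def[symmetric] power2_eq_square)
      then show ?thesis using t hz Ch CA
        by (subst ennreal_mult[symmetric], simp, simp, subst ennreal_mult[symmetric], simp_all)
    qed
    ultimately show "ennreal (cmod (f z) powr p) \<le> ennreal (8 * Ch * CA / pi / mass z) * bergman_int p f"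
      by (simp only: mult.assoc[symmetric] mult_1)
  qed
qed

text \<open>Writing |f|^q as |f|^p times |f|^(q - p), the second factor is bounded by the growth
  estimate; this is where p <= q enters. The powers of \<open>mass x\<close> and of 1 - cmod x then
  combine to |f|^p against the regularised density, whose integral is bounded. The ratio bound R is
  required near the circle only, where it can be made small for compactness.\<close>

lemma higher_deriv_int_le_of_ratio:
  assumes p: "0 < p" "p \<le> q" and r: "0 < r" "r < 1"
  obtains C where "0 < C" "\<And>f \<nu> \<rho> R. f holomorphic_on ball 0 1 \<Longrightarrow> bergman_int p f \<le> 1 \<Longrightarrow> sets \<nu> = sets borel \<Longrightarrow>
      sigma_finite_measure \<nu> \<Longrightarrow> 0 \<le> R \<Longrightarrow>
      (\<And>x. x \<in> ball 0 1 - ball 0 (1 - 2 * (1 - \<rho>)) \<Longrightarrow>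
         emeasure \<nu> (pseudohyperbolic_disc x r) \<le> ennreal (R * (mass x powr (q / p) * (1 - cmod x) powr (real n * q)))) \<Longrightarrow>
      deriv_int_on (ball 0 1 - ball 0 \<rho>) n q \<nu> f \<le> ennreal (C * R)"
proof -
  have q: "0 < q" using p by simp
  obtain C0 where C0: "0 < C0"
    "\<And>f \<nu> \<rho>. f holomorphic_on ball 0 1 \<Longrightarrow> sets \<nu> = sets borel \<Longrightarrow> sigma_finite_measure \<nu> \<Longrightarrow>
      deriv_int_on (ball 0 1 - ball 0 \<rho>) n q \<nu> f
        \<le> ennreal C0 * (\<integral>\<^sup>+x\<in>ball 0 1 - ball 0 (1 - 2 * (1 - \<rho>)).
            ennreal (cmod (f x) powr q) * (emeasure \<nu> (pseudohyperbolic_disc x r) * ennreal ((1 - cmod x) powr (- (real n * q) - 2))) \<partial>lborel)"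
    using nn_integral_higher_deriv_le[OF q r] by blast
  obtain CA where CA: "0 < CA" "\<And>f p. f holomorphic_on ball 0 1 \<Longrightarrow> 0 < p \<Longrightarrow>
    (\<integral>\<^sup>+z\<in>ball 0 1. ennreal (cmod (f z) powr p) * ennreal (h (cmod z) / (1 - cmod z)) \<partial>lborel) \<le> ennreal CA * bergman_int p f"
    using nn_integral_tilde_le_bergman by blast
  obtain CP where CP: "0 < CP" "\<And>f p z. f holomorphic_on ball 0 1 \<Longrightarrow> 0 < p \<Longrightarrow> cmod z < 1 \<Longrightarrow>
    ennreal (cmod (f z) powr p) \<le> ennreal (CP / mass z) * bergman_int p f"
    using pointwise_le_bergman by blast
  define D where "D = CP powr ((q - p) / p)"
  have D: "0 < D" using CP by (simp add: D_def)
  show ?thesis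
  proof (rule that[of "C0 * (D * CA)"])
    show "0 < C0 * (D * CA)" using C0 D CA by simp
    fix f and \<nu> :: "complex measure" and \<rho> R :: real
    assume f: "f holomorphic_on ball 0 1" "bergman_int p f \<le> 1" and s: "sets \<nu> = sets borel" "sigma_finite_measure \<nu>"
      and R: "0 \<le> R" "\<And>x. x \<in> ball 0 1 - ball 0 (1 - 2 * (1 - \<rho>)) \<Longrightarrow>
         emeasure \<nu> (pseudohyperbolic_disc x r) \<le> ennreal (R * (mass x powr (q / p) * (1 - cmod x) powr (real n * q)))"
    let ?E = "ball 0 1 - ball (0::complex) (1 - 2 * (1 - \<rho>))"
    have "(\<integral>\<^sup>+x\<in>?E. ennreal (cmod (f x) powr q) * (emeasure \<nu> (pseudohyperbolic_disc x r) * ennreal ((1 - cmod x) powr (- (real n * q) - 2))) \<partial>lborel)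
      \<le> (\<integral>\<^sup>+x. ennreal (D * R) * (ennreal (cmod (f x) powr p) * ennreal (h (cmod x) / (1 - cmod x)) * indicator (ball 0 1) x) \<partial>lborel)"
    proof (intro nn_integral_mono)
      fix x :: complex
      show "ennreal (cmod (f x) powr q) * (emeasure \<nu> (pseudohyperbolic_disc x r) * ennreal ((1 - cmod x) powr (- (real n * q) - 2))) * indicator ?E x
        \<le> ennreal (D * R) * (ennreal (cmod (f x) powr p) * ennreal (h (cmod x) / (1 - cmod x)) * indicator (ball 0 1) x)"
      proof (cases "x \<in> ?E")
        case True
        then have x: "cmod x < 1" by simp
        define t where "t = 1 - cmod x"
        have t: "0 < t" using x by (simp add: t_def)
        have m: "0 < mass x" using mass_pos[OF x] .
        have "ennreal (cmod (f x) powr p) \<le> ennreal (CP / mass x) * 1"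
          by (rule order_trans[OF CP(2)[OF f(1) p(1) x]]) (intro mult_left_mono f, simp)
        then have "cmod (f x) powr p \<le> CP / mass x" using CP(1) m by (simp add: ennreal_le_iff)
        then have "(cmod (f x) powr p) powr ((q - p) / p) \<le> (CP / mass x) powr ((q - p) / p)"
          using p by (intro powr_mono2) auto
        also have "(cmod (f x) powr p) powr ((q - p) / p) = cmod (f x) powr (q - p)" using p by (simp add: powr_powr)
        also have "(CP / mass x) powr ((q - p) / p) = D / mass x powr ((q - p) / p)" using CP(1) m by (simp add: D_def powr_divide)
        finally have fqp: "cmod (f x) powr (q - p) \<le> D / mass x powr ((q - p) / p)" .
        have fq: "cmod (f x) powr q \<le> cmod (f x) powr p * (D / mass x powr ((q - p) / p))"
        proof (cases "f x = 0")
          case False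
          then have "cmod (f x) powr q = cmod (f x) powr p * cmod (f x) powr (q - p)" by (simp add: powr_add[symmetric])
          then show ?thesis using mult_left_mono[OF fqp, of "cmod (f x) powr p"] by simp
        qed simp
        have "cmod (f x) powr q * ((R * (mass x powr (q / p) * t powr (real n * q))) * t powr (- (real n * q) - 2))
           \<le> (cmod (f x) powr p * (D / mass x powr ((q - p) / p))) * ((R * (mass x powr (q / p) * t powr (real n * q))) * t powr (- (real n * q) - 2))"
          using fq R(1) by (intro mult_right_mono) auto
        also have "\<dots> = D * R * (cmod (f x) powr p * ((mass x powr (q / p) / mass x powr ((q - p) / p)) * (t powr (real n * q) * t powr (- (real n * q) - 2))))"
          by simp
        also have "mass x powr (q / p) / mass x powr ((q - p) / p) = mass x"
        proof -
          have "mass x powr (q / p) / mass x powr ((q - p) / p) = mass x powr (q / p - (q - p) / p)"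
            using m by (simp add: powr_diff)
          also have "q / p - (q - p) / p = 1" using p by (simp add: diff_divide_distrib)
          finally show ?thesis using m by simp
        qed
        also have "t powr (real n * q) * t powr (- (real n * q) - 2) = 1 / t\<^sup>2"
          using t by (simp add: powr_add[symmetric] powr_minus_divide flip: powr_numeral)
        also have "mass x * (1 / t\<^sup>2) = h (cmod x) / (1 - cmod x)"
          using t by (simp add: mass_def t_def[symmetric] power2_eq_square)
        finally have main: "cmod (f x) powr q * ((R * (mass x powr (q / p) * t powr (real n * q))) * t powr (- (real n * q) - 2))
           \<le> D * R * (cmod (f x) powr p * (h (cmod x) / (1 - cmod x)))" .
        have "ennreal (cmod (f x) powr q) * (emeasure \<nu> (pseudohyperbolic_disc x r) * ennreal (t powr (- (real n * q) - 2)))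
          \<le> ennreal (cmod (f x) powr q) * (ennreal (R * (mass x powr (q / p) * t powr (real n * q))) * ennreal (t powr (- (real n * q) - 2)))"
          using R(2)[OF True] by (intro mult_left_mono mult_right_mono) (auto simp: t_def)
        also have "\<dots> = ennreal (cmod (f x) powr q * ((R * (mass x powr (q / p) * t powr (real n * q))) * t powr (- (real n * q) - 2)))"
          using R(1) by (simp add: ennreal_mult)
        also have "\<dots> \<le> ennreal (D * R * (cmod (f x) powr p * (h (cmod x) / (1 - cmod x))))"
          by (rule ennreal_leI[OF main])
        also have "\<dots> = ennreal (D * R) * (ennreal (cmod (f x) powr p) * ennreal (h (cmod x) / (1 - cmod x)))"
          by (subst ennreal_mult', use D R(1) in simp, subst ennreal_mult'[of "cmod (f x) powr p"], simp_all)
        finally show ?thesis using True x by (simp add: t_def)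
      qed simp
    qed
    also have "\<dots> = ennreal (D * R) * (\<integral>\<^sup>+x\<in>ball 0 1. ennreal (cmod (f x) powr p) * ennreal (h (cmod x) / (1 - cmod x)) \<partial>lborel)"
    proof (rule nn_integral_cmult)
      have "(\<lambda>x. pow_mod f p x * ennreal (h (cmod x) / (1 - cmod x))) \<in> borel_measurable lborel"
        using borel_measurable_pow_mod[OF f(1)] by measurable
      then show "(\<lambda>x. ennreal (cmod (f x) powr p) * ennreal (h (cmod x) / (1 - cmod x)) * indicator (ball 0 1) x) \<in> borel_measurable lborel"
        by (simp add: pow_mod_def mult_ac)
    qed
    also have "\<dots> \<le> ennreal (D * R) * (ennreal CA * 1)"
      by (intro mult_left_mono order_trans[OF CA(2)[OF f(1) p(1)]] f(2)) auto
    finally have "ennreal C0 * (\<integral>\<^sup>+x\<in>?E. ennreal (cmod (f x) powr q) * (emeasure \<nu> (pseudohyperbolic_disc x r) * ennreal ((1 - cmod x) powr (- (real n * q) - 2))) \<partial>lborel)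
       \<le> ennreal C0 * (ennreal (D * R) * (ennreal CA * 1))" by (rule mult_left_mono) simp
    also have "\<dots> = ennreal (C0 * (D * CA) * R)"
      using C0 D CA R(1) by (simp add: ennreal_mult[symmetric] mult_ac)
    finally show "deriv_int_on (ball 0 1 - ball 0 \<rho>) n q \<nu> f \<le> ennreal (C0 * (D * CA) * R)"
      using C0(2)[OF f(1) s] by (rule order_trans[rotated])
  qed
qed

text \<open>For q < p the growth estimate is of no help. The integrand is |f|^q times the mass ratio
  X against the regularised density, and Young's inequality separates the two. The parameter
  \<theta> makes the term with f small on the whole unit ball; the other term does not contain f and
  is small near the circle once its integral is finite.\<close>

lemma higher_deriv_int_le_of_integral:
  assumes q: "0 < q" "q < p" and r: "0 < r" "r < 1"
  obtains C where "0 < C" "\<And>f \<nu> \<rho> \<theta>. f holomorphic_on ball 0 1 \<Longrightarrow> bergman_int p f \<le> 1 \<Longrightarrow> sets \<nu> = sets borel \<Longrightarrow>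
      sigma_finite_measure \<nu> \<Longrightarrow> 0 < \<theta> \<Longrightarrow> (\<And>x. cmod x < 1 \<Longrightarrow> emeasure \<nu> (pseudohyperbolic_disc x r) < \<infinity>) \<Longrightarrow>
      deriv_int_on (ball 0 1 - ball 0 \<rho>) n q \<nu> f
        \<le> ennreal (C * \<theta>) + ennreal (C * \<theta> powr (- q / (p - q))) * (\<integral>\<^sup>+x\<in>ball 0 1 - ball 0 (1 - 2 * (1 - \<rho>)).
            ennreal ((measure \<nu> (pseudohyperbolic_disc x r) / (mass x * (1 - cmod x) powr (real n * q))) powr (p / (p - q))
              * (h (cmod x) / (1 - cmod x))) \<partial>lborel)"
proof -
  have p: "0 < p" using q by simp
  obtain C0 where C0: "0 < C0"
    "\<And>f \<nu> \<rho>. f holomorphic_on ball 0 1 \<Longrightarrow> sets \<nu> = sets borel \<Longrightarrow> sigma_finite_measure \<nu> \<Longrightarrow>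
      deriv_int_on (ball 0 1 - ball 0 \<rho>) n q \<nu> f
        \<le> ennreal C0 * (\<integral>\<^sup>+x\<in>ball 0 1 - ball 0 (1 - 2 * (1 - \<rho>)).
            ennreal (cmod (f x) powr q) * (emeasure \<nu> (pseudohyperbolic_disc x r) * ennreal ((1 - cmod x) powr (- (real n * q) - 2))) \<partial>lborel)"
    using nn_integral_higher_deriv_le[OF q(1) r] by blast
  obtain CA where CA: "0 < CA" "\<And>f p. f holomorphic_on ball 0 1 \<Longrightarrow> 0 < p \<Longrightarrow>
    (\<integral>\<^sup>+z\<in>ball 0 1. ennreal (cmod (f z) powr p) * ennreal (h (cmod z) / (1 - cmod z)) \<partial>lborel) \<le> ennreal CA * bergman_int p f"
    using nn_integral_tilde_le_bergman by blast
  define \<sigma> where "\<sigma> = p / (p - q)"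
  \<comment> \<open>If X is at most \<theta> * F powr (p / q - 1), the first term already bounds F *
    X. Otherwise F is at most a power of X / \<theta>, and the second term does.\<close>
  have young: "F * X \<le> \<theta> * F powr (p / q) + \<theta> powr (- q / (p - q)) * X powr \<sigma>" if FX: "0 \<le> F" "0 \<le> X" "0 < \<theta>" for F X \<theta> :: real
  proof (cases "X \<le> \<theta> * F powr (p / q - 1)")
    case True
    have "F * X \<le> F * (\<theta> * F powr (p / q - 1))" using True FX by (intro mult_left_mono)
    also have "\<dots> = \<theta> * F powr (p / q)"
    proof (cases "F = 0")
      case False
      then have "F * F powr (p / q - 1) = F powr (p / q)" using FX powr_mult_base[of F "p / q - 1"] by simp
      then show ?thesis by (simp add: mult_ac)
    qed simp
    finally show ?thesis using FX by (simp add: add_increasing2)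
  next
    case False
    then have l: "\<theta> * F powr ((p - q) / q) < X" using q by (simp add: diff_divide_distrib)
    have X: "0 < X" using l FX by (auto intro: le_less_trans[rotated])
    have "F powr ((p - q) / q) \<le> X / \<theta>" using l FX by (simp add: field_simps)
    then have "(F powr ((p - q) / q)) powr (q / (p - q)) \<le> (X / \<theta>) powr (q / (p - q))" using q by (intro powr_mono2) auto
    then have "F \<le> (X / \<theta>) powr (q / (p - q))" using q FX by (simp add: powr_powr)
    then have "F * X \<le> (X / \<theta>) powr (q / (p - q)) * X" using FX by (intro mult_right_mono) auto
    also have "(X / \<theta>) powr (q / (p - q)) * X = \<theta> powr (- q / (p - q)) * (X * X powr (q / (p - q)))"
      using X FX by (simp add: powr_divide powr_minus_divide minus_divide_left[symmetric])
    also have "X * X powr (q / (p - q)) = X powr \<sigma>"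
    proof -
      have "1 + q / (p - q) = \<sigma>" using q by (simp add: \<sigma>_def field_simps)
      then show ?thesis using X powr_mult_base[of X "q / (p - q)"] by simp
    qed
    finally show ?thesis using FX by (simp add: add_increasing)
  qed
  define C where "C = C0 * max CA 1"
  show ?thesis
  proof (rule that[of C])
    show "0 < C" using C0 CA by (simp add: C_def)
    fix f and \<nu> :: "complex measure" and \<rho> \<theta> :: real
    assume f: "f holomorphic_on ball 0 1" "bergman_int p f \<le> 1" and s: "sets \<nu> = sets borel" "sigma_finite_measure \<nu>"
      and \<theta>: "0 < \<theta>" and fin: "\<And>x. cmod x < 1 \<Longrightarrow> emeasure \<nu> (pseudohyperbolic_disc x r) < \<infinity>"
    let ?E = "ball 0 1 - ball (0::complex) (1 - 2 * (1 - \<rho>))"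
    define X where "X x = measure \<nu> (pseudohyperbolic_disc x r) / (mass x * (1 - cmod x) powr (real n * q))" for x
    let ?w = "\<lambda>x. h (cmod x) / (1 - cmod x)"
    have mem: "(\<lambda>x. emeasure \<nu> (pseudohyperbolic_disc x r)) \<in> borel_measurable borel"
      by (rule borel_measurable_emeasure_pseudohyperbolic_disc[OF s(2,1)])
    have mX [measurable]: "X \<in> borel_measurable borel"
      unfolding X_def[abs_def] mass_def measure_def using mem by measurable
    have mf: "(\<lambda>x. pow_mod f p x) \<in> borel_measurable borel" using borel_measurable_pow_mod[OF f(1)] .
    have "(\<integral>\<^sup>+x\<in>?E. ennreal (cmod (f x) powr q) * (emeasure \<nu> (pseudohyperbolic_disc x r) * ennreal ((1 - cmod x) powr (- (real n * q) - 2))) \<partial>lborel)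
      \<le> (\<integral>\<^sup>+x. ennreal \<theta> * (pow_mod f p x * ennreal (?w x) * indicator (ball 0 1) x)
          + ennreal (\<theta> powr (- q / (p - q))) * (ennreal (X x powr \<sigma> * ?w x) * indicator ?E x) \<partial>lborel)"
    proof (intro nn_integral_mono)
      fix x :: complex
      show "ennreal (cmod (f x) powr q) * (emeasure \<nu> (pseudohyperbolic_disc x r) * ennreal ((1 - cmod x) powr (- (real n * q) - 2))) * indicator ?E x
        \<le> ennreal \<theta> * (pow_mod f p x * ennreal (?w x) * indicator (ball 0 1) x)
          + ennreal (\<theta> powr (- q / (p - q))) * (ennreal (X x powr \<sigma> * ?w x) * indicator ?E x)"
      proof (cases "x \<in> ?E")
        case True
        then have x: "cmod x < 1" by simp
        define t where "t = 1 - cmod x"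
        have t: "0 < t" using x by (simp add: t_def)
        have m: "0 < mass x" using mass_pos[OF x] .
        have w: "0 \<le> ?w x" using x h_pos[of "cmod x"] by simp
        have X0: "0 \<le> X x" using m by (simp add: X_def)
        define Mx where "Mx = measure \<nu> (pseudohyperbolic_disc x r)"
        have M: "emeasure \<nu> (pseudohyperbolic_disc x r) = ennreal Mx"
          using fin[OF x] unfolding Mx_def by (intro emeasure_eq_ennreal_measure) auto
        have MX: "Mx * t powr (- (real n * q) - 2) = X x * ?w x"
        proof -
          have "X x * ?w x = (Mx / (mass x * t powr (real n * q))) * (mass x / t\<^sup>2)"
            using t by (simp add: X_def Mx_def mass_def t_def power2_eq_square)
          also have "\<dots> = Mx / (t powr (real n * q) * t\<^sup>2)" using m by simp
          also have "t powr (real n * q) * t\<^sup>2 = t powr (real n * q + 2)" using t by (simp add: powr_add)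
          also have "Mx / t powr (real n * q + 2) = Mx * t powr (- (real n * q) - 2)"
            using powr_minus_divide[of t "real n * q + 2"] by simp
          finally show ?thesis by simp
        qed
        have "cmod (f x) powr q * X x \<le> \<theta> * (cmod (f x) powr q) powr (p / q) + \<theta> powr (- q / (p - q)) * X x powr \<sigma>"
          using X0 \<theta> by (intro young) auto
        then have "cmod (f x) powr q * X x * ?w x \<le> (\<theta> * cmod (f x) powr p + \<theta> powr (- q / (p - q)) * X x powr \<sigma>) * ?w x"
          using w q by (intro mult_right_mono) (auto simp: powr_powr)
        then have le: "cmod (f x) powr q * (Mx * t powr (- (real n * q) - 2)) \<le> \<theta> * (cmod (f x) powr p * ?w x) + \<theta> powr (- q / (p - q)) * (X x powr \<sigma> * ?w x)"
          unfolding MX by (simp only: distrib_right mult.assoc)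
        have "ennreal (cmod (f x) powr q) * (emeasure \<nu> (pseudohyperbolic_disc x r) * ennreal (t powr (- (real n * q) - 2)))
           = ennreal (cmod (f x) powr q * (Mx * t powr (- (real n * q) - 2)))"
          unfolding M by (simp add: ennreal_mult Mx_def)
        also have "\<dots> \<le> ennreal (\<theta> * (cmod (f x) powr p * ?w x) + \<theta> powr (- q / (p - q)) * (X x powr \<sigma> * ?w x))"
          by (rule ennreal_leI[OF le])
        also have "\<dots> = ennreal \<theta> * (ennreal (cmod (f x) powr p) * ennreal (?w x)) + ennreal (\<theta> powr (- q / (p - q))) * ennreal (X x powr \<sigma> * ?w x)"
        proof -
          have "ennreal (\<theta> * (cmod (f x) powr p * ?w x) + \<theta> powr (- q / (p - q)) * (X x powr \<sigma> * ?w x))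
             = ennreal (\<theta> * (cmod (f x) powr p * ?w x)) + ennreal (\<theta> powr (- q / (p - q)) * (X x powr \<sigma> * ?w x))"
            using w \<theta> by (intro ennreal_plus mult_nonneg_nonneg) auto
          also have "ennreal (\<theta> * (cmod (f x) powr p * ?w x)) = ennreal \<theta> * (ennreal (cmod (f x) powr p) * ennreal (?w x))"
            using \<theta> by (subst ennreal_mult', simp, subst ennreal_mult', simp_all)
          also have "ennreal (\<theta> powr (- q / (p - q)) * (X x powr \<sigma> * ?w x)) = ennreal (\<theta> powr (- q / (p - q))) * ennreal (X x powr \<sigma> * ?w x)"
            by (rule ennreal_mult') simp
          finally show ?thesis .
        qed
        finally show ?thesis using True x by (simp add: t_def pow_mod_def)
      qed simp
    qed
    also have "\<dots> = ennreal \<theta> * (\<integral>\<^sup>+x\<in>ball 0 1. pow_mod f p x * ennreal (?w x) \<partial>lborel)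
        + ennreal (\<theta> powr (- q / (p - q))) * (\<integral>\<^sup>+x\<in>?E. ennreal (X x powr \<sigma> * ?w x) \<partial>lborel)"
      using mf by (subst nn_integral_add) (auto simp: nn_integral_cmult)
    also have "(\<integral>\<^sup>+x\<in>ball 0 1. pow_mod f p x * ennreal (?w x) \<partial>lborel) = (\<integral>\<^sup>+x\<in>ball 0 1. ennreal (cmod (f x) powr p) * ennreal (?w x) \<partial>lborel)"
      unfolding pow_mod_def by (intro nn_integral_cong) (auto split: split_indicator)
    finally have "(\<integral>\<^sup>+x\<in>?E. ennreal (cmod (f x) powr q) * (emeasure \<nu> (pseudohyperbolic_disc x r) * ennreal ((1 - cmod x) powr (- (real n * q) - 2))) \<partial>lborel)
      \<le> ennreal \<theta> * (\<integral>\<^sup>+x\<in>ball 0 1. ennreal (cmod (f x) powr p) * ennreal (?w x) \<partial>lborel)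
        + ennreal (\<theta> powr (- q / (p - q))) * (\<integral>\<^sup>+x\<in>?E. ennreal (X x powr \<sigma> * ?w x) \<partial>lborel)" .
    also have "\<dots> \<le> ennreal \<theta> * (ennreal CA * 1)
        + ennreal (\<theta> powr (- q / (p - q))) * (\<integral>\<^sup>+x\<in>?E. ennreal (X x powr \<sigma> * ?w x) \<partial>lborel)"
      by (intro add_right_mono mult_left_mono order_trans[OF CA(2)[OF f(1) p]] f(2)) auto
    finally have "ennreal C0 * (\<integral>\<^sup>+x\<in>?E. ennreal (cmod (f x) powr q) * (emeasure \<nu> (pseudohyperbolic_disc x r) * ennreal ((1 - cmod x) powr (- (real n * q) - 2))) \<partial>lborel)
      \<le> ennreal C0 * (ennreal \<theta> * (ennreal CA * 1)
        + ennreal (\<theta> powr (- q / (p - q))) * (\<integral>\<^sup>+x\<in>?E. ennreal (X x powr \<sigma> * ?w x) \<partial>lborel))"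
      by (rule mult_left_mono) simp
    also have "\<dots> = ennreal (C0 * CA * \<theta>) + ennreal (C0 * 1 * \<theta> powr (- q / (p - q))) * (\<integral>\<^sup>+x\<in>?E. ennreal (X x powr \<sigma> * ?w x) \<partial>lborel)"
      using C0 CA \<theta> by (simp add: distrib_left ennreal_mult mult_ac)
    also have "\<dots> \<le> ennreal (C * \<theta>) + ennreal (C * \<theta> powr (- q / (p - q))) * (\<integral>\<^sup>+x\<in>?E. ennreal (X x powr \<sigma> * ?w x) \<partial>lborel)"
      unfolding C_def using C0 \<theta> by (intro add_mono mult_right_mono ennreal_leI mult_left_mono) auto
    finally show "deriv_int_on (ball 0 1 - ball 0 \<rho>) n q \<nu> f
        \<le> ennreal (C * \<theta>) + ennreal (C * \<theta> powr (- q / (p - q))) * (\<integral>\<^sup>+x\<in>?E.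
            ennreal ((measure \<nu> (pseudohyperbolic_disc x r) / (mass x * (1 - cmod x) powr (real n * q))) powr (p / (p - q))
              * ?w x) \<partial>lborel)"
      unfolding X_def \<sigma>_def using C0(2)[OF f(1) s] by (rule order_trans[rotated])
  qed
qed

section \<open>Test functions\<close>

abbreviation test_function :: "nat \<Rightarrow> real \<Rightarrow> complex \<Rightarrow> complex \<Rightarrow> complex" where
  "test_function m p a \<equiv> (\<lambda>z. of_real ((1 - cmod a) ^ m / mass a powr (1 / p)) * inverse (1 - cnj a * z) ^ m)"

text \<open>The exponent is one larger than integrability requires: this makes the normalising factor
  \<open>t ^ m / mass a powr (1 / p)\<close> of order \<open>t = 1 - cmod a\<close>, so the test functions vanish locally uniformly
  at the boundary.\<close>

lemma test_functions:
  assumes p: "0 < p"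
  obtains m C where "0 < m" "0 < C"
    "\<And>a. cmod a < 1 \<Longrightarrow> bergman_int p (test_function m p a) \<le> ennreal C"
    "\<And>a. cmod a < 1 \<Longrightarrow> (1 - cmod a) ^ m / mass a powr (1 / p) \<le> C * (1 - cmod a)"
proof -
  obtain m0 where m0: "\<And>m. m0 \<le> m \<Longrightarrow> \<exists>C>0. \<forall>J a b. finite J \<longrightarrow> (\<forall>k\<in>J. a k \<in> whitney_box k \<and> 0 \<le> b k) \<longrightarrow>
      (\<integral>\<^sup>+z\<in>ball 0 1. ennreal (kernel_sum m J b a z powr p) * W (cmod z) \<partial>lborel)
        \<le> ennreal (C * (\<Sum>k\<in>J. b k powr p * ((1 - cmod (a k)) * h (cmod (a k)))))"
    using synthesis_le[OF p] by blast
  have single: "\<exists>C>0. \<forall>a. cmod a < 1 \<longrightarrow>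
      (\<integral>\<^sup>+z\<in>ball 0 1. ennreal ((((1 - cmod a) / cmod (1 - cnj a * z)) ^ m) powr p) * W (cmod z) \<partial>lborel) \<le> ennreal (C * mass a)"
    if m: "m0 \<le> m" for m
  proof -
    from m0[OF m] obtain C where C: "0 < C" and
      le: "\<forall>J a b. finite J \<longrightarrow> (\<forall>k\<in>J. a k \<in> whitney_box k \<and> 0 \<le> b k) \<longrightarrow>
      (\<integral>\<^sup>+z\<in>ball 0 1. ennreal (kernel_sum m J b a z powr p) * W (cmod z) \<partial>lborel)
        \<le> ennreal (C * (\<Sum>k\<in>J. b k powr p * ((1 - cmod (a k)) * h (cmod (a k)))))"
      by blast
    have "(\<integral>\<^sup>+z\<in>ball 0 1. ennreal ((((1 - cmod a) / cmod (1 - cnj a * z)) ^ m) powr p) * W (cmod z) \<partial>lborel) \<le> ennreal (C * mass a)"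
      if a: "cmod a < 1" for a
    proof -
      obtain k where k: "a \<in> whitney_box k" using whitney_box_cover[OF a] by blast
      show ?thesis using le[rule_format, of "{k}" "\<lambda>_. a" "\<lambda>_. 1"] k by (simp add: mass_def)
    qed
    then show ?thesis using C by blast
  qed
  obtain C0 where C0: "0 < C0" "\<And>a. cmod a < 1 \<Longrightarrow>
      (\<integral>\<^sup>+z\<in>ball 0 1. ennreal ((((1 - cmod a) / cmod (1 - cnj a * z)) ^ m0) powr p) * W (cmod z) \<partial>lborel) \<le> ennreal (C0 * mass a)"
    using single[of m0] by blast
  obtain C1' where C1': "0 < C1'" "\<And>a. cmod a < 1 \<Longrightarrow>
      (\<integral>\<^sup>+z\<in>ball 0 1. ennreal ((((1 - cmod a) / cmod (1 - cnj a * z)) ^ Suc m0) powr p) * W (cmod z) \<partial>lborel) \<le> ennreal (C1' * mass a)"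
    using single[of "Suc m0"] le_SucI[OF order_refl] by blast
  obtain c where c: "0 < c" "\<And>a. cmod a < 1 \<Longrightarrow> ennreal (c * ((1 - cmod a) * h (cmod a))) \<le> square_weight a"
    using carleson_square_weight by metis
  define c0 where "c0 = c * h 0"
  have c0: "0 < c0" "ennreal c0 \<le> (\<integral>\<^sup>+z\<in>ball (0::complex) 1. W (cmod z) \<partial>lborel)"
    using c(1) c(2)[of 0] h_pos[of 0] by (simp_all add: c0_def carleson_square_def)
  define C where "C = max C1' (2 ^ m0 * (C0 / c0) powr (1 / p))"
  \<comment> \<open>On the whole disc the kernel with exponent m0 is at least (t / 2) ^ m0, as its
    denominator is below 2. So its integral is at least the total weight times the p-th power of
    that number, and the upper bound by \<open>mass a\<close> becomes a lower bound for
    \<open>mass a\<close>.\<close>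
  have decay: "(1 - cmod a) ^ m0 \<le> 2 ^ m0 * (C0 / c0) powr (1 / p) * mass a powr (1 / p)" if a: "cmod a < 1" for a
  proof -
    define t where "t = 1 - cmod a"
    have t: "0 < t" using a by (simp add: t_def)
    have "ennreal (((t / 2) ^ m0) powr p) * ennreal c0 \<le> ennreal (((t / 2) ^ m0) powr p) * (\<integral>\<^sup>+z\<in>ball (0::complex) 1. W (cmod z) \<partial>lborel)"
      by (intro mult_left_mono c0) simp
    also have "\<dots> = (\<integral>\<^sup>+z. ennreal (((t / 2) ^ m0) powr p) * (W (cmod z) * indicator (ball (0::complex) 1) z) \<partial>lborel)"
      by (rule nn_integral_cmult[symmetric]) measurable
    also have "\<dots> \<le> (\<integral>\<^sup>+z\<in>ball 0 1. ennreal (((t / cmod (1 - cnj a * z)) ^ m0) powr p) * W (cmod z) \<partial>lborel)"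
    proof (intro nn_integral_mono)
      fix z :: complex
      show "ennreal (((t / 2) ^ m0) powr p) * (W (cmod z) * indicator (ball (0::complex) 1) z)
         \<le> ennreal (((t / cmod (1 - cnj a * z)) ^ m0) powr p) * W (cmod z) * indicator (ball 0 1) z"
      proof (cases "cmod z < 1")
        case True
        have X: "t \<le> cmod (1 - cnj a * z)" "cmod (1 - cnj a * z) < 2"
          using norm_1_minus_cnj_mult(1,4)[OF a True] by (auto simp: t_def)
        then have "t / 2 \<le> t / cmod (1 - cnj a * z)" using t by (intro divide_left_mono) auto
        then have "((t / 2) ^ m0) powr p \<le> ((t / cmod (1 - cnj a * z)) ^ m0) powr p"
          using t p by (intro powr_mono2 power_mono) auto
        then show ?thesis using True by (simp add: mult_right_mono ennreal_leI)
      qed simp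
    qed
    also have "\<dots> \<le> ennreal (C0 * mass a)" unfolding t_def by (rule C0(2)[OF a])
    finally have "ennreal (((t / 2) ^ m0) powr p * c0) \<le> ennreal (C0 * mass a)" using c0(1) by (simp add: ennreal_mult)
    then have "((t / 2) ^ m0) powr p * c0 \<le> C0 * mass a" using C0(1) mass_pos[OF a] by (simp add: ennreal_le_iff)
    then have "((t / 2) ^ m0) powr p \<le> (C0 / c0) * mass a" using c0(1) by (simp add: field_simps)
    then have "(((t / 2) ^ m0) powr p) powr (1 / p) \<le> ((C0 / c0) * mass a) powr (1 / p)" using p by (intro powr_mono2) auto
    also have "\<dots> = (C0 / c0) powr (1 / p) * mass a powr (1 / p)" using C0(1) c0(1) mass_pos[OF a] by (simp only: powr_mult)
    finally have "(t / 2) ^ m0 \<le> (C0 / c0) powr (1 / p) * mass a powr (1 / p)" using p t by (simp add: powr_powr)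
    then have "2 ^ m0 * (t / 2) ^ m0 \<le> 2 ^ m0 * ((C0 / c0) powr (1 / p) * mass a powr (1 / p))" by (intro mult_left_mono) auto
    then show ?thesis by (simp add: t_def[symmetric] power_divide mult.assoc)
  qed
  show ?thesis
  proof (rule that[of "Suc m0" C])
    show "0 < C" using C1' by (simp add: C_def less_max_iff_disj)
    fix a :: complex assume a: "cmod a < 1"
    define t where "t = 1 - cmod a"
    have t: "0 < t" using a by (simp add: t_def)
    have m: "0 < mass a" using mass_pos[OF a] .
    have "bergman_int p (\<lambda>z. of_real (t ^ Suc m0 / mass a powr (1 / p)) * inverse (1 - cnj a * z) ^ Suc m0)
      = (\<integral>\<^sup>+z. ennreal (1 / mass a) * (ennreal (((t / cmod (1 - cnj a * z)) ^ Suc m0) powr p) * W (cmod z) * indicator (ball 0 1) z) \<partial>lborel)"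
      unfolding bergman_int_def
    proof (intro nn_integral_cong)
      fix z :: complex
      have "cmod (of_real (t ^ Suc m0 / mass a powr (1 / p)) * inverse (1 - cnj a * z) ^ Suc m0)
        = (t / cmod (1 - cnj a * z)) ^ Suc m0 / mass a powr (1 / p)"
        using t m by (simp add: norm_mult norm_power norm_inverse norm_divide power_divide divide_inverse power_inverse power_mult_distrib del: power_Suc)
      then have "cmod (of_real (t ^ Suc m0 / mass a powr (1 / p)) * inverse (1 - cnj a * z) ^ Suc m0) powr p
        = ((t / cmod (1 - cnj a * z)) ^ Suc m0) powr p / mass a"
        using t m p by (simp add: powr_divide powr_powr del: power_Suc)
      also have "\<dots> = 1 / mass a * ((t / cmod (1 - cnj a * z)) ^ Suc m0) powr p" by simp
      finally have ceq: "cmod (of_real (t ^ Suc m0 / mass a powr (1 / p)) * inverse (1 - cnj a * z) ^ Suc m0) powr p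
        = 1 / mass a * ((t / cmod (1 - cnj a * z)) ^ Suc m0) powr p" .
      have "ennreal (1 / mass a * ((t / cmod (1 - cnj a * z)) ^ Suc m0) powr p)
        = ennreal (1 / mass a) * ennreal (((t / cmod (1 - cnj a * z)) ^ Suc m0) powr p)"
        using m by (intro ennreal_mult') simp
      then have "ennreal (cmod (of_real (t ^ Suc m0 / mass a powr (1 / p)) * inverse (1 - cnj a * z) ^ Suc m0) powr p)
        = ennreal (1 / mass a) * ennreal (((t / cmod (1 - cnj a * z)) ^ Suc m0) powr p)"
        by (simp only: ceq)
      then show "ennreal (cmod (of_real (t ^ Suc m0 / mass a powr (1 / p)) * inverse (1 - cnj a * z) ^ Suc m0) powr p) * W (cmod z) * indicator (ball 0 1) z
        = ennreal (1 / mass a) * (ennreal (((t / cmod (1 - cnj a * z)) ^ Suc m0) powr p) * W (cmod z) * indicator (ball 0 1) z)"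
        by (simp only: mult.assoc)
    qed
    also have "\<dots> = ennreal (1 / mass a) * (\<integral>\<^sup>+z\<in>ball 0 1. ennreal (((t / cmod (1 - cnj a * z)) ^ Suc m0) powr p) * W (cmod z) \<partial>lborel)"
      by (rule nn_integral_cmult) measurable
    also have "\<dots> \<le> ennreal (1 / mass a) * ennreal (C1' * mass a)"
      unfolding t_def by (intro mult_left_mono C1'(2) a) simp
    also have "\<dots> = ennreal C1'" using m C1'(1) by (subst ennreal_mult[symmetric]) auto
    also have "\<dots> \<le> ennreal C" by (intro ennreal_leI) (simp add: C_def)
    finally show "bergman_int p (\<lambda>z. of_real ((1 - cmod a) ^ Suc m0 / mass a powr (1 / p)) * inverse (1 - cnj a * z) ^ Suc m0) \<le> ennreal C"
      by (simp only: t_def)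
    have "t ^ m0 / mass a powr (1 / p) \<le> 2 ^ m0 * (C0 / c0) powr (1 / p)"
      using decay[OF a] m by (simp add: t_def pos_divide_le_eq)
    also have "\<dots> \<le> C" by (simp add: C_def)
    finally have "t ^ m0 / mass a powr (1 / p) * t \<le> C * t" using t by (intro mult_right_mono) auto
    then show "(1 - cmod a) ^ Suc m0 / mass a powr (1 / p) \<le> C * (1 - cmod a)" by (simp add: t_def mult.commute)
  qed simp
qed

lemma higher_deriv_test_function:
  assumes "cmod a < 1" "cmod z < 1"
  shows "cmod ((deriv ^^ n) (\<lambda>z. of_real c * inverse (1 - cnj a * z) ^ m) z)
    = \<bar>c\<bar> * (real (pochhammer m n) * cmod a ^ n * (1 / cmod (1 - cnj a * z)) ^ (m + n))"
proof -
  have "(deriv ^^ n) (\<lambda>z. \<Sum>k\<in>{()}. of_real c * inverse (1 - cnj a * z) ^ m) z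
    = (\<Sum>k\<in>{()}. of_real c * (of_nat (pochhammer m n) * cnj a ^ n * inverse (1 - cnj a * z) ^ (m + n)))"
    using assms by (intro higher_deriv_sum_inverse_power) auto
  then show ?thesis by (simp add: norm_mult norm_power norm_inverse divide_inverse)
qed

lemma holomorphic_test_function:
  assumes "cmod a < 1"
  shows "(\<lambda>z. of_real c * inverse (1 - cnj a * z) ^ m) holomorphic_on ball 0 1"
  using holomorphic_sum_inverse_power[of "{()}" "\<lambda>_. cnj a" "\<lambda>_. of_real c" m] assms by simp

lemma bergman_int_mono:
  assumes "\<And>z. cmod z < 1 \<Longrightarrow> cmod (f z) \<le> cmod (g z)" "0 < p"
  shows "bergman_int p f \<le> bergman_int p g"
  unfolding bergman_int_def using assms
  by (intro nn_integral_mono) (auto split: split_indicator intro!: mult_right_mono ennreal_leI powr_mono2)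

lemma bergman_int_cmult:
  assumes "f holomorphic_on ball 0 1" "0 < p"
  shows "bergman_int p (\<lambda>z. c * f z) = ennreal (cmod c powr p) * bergman_int p f"
proof -
  have [measurable]: "pow_mod f p \<in> borel_measurable borel" using borel_measurable_pow_mod[OF assms(1)] .
  have "bergman_int p (\<lambda>z. c * f z) = (\<integral>\<^sup>+z. ennreal (cmod c powr p) * (pow_mod f p z * W (cmod z) * indicator (ball 0 1) z) \<partial>lborel)"
    unfolding bergman_int_def pow_mod_def
    by (intro nn_integral_cong) (auto simp: norm_mult powr_mult ennreal_mult mult_ac split: split_indicator)
  also have "\<dots> = ennreal (cmod c powr p) * bergman_int p f"
    unfolding bergman_int_eq by (rule nn_integral_cmult) measurable
  finally show ?thesis .
qed

lemma bergman_int_1_finite: "bergman_int p (\<lambda>_. 1) < \<infinity>"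
proof -
  obtain C where C: "\<And>a. cmod a < 1 \<Longrightarrow> square_weight a \<le> ennreal (C * ((1 - cmod a) * h (cmod a)))"
    using carleson_square_weight by metis
  have "bergman_int p (\<lambda>_. 1) = (\<integral>\<^sup>+z\<in>carleson_square 0. W (cmod z) \<partial>lborel)"
    by (simp add: bergman_int_def carleson_square_def)
  also have "\<dots> \<le> ennreal (C * ((1 - cmod 0) * h (cmod 0)))" by (rule C) simp
  finally show ?thesis by (simp add: le_less_trans)
qed

end

subsection \<open>From doubling weights to profiles\<close>

lemma space_disc_area [simp]: "space disc_area = ball 0 1"
  by (simp add: disc_area_def space_scale_measure)

lemma sets_disc_area: "sets disc_area = sets (lebesgue_on (ball 0 1))"
  by (simp add: disc_area_def)

lemma measurable_disc_area_iff: "f \<in> borel_measurable disc_area \<longleftrightarrow> f \<in> borel_measurable (lebesgue_on (ball 0 1))"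
  by (rule iffI) (auto simp: measurable_def sets_disc_area)

lemma borel_in_sets_disc_area:
  assumes "A \<in> sets borel" "A \<subseteq> ball 0 1"
  shows "A \<in> sets disc_area"
  using assms by (auto simp: sets_disc_area sets_restrict_space_iff)

lemma nn_integral_disc_area:
  assumes "f \<in> borel_measurable disc_area"
  shows "(\<integral>\<^sup>+z. f z \<partial>disc_area) = ennreal (1 / pi) * (\<integral>\<^sup>+z\<in>ball 0 1. f z \<partial>lborel)"
proof -
  have "(\<integral>\<^sup>+z. f z \<partial>disc_area) = ennreal (1 / pi) * (\<integral>\<^sup>+z. f z \<partial>lebesgue_on (ball 0 1))"
    unfolding disc_area_def using assms by (intro nn_integral_scale_measure) (simp add: measurable_disc_area_iff)
  also have "(\<integral>\<^sup>+z. f z \<partial>lebesgue_on (ball 0 1)) = (\<integral>\<^sup>+z\<in>ball 0 1. f z \<partial>lebesgue)"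
    by (rule nn_integral_restrict_space) simp
  finally show ?thesis by (simp only: nn_integral_completion)
qed

lemma ennreal_inverse_pi_mult_finite: "ennreal (1 / pi) * X < \<infinity> \<longleftrightarrow> X < \<infinity>"
proof -
  have "0 < 1 / pi" by simp
  then have "ennreal (1 / pi) \<noteq> 0" by (simp only: ennreal_eq_0_iff not_le)
  then show ?thesis by (auto simp: ennreal_mult_less_top)
qed

lemma AE_disc_area_iff: "(AE z in disc_area. P z) \<longleftrightarrow> (AE z in lborel. z \<in> ball 0 1 \<longrightarrow> P z)"
proof -
  have null: "N \<in> null_sets disc_area \<longleftrightarrow> N \<in> null_sets (lebesgue_on (ball 0 1))" for N
    by (auto simp: null_sets_def disc_area_def)
  then have null_eq: "null_sets disc_area = null_sets (lebesgue_on (ball 0 1))" by blast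
  have "(AE z in disc_area. P z) \<longleftrightarrow> (AE z in lebesgue_on (ball 0 1). P z)"
    unfolding eventually_ae_filter null_eq by (simp add: space_restrict_space)
  also have "\<dots> \<longleftrightarrow> (AE z in lebesgue. z \<in> ball 0 1 \<longrightarrow> P z)" by (rule AE_restrict_space_iff) simp
  finally show ?thesis by (simp only: AE_completion_iff)
qed

lemma continuous_measurable_disc_area:
  fixes f :: "complex \<Rightarrow> 'a::euclidean_space"
  assumes "continuous_on (ball 0 1) f"
  shows "f \<in> borel_measurable disc_area"
  unfolding measurable_disc_area_iff using assms by (intro continuous_imp_measurable_on_sets_lebesgue) auto

lemma borel_measurable_disc_area:
  assumes "f \<in> borel_measurable borel"
  shows "f \<in> borel_measurable disc_area"
  unfolding measurable_disc_area_iff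
  using assms by (intro measurable_restrict_space1 measurable_completion) simp

text \<open>A null set of radii sweeps out a null set of the disc, because the radial integral
  dominates. The origin, of radius 0, is kept apart.\<close>

lemma AE_ball_radial:
  assumes "AE s in lborel. s \<in> {0<..<1} \<longrightarrow> P s"
  shows "AE z in lborel. z \<in> ball (0::complex) 1 \<longrightarrow> z \<noteq> 0 \<longrightarrow> P (cmod z)"
proof -
  obtain N where N0: "{s \<in> space lborel. \<not> (s \<in> {0<..<1} \<longrightarrow> P s)} \<subseteq> N" "emeasure lborel N = 0" "N \<in> sets lborel"
    by (rule AE_E[OF assms]) (rule that)
  have N: "{s. \<not> (s \<in> {0<..<1} \<longrightarrow> P s)} \<subseteq> N" "N \<in> sets borel" "emeasure lborel N = 0"
    using N0 by simp_all
  have "(\<integral>\<^sup>+z\<in>ball (0::complex) 1. indicator N (cmod z) \<partial>lborel) \<le> ennreal (2 * pi) * (\<integral>\<^sup>+s\<in>{0..<1}. indicator N s \<partial>lborel)"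
    using N(2) by (intro nn_integral_radial_le) auto
  also have "(\<integral>\<^sup>+s\<in>{0..<1}. indicator N s \<partial>lborel) \<le> (\<integral>\<^sup>+s. indicator N s \<partial>lborel)"
    by (intro nn_integral_mono) (auto split: split_indicator)
  also have "\<dots> = 0" using N by simp
  finally have "(\<integral>\<^sup>+z\<in>ball (0::complex) 1. indicator N (cmod z) \<partial>lborel) = 0" by (simp add: mult_left_mono)
  then have "AE z in lborel. indicator N (cmod z) * indicator (ball (0::complex) 1) z = (0::ennreal)"
    using N(2) by (subst (asm) nn_integral_0_iff_AE) auto
  then show ?thesis
  proof eventually_elim
    case (elim z)
    show ?case
    proof (intro impI)
      assume z: "z \<in> ball 0 1" "z \<noteq> 0"
      then have "cmod z \<notin> N" using elim by (auto simp: indicator_def split: if_splits)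
      moreover have "cmod z \<in> {0<..<1}" using z by simp
      ultimately show "P (cmod z)" using N(1) by blast
    qed
  qed
qed

text \<open>The weight is only Lebesgue measurable on the disc and a ray is a null set, so nothing
  is known beforehand about measurability along the ray. A Borel version g differs from the weight
  inside a null set N, almost every circle meets N in a null set of angles, and on such a circle the
  mean of g is the radial value of the weight. Circular means are Borel in the radius.\<close>

lemma radial_weight_profile:
  assumes "radial_weight \<omega>"
  obtains W where "W \<in> borel_measurable borel" "AE s in lborel. s \<in> {0<..<1} \<longrightarrow> ennreal (\<omega> (of_real s)) = W s"
    "AE z in lborel. z \<in> ball 0 1 \<longrightarrow> ennreal (\<omega> z) = W (cmod z)"
    "\<And>s. s < 0 \<Longrightarrow> W s = 0"
proof -
  have int: "integrable disc_area \<omega>" and rad: "\<And>z. z \<in> ball 0 1 \<Longrightarrow> \<omega> z = \<omega> (of_real (cmod z))"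
    using assms unfolding radial_weight_def weight_def by blast+
  have "\<omega> \<in> borel_measurable (lebesgue_on (ball 0 1))"
    using borel_measurable_integrable[OF int] by (simp add: measurable_disc_area_iff)
  then have "(\<lambda>z. indicator (ball 0 1) z *\<^sub>R \<omega> z) \<in> borel_measurable lebesgue"
    by (subst (asm) borel_measurable_restrict_space_iff) auto
  then have "\<exists>g\<in>borel_measurable lborel. AE z in lborel. indicator (ball 0 1) z *\<^sub>R \<omega> z = g z"
    by (rule completion_ex_borel_measurable_real)
  then obtain g :: "complex \<Rightarrow> real" where g: "g \<in> borel_measurable lborel"
    "AE z in lborel. indicator (ball 0 1) z *\<^sub>R \<omega> z = g z" by blast
  have gm [measurable]: "g \<in> borel_measurable borel" using g(1) by simp
  obtain N where N0: "{z \<in> space lborel. indicator (ball 0 1) z *\<^sub>R \<omega> z \<noteq> g z} \<subseteq> N" "emeasure lborel N = 0" "N \<in> sets lborel"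
    by (rule AE_E[OF g(2)]) (rule that)
  have N: "{z. indicator (ball 0 1) z *\<^sub>R \<omega> z \<noteq> g z} \<subseteq> N" "N \<in> sets borel" "emeasure lborel N = 0"
    using N0 by simp_all
  have [measurable]: "(indicator N :: complex \<Rightarrow> ennreal) \<in> borel_measurable borel" using N(2) by simp
  let ?k = "\<lambda>s. circle_avg (indicator N) (complex_of_real s)"
  have km [measurable]: "?k \<in> borel_measurable borel"
    by (intro measurable_compose[OF _ borel_measurable_circle_avg]) auto
  \<comment> \<open>N has mean 0 on almost every circle. Radius 0 is lost because the Jacobian
    vanishes there.\<close>
  have "0 = (\<integral>\<^sup>+z. indicator N z * indicator {..<1} (cmod z) \<partial>lborel)"
  proof -
    have "(\<integral>\<^sup>+z. indicator N z * indicator {..<1} (cmod z) \<partial>lborel) \<le> (\<integral>\<^sup>+z. indicator N z \<partial>lborel)"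
      by (intro nn_integral_mono) (auto split: split_indicator)
    then show ?thesis using N by simp
  qed
  also have "\<dots> = (\<integral>\<^sup>+z. circle_avg (indicator N) z * indicator {..<1} (cmod z) \<partial>lborel)"
    by (rule nn_integral_circle_avg) measurable
  also have "\<dots> = (\<integral>\<^sup>+z\<in>ball 0 1. ?k (cmod z) \<partial>lborel)"
  proof (intro nn_integral_cong)
    fix z :: complex
    have "circle_avg (indicator N) z = ?k (cmod z)" by (intro circle_avg_norm_cong) auto
    then show "circle_avg (indicator N) z * indicator {..<1} (cmod z) = ?k (cmod z) * indicator (ball 0 1) z"
      by (auto split: split_indicator)
  qed
  also have "\<dots> = (\<integral>\<^sup>+s\<in>{0..<1}. ennreal (2 * pi * s) * ?k s \<partial>lborel)"
    by (rule nn_integral_radial) measurable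
  finally have "(\<integral>\<^sup>+s\<in>{0..<1}. ennreal (2 * pi * s) * ?k s \<partial>lborel) = 0" by simp
  then have "AE s in lborel. ennreal (2 * pi * s) * ?k s * indicator {0..<1} s = 0"
    by (subst (asm) nn_integral_0_iff_AE) auto
  then have k0: "AE s in lborel. s \<in> {0<..<1} \<longrightarrow> ?k s = 0"
  proof eventually_elim
    case (elim s)
    show ?case
    proof
      assume s: "s \<in> {0<..<1}"
      then have "0 < 2 * pi * s" using pi_gt_zero by simp
      then have "ennreal (2 * pi * s) \<noteq> 0" by (simp only: ennreal_eq_0_iff not_le)
      moreover have "indicator {0..<1} s = (1 :: ennreal)" using s by simp
      ultimately show "?k s = 0" using elim by (simp only: mult_eq_0_iff simp_thms mult_1_right)
    qed
  qed
  \<comment> \<open>Set to 0 at negative radii, where the circular mean would reflect the values at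
    positive ones; the tail integral is then constant to the left of 0.\<close>
  define W where "W s = circle_avg (\<lambda>z. ennreal (g z)) (of_real s) * indicator {0..} s" for s
  have Wm [measurable]: "W \<in> borel_measurable borel"
  proof -
    have "(\<lambda>s. circle_avg (\<lambda>z. ennreal (g z)) (complex_of_real s)) \<in> borel_measurable borel"
      by (intro measurable_compose[OF _ borel_measurable_circle_avg]) auto
    then show ?thesis unfolding W_def[abs_def] by measurable
  qed
  have eqW: "ennreal (\<omega> (of_real s)) = W s" if s: "0 < s" "s < 1" and k: "?k s = 0" for s
  proof -
    have "(\<integral>\<^sup>+\<phi>\<in>{0..<2 * pi}. indicator N (of_real s * cis \<phi>) \<partial>lborel) = 0"
    proof -
      have "0 < 1 / (2 * pi)" by simp
      then have "ennreal (1 / (2 * pi)) \<noteq> 0" by (simp only: ennreal_eq_0_iff not_le)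
      then show ?thesis using k unfolding circle_avg_def by (simp only: mult_eq_0_iff simp_thms)
    qed
    then have "AE \<phi> in lborel. indicator N (of_real s * cis \<phi>) * indicator {0..<2 * pi} \<phi> = (0::ennreal)"
      by (subst (asm) nn_integral_0_iff_AE) auto
    then have "AE \<phi> in lborel. ennreal (g (of_real s * cis \<phi>)) * indicator {0..<2 * pi} \<phi> = ennreal (\<omega> (of_real s)) * indicator {0..<2 * pi} \<phi>"
    proof eventually_elim
      case (elim \<phi>)
      show ?case
      proof (cases "\<phi> \<in> {0..<2 * pi}")
        case True
        then have "of_real s * cis \<phi> \<notin> N" using elim by (auto simp: indicator_def split: if_splits)
        then have "indicator (ball 0 1) (of_real s * cis \<phi>) *\<^sub>R \<omega> (of_real s * cis \<phi>) = g (of_real s * cis \<phi>)" using N(1) by auto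
        moreover have "of_real s * cis \<phi> \<in> ball 0 1" using s by (simp add: norm_mult)
        moreover have "\<omega> (of_real s * cis \<phi>) = \<omega> (of_real s)" using rad[OF calculation(2)] s by (simp add: norm_mult)
        ultimately show ?thesis by simp
      qed simp
    qed
    then have "(\<integral>\<^sup>+\<phi>\<in>{0..<2 * pi}. ennreal (g (of_real s * cis \<phi>)) \<partial>lborel) = (\<integral>\<^sup>+\<phi>\<in>{0..<2 * pi}. ennreal (\<omega> (of_real s)) \<partial>lborel)"
      by (rule nn_integral_cong_AE)
    also have "\<dots> = ennreal (\<omega> (of_real s)) * ennreal (2 * pi)"
      by (subst nn_integral_cmult_indicator) auto
    finally have "circle_avg (\<lambda>z. ennreal (g z)) (of_real s) = ennreal (1 / (2 * pi)) * (ennreal (\<omega> (of_real s)) * ennreal (2 * pi))"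
      by (simp add: circle_avg_def)
    also have "\<dots> = (ennreal (1 / (2 * pi)) * ennreal (2 * pi)) * ennreal (\<omega> (of_real s))" by (simp only: mult_ac)
    also have "ennreal (1 / (2 * pi)) * ennreal (2 * pi) = 1" by (subst ennreal_mult[symmetric]) auto
    finally show ?thesis using s by (simp add: W_def)
  qed
  have A: "AE s in lborel. s \<in> {0<..<1} \<longrightarrow> ennreal (\<omega> (of_real s)) = W s"
    using k0 by eventually_elim (auto intro: eqW)
  have "AE z in lborel. z \<in> ball 0 1 \<longrightarrow> ennreal (\<omega> z) = W (cmod z)"
    using AE_ball_radial[OF A] AE_lborel_singleton[of 0]
  proof eventually_elim
    case (elim z)
    then show ?case using rad[of z] by auto
  qed
  moreover have "W s = 0" if "s < 0" for s using that by (simp add: W_def)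
  ultimately show ?thesis using that[OF Wm A] by blast
qed

text \<open>Joins a profile to a weight. The density is matched almost everywhere only, being a
  Borel version, whereas the tail integrals agree at every point of the disc; \<open>hat_eq\<close>
  also records that they are finite.\<close>

locale bergman_setting = doubling_profile W h C1 C2 K for W h C1 C2 K +
  fixes \<omega> :: "complex \<Rightarrow> real"
  assumes weight: "weight \<omega>"
    and W_eq: "AE z in lborel. z \<in> ball 0 1 \<longrightarrow> ennreal (\<omega> z) = W (cmod z)"
    and hat_eq: "\<And>z. cmod z < 1 \<Longrightarrow> omega_hat \<omega> z = ennreal (h (cmod z))"

text \<open>Two facts have to be extracted from the definition. The tail is finite: away from the
  origin by area integrability, at the origin by condition (1) with r = 0. The tail is positive: if
  it vanished at some r < 1, iterating condition (1) would make it vanish at the origin, and the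
  weight would be 0 almost everywhere.\<close>

lemma doubling_weight_setting:
  assumes dw: "doubling_weight \<omega>"
  obtains W h C1 C2 K where "bergman_setting W h C1 C2 K \<omega>"
proof -
  have rw: "radial_weight \<omega>" using dw by (simp add: doubling_weight_def)
  then have w: "weight \<omega>" and nz: "\<not> (AE z in disc_area. \<omega> z = 0)"
    unfolding radial_weight_def by blast+
  obtain W where Wm [measurable]: "W \<in> borel_measurable borel" and W1: "AE s in lborel. s \<in> {0<..<1} \<longrightarrow> ennreal (\<omega> (of_real s)) = W s"
    and W2: "AE z in lborel. z \<in> ball 0 1 \<longrightarrow> ennreal (\<omega> z) = W (cmod z)" and W0: "\<And>s. s < 0 \<Longrightarrow> W s = 0"
  proof (rule radial_weight_profile[OF rw])
    fix W assume a: "W \<in> borel_measurable borel" "AE s in lborel. s \<in> {0<..<1} \<longrightarrow> ennreal (\<omega> (of_real s)) = W s"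
      "AE z in lborel. z \<in> ball 0 1 \<longrightarrow> ennreal (\<omega> z) = W (cmod z)" "\<And>s. s < 0 \<Longrightarrow> W s = 0"
    show thesis by (rule that[OF a])
  qed
  define H where "H r = (\<integral>\<^sup>+s\<in>{r..<1}. W s \<partial>lborel)" for r
  have hat: "omega_hat \<omega> z = H (cmod z)" for z
  proof -
    have "omega_hat \<omega> z = (\<integral>\<^sup>+s\<in>{cmod z..<1}. ennreal (\<omega> (of_real s)) \<partial>lborel)"
      unfolding omega_hat_def by (rule nn_integral_completion)
    also have "\<dots> = H (cmod z)"
      unfolding H_def
    proof (rule nn_integral_cong_AE)
      show "AE s in lborel. ennreal (\<omega> (of_real s)) * indicator {cmod z..<1} s = W s * indicator {cmod z..<1} s"
        using W1 AE_lborel_singleton[of "0::real"]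
      proof eventually_elim
        case (elim s)
        show ?case
        proof (cases "s \<in> {cmod z..<1}")
          case True
          then have "0 \<le> s" using norm_ge_zero[of z] by (meson atLeastLessThan_iff order_trans)
          then have "0 < s" using elim(2) by simp
          then show ?thesis using elim(1) True by auto
        qed simp
      qed
    qed
    finally show ?thesis .
  qed
  obtain D1 :: real where D1: "1 \<le> D1" "\<And>r. 0 \<le> r \<Longrightarrow> r < 1 \<Longrightarrow> H r \<le> ennreal D1 * H ((1 + r) / 2)"
  proof -
    obtain C :: real where C: "1 \<le> C" "\<And>r. 0 \<le> r \<Longrightarrow> r < 1 \<Longrightarrow> omega_hat \<omega> (of_real r) \<le> ennreal C * omega_hat \<omega> (of_real ((1 + r) / 2))"
      using dw unfolding doubling_weight_def by blast
    have "H r \<le> ennreal C * H ((1 + r) / 2)" if "0 \<le> r" "r < 1" for r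
    proof -
      have "cmod (of_real ((1 + r) / 2)) = (1 + r) / 2" using that by (simp only: norm_of_real) simp
      then show ?thesis using C(2)[OF that] that by (simp only: hat norm_of_real) simp
    qed
    then show ?thesis using C(1) that by blast
  qed
  obtain K D2 :: real where D2: "1 < K" "1 < D2" "\<And>r. 0 \<le> r \<Longrightarrow> r < 1 \<Longrightarrow> ennreal D2 * H (1 - (1 - r) / K) \<le> H r"
  proof -
    obtain K C :: real where C: "1 < K" "1 < C" "\<And>r. 0 \<le> r \<Longrightarrow> r < 1 \<Longrightarrow> ennreal C * omega_hat \<omega> (of_real (1 - (1 - r) / K)) \<le> omega_hat \<omega> (of_real r)"
      using dw unfolding doubling_weight_def by blast
    have "ennreal C * H (1 - (1 - r) / K) \<le> H r" if "0 \<le> r" "r < 1" for r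
    proof -
      have "(1 - r) / K \<le> (1 - r) / 1" using that C(1) by (intro divide_left_mono) auto
      then have "0 \<le> 1 - (1 - r) / K" using that by simp
      then have "cmod (of_real (1 - (1 - r) / K)) = 1 - (1 - r) / K" by (simp only: norm_of_real abs_of_nonneg)
      then show ?thesis using C(3)[OF that] that by (simp only: hat norm_of_real) simp
    qed
    then show ?thesis using C(1,2) that by blast
  qed
  have mono: "H s \<le> H r" if "r \<le> s" for r s
    unfolding H_def using that by (intro nn_integral_mono) (auto split: split_indicator)
  \<comment> \<open>Beyond radius 1 / 2 the Jacobian 2 * pi * s is at least 1, so area integrability
    bounds the one-dimensional tail.\<close>
  have fin_half: "H (1 / 2) < \<infinity>"
  proof -
    have int: "integrable disc_area \<omega>" using w by (simp add: weight_def)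
    have "ennreal (1 / pi) * (\<integral>\<^sup>+z\<in>ball 0 1. ennreal (norm (\<omega> z)) \<partial>lborel) = (\<integral>\<^sup>+z. ennreal (norm (\<omega> z)) \<partial>disc_area)"
      using borel_measurable_integrable[OF int] by (intro nn_integral_disc_area[symmetric]) auto
    also have "\<dots> < \<infinity>" using int by (simp add: integrable_iff_bounded)
    finally have f1: "(\<integral>\<^sup>+z\<in>ball 0 1. ennreal (norm (\<omega> z)) \<partial>lborel) < \<infinity>"
      by (auto simp: ennreal_mult_less_top)
    have "H (1 / 2) \<le> (\<integral>\<^sup>+s\<in>{0..<1}. ennreal (2 * pi * s) * W s \<partial>lborel)"
      unfolding H_def
    proof (intro nn_integral_mono)
      fix s :: real
      show "W s * indicator {1 / 2..<1} s \<le> ennreal (2 * pi * s) * W s * indicator {0..<1} s"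
      proof (cases "s \<in> {1 / 2..<1}")
        case True
        then have "1 \<le> 2 * pi * s" using mult_mono[of 1 pi 1 "2 * s"] pi_ge_two by simp
        then have "ennreal 1 \<le> ennreal (2 * pi * s)" by (rule ennreal_leI)
        then have "1 * W s \<le> ennreal (2 * pi * s) * W s" by (intro mult_right_mono) auto
        then show ?thesis using True by simp
      qed simp
    qed
    also have "\<dots> = (\<integral>\<^sup>+z\<in>ball 0 1. W (cmod z) \<partial>lborel)" by (rule nn_integral_radial[symmetric]) measurable
    also have "\<dots> = (\<integral>\<^sup>+z\<in>ball 0 1. ennreal (norm (\<omega> z)) \<partial>lborel)"
    proof (rule nn_integral_cong_AE)
      show "AE z in lborel. W (cmod z) * indicator (ball 0 1) z = ennreal (norm (\<omega> z)) * indicator (ball 0 1) z"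
        using W2 by eventually_elim (use w in \<open>auto simp: weight_def split: split_indicator\<close>)
    qed
    finally show ?thesis using f1 by (rule le_less_trans)
  qed
  have fin: "H r < \<infinity>" for r
  proof -
    have "H 0 \<le> ennreal D1 * H (1 / 2)" using D1(2)[of 0] by simp
    also have "\<dots> < \<infinity>" using fin_half by (simp add: ennreal_mult_less_top)
    finally have "H 0 < \<infinity>" .
    moreover have "H r \<le> H 0"
    proof (cases "r < 0")
      case True
      have "H r = H 0" unfolding H_def
        using True by (intro nn_integral_cong) (auto simp: W0 split: split_indicator)
      then show ?thesis by simp
    qed (use mono in auto)
    ultimately show ?thesis by (rule le_less_trans[rotated])
  qed
  define h where "h r = enn2real (H r)" for r
  have Hh: "H r = ennreal (h r)" for r using fin[of r] by (simp add: h_def)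
  have h0: "0 \<le> h r" for r by (simp add: h_def)
  have hm: "h \<in> borel_measurable borel"
  proof -
    have "mono (\<lambda>r. - h r)"
      using mono fin by (intro monoI) (auto simp: h_def intro!: enn2real_mono)
    then have "(\<lambda>r. - h r) \<in> borel_measurable borel" by (rule borel_measurable_mono)
    then have "(\<lambda>r. - (- h r)) \<in> borel_measurable borel" by (rule borel_measurable_uminus)
    then show ?thesis by simp
  qed
  have hpos: "0 < h r" if r: "0 \<le> r" "r < 1" for r
  proof (rule ccontr)
    assume "\<not> 0 < h r"
    then have Hr: "H r = 0" using h0[of r] by (simp add: Hh)
    have step: "H 0 \<le> ennreal (D1 ^ k) * H (1 - 1 / 2 ^ k)" for k
    proof (induction k)
      case (Suc k)
      have e: "(1 + (1 - 1 / 2 ^ k)) / 2 = 1 - 1 / (2::real) ^ Suc k" by (simp add: field_simps)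
      have "H (1 - 1 / 2 ^ k) \<le> ennreal D1 * H ((1 + (1 - 1 / 2 ^ k)) / 2)" by (intro D1(2)) (auto simp: field_simps)
      then have "ennreal (D1 ^ k) * H (1 - 1 / 2 ^ k) \<le> ennreal (D1 ^ k) * (ennreal D1 * H (1 - 1 / 2 ^ Suc k))"
        unfolding e by (intro mult_left_mono) auto
      also have "\<dots> = ennreal (D1 ^ Suc k) * H (1 - 1 / 2 ^ Suc k)"
        using D1(1) by (simp add: ennreal_mult mult_ac)
      finally show ?case using Suc by (rule order_trans[rotated])
    qed simp
    obtain k :: nat where k: "1 / (1 - r) < 2 ^ k" using real_arch_pow[of 2] by auto
    then have "1 / 2 ^ k \<le> 1 - r" using r by (simp add: field_simps)
    then have "H (1 - 1 / 2 ^ k) \<le> H r" by (intro mono) simp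
    then have "H 0 \<le> 0" using step[of k] Hr by simp
    then have "(\<integral>\<^sup>+s\<in>{0..<1}. W s \<partial>lborel) = 0" by (simp add: H_def)
    then have "AE s in lborel. W s * indicator {0..<1} s = 0" by (subst (asm) nn_integral_0_iff_AE) auto
    then have "AE s in lborel. s \<in> {0<..<1} \<longrightarrow> W s = 0" by eventually_elim (auto split: split_indicator_asm)
    from AE_ball_radial[OF this] W2 AE_lborel_singleton[of "0::complex"]
    have "AE z in lborel. z \<in> ball 0 1 \<longrightarrow> \<omega> z = 0"
    proof eventually_elim
      case (elim z)
      show ?case
      proof
        assume z: "z \<in> ball 0 1"
        then have "ennreal (\<omega> z) = 0" using elim by simp
        moreover have "0 \<le> \<omega> z" using w z unfolding weight_def by blast
        ultimately show "\<omega> z = 0" by (simp add: ennreal_eq_0_iff)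
      qed
    qed
    then show False using nz by (simp add: AE_disc_area_iff)
  qed
  have "bergman_setting W h D1 D2 K \<omega>"
  proof
    show "(\<integral>\<^sup>+s\<in>{r..<1}. W s \<partial>lborel) = ennreal (h r)" for r using Hh[of r] by (simp add: H_def)
    show "h r \<le> D1 * h ((1 + r) / 2)" if "0 \<le> r" "r < 1" for r
    proof -
      have "ennreal (h r) \<le> ennreal (D1 * h ((1 + r) / 2))"
        using D1(2)[OF that] D1(1) h0 by (simp add: Hh ennreal_mult)
      then show ?thesis using D1(1) h0 by (subst (asm) ennreal_le_iff) auto
    qed
    show "D2 * h (1 - (1 - r) / K) \<le> h r" if "0 \<le> r" "r < 1" for r
    proof -
      have "ennreal (D2 * h (1 - (1 - r) / K)) \<le> ennreal (h r)"
        using D2(3)[OF that] D2(2) h0 by (simp add: Hh ennreal_mult)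
      then show ?thesis using h0 by (subst (asm) ennreal_le_iff) auto
    qed
  qed (use Wm hm hpos D1(1) D2(1,2) w W2 hat Hh in auto)
  then show ?thesis by (rule that)
qed

text \<open>A measure on the disc lives on a restricted space; extended by zero to the Borel sets of
  the plane it can be paired with area in Tonelli's theorem and evaluated on arbitrary Borel sets of
  the plane.\<close>

definition disc_ext :: "complex measure \<Rightarrow> complex measure" where
  "disc_ext \<mu> = distr \<mu> borel (\<lambda>z. z)"

lemma borel_measure_on_disc_space: "borel_measure_on_disc \<mu> \<Longrightarrow> space \<mu> = ball 0 1"
  unfolding borel_measure_on_disc_def by (drule sets_eq_imp_space_eq) (simp add: space_restrict_space)

lemma borel_measurable_on_disc:
  assumes "borel_measure_on_disc \<mu>" "F \<in> borel_measurable borel"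
  shows "F \<in> borel_measurable \<mu>"
proof -
  have "F \<in> borel_measurable (restrict_space borel (ball 0 1))" using assms(2) by (rule measurable_restrict_space1)
  then show ?thesis using assms(1) measurable_cong_sets[of \<mu> "restrict_space borel (ball 0 1)" borel borel]
    by (simp add: borel_measure_on_disc_def)
qed

lemma continuous_borel_measurable_on_disc:
  fixes f :: "complex \<Rightarrow> complex"
  assumes "borel_measure_on_disc \<mu>" "continuous_on (ball 0 1) f"
  shows "f \<in> borel_measurable \<mu>"
proof -
  have "f \<in> borel_measurable (restrict_space borel (ball 0 1))"
    using assms(2) by (rule borel_measurable_continuous_on_restrict)
  then show ?thesis using assms(1) measurable_cong_sets[of \<mu> "restrict_space borel (ball 0 1)" borel borel]
    by (simp add: borel_measure_on_disc_def)
qed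

lemma sets_disc_ext [simp]: "sets (disc_ext \<mu>) = sets borel"
  by (simp add: disc_ext_def)

lemma emeasure_disc_ext:
  assumes "borel_measure_on_disc \<mu>" "A \<in> sets borel"
  shows "emeasure (disc_ext \<mu>) A = emeasure \<mu> (A \<inter> ball 0 1)"
proof -
  have "(\<lambda>z. z) \<in> measurable \<mu> borel" using borel_measurable_on_disc[OF assms(1), of "\<lambda>z. z"] by simp
  then show ?thesis unfolding disc_ext_def using assms by (subst emeasure_distr) (auto simp: borel_measure_on_disc_space)
qed

lemma nn_integral_disc_ext:
  assumes "borel_measure_on_disc \<mu>" "A \<in> sets borel" "A \<subseteq> ball 0 1"
    "(\<lambda>z. F z * indicator (ball 0 1) z) \<in> borel_measurable borel"
  shows "(\<integral>\<^sup>+z\<in>A. F z \<partial>disc_ext \<mu>) = (\<integral>\<^sup>+z\<in>A. F z \<partial>\<mu>)"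
proof -
  have m: "(\<lambda>z. z) \<in> measurable \<mu> borel" using borel_measurable_on_disc[OF assms(1), of "\<lambda>z. z"] by simp
  have eq: "(\<lambda>z. F z * indicator A z) = (\<lambda>z. (F z * indicator (ball 0 1) z) * indicator A z)"
    using assms(3) by (auto simp: fun_eq_iff split: split_indicator)
  have "(\<lambda>z. F z * indicator A z) \<in> borel_measurable borel"
    unfolding eq using assms(2) by (intro borel_measurable_times_ennreal[OF assms(4)] borel_measurable_indicator) auto
  then show ?thesis unfolding disc_ext_def using m by (subst nn_integral_distr) auto
qed

lemma Lp_space_higher_deriv_iff:
  assumes \<mu>: "borel_measure_on_disc \<mu>" and f: "f holomorphic_on ball 0 1"
  shows "(deriv ^^ n) f \<in> Lp_space \<mu> q \<longleftrightarrow> deriv_int_on (ball 0 1) n q (disc_ext \<mu>) f < \<infinity>"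
    and "Lp_norm \<mu> q ((deriv ^^ n) f) = enn2real (deriv_int_on (ball 0 1) n q (disc_ext \<mu>) f) powr (1 / q)"
proof -
  let ?g = "(deriv ^^ n) f"
  have c: "continuous_on (ball 0 1) ?g"
    using f by (intro holomorphic_on_imp_continuous_on holomorphic_higher_deriv) auto
  have m: "?g \<in> borel_measurable \<mu>" by (rule continuous_borel_measurable_on_disc[OF \<mu> c])
  have "(\<integral>\<^sup>+z\<in>ball 0 1. ennreal (cmod (?g z) powr q) \<partial>disc_ext \<mu>) = (\<integral>\<^sup>+z\<in>ball 0 1. ennreal (cmod (?g z) powr q) \<partial>\<mu>)"
    using borel_measurable_higher_deriv_powr[OF f] by (intro nn_integral_disc_ext \<mu>) auto
  also have "\<dots> = (\<integral>\<^sup>+z. ennreal (cmod (?g z) powr q) \<partial>\<mu>)"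
    by (intro nn_integral_cong) (simp add: borel_measure_on_disc_space[OF \<mu>])
  finally have I: "(\<integral>\<^sup>+z\<in>ball 0 1. ennreal (cmod (?g z) powr q) \<partial>disc_ext \<mu>) = (\<integral>\<^sup>+z. ennreal (cmod (?g z) powr q) \<partial>\<mu>)" .
  show "?g \<in> Lp_space \<mu> q \<longleftrightarrow> (\<integral>\<^sup>+z\<in>ball 0 1. ennreal (cmod (?g z) powr q) \<partial>disc_ext \<mu>) < \<infinity>"
    unfolding I Lp_space_def integrable_iff_bounded using m by simp
  show "Lp_norm \<mu> q ?g = enn2real (\<integral>\<^sup>+z\<in>ball 0 1. ennreal (cmod (?g z) powr q) \<partial>disc_ext \<mu>) powr (1 / q)"
    unfolding I Lp_norm_def using m by (subst integral_eq_nn_integral) auto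
qed

context bergman_setting
begin

lemma omega_nonneg: "cmod z < 1 \<Longrightarrow> 0 \<le> \<omega> z"
  using weight by (simp add: weight_def)

lemma omega_measurable: "\<omega> \<in> borel_measurable disc_area"
  using weight by (auto simp: weight_def)

lemma nn_integral_weighted_area:
  assumes F: "F \<in> borel_measurable disc_area"
  shows "(\<integral>\<^sup>+z. F z \<partial>weighted_area \<omega>) = ennreal (1 / pi) * (\<integral>\<^sup>+z\<in>ball 0 1. F z * W (cmod z) \<partial>lborel)"
proof -
  have "(\<integral>\<^sup>+z. F z \<partial>weighted_area \<omega>) = (\<integral>\<^sup>+z. ennreal (\<omega> z) * F z \<partial>disc_area)"
    unfolding weighted_area_def using F omega_measurable by (intro nn_integral_density) auto
  also have "\<dots> = ennreal (1 / pi) * (\<integral>\<^sup>+z\<in>ball 0 1. ennreal (\<omega> z) * F z \<partial>lborel)"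
    using F omega_measurable by (intro nn_integral_disc_area) auto
  also have "(\<integral>\<^sup>+z\<in>ball 0 1. ennreal (\<omega> z) * F z \<partial>lborel) = (\<integral>\<^sup>+z\<in>ball 0 1. F z * W (cmod z) \<partial>lborel)"
  proof (rule nn_integral_cong_AE)
    show "AE z in lborel. ennreal (\<omega> z) * F z * indicator (ball 0 1) z = F z * W (cmod z) * indicator (ball 0 1) z"
      using W_eq by eventually_elim (auto simp: mult.commute split: split_indicator)
  qed
  finally show ?thesis .
qed

lemma bergman_space_iff: "f \<in> bergman_space \<omega> p \<longleftrightarrow> f holomorphic_on ball 0 1 \<and> bergman_int p f < \<infinity>"
  and Lp_norm_weighted_area: "f holomorphic_on ball 0 1 \<Longrightarrow>
    Lp_norm (weighted_area \<omega>) p f = (enn2real (bergman_int p f) / pi) powr (1 / p)"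
proof -
  have sets: "f \<in> borel_measurable (weighted_area \<omega>) \<longleftrightarrow> f \<in> borel_measurable disc_area" for f :: "complex \<Rightarrow> complex"
    by (simp add: weighted_area_def)
  have m: "f \<in> borel_measurable disc_area" if "f holomorphic_on ball 0 1"
    using that by (intro continuous_measurable_disc_area holomorphic_on_imp_continuous_on)
  have I: "(\<integral>\<^sup>+z. ennreal (cmod (f z) powr p) \<partial>weighted_area \<omega>) = ennreal (1 / pi) * bergman_int p f" if "f holomorphic_on ball 0 1"
    unfolding bergman_int_def using m[OF that] by (intro nn_integral_weighted_area) auto
  note c = ennreal_inverse_pi_mult_finite
  show "f \<in> bergman_space \<omega> p \<longleftrightarrow> f holomorphic_on ball 0 1 \<and> bergman_int p f < \<infinity>"
  proof (cases "f holomorphic_on ball 0 1")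
    case f: True
    have "(\<lambda>z. cmod (f z) powr p) \<in> borel_measurable (weighted_area \<omega>)"
      using m[OF f] unfolding sets[symmetric] by measurable
    then have "f \<in> Lp_space (weighted_area \<omega>) p \<longleftrightarrow> (\<integral>\<^sup>+z. ennreal (cmod (f z) powr p) \<partial>weighted_area \<omega>) < \<infinity>"
      using m[OF f] by (simp add: Lp_space_def integrable_iff_bounded sets)
    then show ?thesis using f unfolding bergman_space_def I[OF f] c by simp
  qed (simp add: bergman_space_def)
  assume f: "f holomorphic_on ball 0 1"
  have "(\<integral>z. norm (f z) powr p \<partial>weighted_area \<omega>) = enn2real (\<integral>\<^sup>+z. ennreal (norm (f z) powr p) \<partial>weighted_area \<omega>)"
    using m[OF f] sets[of f] by (intro integral_eq_nn_integral) auto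
  also have "\<dots> = enn2real (bergman_int p f) / pi"
    by (simp add: I[OF f] enn2real_mult)
  finally show "Lp_norm (weighted_area \<omega>) p f = (enn2real (bergman_int p f) / pi) powr (1 / p)"
    by (simp add: Lp_norm_def)
qed

lemma weight_of_carleson_square_eq:
  "weight_of \<omega> (carleson_square a) = enn2real (square_weight a) / pi"
proof -
  let ?S = "carleson_square a"
  have sub: "?S \<subseteq> ball 0 1" by (auto simp: carleson_square_def)
  have mS: "?S \<in> sets disc_area" using sub by (intro borel_in_sets_disc_area) auto
  have m: "(\<lambda>z. indicator ?S z *\<^sub>R \<omega> z) \<in> borel_measurable disc_area"
    using mS omega_measurable by (intro borel_measurable_scaleR borel_measurable_indicator)
  have "weight_of \<omega> ?S = (\<integral>z. indicator ?S z *\<^sub>R \<omega> z \<partial>disc_area)"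
    by (simp add: weight_of_def set_lebesgue_integral_def)
  also have "\<dots> = enn2real (\<integral>\<^sup>+z. ennreal (indicator ?S z *\<^sub>R \<omega> z) \<partial>disc_area)"
    using m by (intro integral_eq_nn_integral AE_I2) (auto simp: omega_nonneg)
  also have "(\<integral>\<^sup>+z. ennreal (indicator ?S z *\<^sub>R \<omega> z) \<partial>disc_area) = ennreal (1 / pi) * (\<integral>\<^sup>+z\<in>ball 0 1. ennreal (indicator ?S z *\<^sub>R \<omega> z) \<partial>lborel)"
    using m by (intro nn_integral_disc_area) auto
  also have "(\<integral>\<^sup>+z\<in>ball 0 1. ennreal (indicator ?S z *\<^sub>R \<omega> z) \<partial>lborel) = (\<integral>\<^sup>+z\<in>?S. W (cmod z) \<partial>lborel)"
  proof (rule nn_integral_cong_AE)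
    show "AE z in lborel. ennreal (indicator ?S z *\<^sub>R \<omega> z) * indicator (ball 0 1) z = W (cmod z) * indicator ?S z"
      using W_eq by eventually_elim (use sub in \<open>auto split: split_indicator\<close>)
  qed
  finally show ?thesis by (simp add: enn2real_mult)
qed

lemma weight_of_carleson_square:
  obtains c C where "0 < c" "0 < C"
    "\<And>a. cmod a < 1 \<Longrightarrow> c * mass a \<le> weight_of \<omega> (carleson_square a)"
    "\<And>a. cmod a < 1 \<Longrightarrow> weight_of \<omega> (carleson_square a) \<le> C * mass a"
proof -
  obtain c C where cC0: "0 < c" "0 < C"
    "\<And>a. cmod a < 1 \<Longrightarrow> ennreal (c * ((1 - cmod a) * h (cmod a))) \<le> square_weight a"
    "\<And>a. cmod a < 1 \<Longrightarrow> square_weight a \<le> ennreal (C * ((1 - cmod a) * h (cmod a)))"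
  proof (rule carleson_square_weight)
    fix c C assume a: "0 < c" "0 < C"
      "\<And>a. cmod a < 1 \<Longrightarrow> ennreal (c * ((1 - cmod a) * h (cmod a))) \<le> square_weight a"
      "\<And>a. cmod a < 1 \<Longrightarrow> square_weight a \<le> ennreal (C * ((1 - cmod a) * h (cmod a)))"
    show thesis by (rule that[OF a])
  qed
  note cC = cC0[folded mass_def]
  note eq = weight_of_carleson_square_eq
  show ?thesis
  proof (rule that[of "c / pi" "C / pi"])
    fix a :: complex assume a: "cmod a < 1"
    have m: "0 < mass a" using mass_pos[OF a] .
    have fin: "square_weight a < \<infinity>" using cC(4)[OF a] by (simp add: le_less_trans)
    have "enn2real (ennreal (c * mass a)) \<le> enn2real (square_weight a)"
      using cC(3)[OF a] fin by (intro enn2real_mono) auto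
    then show "c / pi * mass a \<le> weight_of \<omega> (carleson_square a)"
      using cC(1) m by (simp add: eq divide_right_mono)
    have "enn2real (square_weight a) \<le> C * mass a"
      using cC(2) m cC(4)[OF a] by (intro enn2real_leI) auto
    then show "weight_of \<omega> (carleson_square a) \<le> C / pi * mass a"
      by (simp add: eq divide_right_mono)
  qed (use cC in auto)
qed

end

subsection \<open>Bounded and compact differentiation operators\<close>

definition deriv_int :: "nat \<Rightarrow> real \<Rightarrow> complex measure \<Rightarrow> (complex \<Rightarrow> complex) \<Rightarrow> ennreal" where
  "deriv_int n q \<nu> f = deriv_int_on (ball 0 1) n q \<nu> f"

text \<open>Stands in for the triangle inequality, for every positive exponent.\<close>

lemma norm_add_powr_le:
  fixes a b :: "'a::real_normed_vector"
  assumes "0 < p"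
  shows "norm (a + b) powr p \<le> 2 powr p * (norm a powr p + norm b powr p)"
proof -
  have "norm (a + b) \<le> 2 * max (norm a) (norm b)" using norm_triangle_ineq[of a b] by (simp add: max_def)
  then have "norm (a + b) powr p \<le> (2 * max (norm a) (norm b)) powr p" using assms by (intro powr_mono2) auto
  also have "\<dots> = 2 powr p * (max (norm a) (norm b)) powr p" by (simp add: powr_mult)
  also have "\<dots> \<le> 2 powr p * (norm a powr p + norm b powr p)" by (intro mult_left_mono) (auto simp: max_def)
  finally show ?thesis .
qed

lemma norm_diff_powr_le:
  fixes a b :: "'a::real_normed_vector"
  assumes "0 < p"
  shows "norm (a - b) powr p \<le> 2 powr p * (norm a powr p + norm b powr p)"
  using norm_add_powr_le[OF assms, of a "- b"] by simp

lemma
  fixes f g :: "'a \<Rightarrow> complex"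
  assumes f: "f \<in> Lp_space M q" and g: "g \<in> Lp_space M q" and q: "0 < q"
  shows integrable_diff_powr: "integrable M (\<lambda>z. cmod (f z - g z) powr q)"
    and integral_powr_le_diff: "(\<integral>z. cmod (f z) powr q \<partial>M)
      \<le> 2 powr q * ((\<integral>z. cmod (f z - g z) powr q \<partial>M) + (\<integral>z. cmod (g z) powr q \<partial>M))"
proof -
  have fi: "integrable M (\<lambda>z. cmod (f z) powr q)" "f \<in> borel_measurable M"
    and gi: "integrable M (\<lambda>z. cmod (g z) powr q)" "g \<in> borel_measurable M" using f g by (auto simp: Lp_space_def)
  show di: "integrable M (\<lambda>z. cmod (f z - g z) powr q)"
  proof (rule Bochner_Integration.integrable_bound)
    show "integrable M (\<lambda>z. 2 powr q * (cmod (f z) powr q + cmod (g z) powr q))"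
      by (intro integrable_mult_right Bochner_Integration.integrable_add fi(1) gi(1))
    show "(\<lambda>z. cmod (f z - g z) powr q) \<in> borel_measurable M" using fi(2) gi(2) by measurable
    show "AE z in M. norm (cmod (f z - g z) powr q) \<le> norm (2 powr q * (cmod (f z) powr q + cmod (g z) powr q))"
    proof (rule AE_I2)
      fix z
      show "norm (cmod (f z - g z) powr q) \<le> norm (2 powr q * (cmod (f z) powr q + cmod (g z) powr q))"
        using norm_diff_powr_le[OF q, of "f z" "g z"] by simp
    qed
  qed
  have "(\<integral>z. cmod (f z) powr q \<partial>M) \<le> (\<integral>z. 2 powr q * (cmod (f z - g z) powr q + cmod (g z) powr q) \<partial>M)"
  proof (rule integral_mono[OF fi(1)])
    show "integrable M (\<lambda>z. 2 powr q * (cmod (f z - g z) powr q + cmod (g z) powr q))"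
      by (intro integrable_mult_right Bochner_Integration.integrable_add gi(1) di)
    show "cmod (f z) powr q \<le> 2 powr q * (cmod (f z - g z) powr q + cmod (g z) powr q)" for z
      using norm_add_powr_le[OF q, of "f z - g z" "g z"] by simp
  qed
  also have "\<dots> = 2 powr q * ((\<integral>z. cmod (f z - g z) powr q \<partial>M) + (\<integral>z. cmod (g z) powr q \<partial>M))"
    using gi(1) di by simp
  finally show "(\<integral>z. cmod (f z) powr q \<partial>M)
    \<le> 2 powr q * ((\<integral>z. cmod (f z - g z) powr q \<partial>M) + (\<integral>z. cmod (g z) powr q \<partial>M))" .
qed

text \<open>Fatou's lemma identifies the limit g as zero, since |f k - g| tends to |g| pointwise; no
  almost everywhere convergent subsequence has to be extracted.\<close>

lemma Lp_limit_vanishing: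
  fixes f :: "nat \<Rightarrow> 'a \<Rightarrow> complex"
  assumes f: "\<And>k. f k \<in> Lp_space M q" and g: "g \<in> Lp_space M q" and q: "0 < q"
    and lim: "(\<lambda>k. Lp_norm M q (\<lambda>z. f k z - g z)) \<longlonglongrightarrow> 0"
    and pw: "\<And>z. z \<in> space M \<Longrightarrow> (\<lambda>k. f k z) \<longlonglongrightarrow> 0"
  shows "(\<lambda>k. \<integral>z. cmod (f k z) powr q \<partial>M) \<longlonglongrightarrow> 0"
proof -
  have fm: "f k \<in> borel_measurable M" and gm: "g \<in> borel_measurable M" for k using f[of k] g by (auto simp: Lp_space_def)
  let ?I = "\<lambda>k. \<integral>z. cmod (f k z - g z) powr q \<partial>M"
  have I0: "0 \<le> ?I k" for k by (rule Bochner_Integration.integral_nonneg) simp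
  have "(\<lambda>k. (?I k powr (1 / q)) powr q) \<longlonglongrightarrow> 0 powr q"
    using lim q unfolding Lp_norm_def by (intro tendsto_powr') auto
  then have lim': "?I \<longlonglongrightarrow> 0" using q I0 by (simp add: powr_powr)
  have "(\<integral>\<^sup>+z. ennreal (cmod (g z) powr q) \<partial>M) = (\<integral>\<^sup>+z. liminf (\<lambda>k. ennreal (cmod (f k z - g z) powr q)) \<partial>M)"
  proof (rule nn_integral_cong)
    fix z assume z: "z \<in> space M"
    have "(\<lambda>k. ennreal (cmod (f k z - g z) powr q)) \<longlonglongrightarrow> ennreal (cmod (0 - g z) powr q)"
      using q by (intro tendsto_ennrealI tendsto_powr' tendsto_norm tendsto_diff pw[OF z] tendsto_const) auto
    then have "liminf (\<lambda>k. ennreal (cmod (f k z - g z) powr q)) = ennreal (cmod (0 - g z) powr q)"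
      by (rule lim_imp_Liminf[OF sequentially_bot])
    then show "ennreal (cmod (g z) powr q) = liminf (\<lambda>k. ennreal (cmod (f k z - g z) powr q))" by simp
  qed
  also have "\<dots> \<le> liminf (\<lambda>k. \<integral>\<^sup>+z. ennreal (cmod (f k z - g z) powr q) \<partial>M)"
    using fm gm by (intro nn_integral_liminf) measurable
  also have "(\<lambda>k. \<integral>\<^sup>+z. ennreal (cmod (f k z - g z) powr q) \<partial>M) = (\<lambda>k. ennreal (?I k))"
    using integrable_diff_powr[OF f g q] by (intro ext nn_integral_eq_integral) auto
  also have "liminf (\<lambda>k. ennreal (?I k)) = ennreal 0"
    by (rule lim_imp_Liminf[OF sequentially_bot tendsto_ennrealI[OF lim']])
  finally have "(\<integral>\<^sup>+z. ennreal (cmod (g z) powr q) \<partial>M) = 0" by simp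
  then have g0: "(\<integral>z. cmod (g z) powr q \<partial>M) = 0"
    using gm by (subst integral_eq_nn_integral) auto
  have up: "(\<lambda>k. 2 powr q * (?I k + 0)) \<longlonglongrightarrow> 2 powr q * (0 + 0)" by (intro tendsto_intros lim')
  show ?thesis
  proof (rule tendsto_sandwich[OF always_eventually always_eventually tendsto_const])
    show "(\<lambda>k. 2 powr q * (?I k + 0)) \<longlonglongrightarrow> 0" using up by simp
    show "\<forall>k. 0 \<le> (\<integral>z. cmod (f k z) powr q \<partial>M)" by (intro allI Bochner_Integration.integral_nonneg) simp
    show "\<forall>k. (\<integral>z. cmod (f k z) powr q \<partial>M) \<le> 2 powr q * (?I k + 0)"
      using integral_powr_le_diff[OF f g q] by (simp add: g0)
  qed
qed

lemma tail_higher_deriv_cmult: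
  assumes f: "f holomorphic_on ball 0 1" and \<nu>: "sets \<nu> = sets borel" and A: "A \<in> sets borel" "A \<subseteq> ball 0 1"
  shows "deriv_int_on A n q \<nu> (\<lambda>z. c * f z)
    = ennreal (cmod c powr q) * deriv_int_on A n q \<nu> f"
proof -
  let ?F = "\<lambda>z. ennreal (cmod ((deriv ^^ n) f z) powr q) * indicator (ball 0 1) z"
  have m: "(\<lambda>z. ?F z * indicator A z) \<in> borel_measurable \<nu>"
    unfolding measurable_cong_sets[OF \<nu> refl]
    by (rule borel_measurable_times_ennreal[OF borel_measurable_higher_deriv_powr[OF f] borel_measurable_indicator[OF A(1)]])
  have eq: "?F z * indicator A z = ennreal (cmod ((deriv ^^ n) f z) powr q) * indicator A z" for z
    using A(2) by (auto split: split_indicator)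
  have "deriv_int_on A n q \<nu> (\<lambda>z. c * f z)
    = (\<integral>\<^sup>+z. ennreal (cmod c powr q) * (?F z * indicator A z) \<partial>\<nu>)"
  proof (intro nn_integral_cong)
    fix z
    show "ennreal (cmod ((deriv ^^ n) (\<lambda>z. c * f z) z) powr q) * indicator A z = ennreal (cmod c powr q) * (?F z * indicator A z)"
    proof (cases "z \<in> A")
      case True
      then have z: "z \<in> ball 0 1" using A(2) by blast
      have "(deriv ^^ n) (\<lambda>z. c * f z) z = c * (deriv ^^ n) f z" by (rule higher_deriv_cmult[OF f z]) simp
      then show ?thesis using True z by (simp add: norm_mult powr_mult ennreal_mult)
    qed simp
  qed
  also have "\<dots> = ennreal (cmod c powr q) * (\<integral>\<^sup>+z. ?F z * indicator A z \<partial>\<nu>)" by (rule nn_integral_cmult[OF m])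
  finally show ?thesis unfolding eq .
qed

text \<open>The disc of radius (1 + \<rho>) / 2 leaves room (1 - \<rho>) / 2 for Cauchy's inequality
  at every point of the smaller disc.\<close>

lemma nn_integral_higher_deriv_ball_le:
  assumes f: "f holomorphic_on ball 0 1" and \<rho>: "0 \<le> \<rho>" "\<rho> < 1" and q: "0 < q" and \<nu>: "sets \<nu> = sets borel"
    and M: "\<And>z. z \<in> cball 0 ((1 + \<rho>) / 2) \<Longrightarrow> cmod (f z) \<le> M"
  shows "deriv_int_on (ball 0 \<rho>) n q \<nu> f
    \<le> ennreal ((fact n * M / ((1 - \<rho>) / 2) ^ n) powr q) * emeasure \<nu> (ball 0 \<rho>)"
proof -
  have bd: "cmod ((deriv ^^ n) f z) \<le> fact n * M / ((1 - \<rho>) / 2) ^ n" if z: "z \<in> ball 0 \<rho>" for z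
  proof (rule Cauchy_inequality)
    have sub: "cball z ((1 - \<rho>) / 2) \<subseteq> cball 0 ((1 + \<rho>) / 2)"
    proof
      fix w assume "w \<in> cball z ((1 - \<rho>) / 2)"
      then have "cmod (w - z) \<le> (1 - \<rho>) / 2" by (simp add: dist_norm norm_minus_commute)
      moreover have "cmod w \<le> cmod (w - z) + cmod z" using norm_triangle_ineq[of "w - z" z] by simp
      ultimately show "w \<in> cball 0 ((1 + \<rho>) / 2)" using z by (simp add: field_simps)
    qed
    have sub2: "cball (0::complex) ((1 + \<rho>) / 2) \<subseteq> ball 0 1" using \<rho> by auto
    have h: "f holomorphic_on cball z ((1 - \<rho>) / 2)" by (rule holomorphic_on_subset[OF f]) (use sub sub2 in blast)
    show "f holomorphic_on ball z ((1 - \<rho>) / 2)" by (rule holomorphic_on_subset[OF h]) auto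
    show "continuous_on (cball z ((1 - \<rho>) / 2)) f" by (rule holomorphic_on_imp_continuous_on[OF h])
    show "0 < (1 - \<rho>) / 2" using \<rho> by simp
    fix x assume "cmod (z - x) = (1 - \<rho>) / 2"
    then have "x \<in> cball z ((1 - \<rho>) / 2)" by (simp add: dist_norm)
    then show "cmod (f x) \<le> M" using sub M by blast
  qed
  have "deriv_int_on (ball 0 \<rho>) n q \<nu> f
      \<le> (\<integral>\<^sup>+z\<in>ball 0 \<rho>. ennreal ((fact n * M / ((1 - \<rho>) / 2) ^ n) powr q) \<partial>\<nu>)"
    using bd q by (intro nn_integral_mono) (auto split: split_indicator intro!: ennreal_leI powr_mono2)
  also have "\<dots> = ennreal ((fact n * M / ((1 - \<rho>) / 2) ^ n) powr q) * emeasure \<nu> (ball 0 \<rho>)"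
    using \<nu> by (intro nn_integral_cmult_indicator) auto
  finally show ?thesis .
qed

lemma deriv_int_split:
  assumes f: "f holomorphic_on ball 0 1" and \<rho>: "\<rho> < 1" and \<nu>: "sets \<nu> = sets borel"
  shows "deriv_int n q \<nu> f = deriv_int_on (ball 0 \<rho>) n q \<nu> f
    + deriv_int_on (ball 0 1 - ball 0 \<rho>) n q \<nu> f"
proof -
  let ?F = "\<lambda>z. ennreal (cmod ((deriv ^^ n) f z) powr q) * indicator (ball 0 1) z"
  have m: "?F \<in> borel_measurable borel" by (rule borel_measurable_higher_deriv_powr[OF f])
  have mA: "(\<lambda>z. ?F z * indicator A z) \<in> borel_measurable \<nu>" if "A \<in> sets borel" for A
    unfolding measurable_cong_sets[OF \<nu> refl]
    by (rule borel_measurable_times_ennreal[OF m borel_measurable_indicator[OF that]])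
  have "deriv_int n q \<nu> f = (\<integral>\<^sup>+z. ?F z * indicator (ball 0 \<rho>) z + ?F z * indicator (ball 0 1 - ball 0 \<rho>) z \<partial>\<nu>)"
    unfolding deriv_int_def using \<rho> by (intro nn_integral_cong) (auto split: split_indicator)
  also have "\<dots> = (\<integral>\<^sup>+z\<in>ball 0 \<rho>. ?F z \<partial>\<nu>) + (\<integral>\<^sup>+z\<in>ball 0 1 - ball 0 \<rho>. ?F z \<partial>\<nu>)"
    by (intro nn_integral_add mA) auto
  also have "(\<integral>\<^sup>+z\<in>ball 0 \<rho>. ?F z \<partial>\<nu>) = deriv_int_on (ball 0 \<rho>) n q \<nu> f"
    using \<rho> by (intro nn_integral_cong) (auto split: split_indicator)
  also have "(\<integral>\<^sup>+z\<in>ball 0 1 - ball 0 \<rho>. ?F z \<partial>\<nu>) = deriv_int_on (ball 0 1 - ball 0 \<rho>) n q \<nu> f"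
    by (intro nn_integral_cong) (auto split: split_indicator)
  finally show ?thesis .
qed

lemma integral_higher_deriv_powr:
  assumes \<mu>: "borel_measure_on_disc \<mu>" and f: "f holomorphic_on ball 0 1" and q: "0 < q"
  shows "(\<integral>z. cmod ((deriv ^^ n) f z) powr q \<partial>\<mu>) = enn2real (deriv_int n q (disc_ext \<mu>) f)"
proof -
  have "(\<integral>z. cmod ((deriv ^^ n) f z) powr q \<partial>\<mu>) powr (1 / q) = enn2real (deriv_int n q (disc_ext \<mu>) f) powr (1 / q)"
    using Lp_space_higher_deriv_iff(2)[OF \<mu> f] unfolding Lp_norm_def deriv_int_def .
  then have "((\<integral>z. cmod ((deriv ^^ n) f z) powr q \<partial>\<mu>) powr (1 / q)) powr q
      = (enn2real (deriv_int n q (disc_ext \<mu>) f) powr (1 / q)) powr q" by simp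
  moreover have "0 \<le> (\<integral>z. cmod ((deriv ^^ n) f z) powr q \<partial>\<mu>)" by (rule Bochner_Integration.integral_nonneg) simp
  ultimately show ?thesis using q by (simp add: powr_powr)
qed

lemma disc_ext_compact_finite:
  assumes "borel_measure_on_disc \<mu>" "finite_on_compacts \<mu>" "\<rho> < 1"
  shows "emeasure (disc_ext \<mu>) (ball 0 \<rho>) < \<infinity>"
proof -
  have sub: "cball (0::complex) \<rho> \<subseteq> ball 0 1" using assms(3) by auto
  have "emeasure (disc_ext \<mu>) (ball 0 \<rho>) \<le> emeasure (disc_ext \<mu>) (cball 0 \<rho>)"
    by (rule emeasure_mono) auto
  also have "\<dots> = emeasure \<mu> (cball 0 \<rho>)" using emeasure_disc_ext[OF assms(1), of "cball 0 \<rho>"] sub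
    by (simp add: Int_absorb2)
  also have "\<dots> < \<infinity>" using assms(2) sub unfolding finite_on_compacts_def by (meson compact_cball)
  finally show ?thesis .
qed

section \<open>Operators through integrals over the disc and near the circle\<close>

context bergman_setting
begin

text \<open>Homogeneity: multiplication by M powr (- 1 / p) brings f into the unit ball. M is any
  positive upper bound rather than the integral itself, so a vanishing integral is included.\<close>

lemma tail_bound_scale:
  assumes f: "f holomorphic_on ball 0 1" and p: "0 < p" and M: "0 < M" "bergman_int p f \<le> ennreal M"
    and \<nu>: "sets \<nu> = sets borel" and A: "A \<in> sets borel" "A \<subseteq> ball 0 1" and \<epsilon>: "0 \<le> \<epsilon>"
    and bd: "\<And>f. f holomorphic_on ball 0 1 \<Longrightarrow> bergman_int p f \<le> 1 \<Longrightarrow>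
      deriv_int_on A n q \<nu> f \<le> ennreal \<epsilon>"
  shows "deriv_int_on A n q \<nu> f \<le> ennreal (\<epsilon> * M powr (q / p))"
proof -
  define c where "c = complex_of_real (M powr (- 1 / p))"
  have cp: "cmod c powr s = M powr (- s / p)" for s by (simp add: c_def powr_powr)
  have hol: "(\<lambda>z. c * f z) holomorphic_on ball 0 1" using f by (intro holomorphic_intros)
  have "bergman_int p (\<lambda>z. c * f z) \<le> ennreal (M powr (-1)) * ennreal M"
    unfolding bergman_int_cmult[OF f p] using p M by (simp add: cp mult_left_mono)
  also have "\<dots> = 1" using M by (simp add: ennreal_mult[symmetric] powr_minus_divide)
  finally have "deriv_int_on A n q \<nu> (\<lambda>z. c * f z) \<le> ennreal \<epsilon>" by (rule bd[OF hol])
  then have "ennreal (M powr (- q / p)) * deriv_int_on A n q \<nu> f \<le> ennreal \<epsilon>"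
    unfolding tail_higher_deriv_cmult[OF f \<nu> A] cp .
  then have "ennreal (M powr (q / p)) * (ennreal (M powr (- q / p)) * deriv_int_on A n q \<nu> f)
      \<le> ennreal (M powr (q / p)) * ennreal \<epsilon>" by (rule mult_left_mono) simp
  moreover have "ennreal (M powr (q / p)) * ennreal (M powr (- q / p)) = 1"
    using M by (simp add: ennreal_mult[symmetric] powr_add[symmetric])
  ultimately show ?thesis using \<epsilon> by (simp add: mult.assoc[symmetric] ennreal_mult mult.commute)
qed

lemma deriv_int_le_of_unit_bound:
  assumes f: "f holomorphic_on ball 0 1" "bergman_int p f < \<infinity>" and p: "0 < p" and q: "0 < q"
    and \<nu>: "sets \<nu> = sets borel" and C: "0 \<le> C"
    and bd: "\<And>f. f holomorphic_on ball 0 1 \<Longrightarrow> bergman_int p f \<le> 1 \<Longrightarrow> deriv_int n q \<nu> f \<le> ennreal C"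
  shows "deriv_int n q \<nu> f \<le> ennreal (C * enn2real (bergman_int p f) powr (q / p))"
proof -
  define X where "X = enn2real (bergman_int p f)"
  have X: "bergman_int p f = ennreal X" "0 \<le> X" using f(2) by (auto simp: X_def)
  have *: "deriv_int n q \<nu> f \<le> ennreal (C * M powr (q / p))" if M: "0 < M" "X \<le> M" for M
    unfolding deriv_int_def using M X bd C
    by (intro tail_bound_scale[OF f(1) p M(1) _ \<nu>]) (auto simp: deriv_int_def intro: ennreal_leI)
  show ?thesis
  proof (cases "X = 0")
    case False
    then show ?thesis using * X unfolding X_def[symmetric] by simp
  next
    case True
    \<comment> \<open>If the integral vanishes, every M > 0 is admissible, and M is sent to
      0.\<close>
    have lim: "((\<lambda>M. ennreal (C * M powr (q / p))) \<longlongrightarrow> ennreal (C * 0 powr (q / p))) (at_right 0)"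
      using p q by (intro tendsto_ennrealI tendsto_intros tendsto_powr') (auto simp: eventually_at_filter)
    have "deriv_int n q \<nu> f \<le> ennreal (C * 0 powr (q / p))"
      by (rule tendsto_lowerbound[OF lim eventually_mono[OF eventually_at_right_less]]) (auto simp: True intro!: *)
    then show ?thesis using True unfolding X_def[symmetric] by simp
  qed
qed

lemma bounded_operator_of_unit_bound:
  assumes \<mu>: "borel_measure_on_disc \<mu>" and p: "0 < p" and q: "0 < q" and C: "0 \<le> C"
    and bd: "\<And>f. f holomorphic_on ball 0 1 \<Longrightarrow> bergman_int p f \<le> 1 \<Longrightarrow> deriv_int n q (disc_ext \<mu>) f \<le> ennreal C"
  shows "bounded_operator \<omega> p \<mu> q (\<lambda>f. (deriv ^^ n) f)"
  unfolding bounded_operator_def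
proof (intro conjI ballI exI)
  fix f assume "f \<in> bergman_space \<omega> p"
  then have f: "f holomorphic_on ball 0 1" "bergman_int p f < \<infinity>" by (auto simp: bergman_space_iff)
  have D: "deriv_int n q (disc_ext \<mu>) f \<le> ennreal (C * enn2real (bergman_int p f) powr (q / p))"
    using f p q C bd by (intro deriv_int_le_of_unit_bound) auto
  show "(deriv ^^ n) f \<in> Lp_space \<mu> q"
    unfolding Lp_space_higher_deriv_iff(1)[OF \<mu> f(1)] deriv_int_def[symmetric]
    by (rule le_less_trans[OF D]) simp
  let ?X = "enn2real (bergman_int p f)"
  have "enn2real (deriv_int n q (disc_ext \<mu>) f) \<le> C * ?X powr (q / p)"
    using D C by (intro enn2real_leI) auto
  then have "enn2real (deriv_int n q (disc_ext \<mu>) f) powr (1 / q) \<le> (C * ?X powr (q / p)) powr (1 / q)"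
    using q by (intro powr_mono2) auto
  also have "\<dots> = C powr (1 / q) * pi powr (1 / p) * (?X / pi) powr (1 / p)"
    using C p q by (simp add: powr_mult powr_powr powr_divide)
  finally show "Lp_norm \<mu> q ((deriv ^^ n) f) \<le> (C powr (1 / q) * pi powr (1 / p)) * Lp_norm (weighted_area \<omega>) p f"
    unfolding Lp_space_higher_deriv_iff(2)[OF \<mu> f(1)] deriv_int_def[symmetric] Lp_norm_weighted_area[OF f(1)] .
qed

lemma deriv_int_le_of_bounded_operator:
  assumes \<mu>: "borel_measure_on_disc \<mu>" and p: "0 < p" and q: "0 < q"
    and bo: "bounded_operator \<omega> p \<mu> q (\<lambda>f. (deriv ^^ n) f)"
  obtains B where "0 \<le> B" "\<And>f. f holomorphic_on ball 0 1 \<Longrightarrow> bergman_int p f < \<infinity> \<Longrightarrow>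
    deriv_int n q (disc_ext \<mu>) f \<le> ennreal (B * enn2real (bergman_int p f) powr (q / p))"
proof -
  obtain C where C: "\<And>f. f \<in> bergman_space \<omega> p \<Longrightarrow> Lp_norm \<mu> q ((deriv ^^ n) f) \<le> C * Lp_norm (weighted_area \<omega>) p f"
    using bo unfolding bounded_operator_def by blast
  \<comment> \<open>The constant in the definition of boundedness carries no sign, and it is about
    to be raised to the power q.\<close>
  define C' where "C' = max C 0"
  show ?thesis
  proof (rule that)
    show "0 \<le> C' powr q * pi powr (- q / p)" by simp
    fix f assume f: "f holomorphic_on ball 0 1" "bergman_int p f < \<infinity>"
    let ?X = "enn2real (bergman_int p f)" and ?d = "enn2real (deriv_int n q (disc_ext \<mu>) f)"
    have fb: "f \<in> bergman_space \<omega> p" using f by (simp add: bergman_space_iff)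
    then have fin: "deriv_int n q (disc_ext \<mu>) f < \<infinity>"
      using bo unfolding bounded_operator_def deriv_int_def Lp_space_higher_deriv_iff(1)[OF \<mu> f(1), symmetric] by blast
    have "?d powr (1 / q) \<le> C * (?X / pi) powr (1 / p)"
      using C[OF fb] unfolding Lp_space_higher_deriv_iff(2)[OF \<mu> f(1)] deriv_int_def[symmetric] Lp_norm_weighted_area[OF f(1)] .
    also have "\<dots> \<le> C' * (?X / pi) powr (1 / p)" by (intro mult_right_mono) (auto simp: C'_def)
    finally have "(?d powr (1 / q)) powr q \<le> (C' * (?X / pi) powr (1 / p)) powr q"
      using q by (intro powr_mono2) auto
    then have "?d \<le> C' powr q * pi powr (- q / p) * ?X powr (q / p)"
      using q by (simp add: powr_powr powr_mult powr_divide C'_def powr_minus field_simps)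
    moreover have "ennreal ?d = deriv_int n q (disc_ext \<mu>) f" using fin by simp
    ultimately show "deriv_int n q (disc_ext \<mu>) f \<le> ennreal (C' powr q * pi powr (- q / p) * ?X powr (q / p))"
      by (metis ennreal_leI)
  qed
qed

text \<open>If the unit ball contained functions whose integrals exceed every k, a subsequence of
  their derivatives would converge in the target and so stay bounded by the quasi-triangle
  inequality, against the growth of k along the subsequence.\<close>

lemma bounded_operator_of_compact_operator:
  assumes \<mu>: "borel_measure_on_disc \<mu>" and p: "0 < p" and q: "0 < q"
    and co: "compact_operator \<omega> p \<mu> q (\<lambda>f. (deriv ^^ n) f)"
  shows "bounded_operator \<omega> p \<mu> q (\<lambda>f. (deriv ^^ n) f)"
proof -
  have "\<exists>k::nat. \<forall>f. f holomorphic_on ball 0 1 \<longrightarrow> bergman_int p f \<le> 1 \<longrightarrow> deriv_int n q (disc_ext \<mu>) f \<le> ennreal (real k)"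
  proof (rule ccontr)
    assume "\<not> ?thesis"
    then have "\<forall>k::nat. \<exists>f. f holomorphic_on ball 0 1 \<and> bergman_int p f \<le> 1 \<and> \<not> deriv_int n q (disc_ext \<mu>) f \<le> ennreal (real k)" by blast
    then obtain F where F: "\<And>k::nat. F k holomorphic_on ball 0 1 \<and> bergman_int p (F k) \<le> 1 \<and> \<not> deriv_int n q (disc_ext \<mu>) (F k) \<le> ennreal (real k)"
      by (rule choice[THEN exE]) blast
    have Fh: "F k holomorphic_on ball 0 1" and F1: "bergman_int p (F k) \<le> 1"
      and Fk: "\<not> deriv_int n q (disc_ext \<mu>) (F k) \<le> ennreal (real k)" for k using F[of k] by blast+
    have Fb: "F k \<in> bergman_space \<omega> p" for k using Fh F1[of k] by (simp add: bergman_space_iff le_less_trans)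
    have nb: "Lp_norm (weighted_area \<omega>) p (F k) \<le> (1 / pi) powr (1 / p)" for k
    proof -
      have "enn2real (bergman_int p (F k)) \<le> 1" using F1[of k] by (intro enn2real_leI) auto
      then show ?thesis unfolding Lp_norm_weighted_area[OF Fh]
        using p by (intro powr_mono2) (auto simp: divide_right_mono)
    qed
    have T: "(deriv ^^ n) (F k) \<in> Lp_space \<mu> q" for k using co Fb unfolding compact_operator_def by blast
    have "\<exists>g\<in>Lp_space \<mu> q. \<exists>s::nat \<Rightarrow> nat. strict_mono s
                \<and> (\<lambda>k. Lp_norm \<mu> q (\<lambda>z. (deriv ^^ n) (F (s k)) z - g z)) \<longlonglongrightarrow> 0"
      using co Fb nb unfolding compact_operator_def by blast
    then obtain g s where g: "g \<in> Lp_space \<mu> q" and s: "strict_mono (s :: nat \<Rightarrow> nat)"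
      and lim: "(\<lambda>k. Lp_norm \<mu> q (\<lambda>z. (deriv ^^ n) (F (s k)) z - g z)) \<longlonglongrightarrow> 0" by blast
    let ?d = "\<lambda>k z. (deriv ^^ n) (F (s k)) z - g z"
    define G where "G = (\<integral>z. cmod (g z) powr q \<partial>\<mu>)"
    have le: "(\<integral>z. cmod ((deriv ^^ n) (F (s k)) z) powr q \<partial>\<mu>) \<le> 2 powr q * ((\<integral>z. cmod (?d k z) powr q \<partial>\<mu>) + G)" for k
      unfolding G_def by (rule integral_powr_le_diff[OF T g q])
    have gt: "real k < (\<integral>z. cmod ((deriv ^^ n) (F k) z) powr q \<partial>\<mu>)" for k
    proof -
      have fin: "deriv_int n q (disc_ext \<mu>) (F k) < \<infinity>"
        unfolding deriv_int_def Lp_space_higher_deriv_iff(1)[OF \<mu> Fh, symmetric] by (rule T)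
      have "(\<integral>z. cmod ((deriv ^^ n) (F k) z) powr q \<partial>\<mu>) = enn2real (deriv_int n q (disc_ext \<mu>) (F k))"
        by (rule integral_higher_deriv_powr[OF \<mu> Fh q])
      moreover have "real k < enn2real (deriv_int n q (disc_ext \<mu>) (F k))"
      proof (rule ccontr)
        assume "\<not> ?thesis"
        then have "ennreal (enn2real (deriv_int n q (disc_ext \<mu>) (F k))) \<le> ennreal (real k)" by (intro ennreal_leI) simp
        moreover have "ennreal (enn2real (deriv_int n q (disc_ext \<mu>) (F k))) = deriv_int n q (disc_ext \<mu>) (F k)" using fin by simp
        ultimately show False using Fk[of k] by metis
      qed
      ultimately show ?thesis by simp
    qed
    have "eventually (\<lambda>k. Lp_norm \<mu> q (?d k) < 1) sequentially" using lim by (rule order_tendstoD) simp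
    moreover have "eventually (\<lambda>k. 2 powr q * (1 + G) \<le> real k) sequentially"
      by (rule eventually_sequentiallyI[of "nat \<lceil>2 powr q * (1 + G)\<rceil>"]) linarith
    ultimately have "eventually (\<lambda>k. False) sequentially"
    proof eventually_elim
      case (elim k)
      define I where "I = (\<integral>z. cmod (?d k z) powr q \<partial>\<mu>)"
      have I: "0 \<le> I" unfolding I_def by (rule Bochner_Integration.integral_nonneg) simp
      have "I powr (1 / q) < 1" using elim(1) by (simp add: Lp_norm_def I_def)
      then have "I \<le> 1" using q ge_one_powr_ge_zero[of I "1 / q"] by (meson linorder_not_le order_less_imp_le zero_le_divide_1_iff)
      then have "2 powr q * (I + G) \<le> 2 powr q * (1 + G)" by (intro mult_left_mono) auto
      moreover have "real k \<le> real (s k)" using seq_suble[OF s, of k] by simp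
      moreover have "real (s k) < 2 powr q * (I + G)" using gt[of "s k"] le[of k] unfolding I_def by simp
      ultimately show False using elim(2) by linarith
    qed
    then show False by simp
  qed
  then obtain k where k: "\<And>f. f holomorphic_on ball 0 1 \<Longrightarrow> bergman_int p f \<le> 1 \<Longrightarrow> deriv_int n q (disc_ext \<mu>) f \<le> ennreal (real k)"
    by blast
  show ?thesis by (rule bounded_operator_of_unit_bound[OF \<mu> p q _ k]) simp_all
qed

text \<open>The outer part is uniformly small by the scaled tail estimate. On the inner disc, which
  has finite measure, Cauchy's inequality turns locally uniform convergence of the functions into
  that of their derivatives.\<close>

lemma deriv_int_tendsto_0:
  assumes \<nu>: "sets \<nu> = sets borel" "\<And>\<rho>. \<rho> < 1 \<Longrightarrow> emeasure \<nu> (ball 0 \<rho>) < \<infinity>" and p: "0 < p" and q: "0 < q"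
    and tails: "\<And>\<epsilon>. 0 < \<epsilon> \<Longrightarrow> \<exists>\<rho>. 0 \<le> \<rho> \<and> \<rho> < 1 \<and> (\<forall>f. f holomorphic_on ball 0 1 \<longrightarrow> bergman_int p f \<le> 1 \<longrightarrow>
      deriv_int_on (ball 0 1 - ball 0 \<rho>) n q \<nu> f \<le> ennreal \<epsilon>)"
    and D: "\<And>k. D k holomorphic_on ball 0 1" "0 < M" "\<And>k. bergman_int p (D k) \<le> ennreal M"
    and lim: "\<And>\<rho>. \<rho> < 1 \<Longrightarrow> uniform_limit (cball 0 \<rho>) D (\<lambda>_. 0) sequentially"
  shows "(\<lambda>k. enn2real (deriv_int n q \<nu> (D k)) powr (1 / q)) \<longlonglongrightarrow> 0"
proof -
  have "(\<lambda>k. enn2real (deriv_int n q \<nu> (D k))) \<longlonglongrightarrow> 0"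
  proof (rule LIMSEQ_I)
    fix \<epsilon> :: real assume \<epsilon>: "0 < \<epsilon>"
    define \<delta> where "\<delta> = \<epsilon> / 3 / M powr (q / p)"
    have \<delta>: "0 < \<delta>" using \<epsilon> D(2) by (simp add: \<delta>_def)
    obtain \<rho> where \<rho>: "0 \<le> \<rho>" "\<rho> < 1" and tl: "\<And>f. f holomorphic_on ball 0 1 \<Longrightarrow> bergman_int p f \<le> 1 \<Longrightarrow>
      deriv_int_on (ball 0 1 - ball 0 \<rho>) n q \<nu> f \<le> ennreal \<delta>"
      using tails[OF \<delta>] by blast
    have tail: "deriv_int_on (ball 0 1 - ball 0 \<rho>) n q \<nu> (D k) \<le> ennreal (\<epsilon> / 3)" for k
    proof -
      have "deriv_int_on (ball 0 1 - ball 0 \<rho>) n q \<nu> (D k) \<le> ennreal (\<delta> * M powr (q / p))"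
        using \<delta> tl by (intro tail_bound_scale[OF D(1) p D(2,3) \<nu>(1)]) auto
      also have "\<delta> * M powr (q / p) = \<epsilon> / 3" using D(2) by (simp add: \<delta>_def)
      finally show ?thesis .
    qed
    define V where "V = measure \<nu> (ball 0 \<rho>)"
    have V: "emeasure \<nu> (ball 0 \<rho>) = ennreal V" "0 \<le> V"
      using \<nu>(2)[OF \<rho>(2)] by (auto simp: V_def emeasure_eq_ennreal_measure)
    define c where "c = fact n / ((1 - \<rho>) / 2) ^ n"
    have c: "0 < c" using \<rho> by (simp add: c_def)
    \<comment> \<open>Chosen so that (c * \<eta>) powr q times the measure V of the inner disc is at
      most \<epsilon> / 3; V + 1 avoids a division by zero.\<close>
    define \<eta> where "\<eta> = (\<epsilon> / 3 / (V + 1)) powr (1 / q) / c"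
    have \<eta>: "0 < \<eta>" using \<epsilon> V c by (simp add: \<eta>_def)
    have "(c * \<eta>) powr q * V = \<epsilon> / 3 / (V + 1) * V"
      using \<epsilon> V c q by (simp add: \<eta>_def powr_powr)
    also have "\<dots> \<le> \<epsilon> / 3" using \<epsilon> V by (simp add: field_simps)
    finally have small: "(c * \<eta>) powr q * V \<le> \<epsilon> / 3" .
    have "(1 + \<rho>) / 2 < 1" using \<rho> by simp
    then have "\<exists>N. \<forall>k\<ge>N. \<forall>z\<in>cball 0 ((1 + \<rho>) / 2). cmod (D k z) < \<eta>"
      using uniform_limitD[OF lim \<eta>, of "(1 + \<rho>) / 2"] unfolding eventually_sequentially dist_norm diff_0_right by blast
    then obtain N where N: "\<And>k z. N \<le> k \<Longrightarrow> z \<in> cball 0 ((1 + \<rho>) / 2) \<Longrightarrow> cmod (D k z) < \<eta>"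
      by blast
    show "\<exists>N. \<forall>k\<ge>N. norm (enn2real (deriv_int n q \<nu> (D k)) - 0) < \<epsilon>"
    proof (intro exI allI impI)
      fix k assume k: "N \<le> k"
      have "deriv_int_on (ball 0 \<rho>) n q \<nu> (D k)
          \<le> ennreal ((fact n * \<eta> / ((1 - \<rho>) / 2) ^ n) powr q) * emeasure \<nu> (ball 0 \<rho>)"
        by (rule nn_integral_higher_deriv_ball_le[OF D(1) \<rho> q \<nu>(1) less_imp_le[OF N[OF k]]])
      also have "\<dots> = ennreal ((c * \<eta>) powr q * V)" using V by (simp add: c_def ennreal_mult)
      also have "\<dots> \<le> ennreal (\<epsilon> / 3)" using small by (rule ennreal_leI)
      finally have "deriv_int n q \<nu> (D k) \<le> ennreal (\<epsilon> / 3) + ennreal (\<epsilon> / 3)"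
        unfolding deriv_int_split[OF D(1) \<rho>(2) \<nu>(1)] by (intro add_mono tail)
      also have "\<dots> = ennreal (\<epsilon> / 3 + \<epsilon> / 3)" using \<epsilon> by (simp add: ennreal_plus[symmetric] del: ennreal_plus)
      finally have "enn2real (deriv_int n q \<nu> (D k)) \<le> \<epsilon> / 3 + \<epsilon> / 3" using \<epsilon> by (intro enn2real_leI) auto
      then show "norm (enn2real (deriv_int n q \<nu> (D k)) - 0) < \<epsilon>" using \<epsilon> by simp
    qed
  qed
  then have "(\<lambda>k. enn2real (deriv_int n q \<nu> (D k)) powr (1 / q)) \<longlonglongrightarrow> 0 powr (1 / q)"
    using q by (intro tendsto_powr') auto
  then show ?thesis by simp
qed

text \<open>The growth estimate bounds the family on compact sets, Montel's theorem gives a locally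
  uniform limit, and Fatou's lemma keeps this limit in the same ball of the Bergman space.\<close>

lemma bergman_normal_family:
  assumes p: "0 < p" and F: "\<And>k. F k holomorphic_on ball 0 1" "\<And>k::nat. bergman_int p (F k) \<le> ennreal M" and M: "0 \<le> M"
  obtains g s where "g holomorphic_on ball 0 1" "strict_mono (s :: nat \<Rightarrow> nat)" "bergman_int p g \<le> ennreal M"
    "\<And>\<rho>. \<rho> < 1 \<Longrightarrow> uniform_limit (cball 0 \<rho>) (\<lambda>k z. F (s k) z - g z) (\<lambda>_. 0) sequentially"
proof -
  obtain C where C: "0 < C" "\<And>f z. f holomorphic_on ball 0 1 \<Longrightarrow> cmod z < 1 \<Longrightarrow>
    ennreal (cmod (f z) powr p) \<le> ennreal (C / mass z) * bergman_int p f"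
    by (rule pointwise_le_bergman) (use p in blast)
  have loc: "\<exists>B. \<forall>f\<in>range F. \<forall>z\<in>K. cmod (f z) \<le> B" if K: "compact K" "K \<subseteq> ball 0 1" for K
  proof -
    obtain \<rho> where \<rho>: "0 \<le> \<rho>" "\<rho> < 1" "K \<subseteq> cball 0 \<rho>"
    proof (cases "K = {}")
      case False
      obtain x where x: "x \<in> K" "\<And>y. y \<in> K \<Longrightarrow> cmod y \<le> cmod x"
        using continuous_attains_sup[OF K(1) False, of cmod] continuous_on_norm_id by blast
      show ?thesis by (rule that[of "cmod x"]) (use x K(2) in auto)
    qed (auto intro: that[of 0])
    have bd: "cmod (F k z) \<le> (C / ((1 - \<rho>) * h \<rho>) * M) powr (1 / p)" if z: "z \<in> K" for k z
    proof -
      have z1: "cmod z \<le> \<rho>" "cmod z < 1" using z \<rho> by auto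
      have m: "(1 - \<rho>) * h \<rho> \<le> mass z" unfolding mass_def
        using z1 \<rho> h_antimono[of "cmod z" \<rho>] h_pos[of \<rho>] by (intro mult_mono) auto
      have m0: "0 < (1 - \<rho>) * h \<rho>" using \<rho> h_pos[of \<rho>] by simp
      have "ennreal (cmod (F k z) powr p) \<le> ennreal (C / mass z) * ennreal M"
        by (rule order_trans[OF C(2)[OF F(1) z1(2)]]) (intro mult_left_mono F(2), simp)
      also have "\<dots> \<le> ennreal (C / ((1 - \<rho>) * h \<rho>)) * ennreal M"
        using m m0 C(1) by (intro mult_right_mono ennreal_leI divide_left_mono) auto
      also have "\<dots> = ennreal (C / ((1 - \<rho>) * h \<rho>) * M)"
        using C(1) m0 M by (intro ennreal_mult[symmetric]) auto
      finally have "cmod (F k z) powr p \<le> C / ((1 - \<rho>) * h \<rho>) * M"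
        using C(1) m0 M by (subst (asm) ennreal_le_iff) auto
      then have "(cmod (F k z) powr p) powr (1 / p) \<le> (C / ((1 - \<rho>) * h \<rho>) * M) powr (1 / p)"
        using p by (intro powr_mono2) auto
      then show ?thesis using p by (simp add: powr_powr)
    qed
    show ?thesis by (rule exI) (use bd in blast)
  qed
  obtain g s where g: "g holomorphic_on ball 0 1" "strict_mono (s :: nat \<Rightarrow> nat)"
      and pw: "\<And>x. x \<in> ball 0 1 \<Longrightarrow> (\<lambda>k. F (s k) x) \<longlonglongrightarrow> g x"
      and un: "\<And>K. compact K \<Longrightarrow> K \<subseteq> ball 0 1 \<Longrightarrow> uniform_limit K (F \<circ> s) g sequentially"
  proof (rule Montel[of "ball 0 1" "range F" F])
    show "\<And>h. h \<in> range F \<Longrightarrow> h holomorphic_on ball 0 1" using F(1) by blast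
    fix g r assume a: "g holomorphic_on ball 0 1" "strict_mono (r :: nat \<Rightarrow> nat)" "\<And>x. x \<in> ball 0 1 \<Longrightarrow> (\<lambda>k. F (r k) x) \<longlonglongrightarrow> g x"
      "\<And>K. compact K \<Longrightarrow> K \<subseteq> ball 0 1 \<Longrightarrow> uniform_limit K (F \<circ> r) g sequentially"
    show thesis by (rule that[OF a])
  qed (use loc in auto)
  show ?thesis
  proof (rule that[OF g])
    let ?G = "\<lambda>k z. pow_mod (F (s k)) p z * W (cmod z) * indicator (ball 0 1) z"
    have m: "?G k \<in> borel_measurable lborel" for k
    proof -
      have [measurable]: "pow_mod (F (s k)) p \<in> borel_measurable borel" by (rule borel_measurable_pow_mod[OF F(1)])
      show ?thesis by measurable
    qed
    have "bergman_int p g \<le> (\<integral>\<^sup>+z. liminf (\<lambda>k. ?G k z) \<partial>lborel)"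
      unfolding bergman_int_eq
    proof (intro nn_integral_mono)
      fix z :: complex
      show "pow_mod g p z * W (cmod z) * indicator (ball 0 1) z \<le> liminf (\<lambda>k. ?G k z)"
      proof (cases "z \<in> ball 0 1 \<and> W (cmod z) < \<infinity>")
        case True
        have "(\<lambda>k. ?G k z) \<longlonglongrightarrow> pow_mod g p z * W (cmod z) * indicator (ball 0 1) z"
          unfolding pow_mod_def using True p pw[of z]
          by (intro tendsto_mult_ennreal tendsto_ennrealI tendsto_powr' tendsto_norm tendsto_const) auto
        then have "liminf (\<lambda>k. ?G k z) = pow_mod g p z * W (cmod z) * indicator (ball 0 1) z"
          by (rule lim_imp_Liminf[OF sequentially_bot])
        then show ?thesis by (rule eq_refl[OF sym])
      next
        \<comment> \<open>Where W is infinite, the product is not continuous in its first factor: if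
          g z is not 0, the terms are eventually infinite, and otherwise the left-hand side is 0.
          Outside the disc the left-hand side is 0 as well.\<close>
        case F: False
        show ?thesis
        proof (cases "z \<in> ball 0 1 \<and> g z \<noteq> 0")
          case True
          then have "eventually (\<lambda>k. F (s k) z \<noteq> 0) sequentially" using pw by (intro tendsto_imp_eventually_ne) auto
          then have "eventually (\<lambda>k. ?G k z = \<infinity>) sequentially"
            by eventually_elim (use True F in \<open>auto simp: pow_mod_def ennreal_mult_eq_top_iff less_top[symmetric]\<close>)
          then have "liminf (\<lambda>k. ?G k z) = liminf (\<lambda>k. \<infinity>::ennreal)" by (rule Liminf_eq)
          then show ?thesis by (simp add: Liminf_const)
        qed (use p in \<open>auto simp: pow_mod_def\<close>)
      qed
    qed
    also have "\<dots> \<le> liminf (\<lambda>k. \<integral>\<^sup>+z. ?G k z \<partial>lborel)" by (rule nn_integral_liminf[OF m])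
    also have "\<dots> \<le> liminf (\<lambda>k::nat. ennreal M)"
      using F(2) unfolding bergman_int_eq by (intro Liminf_mono always_eventually) auto
    also have "\<dots> = ennreal M" by (simp add: Liminf_const)
    finally show "bergman_int p g \<le> ennreal M" .
    fix \<rho> :: real assume "\<rho> < 1"
    then have "uniform_limit (cball 0 \<rho>) (F \<circ> s) g sequentially" by (intro un) auto
    then show "uniform_limit (cball 0 \<rho>) (\<lambda>k z. F (s k) z - g z) (\<lambda>_. 0) sequentially"
      by (simp add: uniform_limit_iff dist_norm)
  qed
qed

text \<open>A bounded sequence has a subsequence converging locally uniformly to some g in the
  Bergman space. The differences to g are bounded and tend to 0 locally uniformly, so with uniformly
  small tails their derivatives tend to 0 in the target; the limit there is the n-th derivative of
  g.\<close>

lemma compact_operator_of_tails: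
  assumes \<mu>: "borel_measure_on_disc \<mu>" and fc: "finite_on_compacts \<mu>" and p: "0 < p" and q: "0 < q"
    and tails: "\<And>\<epsilon>. 0 < \<epsilon> \<Longrightarrow> \<exists>\<rho>. 0 \<le> \<rho> \<and> \<rho> < 1 \<and> (\<forall>f. f holomorphic_on ball 0 1 \<longrightarrow> bergman_int p f \<le> 1 \<longrightarrow>
      deriv_int_on (ball 0 1 - ball 0 \<rho>) n q (disc_ext \<mu>) f \<le> ennreal \<epsilon>)"
  shows "compact_operator \<omega> p \<mu> q (\<lambda>f. (deriv ^^ n) f)"
  unfolding compact_operator_def
proof (intro conjI ballI allI impI)
  let ?\<nu> = "disc_ext \<mu>"
  have fin: "emeasure ?\<nu> (ball 0 \<rho>) < \<infinity>" if "\<rho> < 1" for \<rho> by (rule disc_ext_compact_finite[OF \<mu> fc that])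
  show T: "(deriv ^^ n) f \<in> Lp_space \<mu> q" if "f \<in> bergman_space \<omega> p" for f
  proof -
    have f: "f holomorphic_on ball 0 1" "bergman_int p f < \<infinity>" using that by (auto simp: bergman_space_iff)
    \<comment> \<open>Membership in the target: the tail estimate with \<epsilon> = 1 covers the
      outer ring, and on the inner disc the derivative is bounded because f is bounded on a larger
      compact disc.\<close>
    obtain \<rho> where \<rho>: "0 \<le> \<rho>" "\<rho> < 1" and tl: "\<And>f. f holomorphic_on ball 0 1 \<Longrightarrow> bergman_int p f \<le> 1 \<Longrightarrow>
      deriv_int_on (ball 0 1 - ball 0 \<rho>) n q ?\<nu> f \<le> ennreal 1"
      using tails[of 1] by force
    define X where "X = enn2real (bergman_int p f) + 1"
    have bX: "bergman_int p f = ennreal (enn2real (bergman_int p f))" using f(2) by simp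
    have X: "0 < X" "bergman_int p f \<le> ennreal X"
      by (simp add: X_def add_nonneg_pos) (subst bX, rule ennreal_leI, simp add: X_def)
    have "deriv_int_on (ball 0 1 - ball 0 \<rho>) n q ?\<nu> f \<le> ennreal (1 * X powr (q / p))"
      using tl by (intro tail_bound_scale[OF f(1) p X sets_disc_ext]) auto
    then have t1: "deriv_int_on (ball 0 1 - ball 0 \<rho>) n q ?\<nu> f < \<infinity>" by (simp add: le_less_trans)
    have "f holomorphic_on cball 0 ((1 + \<rho>) / 2)" by (rule holomorphic_on_subset[OF f(1)]) (use \<rho> in auto)
    then have "compact (f ` cball 0 ((1 + \<rho>) / 2))" by (intro compact_continuous_image holomorphic_on_imp_continuous_on) auto
    then obtain M where M: "\<And>z. z \<in> cball 0 ((1 + \<rho>) / 2) \<Longrightarrow> cmod (f z) \<le> M"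
      using compact_imp_bounded bounded_iff by (metis imageI)
    have "deriv_int_on (ball 0 \<rho>) n q ?\<nu> f
        \<le> ennreal ((fact n * M / ((1 - \<rho>) / 2) ^ n) powr q) * emeasure ?\<nu> (ball 0 \<rho>)"
      by (rule nn_integral_higher_deriv_ball_le[OF f(1) \<rho> q sets_disc_ext M])
    also have "\<dots> < \<infinity>" using fin[OF \<rho>(2)] by (simp add: ennreal_mult_less_top)
    finally have "deriv_int n q ?\<nu> f < \<infinity>" unfolding deriv_int_split[OF f(1) \<rho>(2) sets_disc_ext] using t1 by simp
    then show ?thesis unfolding Lp_space_higher_deriv_iff(1)[OF \<mu> f(1)] deriv_int_def .
  qed
  fix F :: "nat \<Rightarrow> complex \<Rightarrow> complex"
  assume "(\<forall>k. F k \<in> bergman_space \<omega> p) \<and> (\<exists>B. \<forall>k. Lp_norm (weighted_area \<omega>) p (F k) \<le> B)"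
  then obtain B where Fb: "\<And>k. F k \<in> bergman_space \<omega> p" and B: "\<And>k. Lp_norm (weighted_area \<omega>) p (F k) \<le> B" by blast
  have Fh: "F k holomorphic_on ball 0 1" "bergman_int p (F k) < \<infinity>" for k using Fb by (auto simp: bergman_space_iff)
  have B0: "0 \<le> B" using B[of 0] unfolding Lp_norm_def by (rule order_trans[rotated]) simp
  define M where "M = pi * B powr p + 1"
  have M: "0 < M" by (simp add: M_def add_nonneg_pos)
  have FM: "bergman_int p (F k) \<le> ennreal M" for k
  proof -
    let ?X = "enn2real (bergman_int p (F k))"
    have "((?X / pi) powr (1 / p)) powr p \<le> B powr p"
      using B[of k] p unfolding Lp_norm_weighted_area[OF Fh(1)] by (intro powr_mono2) auto
    then have "?X / pi \<le> B powr p" using p by (simp add: powr_powr)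
    then have "?X \<le> M" by (simp add: M_def pos_divide_le_eq mult.commute)
    then have "ennreal ?X \<le> ennreal M" by (rule ennreal_leI)
    then show ?thesis using Fh(2) by simp
  qed
  obtain g s where g: "g holomorphic_on ball 0 1" "strict_mono (s :: nat \<Rightarrow> nat)" "bergman_int p g \<le> ennreal M"
    and un: "\<And>\<rho>. \<rho> < 1 \<Longrightarrow> uniform_limit (cball 0 \<rho>) (\<lambda>k z. F (s k) z - g z) (\<lambda>_. 0) sequentially"
  proof (rule bergman_normal_family[OF p Fh(1) FM])
    show "0 \<le> M" using M by simp
    fix g s assume a: "g holomorphic_on ball 0 1" "strict_mono (s :: nat \<Rightarrow> nat)" "bergman_int p g \<le> ennreal M"
     "\<And>\<rho>. \<rho> < 1 \<Longrightarrow> uniform_limit (cball 0 \<rho>) (\<lambda>k z. F (s k) z - g z) (\<lambda>_. 0) sequentially"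
    show thesis by (rule that[OF a])
  qed
  define D where "D = (\<lambda>k z. F (s k) z - g z)"
  have Dh: "D k holomorphic_on ball 0 1" for k unfolding D_def by (intro holomorphic_on_diff Fh(1) g(1))
  have Db: "bergman_int p (D k) \<le> ennreal (2 powr p * (M + M))" for k
  proof -
    have [measurable]: "pow_mod (F (s k)) p \<in> borel_measurable borel" "pow_mod g p \<in> borel_measurable borel"
      using borel_measurable_pow_mod[OF Fh(1)] borel_measurable_pow_mod[OF g(1)] by blast+
    have "bergman_int p (D k) \<le> (\<integral>\<^sup>+z. ennreal (2 powr p) * (pow_mod (F (s k)) p z * W (cmod z) * indicator (ball 0 1) z
        + pow_mod g p z * W (cmod z) * indicator (ball 0 1) z) \<partial>lborel)"
      unfolding bergman_int_def
    proof (intro nn_integral_mono)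
      fix z :: complex
      have "ennreal (cmod (D k z) powr p) \<le> ennreal (2 powr p * (cmod (F (s k) z) powr p + cmod (g z) powr p))"
        unfolding D_def by (intro ennreal_leI norm_diff_powr_le p)
      then have "ennreal (cmod (D k z) powr p) \<le> ennreal (2 powr p) * (ennreal (cmod (F (s k) z) powr p) + ennreal (cmod (g z) powr p))"
        by (simp add: ennreal_mult)
      then have "ennreal (cmod (D k z) powr p) * (W (cmod z) * indicator (ball 0 1) z)
        \<le> ennreal (2 powr p) * (ennreal (cmod (F (s k) z) powr p) + ennreal (cmod (g z) powr p)) * (W (cmod z) * indicator (ball 0 1) z)"
        by (rule mult_right_mono) simp
      then show "ennreal (cmod (D k z) powr p) * W (cmod z) * indicator (ball 0 1) z \<le> ennreal (2 powr p) *
          (pow_mod (F (s k)) p z * W (cmod z) * indicator (ball 0 1) z + pow_mod g p z * W (cmod z) * indicator (ball 0 1) z)"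
        by (cases "z \<in> ball 0 1") (simp_all add: pow_mod_def algebra_simps)
    qed
    also have "\<dots> = ennreal (2 powr p) * (bergman_int p (F (s k)) + bergman_int p g)"
      unfolding bergman_int_eq by (subst nn_integral_cmult, measurable, subst nn_integral_add, measurable)
    also have "\<dots> \<le> ennreal (2 powr p) * (ennreal M + ennreal M)" by (intro mult_left_mono add_mono FM g) simp
    also have "ennreal M + ennreal M = ennreal (M + M)" using M by (intro ennreal_plus[symmetric]) auto
    also have "ennreal (2 powr p) * ennreal (M + M) = ennreal (2 powr p * (M + M))"
      using M by (intro ennreal_mult[symmetric]) auto
    finally show ?thesis .
  qed
  have g_Lp: "(deriv ^^ n) g \<in> Lp_space \<mu> q"
    using g by (intro T) (simp add: bergman_space_iff le_less_trans)
  have "(\<lambda>k. enn2real (deriv_int n q ?\<nu> (D k)) powr (1 / q)) \<longlonglongrightarrow> 0"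
    by (rule deriv_int_tendsto_0[OF sets_disc_ext fin p q tails Dh _ Db]) (use M un in \<open>auto simp: D_def\<close>)
  moreover have "Lp_norm \<mu> q (\<lambda>z. (deriv ^^ n) (F (s k)) z - (deriv ^^ n) g z) = enn2real (deriv_int n q ?\<nu> (D k)) powr (1 / q)" for k
  proof -
    have "Lp_norm \<mu> q (\<lambda>z. (deriv ^^ n) (F (s k)) z - (deriv ^^ n) g z) = Lp_norm \<mu> q ((deriv ^^ n) (D k))"
      unfolding Lp_norm_def D_def using Fh(1) g(1)
      by (intro arg_cong[where f = "\<lambda>x. x powr (1 / q)"] Bochner_Integration.integral_cong refl)
        (simp add: borel_measure_on_disc_space[OF \<mu>] higher_deriv_diff[where S = "ball 0 1"])
    then show ?thesis by (simp add: Lp_space_higher_deriv_iff(2)[OF \<mu> Dh] deriv_int_def)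
  qed
  ultimately have "(\<lambda>k. Lp_norm \<mu> q (\<lambda>z. (deriv ^^ n) (F (s k)) z - (deriv ^^ n) g z)) \<longlonglongrightarrow> 0" by simp
  then show "\<exists>g\<in>Lp_space \<mu> q. \<exists>s::nat \<Rightarrow> nat. strict_mono s \<and> (\<lambda>k. Lp_norm \<mu> q (\<lambda>z. (deriv ^^ n) (F (s k)) z - g z)) \<longlonglongrightarrow> 0"
    using g_Lp g(2) by blast
qed

end

subsection \<open>Mass ratios\<close>

lemma ennreal_divide_le_iff:
  assumes "0 < D" "0 \<le> R"
  shows "E / ennreal D \<le> ennreal R \<longleftrightarrow> E \<le> ennreal (R * D)"
proof (cases E)
  case (real e)
  then show ?thesis using assms by (simp add: divide_ennreal pos_divide_le_eq)
next
  case top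
  then show ?thesis using assms by (simp add: ennreal_top_divide ennreal_mult_eq_top_iff top_unique)
qed

lemma pseudohyperbolic_disc_subset_ball:
  assumes "cmod a < 1" "0 < r" "r < 1"
  obtains \<rho> where "\<rho> < 1" "pseudohyperbolic_disc a r \<subseteq> ball 0 \<rho>"
proof -
  define B where "B = 4 / (1 - r\<^sup>2)"
  have B: "0 < B" using assms by (simp add: B_def power_less_one_iff)
  have "pseudohyperbolic_disc a r \<subseteq> ball 0 (1 - (1 - cmod a) / (2 * B))"
  proof
    fix z assume "z \<in> pseudohyperbolic_disc a r"
    then have "1 - cmod a \<le> B * (1 - cmod z)"
      using pseudohyperbolic_disc_bounds(3)[OF assms(1,2,3)] by (simp add: B_def)
    then have "(1 - cmod a) / B \<le> 1 - cmod z" using B by (simp add: pos_divide_le_eq mult.commute)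
    moreover have "(1 - cmod a) / (2 * B) < (1 - cmod a) / B" using B assms(1) by (simp add: field_simps)
    ultimately show "z \<in> ball 0 (1 - (1 - cmod a) / (2 * B))" by simp
  qed
  moreover have "1 - (1 - cmod a) / (2 * B) < 1" using B assms(1) by simp
  ultimately show ?thesis using that by blast
qed

text \<open>A good centre near x is asked for, not x itself: integrability of the mass ratio yields
  finite disc measures at almost every point only. Finitely many such discs cover a compact
  set.\<close>

lemma finite_on_compacts_of_discs:
  assumes \<mu>: "borel_measure_on_disc \<mu>" and r: "0 < r" "r < 1"
    and fin: "\<And>x. cmod x < 1 \<Longrightarrow> \<exists>\<zeta>. cmod \<zeta> < 1 \<and> cmod (x - \<zeta>) < r * (1 - cmod \<zeta>) \<and>
      emeasure (disc_ext \<mu>) (pseudohyperbolic_disc \<zeta> r) < \<infinity>"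
  shows "finite_on_compacts \<mu>"
  unfolding finite_on_compacts_def
proof (intro allI impI)
  fix K :: "complex set" assume K: "compact K \<and> K \<subseteq> ball 0 1"
  let ?G = "{\<zeta>. cmod \<zeta> < 1 \<and> emeasure (disc_ext \<mu>) (pseudohyperbolic_disc \<zeta> r) < \<infinity>}"
  let ?U = "\<lambda>\<zeta>. ball \<zeta> (r * (1 - cmod \<zeta>)) \<inter> ball 0 1"
  have "K \<subseteq> (\<Union>\<zeta>\<in>?G. ?U \<zeta>)"
  proof
    fix x assume "x \<in> K"
    then have x: "cmod x < 1" using K by auto
    obtain \<zeta> where \<zeta>: "cmod \<zeta> < 1" "cmod (x - \<zeta>) < r * (1 - cmod \<zeta>)" "emeasure (disc_ext \<mu>) (pseudohyperbolic_disc \<zeta> r) < \<infinity>"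
      using fin[OF x] by blast
    then have "x \<in> ?U \<zeta>" using x by (simp add: dist_norm norm_minus_commute)
    then show "x \<in> (\<Union>\<zeta>\<in>?G. ?U \<zeta>)" using \<zeta>(1,3) by blast
  qed
  then obtain J where J: "J \<subseteq> ?G" "finite J" "K \<subseteq> (\<Union>\<zeta>\<in>J. ?U \<zeta>)"
    using compactE_image[of K ?G ?U] K by (metis (no_types, lifting) open_Int open_ball)
  have "?U \<zeta> \<subseteq> pseudohyperbolic_disc \<zeta> r" if "\<zeta> \<in> J" for \<zeta>
  proof
    fix z assume "z \<in> ?U \<zeta>"
    then show "z \<in> pseudohyperbolic_disc \<zeta> r"
      using that J(1) r by (intro near_in_pseudohyperbolic_disc) (auto simp: dist_norm norm_minus_commute)
  qed
  then have sub: "K \<subseteq> (\<Union>\<zeta>\<in>J. pseudohyperbolic_disc \<zeta> r)" using J(3) by blast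
  have "emeasure \<mu> K = emeasure (disc_ext \<mu>) K"
    using K emeasure_disc_ext[OF \<mu>, of K] by (simp add: Int_absorb2 borel_compact)
  also have "\<dots> \<le> emeasure (disc_ext \<mu>) (\<Union>\<zeta>\<in>J. pseudohyperbolic_disc \<zeta> r)"
    by (rule emeasure_mono[OF sub]) (use J(2) in auto)
  also have "\<dots> \<le> (\<Sum>\<zeta>\<in>J. emeasure (disc_ext \<mu>) (pseudohyperbolic_disc \<zeta> r))"
    by (rule emeasure_subadditive_finite[OF J(2)]) auto
  also have "\<dots> < \<infinity>" using J(1,2) by (subst infinity_ennreal_def, subst ennreal_sum_less_top) auto
  finally show "emeasure \<mu> K < \<infinity>" .
qed

lemma disc_ext_outside:
  assumes "borel_measure_on_disc \<mu>"
  shows "emeasure (disc_ext \<mu>) (- ball 0 1) = 0"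
  using emeasure_disc_ext[OF assms, of "- ball 0 1"] by (simp add: Compl_disjoint2)

lemma sigma_finite_disc_ext:
  assumes \<mu>: "borel_measure_on_disc \<mu>" and fc: "finite_on_compacts \<mu>"
  shows "sigma_finite_measure (disc_ext \<mu>)"
proof
  let ?B = "\<lambda>k::nat. ball (0::complex) (1 - 1 / real (Suc k))"
  let ?A = "insert (- ball 0 1) (range ?B)"
  have "z \<in> \<Union>?A" for z :: complex
  proof (cases "cmod z < 1")
    case True
    obtain k :: nat where "1 / real (Suc k) < 1 - cmod z"
      using True reals_Archimedean[of "1 - cmod z"] by (auto simp: inverse_eq_divide)
    then have "z \<in> ?B k" by simp
    then show ?thesis by blast
  qed simp
  then have "\<Union>?A = UNIV" by blast
  then have "\<Union>?A = space (disc_ext \<mu>)" by (simp only: disc_ext_def space_distr space_borel)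
  moreover have "\<forall>a\<in>?A. emeasure (disc_ext \<mu>) a \<noteq> \<infinity>"
  proof
    fix a assume "a \<in> ?A"
    then consider "a = - ball 0 1" | k where "a = ?B k" by blast
    then have "emeasure (disc_ext \<mu>) a < \<infinity>"
    proof cases
      case 2
      show ?thesis unfolding 2 by (rule disc_ext_compact_finite[OF \<mu> fc]) simp
    qed (simp add: disc_ext_outside[OF \<mu>])
    then show "emeasure (disc_ext \<mu>) a \<noteq> \<infinity>" by simp
  qed
  ultimately show "\<exists>A. countable A \<and> A \<subseteq> sets (disc_ext \<mu>) \<and> \<Union>A = space (disc_ext \<mu>) \<and> (\<forall>a\<in>A. emeasure (disc_ext \<mu>) a \<noteq> \<infinity>)"
    by (intro exI[of _ ?A] conjI) auto
qed

lemma mass_ratio_disc_ext: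
  assumes "borel_measure_on_disc \<mu>"
  shows "mass_ratio \<omega> \<mu> r a b z = emeasure (disc_ext \<mu>) (pseudohyperbolic_disc z r)
    / ennreal (weight_of \<omega> (carleson_square z) powr a * (1 - cmod z) powr b)"
proof -
  have "pseudohyperbolic_disc z r \<inter> ball 0 1 = pseudohyperbolic_disc z r" by (auto simp: pseudohyperbolic_disc_def)
  then show ?thesis using emeasure_disc_ext[OF assms, of "pseudohyperbolic_disc z r"] by (simp add: mass_ratio_def)
qed

context bergman_setting
begin

text \<open>Passes between the weight of the Carleson square and \<open>mass\<close>. The form with
  a bound R avoids having to know beforehand that the disc measure is finite.\<close>

lemma mass_ratio_comparable:
  assumes \<mu>: "borel_measure_on_disc \<mu>" and a: "0 \<le> a"
  obtains C where "0 < C"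
    "\<And>r b z R. cmod z < 1 \<Longrightarrow> 0 \<le> R \<Longrightarrow> mass_ratio \<omega> \<mu> r a b z \<le> ennreal R \<Longrightarrow>
       emeasure (disc_ext \<mu>) (pseudohyperbolic_disc z r) \<le> ennreal (C * R * (mass z powr a * (1 - cmod z) powr b))"
    "\<And>r b z R. cmod z < 1 \<Longrightarrow> 0 \<le> R \<Longrightarrow>
       emeasure (disc_ext \<mu>) (pseudohyperbolic_disc z r) \<le> ennreal (R * (mass z powr a * (1 - cmod z) powr b)) \<Longrightarrow>
       mass_ratio \<omega> \<mu> r a b z \<le> ennreal (C * R)"
proof -
  obtain c0 C0 where w: "0 < c0" "0 < C0"
    "\<And>a. cmod a < 1 \<Longrightarrow> c0 * mass a \<le> weight_of \<omega> (carleson_square a)"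
    "\<And>a. cmod a < 1 \<Longrightarrow> weight_of \<omega> (carleson_square a) \<le> C0 * mass a"
    by (rule weight_of_carleson_square) blast
  define C where "C = max (C0 powr a) (c0 powr (- a))"
  have C: "C0 powr a \<le> C" "c0 powr (- a) \<le> C" by (auto simp: C_def)
  show ?thesis
  proof (rule that[of C])
    show "0 < C" using w(1) by (auto simp: C_def less_max_iff_disj)
    fix r b R :: real and z :: complex assume z: "cmod z < 1" and R: "0 \<le> R"
    have m: "0 < mass z" by (rule mass_pos[OF z])
    let ?S = "weight_of \<omega> (carleson_square z)"
    have S0: "0 < ?S" using w(1) m w(3)[OF z] by (meson mult_pos_pos order_less_le_trans)
    have up: "?S powr a \<le> C0 powr a * mass z powr a"
      using powr_mono2[OF a _ w(4)[OF z]] S0 w(2) m by (simp add: powr_mult)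
    have lo: "mass z powr a \<le> c0 powr (- a) * ?S powr a"
      using powr_mono2[OF a _ w(3)[OF z]] S0 w(1) m by (simp add: powr_mult powr_minus field_simps)
    have t: "0 < (1 - cmod z) powr b" using z by simp
    have D: "0 < ?S powr a * (1 - cmod z) powr b" using t S0 by simp
    let ?E = "emeasure (disc_ext \<mu>) (pseudohyperbolic_disc z r)"
    have eq: "mass_ratio \<omega> \<mu> r a b z = ?E / ennreal (?S powr a * (1 - cmod z) powr b)" by (rule mass_ratio_disc_ext[OF \<mu>])
    show "?E \<le> ennreal (C * R * (mass z powr a * (1 - cmod z) powr b))" if "mass_ratio \<omega> \<mu> r a b z \<le> ennreal R"
    proof -
      have "?E \<le> ennreal (R * (?S powr a * (1 - cmod z) powr b))" using that unfolding eq ennreal_divide_le_iff[OF D R] .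
      also have "\<dots> \<le> ennreal (R * ((C * mass z powr a) * (1 - cmod z) powr b))"
        using R t order_trans[OF up mult_right_mono[OF C(1)]] by (intro ennreal_leI mult_left_mono mult_right_mono) auto
      finally show ?thesis by (simp add: mult_ac)
    qed
    assume "?E \<le> ennreal (R * (mass z powr a * (1 - cmod z) powr b))"
    also have "\<dots> \<le> ennreal (R * ((C * ?S powr a) * (1 - cmod z) powr b))"
      using R t order_trans[OF lo mult_right_mono[OF C(2)]] by (intro ennreal_leI mult_left_mono mult_right_mono) auto
    also have "R * ((C * ?S powr a) * (1 - cmod z) powr b) = C * R * (?S powr a * (1 - cmod z) powr b)" by simp
    finally show "mass_ratio \<omega> \<mu> r a b z \<le> ennreal (C * R)"
      unfolding eq using R w(1) by (subst ennreal_divide_le_iff[OF D]) (auto simp: C_def le_max_iff_disj)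
  qed
qed

section \<open>Sufficiency for p at most q\<close>

lemma bounded_operator_of_mass_ratio:
  assumes \<mu>: "borel_measure_on_disc \<mu>" and p: "0 < p" "p \<le> q" and r: "0 < r" "r < 1"
    and sup: "(SUP z\<in>ball 0 1. mass_ratio \<omega> \<mu> r (q / p) (real n * q) z) < \<infinity>"
  shows "bounded_operator \<omega> p \<mu> q (\<lambda>f. (deriv ^^ n) f)"
proof -
  define R where "R = enn2real (SUP z\<in>ball 0 1. mass_ratio \<omega> \<mu> r (q / p) (real n * q) z)"
  have R: "0 \<le> R" "mass_ratio \<omega> \<mu> r (q / p) (real n * q) z \<le> ennreal R" if "cmod z < 1" for z
  proof -
    have "mass_ratio \<omega> \<mu> r (q / p) (real n * q) z \<le> (SUP z\<in>ball 0 1. mass_ratio \<omega> \<mu> r (q / p) (real n * q) z)"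
      using that by (intro SUP_upper) simp
    then show "mass_ratio \<omega> \<mu> r (q / p) (real n * q) z \<le> ennreal R" using sup by (simp add: R_def)
  qed (simp add: R_def)
  have R0: "0 \<le> R" by (simp add: R_def)
  obtain C where C: "0 < C" "\<And>r b z R. cmod z < 1 \<Longrightarrow> 0 \<le> R \<Longrightarrow> mass_ratio \<omega> \<mu> r (q / p) b z \<le> ennreal R \<Longrightarrow>
       emeasure (disc_ext \<mu>) (pseudohyperbolic_disc z r) \<le> ennreal (C * R * (mass z powr (q / p) * (1 - cmod z) powr b))"
    by (rule mass_ratio_comparable[OF \<mu>, of "q / p"]) (use p in auto)
  have bd: "emeasure (disc_ext \<mu>) (pseudohyperbolic_disc z r) \<le> ennreal (C * R * (mass z powr (q / p) * (1 - cmod z) powr (real n * q)))"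
    if "cmod z < 1" for z by (rule C(2)[OF that R0 R(2)[OF that]])
  have fc: "finite_on_compacts \<mu>"
  proof (rule finite_on_compacts_of_discs[OF \<mu> r])
    fix x :: complex assume x: "cmod x < 1"
    have "emeasure (disc_ext \<mu>) (pseudohyperbolic_disc x r) < \<infinity>" using bd[OF x] by (rule le_less_trans) simp
    then show "\<exists>\<zeta>. cmod \<zeta> < 1 \<and> cmod (x - \<zeta>) < r * (1 - cmod \<zeta>) \<and> emeasure (disc_ext \<mu>) (pseudohyperbolic_disc \<zeta> r) < \<infinity>"
      using x r by (intro exI[of _ x]) simp
  qed
  obtain C' where C': "0 < C'" "\<And>f \<nu> \<rho> R. f holomorphic_on ball 0 1 \<Longrightarrow> bergman_int p f \<le> 1 \<Longrightarrow> sets \<nu> = sets borel \<Longrightarrow>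
      sigma_finite_measure \<nu> \<Longrightarrow> 0 \<le> R \<Longrightarrow>
      (\<And>x. x \<in> ball 0 1 - ball 0 (1 - 2 * (1 - \<rho>)) \<Longrightarrow>
         emeasure \<nu> (pseudohyperbolic_disc x r) \<le> ennreal (R * (mass x powr (q / p) * (1 - cmod x) powr (real n * q)))) \<Longrightarrow>
      deriv_int_on (ball 0 1 - ball 0 \<rho>) n q \<nu> f \<le> ennreal (C' * R)"
    by (rule higher_deriv_int_le_of_ratio[OF p r, where n = n]) blast
  show ?thesis
  proof (rule bounded_operator_of_unit_bound[OF \<mu> p(1)])
    show "0 < q" using p by simp
    show "0 \<le> C' * (C * R)" using C' C R0 by simp
    fix f assume f: "f holomorphic_on ball 0 1" "bergman_int p f \<le> 1"
    \<comment> \<open>With \<rho> = 0 the excised ball is empty, and the ring is the whole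
      disc.\<close>
    have "deriv_int_on (ball 0 1 - ball 0 0) n q (disc_ext \<mu>) f \<le> ennreal (C' * (C * R))"
      by (rule C'(2)[OF f sets_disc_ext sigma_finite_disc_ext[OF \<mu> fc]]) (use C R0 bd in auto)
    then show "deriv_int n q (disc_ext \<mu>) f \<le> ennreal (C' * (C * R))" by (simp add: deriv_int_def)
  qed
qed

lemma compact_operator_of_mass_ratio:
  assumes \<mu>: "borel_measure_on_disc \<mu>" and fc: "finite_on_compacts \<mu>" and p: "0 < p" "p \<le> q" and r: "0 < r" "r < 1"
    and lim: "(mass_ratio \<omega> \<mu> r (q / p) (real n * q) \<longlongrightarrow> 0) (filtercomap cmod (at_left 1))"
  shows "compact_operator \<omega> p \<mu> q (\<lambda>f. (deriv ^^ n) f)"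
proof -
  obtain C where C: "0 < C" "\<And>r b z R. cmod z < 1 \<Longrightarrow> 0 \<le> R \<Longrightarrow> mass_ratio \<omega> \<mu> r (q / p) b z \<le> ennreal R \<Longrightarrow>
       emeasure (disc_ext \<mu>) (pseudohyperbolic_disc z r) \<le> ennreal (C * R * (mass z powr (q / p) * (1 - cmod z) powr b))"
    by (rule mass_ratio_comparable[OF \<mu>, of "q / p"]) (use p in auto)
  obtain C' where C': "0 < C'" "\<And>f \<nu> \<rho> R. f holomorphic_on ball 0 1 \<Longrightarrow> bergman_int p f \<le> 1 \<Longrightarrow> sets \<nu> = sets borel \<Longrightarrow>
      sigma_finite_measure \<nu> \<Longrightarrow> 0 \<le> R \<Longrightarrow>
      (\<And>x. x \<in> ball 0 1 - ball 0 (1 - 2 * (1 - \<rho>)) \<Longrightarrow>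
         emeasure \<nu> (pseudohyperbolic_disc x r) \<le> ennreal (R * (mass x powr (q / p) * (1 - cmod x) powr (real n * q)))) \<Longrightarrow>
      deriv_int_on (ball 0 1 - ball 0 \<rho>) n q \<nu> f \<le> ennreal (C' * R)"
    by (rule higher_deriv_int_le_of_ratio[OF p r, where n = n]) blast
  show ?thesis
  proof (rule compact_operator_of_tails[OF \<mu> fc p(1)])
    show "0 < q" using p by simp
    fix \<epsilon> :: real assume \<epsilon>: "0 < \<epsilon>"
    define R where "R = \<epsilon> / (C * C')"
    have R: "0 < R" "C' * (C * R) = \<epsilon>" using \<epsilon> C C' by (auto simp: R_def)
    have "eventually (\<lambda>z. mass_ratio \<omega> \<mu> r (q / p) (real n * q) z < ennreal R) (filtercomap cmod (at_left 1))"
      using lim R by (intro order_tendstoD(2)) auto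
    then obtain Q where Q: "eventually Q (at_left 1)" "\<And>z. Q (cmod z) \<Longrightarrow> mass_ratio \<omega> \<mu> r (q / p) (real n * q) z < ennreal R"
      unfolding eventually_filtercomap by blast
    obtain \<rho>0 where \<rho>0: "\<rho>0 < (1::real)" "\<And>y. \<rho>0 < y \<Longrightarrow> y < 1 \<Longrightarrow> Q y"
      using Q(1) eventually_at_left[of 0 "1::real" Q] by auto
    \<comment> \<open>This makes 1 - 2 * (1 - \<rho>) equal to (1 + max \<rho>0 0) / 2, which still
      exceeds \<rho>0: the estimate beyond \<rho> involves disc centres up to twice as far from the
      circle.\<close>
    define \<rho> where "\<rho> = (3 + max \<rho>0 0) / 4"
    have \<rho>: "0 \<le> \<rho>" "\<rho> < 1" "\<rho>0 < 1 - 2 * (1 - \<rho>)" using \<rho>0(1) by (auto simp: \<rho>_def field_simps max_def)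
    have "emeasure (disc_ext \<mu>) (pseudohyperbolic_disc x r) \<le> ennreal (C * R * (mass x powr (q / p) * (1 - cmod x) powr (real n * q)))"
      if x: "x \<in> ball 0 1 - ball 0 (1 - 2 * (1 - \<rho>))" for x
    proof -
      have x': "cmod x < 1" "\<rho>0 < cmod x" using x \<rho>(3) by auto
      show ?thesis by (rule C(2)[OF x'(1) less_imp_le[OF R(1)] less_imp_le[OF Q(2)[OF \<rho>0(2)[OF x'(2,1)]]]])
    qed
    then have "deriv_int_on (ball 0 1 - ball 0 \<rho>) n q (disc_ext \<mu>) f \<le> ennreal (C' * (C * R))"
      if "f holomorphic_on ball 0 1" "bergman_int p f \<le> 1" for f
      using C(1) R(1) by (intro C'(2)[OF that sets_disc_ext sigma_finite_disc_ext[OF \<mu> fc]]) auto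
    then show "\<exists>\<rho>. 0 \<le> \<rho> \<and> \<rho> < 1 \<and> (\<forall>f. f holomorphic_on ball 0 1 \<longrightarrow> bergman_int p f \<le> 1 \<longrightarrow>
      deriv_int_on (ball 0 1 - ball 0 \<rho>) n q (disc_ext \<mu>) f \<le> ennreal \<epsilon>)"
      using \<rho>(1,2) unfolding R(2) by blast
  qed
qed

section \<open>Necessity by test functions\<close>

lemma emeasure_ball_finite_of_operator:
  assumes \<mu>: "borel_measure_on_disc \<mu>" and p: "0 < p" and q: "0 < q"
    and T: "\<And>f. f \<in> bergman_space \<omega> p \<Longrightarrow> (deriv ^^ n) f \<in> Lp_space \<mu> q"
  shows "emeasure (disc_ext \<mu>) (ball 0 1) < \<infinity>"
proof -
  \<comment> \<open>The n-th derivative is the constant n!, so its integral sees the total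
    mass.\<close>
  let ?f = "\<lambda>z::complex. z ^ n"
  have f: "?f holomorphic_on ball 0 1" by (intro holomorphic_intros)
  have "bergman_int p ?f \<le> bergman_int p (\<lambda>_. 1)"
    using p by (intro bergman_int_mono) (auto simp: norm_power power_le_one)
  then have "?f \<in> bergman_space \<omega> p" using f bergman_int_1_finite[of p] by (simp add: bergman_space_iff le_less_trans)
  then have fin: "deriv_int_on (ball 0 1) n q (disc_ext \<mu>) ?f < \<infinity>"
    using T unfolding Lp_space_higher_deriv_iff(1)[OF \<mu> f, symmetric] by blast
  have D: "(deriv ^^ n) ?f z = fact n" for z
    using higher_deriv_power[of n 0 n z] by (simp add: pochhammer_fact)
  have "emeasure (disc_ext \<mu>) (ball 0 1) = (\<integral>\<^sup>+z. indicator (ball 0 1) z \<partial>disc_ext \<mu>)" by simp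
  also have "\<dots> \<le> deriv_int_on (ball 0 1) n q (disc_ext \<mu>) ?f"
  proof (intro nn_integral_mono)
    fix z :: complex
    have "1 \<le> (fact n :: real) powr q" using q by (intro ge_one_powr_ge_zero fact_ge_1) simp
    then have "ennreal 1 \<le> ennreal (cmod ((deriv ^^ n) ?f z) powr q)" unfolding D by (intro ennreal_leI) simp
    then show "indicator (ball 0 1) z \<le> ennreal (cmod ((deriv ^^ n) ?f z) powr q) * indicator (ball 0 1) z"
      by (auto split: split_indicator)
  qed
  finally show ?thesis using fin by (rule le_less_trans)
qed

text \<open>On the disc of radius 1 / 2 about a the denominator is at most B * (1 - cmod a), so the
  n-th derivative of the test function has at least the order (1 - cmod a) powr (- n) * mass a powr
  (- 1 / p) there. The condition 1 / 2 <= cmod a keeps the factor cmod a ^ n away from 0.\<close>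

lemma disc_measure_le_test_function:
  assumes m: "0 < m" and p: "0 < p" and q: "0 < q"
  obtains C where "0 < C" "\<And>\<nu> a d. sets \<nu> = sets borel \<Longrightarrow> 1 / 2 \<le> cmod a \<Longrightarrow> cmod a < 1 \<Longrightarrow> 0 \<le> d \<Longrightarrow>
    deriv_int n q \<nu> (test_function m p a) \<le> ennreal d \<Longrightarrow>
    emeasure \<nu> (pseudohyperbolic_disc a (1 / 2)) \<le> ennreal (C * d * (mass a powr (q / p) * (1 - cmod a) powr (real n * q)))"
proof -
  define B where "B = (4 / (1 - (1 / 2)\<^sup>2) :: real)"
  have B: "0 < B" by (simp add: B_def power2_eq_square)
  define \<kappa> where "\<kappa> = (1 / 2) ^ n / B ^ (m + n)"
  have \<kappa>: "0 < \<kappa>" using B by (simp add: \<kappa>_def)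
  show ?thesis
  proof (rule that[of "\<kappa> powr (- q)"])
    show "0 < \<kappa> powr (- q)" using \<kappa> by simp
    fix \<nu> :: "complex measure" and a :: complex and d :: real
    assume \<nu>: "sets \<nu> = sets borel" and a: "1 / 2 \<le> cmod a" "cmod a < 1" and d0: "0 \<le> d"
    let ?c = "(1 - cmod a) ^ m / mass a powr (1 / p)"
    let ?f = "\<lambda>z. of_real ?c * inverse (1 - cnj a * z) ^ m"
    assume d: "deriv_int n q \<nu> ?f \<le> ennreal d"
    define t where "t = 1 - cmod a"
    have t: "0 < t" using a by (simp add: t_def)
    have mm: "0 < mass a" by (rule mass_pos[OF a(2)])
    define L where "L = \<kappa> * (1 / t ^ n) * mass a powr (- 1 / p)"
    have L: "0 < L" using \<kappa> t mm by (simp add: L_def)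
    have low: "L \<le> cmod ((deriv ^^ n) ?f z)" if z: "z \<in> pseudohyperbolic_disc a (1 / 2)" for z
    proof -
      have z1: "cmod z < 1" using z by (simp add: pseudohyperbolic_disc_def)
      define X where "X = cmod (1 - cnj a * z)"
      have "X \<le> B * t" using pseudohyperbolic_disc_bounds(1)[OF a(2) _ _ z] by (simp add: X_def B_def t_def)
      moreover have X0: "0 < X" using norm_1_minus_cnj_mult(1)[OF a(2) z1] a unfolding X_def by linarith
      ultimately have inv: "1 / (B * t) \<le> 1 / X" using B t by (intro divide_left_mono) auto
      have poch: "1 \<le> real (pochhammer m n)" using pochhammer_pos[of m n] m by linarith
      have "L = t ^ m / mass a powr (1 / p) * ((1 / 2) ^ n * (1 / (B * t)) ^ (m + n))"
        using t B by (simp add: L_def \<kappa>_def power_add power_divide power_mult_distrib powr_minus field_simps)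
      also have "\<dots> \<le> t ^ m / mass a powr (1 / p) * ((real (pochhammer m n) * cmod a ^ n) * (1 / X) ^ (m + n))"
      proof (intro mult_left_mono mult_mono)
        have "1 * (1 / 2) ^ n \<le> real (pochhammer m n) * cmod a ^ n"
          using poch a by (intro mult_mono power_mono) auto
        then show "(1 / 2) ^ n \<le> real (pochhammer m n) * cmod a ^ n" by simp
        show "(1 / (B * t)) ^ (m + n) \<le> (1 / X) ^ (m + n)" using inv B t by (intro power_mono) auto
      qed (use t B mm in auto)
      also have "\<dots> = cmod ((deriv ^^ n) ?f z)"
        using t mm unfolding higher_deriv_test_function[OF a(2) z1] X_def t_def by simp
      finally show ?thesis .
    qed
    have "ennreal (L powr q) * emeasure \<nu> (pseudohyperbolic_disc a (1 / 2))
        = (\<integral>\<^sup>+z\<in>pseudohyperbolic_disc a (1 / 2). ennreal (L powr q) \<partial>\<nu>)"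
      using \<nu> by (intro nn_integral_cmult_indicator[symmetric]) auto
    also have "\<dots> \<le> deriv_int n q \<nu> ?f"
      unfolding deriv_int_def
    proof (intro nn_integral_mono)
      fix z
      show "ennreal (L powr q) * indicator (pseudohyperbolic_disc a (1 / 2)) z \<le> ennreal (cmod ((deriv ^^ n) ?f z) powr q) * indicator (ball 0 1) z"
      proof (cases "z \<in> pseudohyperbolic_disc a (1 / 2)")
        case True
        have "L powr q \<le> cmod ((deriv ^^ n) ?f z) powr q" using L q low[OF True] by (intro powr_mono2) auto
        then have "ennreal (L powr q) \<le> ennreal (cmod ((deriv ^^ n) ?f z) powr q)" by (rule ennreal_leI)
        then show ?thesis using True by (simp add: pseudohyperbolic_disc_def)
      qed simp
    qed
    finally have "ennreal (L powr q) * emeasure \<nu> (pseudohyperbolic_disc a (1 / 2)) \<le> ennreal d" using d by (rule order_trans)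
    then have "ennreal (L powr (- q)) * (ennreal (L powr q) * emeasure \<nu> (pseudohyperbolic_disc a (1 / 2))) \<le> ennreal (L powr (- q)) * ennreal d"
      by (rule mult_left_mono) simp
    moreover have "ennreal (L powr (- q)) * ennreal (L powr q) = 1"
      using L by (simp add: ennreal_mult[symmetric] powr_add[symmetric])
    ultimately have "emeasure \<nu> (pseudohyperbolic_disc a (1 / 2)) \<le> ennreal (L powr (- q) * d)"
      using d0 by (simp add: mult.assoc[symmetric] ennreal_mult)
    also have "L powr (- q) = \<kappa> powr (- q) * (mass a powr (q / p) * t powr (real n * q))"
    proof -
      have "L = \<kappa> * t powr (- real n) * mass a powr (- 1 / p)"
        using t by (simp add: L_def powr_minus powr_realpow inverse_eq_divide)
      then have "L powr (- q) = \<kappa> powr (- q) * (t powr (- real n)) powr (- q) * (mass a powr (- 1 / p)) powr (- q)"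
        using \<kappa> by (simp add: powr_mult)
      then show ?thesis by (simp add: powr_powr)
    qed
    finally show "emeasure \<nu> (pseudohyperbolic_disc a (1 / 2)) \<le> ennreal (\<kappa> powr (- q) * d * (mass a powr (q / p) * (1 - cmod a) powr (real n * q)))"
      by (simp add: t_def mult_ac)
  qed
qed

text \<open>Test functions handle the points with 1 / 2 <= cmod a. At the others the denominator of
  the ratio is bounded below, and finiteness of the total mass, obtained from the monomial z ^ n, is
  enough.\<close>

lemma mass_ratio_of_bounded_operator:
  assumes \<mu>: "borel_measure_on_disc \<mu>" and p: "0 < p" and q: "0 < q"
    and bo: "bounded_operator \<omega> p \<mu> q (\<lambda>f. (deriv ^^ n) f)"
  shows "(SUP z\<in>ball 0 1. mass_ratio \<omega> \<mu> (1 / 2) (q / p) (real n * q) z) < \<infinity>"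
proof -
  obtain B where B: "0 \<le> B" "\<And>f. f holomorphic_on ball 0 1 \<Longrightarrow> bergman_int p f < \<infinity> \<Longrightarrow>
    deriv_int n q (disc_ext \<mu>) f \<le> ennreal (B * enn2real (bergman_int p f) powr (q / p))"
    by (rule deriv_int_le_of_bounded_operator[OF \<mu> p q bo]) blast
  have "emeasure (disc_ext \<mu>) (ball 0 1) < \<infinity>"
    by (rule emeasure_ball_finite_of_operator[OF \<mu> p q]) (use bo in \<open>auto simp: bounded_operator_def\<close>)
  then obtain V where V: "0 \<le> V" "emeasure (disc_ext \<mu>) (ball 0 1) = ennreal V"
    by (metis enn2real_nonneg ennreal_enn2real infinity_ennreal_def)
  obtain m C1 where m: "0 < m" "0 < C1"
    "\<And>a. cmod a < 1 \<Longrightarrow> bergman_int p (test_function m p a) \<le> ennreal C1"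
    by (rule test_functions[OF p]) blast
  obtain C2 where C2: "0 < C2" "\<And>\<nu> a d. sets \<nu> = sets borel \<Longrightarrow> 1 / 2 \<le> cmod a \<Longrightarrow> cmod a < 1 \<Longrightarrow> 0 \<le> d \<Longrightarrow>
    deriv_int n q \<nu> (test_function m p a) \<le> ennreal d \<Longrightarrow>
    emeasure \<nu> (pseudohyperbolic_disc a (1 / 2)) \<le> ennreal (C2 * d * (mass a powr (q / p) * (1 - cmod a) powr (real n * q)))"
    by (rule disc_measure_le_test_function[OF m(1) p q, where n = n]) blast
  obtain C3 where C3: "0 < C3" "\<And>r b z R. cmod z < 1 \<Longrightarrow> 0 \<le> R \<Longrightarrow>
       emeasure (disc_ext \<mu>) (pseudohyperbolic_disc z r) \<le> ennreal (R * (mass z powr (q / p) * (1 - cmod z) powr b)) \<Longrightarrow>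
       mass_ratio \<omega> \<mu> r (q / p) b z \<le> ennreal (C3 * R)"
    by (rule mass_ratio_comparable[OF \<mu>, of "q / p"]) (use p q in auto)
  define d where "d = B * C1 powr (q / p)"
  have d: "0 \<le> d" using B by (simp add: d_def)
  define e where "e = (h (1 / 2) / 2) powr (q / p) * (1 / 2) powr (real n * q)"
  have e: "0 < e" using h_pos[of "1 / 2"] by (simp add: e_def)
  define R where "R = max (C2 * d) (V / e)"
  have R: "0 \<le> R" "C2 * d \<le> R" "V / e \<le> R" using C2 d by (auto simp: R_def le_max_iff_disj)
  have "mass_ratio \<omega> \<mu> (1 / 2) (q / p) (real n * q) a \<le> ennreal (C3 * R)" if a: "cmod a < 1" for a
  proof (rule C3(2)[OF a R(1)])
    have mm: "0 < mass a" by (rule mass_pos[OF a])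
    show "emeasure (disc_ext \<mu>) (pseudohyperbolic_disc a (1 / 2)) \<le> ennreal (R * (mass a powr (q / p) * (1 - cmod a) powr (real n * q)))"
    proof (cases "1 / 2 \<le> cmod a")
      case True
      let ?f = "\<lambda>z. of_real ((1 - cmod a) ^ m / mass a powr (1 / p)) * inverse (1 - cnj a * z) ^ m"
      have f: "?f holomorphic_on ball 0 1" by (rule holomorphic_test_function[OF a])
      have "deriv_int n q (disc_ext \<mu>) ?f \<le> ennreal (B * enn2real (bergman_int p ?f) powr (q / p))"
        by (rule B(2)[OF f]) (rule le_less_trans[OF m(3)[OF a]], simp)
      also have "\<dots> \<le> ennreal d"
        unfolding d_def using B(1) p q m(2) m(3)[OF a]
        by (intro ennreal_leI mult_left_mono powr_mono2 enn2real_leI) auto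
      finally have "emeasure (disc_ext \<mu>) (pseudohyperbolic_disc a (1 / 2)) \<le> ennreal (C2 * d * (mass a powr (q / p) * (1 - cmod a) powr (real n * q)))"
        by (rule C2(2)[OF sets_disc_ext True a d])
      also have "\<dots> \<le> ennreal (R * (mass a powr (q / p) * (1 - cmod a) powr (real n * q)))"
        using R by (intro ennreal_leI mult_right_mono) auto
      finally show ?thesis .
    next
      case False
      have "h (1 / 2) / 2 \<le> mass a"
        unfolding mass_def using h_antimono[of "cmod a" "1 / 2"] False h_pos[of "1 / 2"]
          mult_mono[of "1 / 2" "1 - cmod a" "h (1 / 2)" "h (cmod a)"] by simp
      then have "e \<le> mass a powr (q / p) * (1 - cmod a) powr (real n * q)"
        unfolding e_def using p q False h_pos[of "1 / 2"] by (intro mult_mono powr_mono2) auto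
      then have "R * e \<le> R * (mass a powr (q / p) * (1 - cmod a) powr (real n * q))" using R by (intro mult_left_mono)
      moreover have "V \<le> R * e" using R(3) e by (simp add: pos_divide_le_eq)
      ultimately have "ennreal V \<le> ennreal (R * (mass a powr (q / p) * (1 - cmod a) powr (real n * q)))" by (intro ennreal_leI) simp
      moreover have "emeasure (disc_ext \<mu>) (pseudohyperbolic_disc a (1 / 2)) \<le> emeasure (disc_ext \<mu>) (ball 0 1)"
        by (intro emeasure_mono) (auto simp: pseudohyperbolic_disc_def)
      ultimately show ?thesis unfolding V(2) by (rule order_trans[rotated])
    qed
  qed
  then have "(SUP z\<in>ball 0 1. mass_ratio \<omega> \<mu> (1 / 2) (q / p) (real n * q) z) \<le> ennreal (C3 * R)" by (intro SUP_least) simp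
  then show ?thesis by (rule le_less_trans) simp
qed

text \<open>Suppose the ratio stays above u along points tending to the circle. The test functions
  there are bounded, and their derivatives tend to 0 pointwise, so the limit that compactness
  provides along a subsequence can only be 0; the lower bound for the derivatives then forces the
  ratios to 0.\<close>

lemma mass_ratio_of_compact_operator:
  assumes \<mu>: "borel_measure_on_disc \<mu>" and p: "0 < p" and q: "0 < q"
    and co: "compact_operator \<omega> p \<mu> q (\<lambda>f. (deriv ^^ n) f)"
  shows "(mass_ratio \<omega> \<mu> (1 / 2) (q / p) (real n * q) \<longlongrightarrow> 0) (filtercomap cmod (at_left 1))"
proof (rule ccontr)
  assume "\<not> ?thesis"
  then obtain u where u: "0 < u" "\<not> eventually (\<lambda>z. mass_ratio \<omega> \<mu> (1 / 2) (q / p) (real n * q) z < u) (filtercomap cmod (at_left 1))"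
    unfolding order_tendsto_iff by auto
  \<comment> \<open>The offset 2 keeps every cmod (a k) at least 1 / 2, as the lower bound for the
    derivatives requires.\<close>
  have "\<exists>a. 1 - 1 / real (k + 2) < cmod a \<and> cmod a < 1 \<and> u \<le> mass_ratio \<omega> \<mu> (1 / 2) (q / p) (real n * q) a" for k
  proof (rule ccontr)
    assume neg: "\<not> ?thesis"
    have "eventually (\<lambda>y::real. 1 - 1 / real (k + 2) < y \<and> y < 1) (at_left 1)"
      unfolding eventually_at_left[of 0 "1::real", OF zero_less_one] by (intro exI[of _ "1 - 1 / real (k + 2)"]) auto
    then have "eventually (\<lambda>z. 1 - 1 / real (k + 2) < cmod z \<and> cmod z < 1) (filtercomap cmod (at_left 1))"
      by (rule eventually_filtercomapI)
    then have "eventually (\<lambda>z. mass_ratio \<omega> \<mu> (1 / 2) (q / p) (real n * q) z < u) (filtercomap cmod (at_left 1))"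
      by (rule eventually_mono) (use neg in \<open>auto simp: not_le\<close>)
    then show False using u(2) by blast
  qed
  then obtain a where a: "\<And>k. 1 - 1 / real (k + 2) < cmod (a k) \<and> cmod (a k) < 1 \<and> u \<le> mass_ratio \<omega> \<mu> (1 / 2) (q / p) (real n * q) (a k)"
    by metis
  have a1: "1 - 1 / real (k + 2) < cmod (a k)" and a2: "cmod (a k) < 1" and a3: "u \<le> mass_ratio \<omega> \<mu> (1 / 2) (q / p) (real n * q) (a k)" for k
    using a[of k] by blast+
  have ahalf: "1 / 2 \<le> cmod (a k)" for k
  proof -
    have "1 / real (k + 2) \<le> 1 / 2" by (intro divide_left_mono) auto
    then show ?thesis using a1[of k] by linarith
  qed
  obtain m C1 where m: "0 < m" "0 < C1"
    "\<And>a. cmod a < 1 \<Longrightarrow> bergman_int p (test_function m p a) \<le> ennreal C1"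
    "\<And>a. cmod a < 1 \<Longrightarrow> (1 - cmod a) ^ m / mass a powr (1 / p) \<le> C1 * (1 - cmod a)"
    by (rule test_functions[OF p]) blast
  obtain C2 where C2: "0 < C2" "\<And>\<nu> a d. sets \<nu> = sets borel \<Longrightarrow> 1 / 2 \<le> cmod a \<Longrightarrow> cmod a < 1 \<Longrightarrow> 0 \<le> d \<Longrightarrow>
    deriv_int n q \<nu> (test_function m p a) \<le> ennreal d \<Longrightarrow>
    emeasure \<nu> (pseudohyperbolic_disc a (1 / 2)) \<le> ennreal (C2 * d * (mass a powr (q / p) * (1 - cmod a) powr (real n * q)))"
    by (rule disc_measure_le_test_function[OF m(1) p q, where n = n]) blast
  obtain C3 where C3: "0 < C3" "\<And>r b z R. cmod z < 1 \<Longrightarrow> 0 \<le> R \<Longrightarrow>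
       emeasure (disc_ext \<mu>) (pseudohyperbolic_disc z r) \<le> ennreal (R * (mass z powr (q / p) * (1 - cmod z) powr b)) \<Longrightarrow>
       mass_ratio \<omega> \<mu> r (q / p) b z \<le> ennreal (C3 * R)"
    by (rule mass_ratio_comparable[OF \<mu>, of "q / p"]) (use p q in auto)
  define c where "c k = (1 - cmod (a k)) ^ m / mass (a k) powr (1 / p)" for k
  have c0: "0 \<le> c k" for k using a2[of k] by (simp add: c_def)
  \<comment> \<open>The normalising factor is at most of order 1 - cmod (a k); the spare power in
    the exponent of the test functions makes it a null sequence.\<close>
  have clim: "c \<longlonglongrightarrow> 0"
  proof (rule tendsto_sandwich[OF always_eventually always_eventually tendsto_const])
    have "(\<lambda>k. 1 / real (k + 2)) \<longlonglongrightarrow> 0" by (rule LIMSEQ_ignore_initial_segment[OF lim_const_over_n])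
    then show "(\<lambda>k. C1 * (1 / real (k + 2))) \<longlonglongrightarrow> 0" by (rule tendsto_mult_right_zero)
    show "\<forall>k. c k \<le> C1 * (1 / real (k + 2))"
    proof
      fix k
      have "c k \<le> C1 * (1 - cmod (a k))" unfolding c_def by (rule m(4)[OF a2])
      also have "\<dots> \<le> C1 * (1 / real (k + 2))" using a1[of k] m(2) by (intro mult_left_mono) auto
      finally show "c k \<le> C1 * (1 / real (k + 2))" .
    qed
  qed (use c0 in blast)
  define F where "F k = (\<lambda>z. of_real (c k) * inverse (1 - cnj (a k) * z) ^ m)" for k
  have Fh: "F k holomorphic_on ball 0 1" for k unfolding F_def by (rule holomorphic_test_function[OF a2])
  have F1: "bergman_int p (F k) \<le> ennreal C1" for k unfolding F_def c_def by (rule m(3)[OF a2])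
  have Fb: "F k \<in> bergman_space \<omega> p" for k using Fh F1[of k] by (simp add: bergman_space_iff le_less_trans)
  have Fn: "Lp_norm (weighted_area \<omega>) p (F k) \<le> (C1 / pi) powr (1 / p)" for k
  proof -
    have "enn2real (bergman_int p (F k)) \<le> C1" using F1[of k] m(2) by (intro enn2real_leI) auto
    then show ?thesis unfolding Lp_norm_weighted_area[OF Fh]
      using p by (intro powr_mono2) (auto simp: divide_right_mono)
  qed
  have T: "(deriv ^^ n) (F k) \<in> Lp_space \<mu> q" for k using co Fb unfolding compact_operator_def by blast
  have "\<exists>g\<in>Lp_space \<mu> q. \<exists>s::nat \<Rightarrow> nat. strict_mono s
              \<and> (\<lambda>k. Lp_norm \<mu> q (\<lambda>z. (deriv ^^ n) (F (s k)) z - g z)) \<longlonglongrightarrow> 0"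
    using co Fb Fn unfolding compact_operator_def by blast
  then obtain g s where g: "g \<in> Lp_space \<mu> q" and s: "strict_mono (s :: nat \<Rightarrow> nat)"
    and lim: "(\<lambda>k. Lp_norm \<mu> q (\<lambda>z. (deriv ^^ n) (F (s k)) z - g z)) \<longlonglongrightarrow> 0" by blast
  have "(\<lambda>k. \<integral>z. cmod ((deriv ^^ n) (F (s k)) z) powr q \<partial>\<mu>) \<longlonglongrightarrow> 0"
  proof (rule Lp_limit_vanishing[OF T g q lim])
    fix z assume "z \<in> space \<mu>"
    then have z: "cmod z < 1" by (simp add: borel_measure_on_disc_space[OF \<mu>])
    show "(\<lambda>k. (deriv ^^ n) (F (s k)) z) \<longlonglongrightarrow> 0"
    proof (rule Lim_null_comparison[OF always_eventually])
      let ?b = "\<lambda>k. c (s k) * (real (pochhammer m n) * (1 / (1 - cmod z)) ^ (m + n))"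
      show "\<forall>k. cmod ((deriv ^^ n) (F (s k)) z) \<le> ?b k"
      proof
        fix k
        have "1 / cmod (1 - cnj (a (s k)) * z) \<le> 1 / (1 - cmod z)"
          using norm_1_minus_cnj_mult(2)[OF a2[of "s k"] z] z by (intro frac_le) auto
        then have "real (pochhammer m n) * cmod (a (s k)) ^ n * (1 / cmod (1 - cnj (a (s k)) * z)) ^ (m + n)
          \<le> real (pochhammer m n) * 1 * (1 / (1 - cmod z)) ^ (m + n)"
          using a2[of "s k"] z by (intro mult_mono power_mono mult_left_mono power_le_one) auto
        then show "cmod ((deriv ^^ n) (F (s k)) z) \<le> ?b k"
          unfolding F_def higher_deriv_test_function[OF a2 z] using c0[of "s k"] by (simp add: mult_left_mono)
      qed
      have "(\<lambda>k. c (s k)) \<longlonglongrightarrow> 0" using LIMSEQ_subseq_LIMSEQ[OF clim s] by (simp add: o_def)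
      then show "?b \<longlonglongrightarrow> 0" by (rule tendsto_mult_left_zero)
    qed
  qed
  then have dlim: "(\<lambda>k. enn2real (deriv_int n q (disc_ext \<mu>) (F (s k)))) \<longlonglongrightarrow> 0"
    unfolding integral_higher_deriv_powr[OF \<mu> Fh q] .
  let ?d = "\<lambda>k. enn2real (deriv_int n q (disc_ext \<mu>) (F (s k)))"
  have "u \<le> ennreal (C3 * (C2 * ?d k))" for k
  proof -
    have "deriv_int n q (disc_ext \<mu>) (F (s k)) < \<infinity>"
      using T[of "s k"] unfolding Lp_space_higher_deriv_iff(1)[OF \<mu> Fh] deriv_int_def .
    then have fin: "deriv_int n q (disc_ext \<mu>) (F (s k)) \<le> ennreal (?d k)" by simp
    then have fin': "deriv_int n q (disc_ext \<mu>) (\<lambda>z. of_real ((1 - cmod (a (s k))) ^ m / mass (a (s k)) powr (1 / p))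
        * inverse (1 - cnj (a (s k)) * z) ^ m) \<le> ennreal (?d k)" by (simp only: F_def c_def)
    have "emeasure (disc_ext \<mu>) (pseudohyperbolic_disc (a (s k)) (1 / 2))
        \<le> ennreal (C2 * ?d k * (mass (a (s k)) powr (q / p) * (1 - cmod (a (s k))) powr (real n * q)))"
      by (rule C2(2)[OF sets_disc_ext ahalf a2 enn2real_nonneg fin'])
    then have "mass_ratio \<omega> \<mu> (1 / 2) (q / p) (real n * q) (a (s k)) \<le> ennreal (C3 * (C2 * ?d k))"
      using C2(1) by (intro C3(2)[OF a2]) auto
    then show ?thesis using a3[of "s k"] by (rule order_trans[rotated])
  qed
  moreover have "(\<lambda>k. ennreal (C3 * (C2 * ?d k))) \<longlonglongrightarrow> ennreal (C3 * (C2 * 0))"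
    by (intro tendsto_ennrealI tendsto_mult tendsto_const dlim)
  ultimately have "u \<le> ennreal (C3 * (C2 * 0))"
    by (intro tendsto_lowerbound[OF _ always_eventually sequentially_bot]) auto
  then show False using u(1) by simp
qed

section \<open>The range q below p\<close>

lemma omega_tilde_eq: "cmod z < 1 \<Longrightarrow> omega_tilde \<omega> z = ennreal (h (cmod z) / (1 - cmod z))"
  using h_pos[of "cmod z"] by (simp add: omega_tilde_def hat_eq divide_ennreal)

lemma omega_tilde_measurable: "omega_tilde \<omega> \<in> borel_measurable disc_area"
proof -
  have "(\<lambda>z. ennreal (h (cmod z) / (1 - cmod z))) \<in> borel_measurable disc_area"
    by (rule borel_measurable_disc_area) measurable
  then show ?thesis by (subst measurable_cong[where g = "\<lambda>z. ennreal (h (cmod z) / (1 - cmod z))"]) (auto simp: omega_tilde_eq)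
qed

text \<open>The regularised density is positive at every point of the disc, so its null sets are
  those of the area. Finiteness is listed separately because the real-valued version of g is 0 where
  g is infinite.\<close>

lemma extended_in_Lp_tilde_iff:
  "extended_in_Lp (density disc_area (omega_tilde \<omega>)) s g \<longleftrightarrow> g \<in> borel_measurable disc_area
    \<and> (AE z in lborel. z \<in> ball 0 1 \<longrightarrow> g z < \<infinity>)
    \<and> (\<integral>\<^sup>+z\<in>ball 0 1. ennreal (enn2real (g z) powr s * (h (cmod z) / (1 - cmod z))) \<partial>lborel) < \<infinity>"
proof (cases "g \<in> borel_measurable disc_area")
  case g: True
  let ?D = "density disc_area (omega_tilde \<omega>)"
  have "(AE z in ?D. g z < \<infinity>) \<longleftrightarrow> (AE z in disc_area. 0 < omega_tilde \<omega> z \<longrightarrow> g z < \<infinity>)"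
    by (rule AE_density[OF omega_tilde_measurable])
  also have "\<dots> \<longleftrightarrow> (AE z in lborel. z \<in> ball 0 1 \<longrightarrow> 0 < omega_tilde \<omega> z \<longrightarrow> g z < \<infinity>)"
    by (rule AE_disc_area_iff)
  also have "\<dots> \<longleftrightarrow> (AE z in lborel. z \<in> ball 0 1 \<longrightarrow> g z < \<infinity>)"
    by (rule AE_cong) (auto simp: omega_tilde_eq h_pos)
  finally have ae: "(AE z in ?D. g z < \<infinity>) \<longleftrightarrow> (AE z in lborel. z \<in> ball 0 1 \<longrightarrow> g z < \<infinity>)" .
  have m: "(\<lambda>z. enn2real (g z) powr s) \<in> borel_measurable disc_area" using g by measurable
  have "(\<integral>\<^sup>+z. ennreal (enn2real (g z) powr s) \<partial>?D) = (\<integral>\<^sup>+z. omega_tilde \<omega> z * ennreal (enn2real (g z) powr s) \<partial>disc_area)"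
    using m omega_tilde_measurable by (intro nn_integral_density) auto
  also have "\<dots> = ennreal (1 / pi) * (\<integral>\<^sup>+z\<in>ball 0 1. omega_tilde \<omega> z * ennreal (enn2real (g z) powr s) \<partial>lborel)"
    using m omega_tilde_measurable by (intro nn_integral_disc_area) auto
  also have "(\<integral>\<^sup>+z\<in>ball 0 1. omega_tilde \<omega> z * ennreal (enn2real (g z) powr s) \<partial>lborel)
      = (\<integral>\<^sup>+z\<in>ball 0 1. ennreal (enn2real (g z) powr s * (h (cmod z) / (1 - cmod z))) \<partial>lborel)"
  proof (intro nn_integral_cong)
    fix z :: complex
    show "omega_tilde \<omega> z * ennreal (enn2real (g z) powr s) * indicator (ball 0 1) z
      = ennreal (enn2real (g z) powr s * (h (cmod z) / (1 - cmod z))) * indicator (ball 0 1) z"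
    proof (cases "cmod z < 1")
      case True
      show ?thesis unfolding omega_tilde_eq[OF True] by (subst ennreal_mult') (auto simp: mult_ac)
    qed simp
  qed
  finally have I: "(\<integral>\<^sup>+z. ennreal (enn2real (g z) powr s) \<partial>?D)
    = ennreal (1 / pi) * (\<integral>\<^sup>+z\<in>ball 0 1. ennreal (enn2real (g z) powr s * (h (cmod z) / (1 - cmod z))) \<partial>lborel)" .
  note c = ennreal_inverse_pi_mult_finite
  have "(\<lambda>z. enn2real (g z)) \<in> Lp_space ?D s \<longleftrightarrow> (\<integral>\<^sup>+z. ennreal (enn2real (g z) powr s) \<partial>?D) < \<infinity>"
    unfolding Lp_space_def integrable_iff_bounded using g m by simp
  then show ?thesis using g unfolding extended_in_Lp_def ae I c by simp
qed (simp add: extended_in_Lp_def)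

text \<open>Away from the origin the weight of the square is an explicit factor times a radial tail
  integral, whose integrand is jointly measurable; at the origin the square jumps to the whole disc
  and a single value is prescribed.\<close>

lemma weight_of_carleson_square_measurable: "(\<lambda>z. weight_of \<omega> (carleson_square z)) \<in> borel_measurable disc_area"
proof -
  define V where "V z = (\<integral>\<^sup>+w\<in>ball 0 1. indicator {cmod z<..<1} (cmod w) * W (cmod w) \<partial>lborel)" for z :: complex
  have "(\<lambda>y. (if cmod (fst y) < cmod (snd y) \<and> cmod (snd y) < 1 then W (cmod (snd y)) else 0) * indicator (ball 0 1) (snd y))
      \<in> borel_measurable (borel \<Otimes>\<^sub>M (lborel :: complex measure))"
    by measurable
  then have "(\<lambda>z. \<integral>\<^sup>+w. (if cmod z < cmod w \<and> cmod w < 1 then W (cmod w) else 0) * indicator (ball 0 1) w \<partial>lborel)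
      \<in> borel_measurable (borel :: complex measure)"
    by (intro lborel.borel_measurable_nn_integral) (simp add: case_prod_beta)
  moreover have "V = (\<lambda>z. \<integral>\<^sup>+w. (if cmod z < cmod w \<and> cmod w < 1 then W (cmod w) else 0) * indicator (ball 0 1) w \<partial>lborel)"
    unfolding V_def by (intro ext nn_integral_cong) (auto split: split_indicator)
  ultimately have [measurable]: "V \<in> borel_measurable borel" by simp
  let ?w = "\<lambda>z. if z = 0 then weight_of \<omega> (carleson_square 0)
    else enn2real (ennreal ((1 - cmod z) / (2 * pi)) * V z) / pi"
  have "?w \<in> borel_measurable disc_area" by (rule borel_measurable_disc_area) measurable
  then show ?thesis
    by (subst measurable_cong[where g = ?w]) (auto simp: weight_of_carleson_square_eq nn_integral_carleson_square V_def)
qed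

lemma mass_ratio_real_comparable:
  assumes \<mu>: "borel_measure_on_disc \<mu>"
  obtains C where "0 < C"
    "\<And>r b z. cmod z < 1 \<Longrightarrow> measure (disc_ext \<mu>) (pseudohyperbolic_disc z r) / (mass z * (1 - cmod z) powr b)
        \<le> C * enn2real (mass_ratio \<omega> \<mu> r 1 b z)"
    "\<And>r b z. cmod z < 1 \<Longrightarrow> enn2real (mass_ratio \<omega> \<mu> r 1 b z)
        \<le> C * (measure (disc_ext \<mu>) (pseudohyperbolic_disc z r) / (mass z * (1 - cmod z) powr b))"
    "\<And>r b z. cmod z < 1 \<Longrightarrow> mass_ratio \<omega> \<mu> r 1 b z < \<infinity> \<longleftrightarrow> emeasure (disc_ext \<mu>) (pseudohyperbolic_disc z r) < \<infinity>"
proof -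
  obtain c0 C0 where w: "0 < c0" "0 < C0"
    "\<And>a. cmod a < 1 \<Longrightarrow> c0 * mass a \<le> weight_of \<omega> (carleson_square a)"
    "\<And>a. cmod a < 1 \<Longrightarrow> weight_of \<omega> (carleson_square a) \<le> C0 * mass a"
    by (rule weight_of_carleson_square) blast
  define C where "C = max C0 (1 / c0)"
  have C: "0 < C" "C0 \<le> C" "1 / c0 \<le> C" using w(2) by (auto simp: C_def)
  have div: "enn2real (E / ennreal D) = enn2real E / D" "E / ennreal D < \<infinity> \<longleftrightarrow> E < \<infinity>" if "0 < D" for E D
    using that by (cases E; simp add: divide_ennreal ennreal_top_divide)+
  show ?thesis
  proof (rule that[OF C(1)])
    fix r b :: real and z :: complex assume z: "cmod z < 1"
    have m: "0 < mass z" by (rule mass_pos[OF z])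
    let ?S = "weight_of \<omega> (carleson_square z)"
    let ?M = "measure (disc_ext \<mu>) (pseudohyperbolic_disc z r)"
    have S0: "0 < ?S" using w(1) m w(3)[OF z] by (meson mult_pos_pos order_less_le_trans)
    have t: "0 < (1 - cmod z) powr b" using z by simp
    have D: "0 < ?S powr 1 * (1 - cmod z) powr b" using t S0 by simp
    have eq: "enn2real (mass_ratio \<omega> \<mu> r 1 b z) = ?M / (?S * (1 - cmod z) powr b)"
      unfolding mass_ratio_disc_ext[OF \<mu>] div(1)[OF D] using S0 by (simp add: measure_def)
    show "mass_ratio \<omega> \<mu> r 1 b z < \<infinity> \<longleftrightarrow> emeasure (disc_ext \<mu>) (pseudohyperbolic_disc z r) < \<infinity>"
      unfolding mass_ratio_disc_ext[OF \<mu>] div(2)[OF D] ..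
    have "?S \<le> C * mass z" using w(4)[OF z] mult_right_mono[OF C(2), of "mass z"] m by linarith
    then have "1 / mass z \<le> C / ?S" using S0 m by (simp add: field_simps)
    then have "1 / mass z * (?M / (1 - cmod z) powr b) \<le> C / ?S * (?M / (1 - cmod z) powr b)"
      using t by (intro mult_right_mono) auto
    then show "?M / (mass z * (1 - cmod z) powr b) \<le> C * enn2real (mass_ratio \<omega> \<mu> r 1 b z)"
      by (simp add: eq)
    have "mass z \<le> 1 / c0 * ?S" using w(1) w(3)[OF z] by (simp add: field_simps)
    also have "\<dots> \<le> C * ?S" using C(3) S0 by (intro mult_right_mono) auto
    finally have "1 / ?S \<le> C / mass z" using S0 m by (simp add: field_simps)
    then have "1 / ?S * (?M / (1 - cmod z) powr b) \<le> C / mass z * (?M / (1 - cmod z) powr b)"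
      using t by (intro mult_right_mono) auto
    then show "enn2real (mass_ratio \<omega> \<mu> r 1 b z) \<le> C * (?M / (mass z * (1 - cmod z) powr b))"
      by (simp add: eq)
  qed
qed

text \<open>Boundedness forces a finite total mass, through the monomial z ^ n, and this is what the
  box estimate presupposes. The radius is arbitrary here, which turns one radius into all
  radii.\<close>

lemma extended_in_Lp_of_bounded_operator:
  assumes \<mu>: "borel_measure_on_disc \<mu>" and q: "0 < q" "q < p" and r: "0 < r" "r < 1"
    and bo: "bounded_operator \<omega> p \<mu> q (\<lambda>f. (deriv ^^ n) f)"
  shows "extended_in_Lp (density disc_area (omega_tilde \<omega>)) (p / (p - q)) (mass_ratio \<omega> \<mu> r 1 (real n * q))"
proof -
  let ?\<nu> = "disc_ext \<mu>"
  have p: "0 < p" using q by simp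
  obtain B where B: "0 \<le> B" "\<And>f. f holomorphic_on ball 0 1 \<Longrightarrow> bergman_int p f < \<infinity> \<Longrightarrow>
    deriv_int n q ?\<nu> f \<le> ennreal (B * enn2real (bergman_int p f) powr (q / p))"
    by (rule deriv_int_le_of_bounded_operator[OF \<mu> p q(1) bo]) blast
  have "emeasure ?\<nu> (ball 0 1) < \<infinity>"
    by (rule emeasure_ball_finite_of_operator[OF \<mu> p q(1)]) (use bo in \<open>auto simp: bounded_operator_def\<close>)
  moreover have "emeasure ?\<nu> (space ?\<nu>) = emeasure ?\<nu> (ball 0 1)"
    using emeasure_disc_ext[OF \<mu>, of UNIV] emeasure_disc_ext[OF \<mu>, of "ball 0 1"] by (simp add: disc_ext_def)
  ultimately have fin: "finite_measure ?\<nu>" by (intro finite_measureI) simp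
  then interpret F: finite_measure ?\<nu> .
  obtain C where C: "0 < C" "\<And>r b z. cmod z < 1 \<Longrightarrow> enn2real (mass_ratio \<omega> \<mu> r 1 b z)
        \<le> C * (measure ?\<nu> (pseudohyperbolic_disc z r) / (mass z * (1 - cmod z) powr b))"
    "\<And>r b z. cmod z < 1 \<Longrightarrow> mass_ratio \<omega> \<mu> r 1 b z < \<infinity> \<longleftrightarrow> emeasure ?\<nu> (pseudohyperbolic_disc z r) < \<infinity>"
    by (rule mass_ratio_real_comparable[OF \<mu>]) blast
  have [measurable]: "(\<lambda>x. emeasure ?\<nu> (pseudohyperbolic_disc x r)) \<in> borel_measurable borel"
    by (rule borel_measurable_emeasure_pseudohyperbolic_disc[OF F.sigma_finite_measure_axioms sets_disc_ext])
  let ?X = "\<lambda>z. measure ?\<nu> (pseudohyperbolic_disc z r) / (mass z * (1 - cmod z) powr (real n * q))"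
  let ?s = "p / (p - q)"
  have J: "(\<integral>\<^sup>+z\<in>ball 0 1. ennreal (?X z powr ?s * (h (cmod z) / (1 - cmod z))) \<partial>lborel) < \<infinity>"
    using B unfolding deriv_int_def by (rule nn_integral_mass_ratio_finite[OF q sets_disc_ext fin _ _ r])
  show ?thesis
    unfolding extended_in_Lp_tilde_iff
  proof (intro conjI)
    have 1: "(\<lambda>z. emeasure ?\<nu> (pseudohyperbolic_disc z r)) \<in> borel_measurable disc_area"
      by (rule borel_measurable_disc_area) measurable
    have 2: "(\<lambda>z. (1 - cmod z) powr (real n * q)) \<in> borel_measurable disc_area"
      by (rule borel_measurable_disc_area) measurable
    show "mass_ratio \<omega> \<mu> r 1 (real n * q) \<in> borel_measurable disc_area"
      unfolding mass_ratio_disc_ext[OF \<mu>, abs_def] using 1 2 weight_of_carleson_square_measurable by measurable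
    show "AE z in lborel. z \<in> ball 0 1 \<longrightarrow> mass_ratio \<omega> \<mu> r 1 (real n * q) z < \<infinity>"
      using C(3) by (intro AE_I2) (simp add: less_top[symmetric])
    have mX [measurable]: "?X \<in> borel_measurable borel" unfolding mass_def measure_def by measurable
    have "(\<integral>\<^sup>+z\<in>ball 0 1. ennreal (enn2real (mass_ratio \<omega> \<mu> r 1 (real n * q) z) powr ?s * (h (cmod z) / (1 - cmod z))) \<partial>lborel)
        \<le> (\<integral>\<^sup>+z. ennreal (C powr ?s) * (ennreal (?X z powr ?s * (h (cmod z) / (1 - cmod z))) * indicator (ball 0 1) z) \<partial>lborel)"
    proof (intro nn_integral_mono)
      fix z :: complex
      show "ennreal (enn2real (mass_ratio \<omega> \<mu> r 1 (real n * q) z) powr ?s * (h (cmod z) / (1 - cmod z))) * indicator (ball 0 1) z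
        \<le> ennreal (C powr ?s) * (ennreal (?X z powr ?s * (h (cmod z) / (1 - cmod z))) * indicator (ball 0 1) z)"
      proof (cases "cmod z < 1")
        case z: True
        have w: "0 \<le> h (cmod z) / (1 - cmod z)" using z h_pos[of "cmod z"] by simp
        have X0: "0 \<le> ?X z" using z mass_pos[OF z] by simp
        have "enn2real (mass_ratio \<omega> \<mu> r 1 (real n * q) z) powr ?s \<le> (C * ?X z) powr ?s"
          using q p C(2)[OF z] by (intro powr_mono2) auto
        also have "\<dots> = C powr ?s * ?X z powr ?s" using X0 C(1) by (simp only: powr_mult less_imp_le)
        finally have "enn2real (mass_ratio \<omega> \<mu> r 1 (real n * q) z) powr ?s * (h (cmod z) / (1 - cmod z))
          \<le> (C powr ?s * ?X z powr ?s) * (h (cmod z) / (1 - cmod z))" using w by (rule mult_right_mono)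
        then have "ennreal (enn2real (mass_ratio \<omega> \<mu> r 1 (real n * q) z) powr ?s * (h (cmod z) / (1 - cmod z)))
          \<le> ennreal (C powr ?s * (?X z powr ?s * (h (cmod z) / (1 - cmod z))))" by (intro ennreal_leI) (simp only: mult.assoc)
        also have "\<dots> = ennreal (C powr ?s) * ennreal (?X z powr ?s * (h (cmod z) / (1 - cmod z)))"
          using w by (intro ennreal_mult mult_nonneg_nonneg) auto
        finally show ?thesis using z by simp
      qed simp
    qed
    also have "\<dots> = ennreal (C powr ?s) * (\<integral>\<^sup>+z\<in>ball 0 1. ennreal (?X z powr ?s * (h (cmod z) / (1 - cmod z))) \<partial>lborel)"
      by (rule nn_integral_cmult) measurable
    also have "\<dots> < \<infinity>" using J by (simp add: ennreal_mult_less_top)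
    finally show "(\<integral>\<^sup>+z\<in>ball 0 1. ennreal (enn2real (mass_ratio \<omega> \<mu> r 1 (real n * q) z) powr ?s * (h (cmod z) / (1 - cmod z))) \<partial>lborel) < \<infinity>" .
  qed
qed

text \<open>Finiteness of the ratio almost everywhere already makes the measure finite on compact
  sets. Then \<theta> is fixed, to make the part of Young's inequality containing f small on the
  whole unit ball, and only afterwards a ring so thin that the integral of the ratio over it is
  small enough for this \<theta>.\<close>

lemma compact_operator_of_extended_in_Lp:
  assumes \<mu>: "borel_measure_on_disc \<mu>" and q: "0 < q" "q < p" and r: "0 < r" "r < 1"
    and ext: "extended_in_Lp (density disc_area (omega_tilde \<omega>)) (p / (p - q)) (mass_ratio \<omega> \<mu> r 1 (real n * q))"
  shows "compact_operator \<omega> p \<mu> q (\<lambda>f. (deriv ^^ n) f)"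
proof -
  let ?\<nu> = "disc_ext \<mu>" and ?s = "p / (p - q)"
  have p: "0 < p" using q by simp
  let ?mr = "\<lambda>z. mass_ratio \<omega> \<mu> r 1 (real n * q) z"
  let ?X = "\<lambda>z. measure ?\<nu> (pseudohyperbolic_disc z r) / (mass z * (1 - cmod z) powr (real n * q))"
  have mm: "?mr \<in> borel_measurable disc_area" and ae: "AE z in lborel. z \<in> ball 0 1 \<longrightarrow> ?mr z < \<infinity>"
    and int: "(\<integral>\<^sup>+z\<in>ball 0 1. ennreal (enn2real (?mr z) powr ?s * (h (cmod z) / (1 - cmod z))) \<partial>lborel) < \<infinity>"
    using ext unfolding extended_in_Lp_tilde_iff by blast+
  obtain C where C: "0 < C" "\<And>r b z. cmod z < 1 \<Longrightarrow> measure ?\<nu> (pseudohyperbolic_disc z r) / (mass z * (1 - cmod z) powr b)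
        \<le> C * enn2real (mass_ratio \<omega> \<mu> r 1 b z)"
    "\<And>r b z. cmod z < 1 \<Longrightarrow> mass_ratio \<omega> \<mu> r 1 b z < \<infinity> \<longleftrightarrow> emeasure ?\<nu> (pseudohyperbolic_disc z r) < \<infinity>"
    by (rule mass_ratio_real_comparable[OF \<mu>]) blast
  have fc: "finite_on_compacts \<mu>"
  proof (rule finite_on_compacts_of_discs[OF \<mu> r])
    fix x :: complex assume x: "cmod x < 1"
    show "\<exists>\<zeta>. cmod \<zeta> < 1 \<and> cmod (x - \<zeta>) < r * (1 - cmod \<zeta>) \<and> emeasure ?\<nu> (pseudohyperbolic_disc \<zeta> r) < \<infinity>"
    proof (rule ccontr)
      assume neg: "\<not> ?thesis"
      \<comment> \<open>Without a good centre the ratio would be infinite throughout this open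
        neighbourhood of x, which has positive area.\<close>
      let ?U = "{\<zeta>. cmod \<zeta> < 1} \<inter> {\<zeta>. cmod (x - \<zeta>) < r * (1 - cmod \<zeta>)}"
      have "open ?U" by (intro open_Int open_Collect_less continuous_intros)
      moreover have "x \<in> ?U" using x r by simp
      ultimately obtain e where e: "0 < e" "ball x e \<subseteq> ?U" by (meson openE)
      have "AE z in lborel. z \<notin> ball x e"
        using ae
      proof eventually_elim
        case (elim z)
        show ?case
        proof
          assume "z \<in> ball x e"
          then have z: "cmod z < 1" "cmod (x - z) < r * (1 - cmod z)" using e(2) by auto
          then have "mass_ratio \<omega> \<mu> r 1 (real n * q) z < \<infinity>" using elim by simp
          then have "emeasure ?\<nu> (pseudohyperbolic_disc z r) < \<infinity>" by (rule C(3)[OF z(1), THEN iffD1])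
          then show False using neg z by blast
        qed
      qed
      then have "ball x e \<in> null_sets lborel" by (subst AE_iff_null_sets) auto
      then show False using e(1) by (auto simp: null_sets_def emeasure_ball_complex)
    qed
  qed
  have sf: "sigma_finite_measure ?\<nu>" by (rule sigma_finite_disc_ext[OF \<mu> fc])
  have fin: "emeasure ?\<nu> (pseudohyperbolic_disc x r) < \<infinity>" if x: "cmod x < 1" for x
  proof -
    obtain \<rho> where \<rho>: "\<rho> < 1" "pseudohyperbolic_disc x r \<subseteq> ball 0 \<rho>"
      by (rule pseudohyperbolic_disc_subset_ball[OF x r]) blast
    have "emeasure ?\<nu> (pseudohyperbolic_disc x r) \<le> emeasure ?\<nu> (ball 0 \<rho>)"
      by (rule emeasure_mono[OF \<rho>(2)]) simp
    then show ?thesis using disc_ext_compact_finite[OF \<mu> fc \<rho>(1)] by (rule le_less_trans)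
  qed
  have [measurable]: "(\<lambda>x. emeasure ?\<nu> (pseudohyperbolic_disc x r)) \<in> borel_measurable borel"
    by (rule borel_measurable_emeasure_pseudohyperbolic_disc[OF sf sets_disc_ext])
  have mX [measurable]: "?X \<in> borel_measurable borel" unfolding mass_def measure_def by measurable
  let ?I = "\<lambda>z. ennreal (?X z powr ?s * (h (cmod z) / (1 - cmod z)))"
  have J: "(\<integral>\<^sup>+z\<in>ball 0 1. ?I z \<partial>lborel) < \<infinity>"
  proof -
    let ?k = "\<lambda>z. ennreal (enn2real (?mr z) powr ?s * (h (cmod z) / (1 - cmod z)))"
    have mk: "?k \<in> borel_measurable disc_area"
    proof -
      have "(\<lambda>z. h (cmod z) / (1 - cmod z)) \<in> borel_measurable disc_area"
        by (rule borel_measurable_disc_area) measurable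
      then show ?thesis using mm by measurable
    qed
    have "ennreal (1 / pi) * (\<integral>\<^sup>+z\<in>ball 0 1. ?I z \<partial>lborel) = (\<integral>\<^sup>+z. ?I z \<partial>disc_area)"
      by (rule nn_integral_disc_area[symmetric]) (rule borel_measurable_disc_area, measurable)
    also have "\<dots> \<le> (\<integral>\<^sup>+z. ennreal (C powr ?s) * ?k z \<partial>disc_area)"
    proof (intro nn_integral_mono)
      fix z assume "z \<in> space disc_area"
      then have z: "cmod z < 1" by simp
      have w: "0 \<le> h (cmod z) / (1 - cmod z)" using z h_pos[of "cmod z"] by simp
      have "0 \<le> ?X z" using z mass_pos[OF z] by simp
      then have "?X z powr ?s \<le> (C * enn2real (?mr z)) powr ?s"
        using q p C(2)[OF z] by (intro powr_mono2) auto
      also have "\<dots> = C powr ?s * enn2real (?mr z) powr ?s" using C(1) by (simp add: powr_mult)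
      finally have "?X z powr ?s * (h (cmod z) / (1 - cmod z)) \<le> (C powr ?s * enn2real (?mr z) powr ?s) * (h (cmod z) / (1 - cmod z))"
        using w by (rule mult_right_mono)
      then have "?I z \<le> ennreal (C powr ?s * (enn2real (?mr z) powr ?s * (h (cmod z) / (1 - cmod z))))"
        by (intro ennreal_leI) (simp only: mult.assoc)
      also have "\<dots> = ennreal (C powr ?s) * ?k z" using w by (intro ennreal_mult mult_nonneg_nonneg) auto
      finally show "?I z \<le> ennreal (C powr ?s) * ?k z" .
    qed
    also have "\<dots> = ennreal (C powr ?s) * (\<integral>\<^sup>+z. ?k z \<partial>disc_area)" by (rule nn_integral_cmult[OF mk])
    also have "(\<integral>\<^sup>+z. ?k z \<partial>disc_area) = ennreal (1 / pi) * (\<integral>\<^sup>+z\<in>ball 0 1. ?k z \<partial>lborel)"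
      by (rule nn_integral_disc_area[OF mk])
    also have "ennreal (C powr ?s) * (ennreal (1 / pi) * (\<integral>\<^sup>+z\<in>ball 0 1. ?k z \<partial>lborel)) < \<infinity>"
      using int by (simp only: ennreal_mult_less_top infinity_ennreal_def ennreal_less_top simp_thms)
    finally show ?thesis by (rule ennreal_inverse_pi_mult_finite[THEN iffD1])
  qed
  \<comment> \<open>Integrability means that this measure is finite on the disc; its values on the
    shrinking rings \<open>A k\<close> then tend to 0 by continuity from above.\<close>
  define N where "N = density lborel (\<lambda>z. ?I z * indicator (ball 0 1) z)"
  define A where "A k = ball 0 1 - ball (0::complex) (1 - 1 / real (Suc k))" for k
  have mA: "A k \<in> sets borel" for k unfolding A_def by (rule sets.Diff[OF ball_sets_borel ball_sets_borel])
  have mI: "(\<lambda>z. ?I z * indicator (ball 0 1) z) \<in> borel_measurable lborel" by measurable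
  have NA: "emeasure N (A k) = (\<integral>\<^sup>+z\<in>A k. ?I z \<partial>lborel)" for k
  proof -
    have "emeasure N (A k) = (\<integral>\<^sup>+z\<in>A k. (?I z * indicator (ball 0 1) z) \<partial>lborel)"
      unfolding N_def using mA[of k] by (intro emeasure_density mI) simp
    also have "\<dots> = (\<integral>\<^sup>+z\<in>A k. ?I z \<partial>lborel)"
      unfolding A_def by (intro nn_integral_cong) (auto split: split_indicator)
    finally show ?thesis .
  qed
  have Alim: "(\<lambda>k. emeasure N (A k)) \<longlonglongrightarrow> 0"
  proof -
    have "(\<lambda>k. emeasure N (A k)) \<longlonglongrightarrow> emeasure N (\<Inter>k. A k)"
    proof (rule Lim_emeasure_decseq)
      show "range A \<subseteq> sets N" using mA by (auto simp: N_def)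
      show "decseq A"
      proof (rule decseq_SucI)
        fix k
        have "1 - 1 / real (Suc k) \<le> 1 - 1 / real (Suc (Suc k))" by (simp add: field_simps)
        then show "A (Suc k) \<subseteq> A k" unfolding A_def by auto
      qed
      fix k
      have "(\<integral>\<^sup>+z\<in>A k. ?I z \<partial>lborel) \<le> (\<integral>\<^sup>+z\<in>ball 0 1. ?I z \<partial>lborel)"
        by (intro nn_integral_mono) (auto simp: A_def split: split_indicator)
      then show "emeasure N (A k) \<noteq> \<infinity>" unfolding NA using J by auto
    qed
    moreover have "(\<Inter>k. A k) = {}"
    proof (rule equals0I)
      fix z assume z: "z \<in> (\<Inter>k. A k)"
      then have "cmod z < 1" by (auto simp: A_def)
      then obtain k :: nat where "1 / real (Suc k) < 1 - cmod z"
        using reals_Archimedean[of "1 - cmod z"] by (auto simp: inverse_eq_divide)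
      then have "z \<notin> A k" by (simp add: A_def)
      then show False using z by blast
    qed
    ultimately show ?thesis by simp
  qed
  obtain C' where C': "0 < C'" "\<And>f \<nu> \<rho> \<theta>. f holomorphic_on ball 0 1 \<Longrightarrow> bergman_int p f \<le> 1 \<Longrightarrow> sets \<nu> = sets borel \<Longrightarrow>
      sigma_finite_measure \<nu> \<Longrightarrow> 0 < \<theta> \<Longrightarrow> (\<And>x. cmod x < 1 \<Longrightarrow> emeasure \<nu> (pseudohyperbolic_disc x r) < \<infinity>) \<Longrightarrow>
      deriv_int_on (ball 0 1 - ball 0 \<rho>) n q \<nu> f
        \<le> ennreal (C' * \<theta>) + ennreal (C' * \<theta> powr (- q / (p - q))) * (\<integral>\<^sup>+x\<in>ball 0 1 - ball 0 (1 - 2 * (1 - \<rho>)).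
            ennreal ((measure \<nu> (pseudohyperbolic_disc x r) / (mass x * (1 - cmod x) powr (real n * q))) powr (p / (p - q))
              * (h (cmod x) / (1 - cmod x))) \<partial>lborel)"
    by (rule higher_deriv_int_le_of_integral[OF q r, where n = n]) blast
  show ?thesis
  proof (rule compact_operator_of_tails[OF \<mu> fc p q(1)])
    fix \<epsilon> :: real assume \<epsilon>: "0 < \<epsilon>"
    define \<theta> where "\<theta> = \<epsilon> / (2 * C')"
    have \<theta>: "0 < \<theta>" "C' * \<theta> = \<epsilon> / 2" using \<epsilon> C'(1) by (auto simp: \<theta>_def)
    define c where "c = C' * \<theta> powr (- q / (p - q))"
    have c: "0 < c" using C'(1) \<theta> by (simp add: c_def)
    have "eventually (\<lambda>k. emeasure N (A k) < ennreal (\<epsilon> / (2 * c))) sequentially"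
      using Alim \<epsilon> c by (intro order_tendstoD(2)) auto
    then obtain k where k: "emeasure N (A k) < ennreal (\<epsilon> / (2 * c))" by (auto simp: eventually_sequentially)
    \<comment> \<open>The derivative estimate beyond \<rho> integrates over a ring of twice the
      width, which is then \<open>A k\<close>.\<close>
    define \<rho> where "\<rho> = 1 - 1 / (2 * real (Suc k))"
    have \<rho>: "0 \<le> \<rho>" "\<rho> < 1" "1 - 2 * (1 - \<rho>) = 1 - 1 / real (Suc k)" by (auto simp: \<rho>_def field_simps)
    have "deriv_int_on (ball 0 1 - ball 0 \<rho>) n q ?\<nu> f \<le> ennreal \<epsilon>"
      if f: "f holomorphic_on ball 0 1" "bergman_int p f \<le> 1" for f
    proof -
      have "deriv_int_on (ball 0 1 - ball 0 \<rho>) n q ?\<nu> f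
          \<le> ennreal (\<epsilon> / 2) + ennreal c * emeasure N (A k)"
        using C'(2)[OF f sets_disc_ext sf \<theta>(1) fin, of \<rho>] unfolding \<theta>(2) \<rho>(3) c_def[symmetric] A_def[symmetric] NA .
      also have "\<dots> \<le> ennreal (\<epsilon> / 2) + ennreal c * ennreal (\<epsilon> / (2 * c))"
        using less_imp_le[OF k] by (intro add_left_mono mult_left_mono) auto
      also have "ennreal c * ennreal (\<epsilon> / (2 * c)) = ennreal (\<epsilon> / 2)"
        using c \<epsilon> by (simp add: ennreal_mult[symmetric])
      also have "ennreal (\<epsilon> / 2) + ennreal (\<epsilon> / 2) = ennreal (\<epsilon> / 2 + \<epsilon> / 2)" using \<epsilon> by (intro ennreal_plus[symmetric]) auto
      finally show ?thesis by simp
    qed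
    then show "\<exists>\<rho>. 0 \<le> \<rho> \<and> \<rho> < 1 \<and> (\<forall>f. f holomorphic_on ball 0 1 \<longrightarrow> bergman_int p f \<le> 1 \<longrightarrow>
      deriv_int_on (ball 0 1 - ball 0 \<rho>) n q ?\<nu> f \<le> ennreal \<epsilon>)"
      using \<rho>(1,2) by blast
  qed
qed

section \<open>The equivalences\<close>

lemma operator_iff_mass_ratio:
  assumes "0 < p" "p \<le> q" "borel_measure_on_disc \<mu>"
  shows "bounded_operator \<omega> p \<mu> q (\<lambda>f. (deriv ^^ n) f) \<longleftrightarrow>
      (SUP z\<in>ball 0 1. mass_ratio \<omega> \<mu> (1 / 2) (q / p) (real n * q) z) < \<infinity>"
    and "finite_on_compacts \<mu> \<Longrightarrow> compact_operator \<omega> p \<mu> q (\<lambda>f. (deriv ^^ n) f) \<longleftrightarrow>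
      (mass_ratio \<omega> \<mu> (1 / 2) (q / p) (real n * q) \<longlongrightarrow> 0) (filtercomap cmod (at_left 1))"
  using bounded_operator_of_mass_ratio[of \<mu> p q "1 / 2" n] mass_ratio_of_bounded_operator[of \<mu> p q n]
    compact_operator_of_mass_ratio[of \<mu> p q "1 / 2" n] mass_ratio_of_compact_operator[of \<mu> p q n] assms by auto

text \<open>The implications run in a circle: integrability for one radius gives compactness,
  compactness gives boundedness, and boundedness gives integrability for every radius.\<close>

lemma operator_iff_extended_in_Lp:
  fixes n :: nat
  defines "E p q \<mu> r \<equiv> extended_in_Lp (density disc_area (omega_tilde \<omega>)) (p / (p - q)) (mass_ratio \<omega> \<mu> r 1 (real n * q))"
  assumes q: "0 < q" "q < p" and \<mu>: "borel_measure_on_disc \<mu>"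
  shows "bounded_operator \<omega> p \<mu> q (\<lambda>f. (deriv ^^ n) f) \<longleftrightarrow> compact_operator \<omega> p \<mu> q (\<lambda>f. (deriv ^^ n) f)"
    and "compact_operator \<omega> p \<mu> q (\<lambda>f. (deriv ^^ n) f) \<longleftrightarrow> (\<exists>r::real. 0 < r \<and> r < 1 \<and> E p q \<mu> r)"
    and "(\<exists>r::real. 0 < r \<and> r < 1 \<and> E p q \<mu> r) \<longleftrightarrow> (\<forall>r::real. 0 < r \<and> r < 1 \<longrightarrow> E p q \<mu> r)"
proof -
  have p: "0 < p" using q by simp
  have 1: "compact_operator \<omega> p \<mu> q (\<lambda>f. (deriv ^^ n) f)" if "0 < r" "r < 1" "E p q \<mu> r" for r
    using that(3) unfolding E_def by (rule compact_operator_of_extended_in_Lp[OF \<mu> q that(1,2)])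
  have 2: "bounded_operator \<omega> p \<mu> q (\<lambda>f. (deriv ^^ n) f)" if "compact_operator \<omega> p \<mu> q (\<lambda>f. (deriv ^^ n) f)"
    by (rule bounded_operator_of_compact_operator[OF \<mu> p q(1) that])
  have 3: "E p q \<mu> r" if "bounded_operator \<omega> p \<mu> q (\<lambda>f. (deriv ^^ n) f)" "0 < r" "r < 1" for r
    unfolding E_def by (rule extended_in_Lp_of_bounded_operator[OF \<mu> q that(2,3,1)])
  have half: "0 < (1 / 2 :: real)" "1 / 2 < (1 :: real)" by simp_all
  show "bounded_operator \<omega> p \<mu> q (\<lambda>f. (deriv ^^ n) f) \<longleftrightarrow> compact_operator \<omega> p \<mu> q (\<lambda>f. (deriv ^^ n) f)"
    and "compact_operator \<omega> p \<mu> q (\<lambda>f. (deriv ^^ n) f) \<longleftrightarrow> (\<exists>r::real. 0 < r \<and> r < 1 \<and> E p q \<mu> r)"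
    and "(\<exists>r::real. 0 < r \<and> r < 1 \<and> E p q \<mu> r) \<longleftrightarrow> (\<forall>r::real. 0 < r \<and> r < 1 \<longrightarrow> E p q \<mu> r)"
    using 1 2 3 half by blast+
qed

end

theorem theorem2:
  fixes \<omega> :: "complex \<Rightarrow> real"
  assumes "doubling_weight \<omega>"
  shows
    "(\<exists>r::real. 0 < r \<and> r < 1 \<and>
        (\<forall>(p::real) (q::real) (n::nat) (\<mu>::complex measure).
           0 < p \<and> p \<le> q \<and> borel_measure_on_disc \<mu> \<longrightarrow>
             (bounded_operator \<omega> p \<mu> q (\<lambda>f. (deriv ^^ n) f) \<longleftrightarrow>
                (SUP z\<in>ball 0 1. mass_ratio \<omega> \<mu> r (q / p) (real n * q) z) < \<infinity>)
             \<and> (finite_on_compacts \<mu> \<longrightarrow>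
                 (compact_operator \<omega> p \<mu> q (\<lambda>f. (deriv ^^ n) f) \<longleftrightarrow>
                    (mass_ratio \<omega> \<mu> r (q / p) (real n * q) \<longlongrightarrow> 0)
                      (filtercomap cmod (at_left 1))))))
     \<and>
     (\<forall>(p::real) (q::real) (n::nat) (\<mu>::complex measure).
        0 < q \<and> q < p \<and> borel_measure_on_disc \<mu> \<longrightarrow>
          (bounded_operator \<omega> p \<mu> q (\<lambda>f. (deriv ^^ n) f) \<longleftrightarrow>
             compact_operator \<omega> p \<mu> q (\<lambda>f. (deriv ^^ n) f))
          \<and> (compact_operator \<omega> p \<mu> q (\<lambda>f. (deriv ^^ n) f) \<longleftrightarrow>
             (\<exists>r::real. 0 < r \<and> r < 1 \<and>
                extended_in_Lp (density disc_area (omega_tilde \<omega>)) (p / (p - q))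
                  (mass_ratio \<omega> \<mu> r 1 (real n * q))))
          \<and> ((\<exists>r::real. 0 < r \<and> r < 1 \<and>
                extended_in_Lp (density disc_area (omega_tilde \<omega>)) (p / (p - q))
                  (mass_ratio \<omega> \<mu> r 1 (real n * q))) \<longleftrightarrow>
             (\<forall>r::real. 0 < r \<and> r < 1 \<longrightarrow>
                extended_in_Lp (density disc_area (omega_tilde \<omega>)) (p / (p - q))
                  (mass_ratio \<omega> \<mu> r 1 (real n * q)))))"
proof -
  obtain W h C1 C2 K where "bergman_setting W h C1 C2 K \<omega>"
    by (rule doubling_weight_setting[OF assms])
  then interpret bergman_setting W h C1 C2 K \<omega> .
  show ?thesis
    \<comment> \<open>The radius 1 / 2 is the one for which the lower bound by test functions is
      proved; the sufficiency estimates are available for every radius in (0, 1).\<close>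
    by (intro conjI exI[of _ "1 / 2"] allI impI; (elim conjE)?;
        ((rule operator_iff_mass_ratio operator_iff_extended_in_Lp; assumption) | simp))
qed

end
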